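(* Let $S$ be a local ring, $I$ a proper ideal of $S$ with $\operatorname{pd}_S I<\infty$, $R=S/I$, and $t=\operatorname{depth}R$. Let $N_R=\operatorname{Hom}_R(I/I^2,R)$ be the normal module of $R$. Suppose there exists an integer $r$ with $0\le r\le t$ such that $I/I^2$ satisfies $(\widetilde S_r)$ as an $R$-module and, if $r<t$, $\operatorname{Ext}_R^i(I/I^2,R)=0$ for all $1\le i\le t-r$. If $\operatorname{pd}_R N_R<\infty$, then $I$ is generated by an $S$-regular sequence (i.e., Vasconcelos' conjecture holds in this case). In particular, if $R$ is Cohen--Macaulay, $I/I^2$ is a maximal Cohen--Macaulay $R$-module, and $\operatorname{pd}_R N_R<\infty$, then $I$ is generated by an $S$-regular sequence.
   Context: Rings are commutative Noetherian. A finitely generated $R$-module $M$ satisfies $(\widetilde S_n)$ if $\operatorname{depth}_{R_{\mathfrak p}}M_{\mathfrak p}\ge\min\{n,\operatorname{depth}R_{\mathfrak p}\}$ for all $\mathfrak p\in\operatorname{Spec}(R)$, with $\operatorname{depth}0=\infty$. $\operatorname{pd}$ is projective dimension. Vasconcelos' conjecture states that, for $S$ local and $\operatorname{pd}_S I<\infty$, the ideal $I$ must be generated by a regular sequence if $\operatorname{pd}_R N_R<\infty$. *)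

theory Defs
  imports "HOL-Library.Extended_Nat" "HOL-Algebra.Module" "HOL-Algebra.Ring_Divisibility"
    "HOL-Algebra.Ideal_Product"
begin

section \<open>Modules\<close>

text \<open>
  A module is a record of the library type \<^typ>\<open>('r, 'm) module\<close>. Its ring fields
  \<^const>\<open>mult\<close> and \<^const>\<open>one\<close> play no role and are left \<^const>\<open>undefined\<close> below.
\<close>

definition trivial_module :: "('r, 'm) module \<Rightarrow> bool" where
  "trivial_module M \<longleftrightarrow> carrier M = {\<zero>\<^bsub>M\<^esub>}"

definition ring_as_module :: "('r, 's) ring_scheme \<Rightarrow> ('r, 'r) module" where
  "ring_as_module R =
     \<lparr>carrier = carrier R, mult = undefined, one = undefined,
      zero = \<zero>\<^bsub>R\<^esub>, add = (\<oplus>\<^bsub>R\<^esub>), smult = (\<otimes>\<^bsub>R\<^esub>)\<rparr>"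

definition ideal_as_module :: "('r, 's) ring_scheme \<Rightarrow> 'r set \<Rightarrow> ('r, 'r) module" where
  "ideal_as_module R J = (ring_as_module R)\<lparr>carrier := J\<rparr>"

definition gen_submodule :: "('r, 's) ring_scheme \<Rightarrow> ('r, 'm) module \<Rightarrow> 'm set \<Rightarrow> 'm set" where
  "gen_submodule R M G = \<Inter>{H. submodule H R M \<and> G \<subseteq> H}"

definition finitely_generated :: "('r, 's) ring_scheme \<Rightarrow> ('r, 'm) module \<Rightarrow> bool" where
  "finitely_generated R M \<longleftrightarrow>
     (\<exists>G. finite G \<and> G \<subseteq> carrier M \<and> gen_submodule R M G = carrier M)"

definition quot_module :: "('r, 'm) module \<Rightarrow> 'm set \<Rightarrow> ('r, 'm set) module" where
  "quot_module M H =
     \<lparr>carrier = a_rcosets\<^bsub>M\<^esub> H, mult = undefined, one = undefined,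
      zero = H, add = set_add M,
      smult = (\<lambda>a X. \<Union>x\<in>X. H +>\<^bsub>M\<^esub> (a \<odot>\<^bsub>M\<^esub> x))\<rparr>"

text \<open>
  Homomorphisms are extensional (\<^const>\<open>undefined\<close> outside the carrier), so that equality of
  functions is equality of homomorphisms.
\<close>

definition module_hom ::
    "('r, 's) ring_scheme \<Rightarrow> ('r, 'm) module \<Rightarrow> ('r, 'n) module \<Rightarrow> ('m \<Rightarrow> 'n) set" where
  "module_hom R M N =
     {f \<in> carrier M \<rightarrow>\<^sub>E carrier N.
        (\<forall>x\<in>carrier M. \<forall>y\<in>carrier M. f (x \<oplus>\<^bsub>M\<^esub> y) = f x \<oplus>\<^bsub>N\<^esub> f y) \<and>
        (\<forall>a\<in>carrier R. \<forall>x\<in>carrier M. f (a \<odot>\<^bsub>M\<^esub> x) = a \<odot>\<^bsub>N\<^esub> f x)}"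

definition hom_module ::
    "('r, 's) ring_scheme \<Rightarrow> ('r, 'm) module \<Rightarrow> ('r, 'n) module \<Rightarrow> ('r, 'm \<Rightarrow> 'n) module" where
  "hom_module R M N =
     \<lparr>carrier = module_hom R M N, mult = undefined, one = undefined,
      zero = (\<lambda>x\<in>carrier M. \<zero>\<^bsub>N\<^esub>),
      add = (\<lambda>f g. \<lambda>x\<in>carrier M. f x \<oplus>\<^bsub>N\<^esub> g x),
      smult = (\<lambda>a f. \<lambda>x\<in>carrier M. a \<odot>\<^bsub>N\<^esub> f x)\<rparr>"

section \<open>Projective resolutions, projective dimension, Ext\<close>

text \<open>The elements of $R^n$ are the sequences that vanish from position $n$ on.\<close>

definition free_module :: "('r, 's) ring_scheme \<Rightarrow> nat \<Rightarrow> ('r, nat \<Rightarrow> 'r) module" where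
  "free_module R n =
     \<lparr>carrier = {v. (\<forall>i<n. v i \<in> carrier R) \<and> (\<forall>i\<ge>n. v i = \<zero>\<^bsub>R\<^esub>)},
      mult = undefined, one = undefined, zero = (\<lambda>_. \<zero>\<^bsub>R\<^esub>),
      add = (\<lambda>v w i. v i \<oplus>\<^bsub>R\<^esub> w i), smult = (\<lambda>a v i. a \<otimes>\<^bsub>R\<^esub> v i)\<rparr>"

text \<open>Finitely generated projective: isomorphic to a direct summand of some $R^n$.\<close>

definition fg_projective :: "('r, 's) ring_scheme \<Rightarrow> ('r, 'm) module \<Rightarrow> bool" where
  "fg_projective R P \<longleftrightarrow> module R P \<and>
     (\<exists>n. \<exists>s \<in> module_hom R P (free_module R n). \<exists>p \<in> module_hom R (free_module R n) P.
        \<forall>x\<in>carrier P. p (s x) = x)"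

text \<open>
  Resolutions of finitely generated modules over Noetherian rings by finitely generated
  projectives, $\cdots \to P_2 \to P_1 \to P_0 \to M \to 0$ with
  $d_i : P_{i+1} \to P_i$ and augmentation $e : P_0 \to M$. Every finitely generated projective
  module is isomorphic to one inside some $R^n$, so letting the $P_i$ have carrier
  type \<^typ>\<open>nat \<Rightarrow> 'r\<close> is no restriction.
\<close>

type_synonym 'r fgmod = "('r, nat \<Rightarrow> 'r) module"
type_synonym ('r, 'm) resolution =
  "(nat \<Rightarrow> 'r fgmod) \<times> (nat \<Rightarrow> (nat \<Rightarrow> 'r) \<Rightarrow> (nat \<Rightarrow> 'r)) \<times> ((nat \<Rightarrow> 'r) \<Rightarrow> 'm)"

fun proj_resolution ::
    "('r, 's) ring_scheme \<Rightarrow> ('r, 'm) module \<Rightarrow> ('r, 'm) resolution \<Rightarrow> bool" where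
  "proj_resolution R M (P, d, e) \<longleftrightarrow>
     (\<forall>i. fg_projective R (P i)) \<and>
     (\<forall>i. d i \<in> module_hom R (P (Suc i)) (P i)) \<and>
     e \<in> module_hom R (P 0) M \<and>
     e ` carrier (P 0) = carrier M \<and>
     d 0 ` carrier (P 1) = {x \<in> carrier (P 0). e x = \<zero>\<^bsub>M\<^esub>} \<and>
     (\<forall>i. d (Suc i) ` carrier (P (Suc (Suc i)))
            = {x \<in> carrier (P (Suc i)). d i x = \<zero>\<^bsub>P i\<^esub>})"

text \<open>
  For finitely generated modules over Noetherian rings. The zero module gets the value 0;
  \<^term>\<open>\<infinity>\<close> means that there is no finite projective resolution.
\<close>

definition proj_dim :: "('r, 's) ring_scheme \<Rightarrow> ('r, 'm) module \<Rightarrow> enat" where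
  "proj_dim R M =
     Inf {enat n |n. \<exists>P d e. proj_resolution R M (P, d, e) \<and> (\<forall>i>n. trivial_module (P i))}"

text \<open>
  $\mathrm{Ext}^i_R(M,N)$ is the $i$-th cohomology of $\mathrm{Hom}_R(P_\bullet, N)$ for a
  chosen projective resolution of $M$.
\<close>

definition ext_cocycles ::
    "('r, 's) ring_scheme \<Rightarrow> ('r, 'm) resolution \<Rightarrow> nat \<Rightarrow> ('r, 'n) module
      \<Rightarrow> ((nat \<Rightarrow> 'r) \<Rightarrow> 'n) set" where
  "ext_cocycles R = (\<lambda>(P, d, e) i N.
     {f \<in> module_hom R (P i) N.
        compose (carrier (P (Suc i))) f (d i) = \<zero>\<^bsub>hom_module R (P (Suc i)) N\<^esub>})"

definition ext_coboundaries ::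
    "('r, 's) ring_scheme \<Rightarrow> ('r, 'm) resolution \<Rightarrow> nat \<Rightarrow> ('r, 'n) module
      \<Rightarrow> ((nat \<Rightarrow> 'r) \<Rightarrow> 'n) set" where
  "ext_coboundaries R = (\<lambda>(P, d, e) i N.
     (case i of
        0 \<Rightarrow> {\<zero>\<^bsub>hom_module R (P 0) N\<^esub>}
      | Suc j \<Rightarrow> (\<lambda>f. compose (carrier (P (Suc j))) f (d j)) ` module_hom R (P j) N))"

definition ext_module ::
    "('r, 's) ring_scheme \<Rightarrow> nat \<Rightarrow> ('r, 'm) module \<Rightarrow> ('r, 'n) module
      \<Rightarrow> ('r, ((nat \<Rightarrow> 'r) \<Rightarrow> 'n) set) module" where
  "ext_module R i M N =
     (let F = (SOME F. proj_resolution R M F)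
      in quot_module
           ((hom_module R (fst F i) N)\<lparr>carrier := ext_cocycles R F i N\<rparr>)
           (ext_coboundaries R F i N))"

section \<open>Local rings, regular sequences, depth, dimension\<close>

definition noetherian_local_ring :: "('r, 's) ring_scheme \<Rightarrow> bool" where
  "noetherian_local_ring R \<longleftrightarrow> cring R \<and> noetherian_ring R \<and> (\<exists>!m. maximalideal m R)"

definition max_ideal :: "('r, 's) ring_scheme \<Rightarrow> 'r set" where
  "max_ideal R = (THE m. maximalideal m R)"

text \<open>The submodule $(A)M$ of $M$.\<close>

definition ideal_times :: "('r, 's) ring_scheme \<Rightarrow> 'r set \<Rightarrow> ('r, 'm) module \<Rightarrow> 'm set" where
  "ideal_times R A M = gen_submodule R M {a \<odot>\<^bsub>M\<^esub> x |a x. a \<in> A \<and> x \<in> carrier M}"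

text \<open>
  The middle condition says that \<^term>\<open>xs ! i\<close> is a nonzerodivisor on
  $M/(x_0,\dots,x_{i-1})M$.
\<close>

definition regular_sequence ::
    "('r, 's) ring_scheme \<Rightarrow> ('r, 'm) module \<Rightarrow> 'r list \<Rightarrow> bool" where
  "regular_sequence R M xs \<longleftrightarrow>
     set xs \<subseteq> carrier R \<and>
     (\<forall>i<length xs. \<forall>y\<in>carrier M.
        xs ! i \<odot>\<^bsub>M\<^esub> y \<in> ideal_times R (set (take i xs)) M
          \<longrightarrow> y \<in> ideal_times R (set (take i xs)) M) \<and>
     ideal_times R (set xs) M \<noteq> carrier M"

definition depth :: "('r, 's) ring_scheme \<Rightarrow> ('r, 'm) module \<Rightarrow> enat" where
  "depth R M =
     (if trivial_module M then \<infinity>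
      else Sup {enat (length xs) |xs. set xs \<subseteq> max_ideal R \<and> regular_sequence R M xs})"

definition ring_depth :: "('r, 's) ring_scheme \<Rightarrow> enat" where
  "ring_depth R = depth R (ring_as_module R)"

definition krull_dim :: "('r, 's) ring_scheme \<Rightarrow> enat" where
  "krull_dim R =
     Sup {enat n |n. \<exists>p. (\<forall>i\<le>n. primeideal (p i) R) \<and> (\<forall>i<n. p i \<subset> p (Suc i))}"

definition cohen_macaulay_ring :: "('r, 's) ring_scheme \<Rightarrow> bool" where
  "cohen_macaulay_ring R \<longleftrightarrow> noetherian_local_ring R \<and> ring_depth R = krull_dim R"

definition maximal_cohen_macaulay :: "('r, 's) ring_scheme \<Rightarrow> ('r, 'm) module \<Rightarrow> bool" where
  "maximal_cohen_macaulay R M \<longleftrightarrow>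
     module R M \<and> finitely_generated R M \<and> depth R M = krull_dim R"

section \<open>Localization and the Serre-type condition\<close>

text \<open>
  The fraction $x/s$ as an equivalence class of pairs, for a multiplicative set $W$. Operations
  on classes are unions over representatives, as for \<^const>\<open>rcoset_mult\<close>.
\<close>

definition loc_frac :: "'r set \<Rightarrow> ('r, 'm) module \<Rightarrow> 'm \<Rightarrow> 'r \<Rightarrow> ('m \<times> 'r) set" where
  "loc_frac W M x s =
     {(y, t). y \<in> carrier M \<and> t \<in> W \<and>
        (\<exists>u\<in>W. u \<odot>\<^bsub>M\<^esub> (t \<odot>\<^bsub>M\<^esub> x) = u \<odot>\<^bsub>M\<^esub> (s \<odot>\<^bsub>M\<^esub> y))}"

definition loc_module ::
    "('r, 's) ring_scheme \<Rightarrow> 'r set \<Rightarrow> ('r, 'm) module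
      \<Rightarrow> (('r \<times> 'r) set, ('m \<times> 'r) set) module" where
  "loc_module R W M =
     \<lparr>carrier = {loc_frac W M x s |x s. x \<in> carrier M \<and> s \<in> W},
      mult = undefined, one = undefined,
      zero = loc_frac W M \<zero>\<^bsub>M\<^esub> \<one>\<^bsub>R\<^esub>,
      add = (\<lambda>X Y. \<Union>(x, s)\<in>X. \<Union>(y, t)\<in>Y.
               loc_frac W M (t \<odot>\<^bsub>M\<^esub> x \<oplus>\<^bsub>M\<^esub> s \<odot>\<^bsub>M\<^esub> y) (s \<otimes>\<^bsub>R\<^esub> t)),
      smult = (\<lambda>A X. \<Union>(a, s)\<in>A. \<Union>(x, t)\<in>X. loc_frac W M (a \<odot>\<^bsub>M\<^esub> x) (s \<otimes>\<^bsub>R\<^esub> t))\<rparr>"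

definition loc_ring :: "('r, 's) ring_scheme \<Rightarrow> 'r set \<Rightarrow> (('r \<times> 'r) set) ring" where
  "loc_ring R W =
     (let L = loc_module R W (ring_as_module R)
      in \<lparr>carrier = carrier L, mult = smult L,
          one = loc_frac W (ring_as_module R) \<one>\<^bsub>R\<^esub> \<one>\<^bsub>R\<^esub>, zero = zero L, add = add L\<rparr>)"

definition serre_tilde :: "('r, 's) ring_scheme \<Rightarrow> nat \<Rightarrow> ('r, 'm) module \<Rightarrow> bool" where
  "serre_tilde R n M \<longleftrightarrow>
     (\<forall>p. primeideal p R \<longrightarrow>
        depth (loc_ring R (carrier R - p)) (loc_module R (carrier R - p) M)
          \<ge> min (enat n) (ring_depth (loc_ring R (carrier R - p))))"

section \<open>The conormal and the normal module\<close>

text \<open>$I/I^2$ as a module over $S/I$: the class of $a$ acts on that of $x$ by $ax + I^2$.\<close>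

definition conormal_module :: "('a, 's) ring_scheme \<Rightarrow> 'a set \<Rightarrow> ('a set, 'a set) module" where
  "conormal_module S I =
     \<lparr>carrier = {(I \<cdot>\<^bsub>S\<^esub> I) +>\<^bsub>S\<^esub> x |x. x \<in> I}, mult = undefined, one = undefined,
      zero = I \<cdot>\<^bsub>S\<^esub> I, add = set_add S, smult = rcoset_mult S (I \<cdot>\<^bsub>S\<^esub> I)\<rparr>"

definition normal_module ::
    "('a, 's) ring_scheme \<Rightarrow> 'a set \<Rightarrow> ('a set, 'a set \<Rightarrow> 'a set) module" where
  "normal_module S I =
     hom_module (S Quot I) (conormal_module S I) (ring_as_module (S Quot I))"

definition generated_by_regular_sequence :: "('a, 's) ring_scheme \<Rightarrow> 'a set \<Rightarrow> bool" where
  "generated_by_regular_sequence S I \<longleftrightarrow>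
     (\<exists>xs. regular_sequence S (ring_as_module S) xs \<and> I = genideal S (set xs))"

end

theory Submission
  imports Defs
begin

text \<open>
  Let $R = S/I$, $M = I/I^2$ and let $D$ be a minimal presentation matrix of $M$ over $R$. Its
  transpose presents the Auslander transpose of $M$, and the second syzygy of the transpose is the
  normal module $M^*$. As the groups $Ext^i(M,R)$ vanish for $1 \le i \le t-r$, a resolution of $M^*$
  prolongs the dual of that of $M$ to an exact complex, so that $pd M^* < \infty$ and the
  Auslander-Buchsbaum bound give $pd Tr M \le r$. If the dual of the resolution of $Tr M$ were not
  exact in degrees $1, \ldots, r$, localize at an associated prime $p$ of the first nonzero homology:
  depth counting along the complex, starting from $depth M_p \ge \min(r, depth R_p)$, excludes a
  socle element there. Hence $D$ splits, and minimality gives $D = 0$, i.e. $M$ is free. By prime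
  avoidance $I$ then contains a minimal generator $x$ that is regular on $S$; the complex for $S/xS$
  inherits finite projective dimension because $I/xS$ is a retract of $I/xI$, and induction shows
  that $I$ is generated by a regular sequence. If $R$ and $M$ are Cohen-Macaulay, so are all their
  localizations, and the argument applies with $r = t$.
\<close>

section \<open>Finitely supported matrices\<close>

text \<open>The algebra takes place over one type-class ring, of which the ring record is a quotient
  by an ideal \<open>K\<close>. Equality in the quotient is membership of a difference in
  \<open>K\<close>, and a localized statement is one that holds after multiplication by some element
  outside \<open>p\<close>; this is where the many factors \<open>u\<close> come from. Homological
  invariants are replaced by finite certificates. Finite projective dimension at \<open>p\<close>
  becomes a quasi-inverse of some differential (\<open>vreg\<close>), and the same witness serves at
  every smaller prime. Depth of the ring is recorded by a regular sequence together with a socle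
  element modulo it, which is exactly what the Auslander-Buchsbaum step consumes. Lower bounds for
  the depth of a module are recorded as vanishing of Ext (\<open>EV\<close>), because this
  propagates along short exact sequences. The delicate point of the depth count is its start at an
  associated prime \<open>p\<close> of the homology in degree \<open>i + 1\<close>: it needs depth
  at least \<open>i + 1\<close> of the ring at \<open>p\<close>. If this fails, the
  Auslander-Buchsbaum bound at \<open>p\<close> already splits the differential there, and no
  homology is left.\<close>

typedef (overloaded) 'a fmat =
  "{A :: nat \<Rightarrow> nat \<Rightarrow> 'a::zero. \<exists>n. \<forall>i j. n \<le> i \<or> n \<le> j \<longrightarrow> A i j = 0}"
  morphisms ent fmat
  by (rule exI[of _ "\<lambda>_ _. 0"]) auto

setup_lifting type_definition_fmat

lemma ent_bound: obtains n where "\<And>i j. n \<le> i \<or> n \<le> j \<Longrightarrow> ent A i j = 0"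
  using ent[of A] by auto

lemma fmat_eqI: "(\<And>i j. ent A i j = ent B i j) \<Longrightarrow> A = B"
  by (simp add: ent_inject[symmetric] fun_eq_iff)

instantiation fmat :: (comm_ring_1) ring
begin

lift_definition zero_fmat :: "'a fmat" is "\<lambda>_ _. 0" by auto

lift_definition plus_fmat :: "'a fmat \<Rightarrow> 'a fmat \<Rightarrow> 'a fmat" is "\<lambda>A B i j. A i j + B i j"
proof -
  fix A B :: "nat \<Rightarrow> nat \<Rightarrow> 'a"
  assume "\<exists>n. \<forall>i j. n \<le> i \<or> n \<le> j \<longrightarrow> A i j = 0" "\<exists>n. \<forall>i j. n \<le> i \<or> n \<le> j \<longrightarrow> B i j = 0"
  then obtain m n where "\<forall>i j. m \<le> i \<or> m \<le> j \<longrightarrow> A i j = 0" "\<forall>i j. n \<le> i \<or> n \<le> j \<longrightarrow> B i j = 0"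
    by auto
  then show "\<exists>n. \<forall>i j. n \<le> i \<or> n \<le> j \<longrightarrow> A i j + B i j = 0"
    by (intro exI[of _ "max m n"]) auto
qed

lift_definition uminus_fmat :: "'a fmat \<Rightarrow> 'a fmat" is "\<lambda>A i j. - A i j" by auto

definition minus_fmat :: "'a fmat \<Rightarrow> 'a fmat \<Rightarrow> 'a fmat" where "A - B = A + - B" for A B :: "'a fmat"

text \<open>The index set is the support of row \<open>i\<close> of \<open>A\<close>. It is finite,
  so the product is defined without choosing a bound for the size of the matrices.\<close>

lift_definition times_fmat :: "'a fmat \<Rightarrow> 'a fmat \<Rightarrow> 'a fmat"
  is "\<lambda>A B i k. \<Sum>j | A i j \<noteq> 0. A i j * B j k"
proof -
  fix A B :: "nat \<Rightarrow> nat \<Rightarrow> 'a"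
  assume "\<exists>n. \<forall>i j. n \<le> i \<or> n \<le> j \<longrightarrow> A i j = 0" "\<exists>n. \<forall>i j. n \<le> i \<or> n \<le> j \<longrightarrow> B i j = 0"
  then obtain m n where "\<forall>i j. m \<le> i \<or> m \<le> j \<longrightarrow> A i j = 0" "\<forall>i j. n \<le> i \<or> n \<le> j \<longrightarrow> B i j = 0"
    by auto
  then show "\<exists>n. \<forall>i k. n \<le> i \<or> n \<le> k \<longrightarrow> (\<Sum>j | A i j \<noteq> 0. A i j * B j k) = 0"
    by (intro exI[of _ "max m n"]) (auto intro!: sum.neutral)
qed

lemma ent_times_bound:
  assumes "\<And>j. n \<le> j \<Longrightarrow> ent A i j = 0"
  shows "ent (A * B) i k = (\<Sum>j<n. ent A i j * ent B j k)"
  unfolding times_fmat.rep_eq using assms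
  by (intro sum.mono_neutral_left) (auto simp: not_le[symmetric])

instance
proof
  fix A B C :: "'a fmat"
  show "A * B * C = A * (B * C)"
  proof (rule fmat_eqI)
    fix i l
    obtain m n where mn: "\<And>i j. m \<le> i \<or> m \<le> j \<Longrightarrow> ent A i j = 0" "\<And>i j. n \<le> i \<or> n \<le> j \<Longrightarrow> ent B i j = 0"
      by (metis ent_bound)
    define N where "N = max m n"
    have b: "\<And>i j. N \<le> i \<or> N \<le> j \<Longrightarrow> ent A i j = 0" "\<And>i j. N \<le> i \<or> N \<le> j \<Longrightarrow> ent B i j = 0"
      using mn by (auto simp: N_def)
    have ab: "ent (A * B) i k = (\<Sum>j<N. ent A i j * ent B j k)" for i k
      using b by (intro ent_times_bound) auto
    have "ent (A * B * C) i l = (\<Sum>k<N. ent (A * B) i k * ent C k l)"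
      using b by (intro ent_times_bound) (auto simp: ab)
    also have "\<dots> = (\<Sum>j<N. ent A i j * (\<Sum>k<N. ent B j k * ent C k l))"
      unfolding ab sum_distrib_left sum_distrib_right
      by (subst sum.swap) (simp add: mult.assoc)
    also have "\<dots> = (\<Sum>j<N. ent A i j * ent (B * C) j l)"
      using b by (intro sum.cong refl arg_cong2[where f="(*)"] ent_times_bound[symmetric]) auto
    also have "\<dots> = ent (A * (B * C)) i l"
      using b by (intro ent_times_bound[symmetric]) auto
    finally show "ent (A * B * C) i l = ent (A * (B * C)) i l" .
  qed
  show "(A + B) * C = A * C + B * C"
  proof (rule fmat_eqI)
    fix i l
    obtain m n where mn: "\<And>i j. m \<le> i \<or> m \<le> j \<Longrightarrow> ent A i j = 0" "\<And>i j. n \<le> i \<or> n \<le> j \<Longrightarrow> ent B i j = 0"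
      by (metis ent_bound)
    define N where "N = max m n"
    have b: "\<And>i j. N \<le> i \<or> N \<le> j \<Longrightarrow> ent A i j = 0" "\<And>i j. N \<le> i \<or> N \<le> j \<Longrightarrow> ent B i j = 0"
      using mn by (auto simp: N_def)
    have c: "ent ((A + B) * C) i l = (\<Sum>j<N. ent (A + B) i j * ent C j l)"
      using b by (intro ent_times_bound) (auto simp: plus_fmat.rep_eq)
    have d: "ent (A * C) i l = (\<Sum>j<N. ent A i j * ent C j l)" "ent (B * C) i l = (\<Sum>j<N. ent B i j * ent C j l)"
      using b by (auto intro!: ent_times_bound)
    show "ent ((A + B) * C) i l = ent (A * C + B * C) i l"
      unfolding plus_fmat.rep_eq c d by (simp add: distrib_right sum.distrib)
  qed
  show "A * (B + C) = A * B + A * C"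
    by (rule fmat_eqI) (simp add: plus_fmat.rep_eq times_fmat.rep_eq distrib_left sum.distrib)
qed (auto intro!: fmat_eqI simp: plus_fmat.rep_eq uminus_fmat.rep_eq zero_fmat.rep_eq minus_fmat_def)

end

lemma ent_zero [simp]: "ent 0 i j = 0" by (simp add: zero_fmat.rep_eq)
lemma ent_plus [simp]: "ent (A + B) i j = ent A i j + ent B i j" by (simp add: plus_fmat.rep_eq)
lemma ent_uminus [simp]: "ent (- A) i j = - ent A i j" by (simp add: uminus_fmat.rep_eq)
lemma ent_minus [simp]: "ent (A - B) i j = ent A i j - ent B i j" by (simp add: minus_fmat_def del: add_uminus_conv_diff)

lift_definition scm :: "'a::comm_ring_1 \<Rightarrow> 'a fmat \<Rightarrow> 'a fmat" (infixr "*\<^sub>m" 75) is "\<lambda>a A i j. a * A i j"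
  by (metis mult_zero_right)
lift_definition tr :: "'a::zero fmat \<Rightarrow> 'a fmat" is "\<lambda>A i j. A j i" by auto
lift_definition mk :: "nat \<Rightarrow> nat \<Rightarrow> (nat \<Rightarrow> nat \<Rightarrow> 'a::zero) \<Rightarrow> 'a fmat"
  is "\<lambda>m n f i j. if i < m \<and> j < n then f i j else 0"
  subgoal for m n f by (rule exI[of _ "max m n"]) auto done

text \<open>The product has no unit, since an infinite identity matrix is not finitely supported.
  Sizes are expressed by these truncated identities: \<open>idm m * A = A\<close> and
  \<open>A * idm n = A\<close> together say that \<open>A\<close> is an m by n matrix.\<close>

definition idm :: "nat \<Rightarrow> 'a::comm_ring_1 fmat" where "idm n = mk n n (\<lambda>i j. if i = j then 1 else 0)"

lemma ent_scm [simp]: "ent (a *\<^sub>m A) i j = a * ent A i j" by (simp add: scm.rep_eq)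
lemma ent_tr [simp]: "ent (tr A) i j = ent A j i" by (simp add: tr.rep_eq)
lemma ent_mk [simp]: "ent (mk m n f) i j = (if i < m \<and> j < n then f i j else 0)" by (simp add: mk.rep_eq)
lemma ent_idm: "ent (idm n) i j = (if i = j \<and> i < n then 1 else 0)" by (auto simp: idm_def)

lemma ent_times_bound':
  assumes "\<And>j. n \<le> j \<Longrightarrow> ent B j k = 0"
  shows "ent (A * B) i k = (\<Sum>j<n. ent A i j * ent B j k)"
proof -
  obtain m where m: "\<And>i j. m \<le> i \<or> m \<le> j \<Longrightarrow> ent A i j = 0" using ent_bound by blast
  have "ent (A * B) i k = (\<Sum>j<max m n. ent A i j * ent B j k)"
    using m by (intro ent_times_bound) auto
  also have "\<dots> = (\<Sum>j<n. ent A i j * ent B j k)"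
    using assms by (intro sum.mono_neutral_right) (auto simp: not_less)
  finally show ?thesis .
qed

lemma ent_idm_mult [simp]: "ent (idm n * A) i j = (if i < n then ent A i j else 0)"
proof -
  have "ent (idm n * A) i j = (\<Sum>k<n. ent (idm n) i k * ent A k j)"
    by (rule ent_times_bound) (auto simp: ent_idm)
  also have "\<dots> = (\<Sum>k<n. if k = i then ent A k j else 0)"
    by (rule sum.cong) (auto simp: ent_idm)
  finally show ?thesis by simp
qed

lemma ent_mult_idm [simp]: "ent (A * idm n) i j = (if j < n then ent A i j else 0)"
proof -
  have "ent (A * idm n) i j = (\<Sum>k<n. ent A i k * ent (idm n) k j)"
    by (rule ent_times_bound') (auto simp: ent_idm)
  also have "\<dots> = (\<Sum>k<n. if k = j then ent A i k else 0)"
    by (rule sum.cong) (auto simp: ent_idm)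
  finally show ?thesis by simp
qed

lemma idm_mult_idm: "idm m * idm n = idm (min m n)"
  by (rule fmat_eqI) (auto simp: ent_idm)
lemma idm_idem [simp]: "idm n * idm n = idm n" by (simp add: idm_mult_idm)
lemma idm_idem_left [simp]: "idm n * (idm n * A) = idm n * A" by (simp flip: mult.assoc)

lemma scm_mult_left [simp]: "(a *\<^sub>m A) * B = a *\<^sub>m (A * B)"
proof (rule fmat_eqI)
  fix i k
  obtain n where n: "\<And>i j. n \<le> i \<or> n \<le> j \<Longrightarrow> ent A i j = 0" using ent_bound by blast
  have "ent (a *\<^sub>m A * B) i k = (\<Sum>j<n. ent (a *\<^sub>m A) i j * ent B j k)"
    using n by (intro ent_times_bound) auto
  also have "\<dots> = a * (\<Sum>j<n. ent A i j * ent B j k)"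
    by (simp add: sum_distrib_left mult.assoc)
  also have "(\<Sum>j<n. ent A i j * ent B j k) = ent (A * B) i k"
    using n by (intro ent_times_bound[symmetric]) auto
  finally show "ent (a *\<^sub>m A * B) i k = ent (a *\<^sub>m (A * B)) i k" by simp
qed

lemma scm_mult_right [simp]: "A * (a *\<^sub>m B) = a *\<^sub>m (A * B)"
proof (rule fmat_eqI)
  fix i k
  obtain n where n: "\<And>i j. n \<le> i \<or> n \<le> j \<Longrightarrow> ent A i j = 0" using ent_bound by blast
  have "ent (A * (a *\<^sub>m B)) i k = (\<Sum>j<n. ent A i j * (a * ent B j k))"
    using n by (subst ent_times_bound[of n]) auto
  also have "\<dots> = (\<Sum>j<n. a * (ent A i j * ent B j k))"
    by (rule sum.cong[OF refl]) (rule mult.left_commute)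
  also have "\<dots> = a * ent (A * B) i k"
    using n by (subst ent_times_bound[of n]) (auto simp: sum_distrib_left)
  finally show "ent (A * (a *\<^sub>m B)) i k = ent (a *\<^sub>m (A * B)) i k" by simp
qed

lemma scm_scm [simp]: "a *\<^sub>m b *\<^sub>m A = (a * b) *\<^sub>m A"
  by (rule fmat_eqI) (simp add: mult.assoc)
lemma scm_add_left: "(a + b) *\<^sub>m A = a *\<^sub>m A + b *\<^sub>m A" by (rule fmat_eqI) (simp add: distrib_right)
lemma scm_add_right: "a *\<^sub>m (A + B) = a *\<^sub>m A + a *\<^sub>m B" by (rule fmat_eqI) (simp add: distrib_left)
lemma scm_diff_left: "(a - b) *\<^sub>m A = a *\<^sub>m A - b *\<^sub>m A" by (rule fmat_eqI) (simp add: algebra_simps)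
lemma scm_diff_right: "a *\<^sub>m (A - B) = a *\<^sub>m A - a *\<^sub>m B" by (rule fmat_eqI) (simp add: algebra_simps)
lemma scm_minus_right [simp]: "a *\<^sub>m (- A) = - (a *\<^sub>m A)" by (rule fmat_eqI) simp
lemma scm_minus_left [simp]: "(- a) *\<^sub>m A = - (a *\<^sub>m A)" by (rule fmat_eqI) simp
lemma scm_one [simp]: "1 *\<^sub>m A = A" by (rule fmat_eqI) simp
lemma scm_zero_left [simp]: "0 *\<^sub>m A = 0" by (rule fmat_eqI) simp
lemma scm_zero_right [simp]: "a *\<^sub>m 0 = 0" by (rule fmat_eqI) simp
lemmas mat_simps = algebra_simps scm_add_left scm_add_right scm_diff_left scm_diff_right

lemma tr_tr [simp]: "tr (tr A) = A" by (rule fmat_eqI) simp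
lemma tr_add [simp]: "tr (A + B) = tr A + tr B" by (rule fmat_eqI) simp
lemma tr_diff [simp]: "tr (A - B) = tr A - tr B" by (rule fmat_eqI) simp
lemma tr_scm [simp]: "tr (a *\<^sub>m A) = a *\<^sub>m tr A" by (rule fmat_eqI) simp
lemma tr_idm [simp]: "tr (idm n) = idm n" by (rule fmat_eqI) (auto simp: ent_idm)
lemma tr_mult [simp]: "tr (A * B) = tr B * (tr A :: 'a::comm_ring_1 fmat)"
proof (rule fmat_eqI)
  fix i k
  obtain n where n: "\<And>i j. n \<le> i \<or> n \<le> j \<Longrightarrow> ent A i j = 0" using ent_bound by blast
  have "ent (A * B) k i = (\<Sum>j<n. ent A k j * ent B j i)"
    using n by (intro ent_times_bound) auto
  also have "\<dots> = ent (tr B * tr A) i k"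
    using n by (subst ent_times_bound'[of n]) (auto simp: mult.commute)
  finally show "ent (tr (A * B)) i k = ent (tr B * tr A) i k" by simp
qed

section \<open>Matrices over ideals\<close>

definition idl :: "'a::comm_ring_1 set \<Rightarrow> bool" where
  "idl K \<longleftrightarrow> 0 \<in> K \<and> (\<forall>a\<in>K. \<forall>b\<in>K. a + b \<in> K) \<and> (\<forall>a. \<forall>b\<in>K. a * b \<in> K)"

text \<open>Matrices over the quotient by \<open>K\<close> are represented by matrices \<open>A\<close>, \<open>B\<close> over the ring itself, and
  equality in the quotient is \<open>A - B \<in> km K\<close>.\<close>

definition km :: "'a::comm_ring_1 set \<Rightarrow> 'a fmat set" where
  "km K = {A. \<forall>i j. ent A i j \<in> K}"

lemma idl_zero: "idl K \<Longrightarrow> 0 \<in> K" by (simp add: idl_def)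
lemma idl_add: "idl K \<Longrightarrow> a \<in> K \<Longrightarrow> b \<in> K \<Longrightarrow> a + b \<in> K" by (simp add: idl_def)
lemma idl_mult: "idl K \<Longrightarrow> b \<in> K \<Longrightarrow> a * b \<in> K" by (simp add: idl_def)
lemma idl_mult': "idl K \<Longrightarrow> a \<in> K \<Longrightarrow> a * b \<in> K" by (metis idl_mult mult.commute)
lemma idl_minus: "idl K \<Longrightarrow> a \<in> K \<Longrightarrow> - a \<in> K" using idl_mult[of K a "-1"] by simp
lemma idl_diff: "idl K \<Longrightarrow> a \<in> K \<Longrightarrow> b \<in> K \<Longrightarrow> a - b \<in> K"
  using idl_add[of K a "- b"] idl_minus by auto
lemma idl_sum: "idl K \<Longrightarrow> (\<And>i. i \<in> X \<Longrightarrow> f i \<in> K) \<Longrightarrow> sum f X \<in> K"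
  by (induction X rule: infinite_finite_induct) (auto intro: idl_zero idl_add)

text \<open>The coefficient ideal \<open>M\<close> is a parameter because three cases occur: the
  ideal generated by the \<open>y i\<close>, where \<open>M\<close> is the whole ring, and the
  products of such an ideal with the maximal ideal or with itself.\<close>

lemma idl_span:
  assumes K: "idl K" and M: "idl M"
  shows "idl {a. \<exists>c. (\<forall>i\<in>X. c i \<in> M) \<and> a - (\<Sum>i\<in>X. c i * y i) \<in> K}" (is "idl ?J")
  unfolding idl_def
proof (intro conjI ballI allI)
  show "0 \<in> ?J" using idl_zero[OF K] idl_zero[OF M] by (intro CollectI exI[of _ "\<lambda>_. 0"]) simp
  fix a b assume "b \<in> ?J"
  then obtain c where c: "\<forall>i\<in>X. c i \<in> M" "b - (\<Sum>i\<in>X. c i * y i) \<in> K" by blast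
  have "a * b - (\<Sum>i\<in>X. (a * c i) * y i) \<in> K"
    using idl_mult[OF K c(2), of a] by (simp add: right_diff_distrib sum_distrib_left mult.assoc)
  moreover have "\<forall>i\<in>X. a * c i \<in> M" using c(1) idl_mult[OF M] by blast
  ultimately show "a * b \<in> ?J" by (intro CollectI exI[of _ "\<lambda>i. a * c i"] conjI)
  assume "a \<in> ?J"
  then obtain d where d: "\<forall>i\<in>X. d i \<in> M" "a - (\<Sum>i\<in>X. d i * y i) \<in> K" by blast
  have "a + b - (\<Sum>i\<in>X. (d i + c i) * y i) = (a - (\<Sum>i\<in>X. d i * y i)) + (b - (\<Sum>i\<in>X. c i * y i))"
    unfolding distrib_right sum.distrib by simp
  then have "a + b - (\<Sum>i\<in>X. (d i + c i) * y i) \<in> K" using idl_add[OF K d(2) c(2)] by (simp only:)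
  moreover have "\<forall>i\<in>X. d i + c i \<in> M" using c(1) d(1) idl_add[OF M] by blast
  ultimately show "a + b \<in> ?J" by (intro CollectI exI[of _ "\<lambda>i. d i + c i"] conjI)
qed

lemma sum_delta_mult:
  fixes y :: "'b \<Rightarrow> 'a::comm_ring_1"
  assumes "finite X" "i \<in> X"
  shows "(\<Sum>k\<in>X. (if k = i then 1 else 0) * y k) = y i"
proof -
  have "(\<Sum>k\<in>X. (if k = i then 1 else 0) * y k) = (\<Sum>k\<in>X. if k = i then y k else 0)"
    by (rule sum.cong) auto
  then show ?thesis using assms by simp
qed

lemma kmI: "(\<And>i j. ent A i j \<in> K) \<Longrightarrow> A \<in> km K" by (simp add: km_def)
lemma kmD: "A \<in> km K \<Longrightarrow> ent A i j \<in> K" by (simp add: km_def)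
lemma km_mono: "K \<subseteq> K' \<Longrightarrow> km K \<subseteq> km K'" by (auto simp: km_def)

lemma km_zero: "idl K \<Longrightarrow> 0 \<in> km K" by (simp add: km_def idl_zero)
lemma km_add: "idl K \<Longrightarrow> A \<in> km K \<Longrightarrow> B \<in> km K \<Longrightarrow> A + B \<in> km K" by (simp add: km_def idl_add)
lemma km_diff: "idl K \<Longrightarrow> A \<in> km K \<Longrightarrow> B \<in> km K \<Longrightarrow> A - B \<in> km K" by (simp add: km_def idl_diff)
lemma km_minus: "idl K \<Longrightarrow> A \<in> km K \<Longrightarrow> - A \<in> km K" by (simp add: km_def idl_minus)
lemma km_scm: "idl K \<Longrightarrow> A \<in> km K \<Longrightarrow> a *\<^sub>m A \<in> km K" by (simp add: km_def idl_mult)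
lemma km_scm': "idl K \<Longrightarrow> a \<in> K \<Longrightarrow> a *\<^sub>m A \<in> km K" by (simp add: km_def idl_mult')
lemma km_left: "idl K \<Longrightarrow> B \<in> km K \<Longrightarrow> A * B \<in> km K"
  by (simp add: km_def times_fmat.rep_eq idl_sum idl_mult)
lemma km_right: "idl K \<Longrightarrow> A \<in> km K \<Longrightarrow> A * B \<in> km K"
  by (simp add: km_def times_fmat.rep_eq idl_sum idl_mult')
lemma km_tr: "tr A \<in> km K \<longleftrightarrow> A \<in> km K" by (auto simp: km_def)

text \<open>Matrix units, used to move single rows and columns: \<open>un 0 j * V\<close> is row
  \<open>j\<close> of \<open>V\<close> as a one-row matrix, and \<open>A * un j 0\<close> is column
  \<open>j\<close> of \<open>A\<close> as a one-column matrix.\<close>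

definition un :: "nat \<Rightarrow> nat \<Rightarrow> 'a::comm_ring_1 fmat" where
  "un i j = mk (Suc i) (Suc j) (\<lambda>k l. if k = i \<and> l = j then 1 else 0)"

lemma ent_un: "ent (un i j) k l = (if k = i \<and> l = j then 1 else 0)"
  by (auto simp: un_def)

lemma ent_un_mult [simp]: "ent (un i k * A) r l = (if r = i then ent A k l else 0)"
proof -
  have "ent (un i k * A) r l = (\<Sum>j<Suc k. ent (un i k) r j * ent A j l)"
    by (rule ent_times_bound) (auto simp: ent_un)
  also have "\<dots> = (if r = i then ent A k l else 0)"
    by (auto simp: ent_un)
  finally show ?thesis .
qed

lemma ent_mult_un [simp]: "ent (A * un k j) r l = (if l = j then ent A r k else 0)"
proof -
  have "ent (A * un k j) r l = (\<Sum>i<Suc k. ent A r i * ent (un k j) i l)"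
    by (rule ent_times_bound') (auto simp: ent_un)
  also have "\<dots> = (if l = j then ent A r k else 0)"
    by (auto simp: ent_un)
  finally show ?thesis .
qed

section \<open>Noetherian rings and free resolutions\<close>

text \<open>Noetherianity of the quotient by \<open>K\<close>. It is stated relative to
  \<open>K\<close> because the ambient ring itself need not be Noetherian.\<close>

definition noeth :: "'a::comm_ring_1 set \<Rightarrow> bool" where
  "noeth K \<longleftrightarrow> idl K \<and> (\<forall>J. idl J \<and> K \<subseteq> J \<longrightarrow>
     (\<exists>n a. (\<forall>i<n. a i \<in> J) \<and> (\<forall>y\<in>J. \<exists>c. y - (\<Sum>i<(n::nat). c i * a i) \<in> K)))"

lemma noeth_idl: "noeth K \<Longrightarrow> idl K" by (simp add: noeth_def)

lemma noeth_gens: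
  assumes "noeth K" "idl J" "K \<subseteq> J"
  obtains n a where "\<And>i. i < (n::nat) \<Longrightarrow> a i \<in> J" "\<And>y. y \<in> J \<Longrightarrow> \<exists>c. y - (\<Sum>i<n. c i * a i) \<in> K"
  using assms unfolding noeth_def by metis

lemma noeth_mono: "noeth K \<Longrightarrow> idl K' \<Longrightarrow> K \<subseteq> K' \<Longrightarrow> noeth K'"
  unfolding noeth_def
proof (intro conjI allI impI)
  fix J assume h: "idl K \<and> (\<forall>J. idl J \<and> K \<subseteq> J \<longrightarrow>
      (\<exists>n a. (\<forall>i<n. a i \<in> J) \<and> (\<forall>y\<in>J. \<exists>c. y - (\<Sum>i<(n::nat). c i * a i) \<in> K)))"
    "K \<subseteq> K'" "idl J \<and> K' \<subseteq> J"
  then obtain n a where "\<forall>i<n. a i \<in> J" "\<forall>y\<in>J. \<exists>c. y - (\<Sum>i<(n::nat). c i * a i) \<in> K"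
    by (metis order_trans)
  then show "\<exists>n a. (\<forall>i<n. a i \<in> J) \<and> (\<forall>y\<in>J. \<exists>c. y - (\<Sum>i<(n::nat). c i * a i) \<in> K')"
    using h(2) by blast
qed auto

lemma sum_lessThan_add: "(\<Sum>j<m + (n::nat). f j) = (\<Sum>j<m. f j) + (\<Sum>j<n. f (m + j)::'a::comm_monoid_add)"
  by (induction n) (auto simp: add.assoc)

text \<open>Induction on the rank: the last coordinates form an ideal, whose generators are lifted
  to vectors of \<open>X\<close>, and the vectors with last coordinate in \<open>K\<close> are
  covered by the induction hypothesis.\<close>

lemma noeth_vectors:
  fixes X :: "(nat \<Rightarrow> 'a::comm_ring_1) set"
  assumes "noeth K" and "(\<lambda>_. 0) \<in> X" "\<And>v w. v \<in> X \<Longrightarrow> w \<in> X \<Longrightarrow> (\<lambda>i. v i + w i) \<in> X"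
    "\<And>a v. v \<in> X \<Longrightarrow> (\<lambda>i. a * v i) \<in> X"
  shows "\<exists>k w. (\<forall>j<(k::nat). w j \<in> X) \<and> (\<forall>v\<in>X. \<exists>c. \<forall>i<n. v i - (\<Sum>j<k. c j * w j i) \<in> K)"
  using assms(2-)
proof (induction n arbitrary: X)
  case 0
  show ?case by (rule exI[of _ 0]) auto
next
  case (Suc n)
  note X = Suc.prems
  have K: "idl K" using assms(1) by (rule noeth_idl)
  have Xsum: "(\<lambda>i. \<Sum>j<(r::nat). c j * g j i) \<in> X" if "\<And>j. j < r \<Longrightarrow> g j \<in> X" for r c g
    using that by (induction r) (auto intro!: X)
  define J where "J = {a. \<exists>v\<in>X. a - v n \<in> K}"
  have "idl J"
    unfolding idl_def
  proof (intro conjI ballI allI)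
    show "0 \<in> J" using X(1) idl_zero[OF K] by (auto simp: J_def intro!: bexI[of _ "\<lambda>_. 0"])
  next
    fix a b assume "a \<in> J" "b \<in> J"
    then obtain v w where "v \<in> X" "a - v n \<in> K" "w \<in> X" "b - w n \<in> K" by (auto simp: J_def)
    then show "a + b \<in> J" using idl_add[OF K, of "a - v n" "b - w n"] X(2)[of v w]
      unfolding J_def by (auto simp: algebra_simps intro!: bexI[of _ "\<lambda>i. v i + w i"])
  next
    fix a b assume "b \<in> J"
    then obtain v where "v \<in> X" "b - v n \<in> K" by (auto simp: J_def)
    then show "a * b \<in> J" using idl_mult[OF K, of "b - v n" a] X(3)[of v a]
      unfolding J_def by (auto simp: algebra_simps intro!: bexI[of _ "\<lambda>i. a * v i"])
  qed
  moreover have "K \<subseteq> J" using X(1) by (auto simp: J_def intro!: bexI[of _ "\<lambda>_. 0"])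
  ultimately obtain r a where a: "\<And>i. i < (r::nat) \<Longrightarrow> a i \<in> J"
    and gen: "\<And>y. y \<in> J \<Longrightarrow> \<exists>c. y - (\<Sum>i<r. c i * a i) \<in> K"
    using noeth_gens[OF assms(1)] by metis
  have "\<forall>i. \<exists>v. i < r \<longrightarrow> v \<in> X \<and> a i - v n \<in> K" using a by (auto simp: J_def)
  then obtain g where g: "\<And>i. i < r \<Longrightarrow> g i \<in> X" "\<And>i. i < r \<Longrightarrow> a i - g i n \<in> K" by metis
  have "\<exists>k w. (\<forall>j<(k::nat). w j \<in> {v\<in>X. v n \<in> K}) \<and>
     (\<forall>v\<in>{v\<in>X. v n \<in> K}. \<exists>c. \<forall>i<n. v i - (\<Sum>j<k. c j * w j i) \<in> K)"
  proof (rule Suc.IH)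
    show "(\<lambda>_. 0) \<in> {v \<in> X. v n \<in> K}" using X(1) idl_zero[OF K] by simp
    show "(\<lambda>i. v i + w i) \<in> {v \<in> X. v n \<in> K}" if "v \<in> {v \<in> X. v n \<in> K}" "w \<in> {v \<in> X. v n \<in> K}" for v w
      using that X(2)[of v w] idl_add[OF K] by simp
    show "(\<lambda>i. a * v i) \<in> {v \<in> X. v n \<in> K}" if "v \<in> {v \<in> X. v n \<in> K}" for a v
      using that X(3)[of v a] idl_mult[OF K] by simp
  qed
  then obtain k w where kw: "\<forall>j<(k::nat). w j \<in> {v\<in>X. v n \<in> K}"
     "\<forall>v\<in>{v\<in>X. v n \<in> K}. \<exists>c. \<forall>i<n. v i - (\<Sum>j<k. c j * w j i) \<in> K" by blast
  then have w: "\<And>j. j < k \<Longrightarrow> w j \<in> X" "\<And>j. j < k \<Longrightarrow> w j n \<in> K"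
    and wgen: "\<And>v. v \<in> X \<Longrightarrow> v n \<in> K \<Longrightarrow> \<exists>c. \<forall>i<n. v i - (\<Sum>j<k. c j * w j i) \<in> K"
    by blast+
  define h where "h j = (if j < k then w j else g (j - k))" for j
  have "\<exists>d. \<forall>i<Suc n. v i - (\<Sum>j<k + r. d j * h j i) \<in> K" if v: "v \<in> X" for v
  proof -
    have "v n \<in> J" using v idl_zero[OF K] by (auto simp: J_def intro!: bexI[of _ v])
    then obtain c where c: "v n - (\<Sum>i<r. c i * a i) \<in> K" using gen by blast
    define v' where "v' = (\<lambda>i. v i + (- 1) * (\<Sum>j<r. c j * g j i))"
    \<comment> \<open>Subtracting the lifted generators moves \<open>v\<close> into the part whose
      last coordinate lies in \<open>K\<close>.\<close>
    have v'X: "v' \<in> X" unfolding v'_def by (rule X(2)[OF v X(3)[OF Xsum]]) (rule g(1))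
    have "(\<Sum>i<r. c i * (a i - g i n)) \<in> K"
      by (rule idl_sum[OF K], rule idl_mult[OF K], rule g(2), simp)
    from idl_add[OF K c this] have v'n: "v' n \<in> K"
      by (simp add: v'_def right_diff_distrib sum_subtractf)
    obtain c' where c': "\<And>i. i < n \<Longrightarrow> v' i - (\<Sum>j<k. c' j * w j i) \<in> K"
      using wgen[OF v'X v'n] by blast
    have c'n: "v' n - (\<Sum>j<k. c' j * w j n) \<in> K"
      by (rule idl_diff[OF K v'n idl_sum[OF K]]) (auto intro: idl_mult[OF K] w)
    define d where "d j = (if j < k then c' j else c (j - k))" for j
    have "(\<Sum>j<k + r. d j * h j i) = (\<Sum>j<k. c' j * w j i) + (\<Sum>j<r. c j * g j i)" for i
      unfolding sum_lessThan_add by (simp add: d_def h_def)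
    then have "v i - (\<Sum>j<k + r. d j * h j i) = v' i - (\<Sum>j<k. c' j * w j i)" for i
      by (simp add: v'_def)
    then show ?thesis using c' c'n by (intro exI[of _ d]) (auto simp: less_Suc_eq)
  qed
  moreover have "\<forall>j<k + r. h j \<in> X" using w g by (auto simp: h_def)
  ultimately show ?case by blast
qed

text \<open>Submodules of a free module are encoded as right ideals of matrices: a matrix belongs to the
  right ideal iff all its columns belong to the submodule.\<close>

definition rid :: "nat \<Rightarrow> 'a::comm_ring_1 fmat set \<Rightarrow> bool" where
  "rid n B \<longleftrightarrow> (\<forall>A\<in>B. idm n * A = A) \<and> 0 \<in> B \<and> (\<forall>A\<in>B. \<forall>C\<in>B. A + C \<in> B) \<and> (\<forall>A\<in>B. \<forall>C. A * C \<in> B)"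

lemma mk_eq_sum: "mk n k (\<lambda>i j. w j i) = (\<Sum>j<k. mk n 1 (\<lambda>i _. w j i) * un 0 j)"
proof (rule fmat_eqI)
  fix i l
  have ents: "ent (\<Sum>j<k. F j) i l = (\<Sum>j<k. ent (F j) i l)" for F :: "nat \<Rightarrow> 'a fmat"
    by (induction k) auto
  show "ent (mk n k (\<lambda>i j. w j i)) i l = ent (\<Sum>j<k. mk n 1 (\<lambda>i _. w j i) * un 0 j) i l"
    by (simp add: ents)
qed

text \<open>The columns of members of \<open>B\<close> form a module of vectors. A matrix
  \<open>D\<close> made of finitely many generating columns generates the right ideal modulo
  \<open>K\<close>, because the coefficients of the columns of \<open>A\<close> assemble to
  \<open>W\<close>.\<close>

lemma rid_fg:
  assumes K: "noeth K" and B: "rid n B"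
  obtains k D where "D \<in> B" "D * idm k = D" "\<And>A. A \<in> B \<Longrightarrow> \<exists>W. A - D * W \<in> km K"
proof -
  define V where "V v = mk n 1 (\<lambda>i _. v i)" for v :: "nat \<Rightarrow> 'a"
  define X where "X = {v. V v \<in> B}"
  have "\<exists>k w. (\<forall>j<(k::nat). w j \<in> X) \<and> (\<forall>v\<in>X. \<exists>c. \<forall>i<n. v i - (\<Sum>j<k. c j * w j i) \<in> K)"
  proof (rule noeth_vectors[OF K])
    have "V (\<lambda>_. 0) = 0" by (rule fmat_eqI) (simp add: V_def)
    then show "(\<lambda>_. 0) \<in> X" using B by (simp add: X_def rid_def)
  next
    fix v w assume "v \<in> X" "w \<in> X"
    moreover have "V (\<lambda>i. v i + w i) = V v + V w" by (rule fmat_eqI) (simp add: V_def)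
    ultimately show "(\<lambda>i. v i + w i) \<in> X" using B by (simp add: X_def rid_def)
  next
    fix a v assume "v \<in> X"
    moreover have "V (\<lambda>i. a * v i) = V v * (a *\<^sub>m idm 1)" by (rule fmat_eqI) (simp add: V_def)
    ultimately show "(\<lambda>i. a * v i) \<in> X" using B unfolding X_def rid_def mem_Collect_eq by metis
  qed
  then obtain k w where w: "\<And>j. j < (k::nat) \<Longrightarrow> w j \<in> X"
    and gen: "\<And>v. v \<in> X \<Longrightarrow> \<exists>c. \<forall>i<n. v i - (\<Sum>j<k. c j * w j i) \<in> K" by metis
  define D where "D = mk n k (\<lambda>i j. w j i)"
  have Bsum: "(\<Sum>j<(k::nat). F j) \<in> B" if "\<And>j. j < k \<Longrightarrow> F j \<in> B" for F k
    using that B by (induction k) (auto simp: rid_def)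
  have "D \<in> B"
    unfolding D_def
  proof (subst mk_eq_sum, rule Bsum)
    fix j assume "j < k"
    then have "V (w j) \<in> B" using w by (simp add: X_def)
    then show "mk n 1 (\<lambda>i _. w j i) * un 0 j \<in> B" using B unfolding rid_def V_def by blast
  qed
  moreover have "D * idm k = D" by (rule fmat_eqI) (simp add: D_def)
  moreover have "\<exists>W. A - D * W \<in> km K" if A: "A \<in> B" for A
  proof -
    obtain N where N: "\<And>i j. N \<le> i \<or> N \<le> j \<Longrightarrow> ent A i j = 0" using ent_bound by blast
    have An: "i \<ge> n \<Longrightarrow> ent A i j = 0" for i j
      using A B ent_idm_mult[of n A i j] by (auto simp: rid_def)
    have "V (\<lambda>i. ent A i j) = A * un j 0" for j
      by (rule fmat_eqI) (auto simp: V_def An)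
    then have "(\<lambda>i. ent A i j) \<in> X" for j using A B by (simp add: X_def rid_def)
    then have "\<forall>j. \<exists>c. \<forall>i<n. ent A i j - (\<Sum>l<k. c l * w l i) \<in> K" using gen by blast
    then obtain c where c: "\<And>j i. i < n \<Longrightarrow> ent A i j - (\<Sum>l<k. c j l * w l i) \<in> K" by metis
    define W where "W = mk k N (\<lambda>l j. c j l)"
    have "ent (D * W) i j = (if i < n \<and> j < N then (\<Sum>l<k. c j l * w l i) else 0)" for i j
      by (subst ent_times_bound[of k]) (auto simp: D_def W_def mult.commute)
    then have "A - D * W \<in> km K"
      using c An N idl_zero[OF noeth_idl[OF K]] by (intro kmI) (auto simp: not_less)
    then show ?thesis by blast
  qed
  ultimately show ?thesis using that by blast
qed

text \<open>Exact complexes of free modules over the quotient by \<open>K\<close>, with \<open>D i\<close> from degree \<open>i + 1\<close> to degree \<open>i\<close>;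
  there is no condition on the cokernel of \<open>D 0\<close>, which is the module being resolved.\<close>

definition cpx :: "'a::comm_ring_1 set \<Rightarrow> (nat \<Rightarrow> nat) \<Rightarrow> (nat \<Rightarrow> 'a fmat) \<Rightarrow> bool" where
  "cpx K n D \<longleftrightarrow> (\<forall>i. idm (n i) * D i = D i \<and> D i * idm (n (Suc i)) = D i \<and> D i * D (Suc i) \<in> km K \<and>
     (\<forall>V. idm (n (Suc i)) * V = V \<longrightarrow> D i * V \<in> km K \<longrightarrow> (\<exists>W. V - D (Suc i) * W \<in> km K)))"

lemma cpxD:
  assumes "cpx K n D"
  shows "idm (n i) * D i = D i" "D i * idm (n (Suc i)) = D i" "D i * D (Suc i) \<in> km K"
    "idm (n (Suc i)) * V = V \<Longrightarrow> D i * V \<in> km K \<Longrightarrow> \<exists>W. V - D (Suc i) * W \<in> km K"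
  using assms unfolding cpx_def by auto

lemma cpx_shift: "cpx K n D \<Longrightarrow> cpx K (\<lambda>i. n (i + k)) (\<lambda>i. D (i + k))"
  unfolding cpx_def by simp

lemma kernel_gens:
  assumes "noeth K" "D0 * idm n1 = D0"
  shows "\<exists>n2 D1. idm n1 * D1 = D1 \<and> D1 * idm n2 = D1 \<and> D0 * D1 \<in> km K \<and>
    (\<forall>V. idm n1 * V = V \<longrightarrow> D0 * V \<in> km K \<longrightarrow> (\<exists>W. V - D1 * W \<in> km K))"
proof -
  have K: "idl K" using assms(1) by (rule noeth_idl)
  have "rid n1 {V. idm n1 * V = V \<and> D0 * V \<in> km K}"
    unfolding rid_def
  proof (intro conjI ballI allI; clarsimp)
    show "0 \<in> km K" by (rule km_zero[OF K])
    show "idm n1 * (A + C) = A + C \<and> D0 * (A + C) \<in> km K"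
      if "idm n1 * A = A" "D0 * A \<in> km K" "idm n1 * C = C" "D0 * C \<in> km K" for A C
      using that km_add[OF K] by (simp add: distrib_left)
    show "idm n1 * (A * C) = A * C \<and> D0 * (A * C) \<in> km K"
      if "idm n1 * A = A" "D0 * A \<in> km K" for A C
      using that km_right[OF K, of "D0 * A" C] by (metis mult.assoc)
  qed
  from assms(1) this obtain k D1 where "D1 \<in> {V. idm n1 * V = V \<and> D0 * V \<in> km K}"
    "D1 * idm k = D1" "\<And>A. A \<in> {V. idm n1 * V = V \<and> D0 * V \<in> km K} \<Longrightarrow> \<exists>W. A - D1 * W \<in> km K"
    by (rule rid_fg) blast
  then show ?thesis by (intro exI[of _ k] exI[of _ D1]) blast
qed

lemma cpx_exists:
  assumes K: "noeth K" and D0: "idm n0 * D0 = D0" "D0 * idm n1 = D0"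
  obtains n D where "cpx K n D" "D 0 = D0" "n 0 = n0" "n (Suc 0) = n1"
proof -
  define P where "P x \<longleftrightarrow> idm (fst x) * snd (snd x) = snd (snd x) \<and> snd (snd x) * idm (fst (snd x)) = snd (snd x)"
    for x :: "nat \<times> nat \<times> 'a fmat"
  define Q where "Q x y \<longleftrightarrow> fst y = fst (snd x) \<and> snd (snd x) * snd (snd y) \<in> km K \<and>
    (\<forall>V. idm (fst y) * V = V \<longrightarrow> snd (snd x) * V \<in> km K \<longrightarrow> (\<exists>W. V - snd (snd y) * W \<in> km K))"
    for x y :: "nat \<times> nat \<times> 'a fmat"
  have "\<exists>f. (\<forall>i. P (f i)) \<and> (\<forall>i. Q (f i) (f (Suc i))) \<and> f 0 = (n0, n1, D0)"
  proof -
    \<comment> \<open>Dependent choice does not prescribe the first element, so the initial triple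
      is made part of the invariant at index 0.\<close>
    define P' where "P' i x \<longleftrightarrow> P x \<and> (i = 0 \<longrightarrow> x = (n0, n1, D0))" for i :: nat and x
    have "\<exists>f. \<forall>i. P' i (f i) \<and> Q (f i) (f (Suc i))"
    proof (rule dependent_nat_choice)
      show "\<exists>x. P' 0 x" using D0 by (auto simp: P'_def P_def)
    next
      fix x :: "nat \<times> nat \<times> 'a fmat" and i assume "P' i x"
      then have "snd (snd x) * idm (fst (snd x)) = snd (snd x)" by (auto simp: P'_def P_def)
      from kernel_gens[OF K this] obtain n2 D1 where
        "idm (fst (snd x)) * D1 = D1" "D1 * idm n2 = D1" "snd (snd x) * D1 \<in> km K"
        "\<forall>V. idm (fst (snd x)) * V = V \<longrightarrow> snd (snd x) * V \<in> km K \<longrightarrow> (\<exists>W. V - D1 * W \<in> km K)"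
        by blast
      then have "P' (Suc i) (fst (snd x), n2, D1) \<and> Q x (fst (snd x), n2, D1)"
        by (auto simp: P'_def P_def Q_def)
      then show "\<exists>y. P' (Suc i) y \<and> Q x y" by blast
    qed
    then obtain f where "\<And>i. P' i (f i)" "\<And>i. Q (f i) (f (Suc i))" by blast
    then show ?thesis by (intro exI[of _ f]) (simp add: P'_def)
  qed
  then obtain f where f: "\<And>i. P (f i)" "\<And>i. Q (f i) (f (Suc i))" "f 0 = (n0, n1, D0)" by blast
  define n where "n i = fst (f i)" for i
  define D where "D i = snd (snd (f i))" for i
  have n': "fst (snd (f i)) = n (Suc i)" for i using f(2)[of i] by (auto simp: Q_def n_def)
  have "cpx K n D"
    unfolding cpx_def using f(1,2) by (auto simp: P_def Q_def n' simp flip: D_def n_def)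
  moreover have "D 0 = D0" "n 0 = n0" "n (Suc 0) = n1"
    using f(3) n'[of 0] by (simp_all add: D_def n_def)
  ultimately show ?thesis using that by blast
qed

section \<open>Localization at a prime and the Auslander-Buchsbaum bound\<close>

definition prim :: "'a::comm_ring_1 set \<Rightarrow> bool" where
  "prim p \<longleftrightarrow> idl p \<and> 1 \<notin> p \<and> (\<forall>a b. a * b \<in> p \<longrightarrow> a \<in> p \<or> b \<in> p)"

lemma prim_idl: "prim p \<Longrightarrow> idl p" by (simp add: prim_def)
lemma prim_one: "prim p \<Longrightarrow> 1 \<notin> p" by (simp add: prim_def)
lemma prim_mult: "prim p \<Longrightarrow> a \<notin> p \<Longrightarrow> b \<notin> p \<Longrightarrow> a * b \<notin> p" by (auto simp: prim_def)

text \<open>Over a local ring a map of free modules that is injective modulo the maximal ideal has a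
  left inverse; this is the version at \<open>p\<close> with cleared denominators. The proof is
  Gaussian elimination without division, extending a left inverse on the first \<open>a\<close>
  columns by one more column.\<close>

lemma left_inverse_mod_prime:
  assumes p: "prim p" and "\<phi> * idm a = \<phi>"
    and "\<And>V. idm a * V = V \<Longrightarrow> \<phi> * V \<in> km p \<Longrightarrow> V \<in> km p"
  shows "\<exists>\<psi> u. u \<notin> p \<and> \<psi> * \<phi> = u *\<^sub>m idm a"
  using assms(2-)
proof (induction a arbitrary: \<phi>)
  case 0
  have "idm 0 = (0 :: 'a fmat)" by (rule fmat_eqI) (simp add: ent_idm)
  then show ?case using prim_one[OF p] by (intro exI[of _ 0] exI[of _ 1]) simp
next
  case (Suc a)
  let ?E = "idm a :: 'a fmat" and ?N = "un a a :: 'a fmat"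
  have EN: "idm (Suc a) = ?E + ?N" by (rule fmat_eqI) (auto simp: ent_idm ent_un)
  have E_N: "?E * ?N = 0" "?N * ?E = 0" "?N * ?N = ?N"
    by (rule fmat_eqI, simp add: ent_un ent_idm)+
  have "\<exists>\<psi> u. u \<notin> p \<and> \<psi> * (\<phi> * ?E) = u *\<^sub>m ?E"
  proof (rule Suc.IH)
    show "\<phi> * ?E * ?E = \<phi> * ?E" by (simp add: mult.assoc)
    fix V assume V: "?E * V = V" "\<phi> * ?E * V \<in> km p"
    have "?N * V = ?N * ?E * V" using V(1) by (simp add: mult.assoc)
    then have "idm (Suc a) * V = V" using V(1) by (simp add: EN distrib_right E_N)
    moreover have "\<phi> * V \<in> km p" using V by (simp add: mult.assoc)
    ultimately show "V \<in> km p" by (rule Suc.prems(2))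
  qed
  then obtain \<psi> u where u: "u \<notin> p" and \<psi>: "\<psi> * (\<phi> * ?E) = u *\<^sub>m ?E" by blast
  \<comment> \<open>\<open>u\<close> times the last basis vector, corrected by earlier ones so that
    the left inverse of the first columns is taken into account. Its last entry is \<open>u\<close>,
    so it is nonzero modulo \<open>p\<close>, and an entry of \<open>\<phi> * V\<close> outside
    \<open>p\<close> becomes the pivot.\<close>
  define V where "V = u *\<^sub>m ?N - ?E * \<psi> * \<phi> * ?N"
  have "idm (Suc a) * V = V"
    unfolding EN V_def by (simp add: mat_simps E_N) (simp add: E_N flip: mult.assoc)
  moreover have "ent V a a = u" by (simp add: V_def ent_un mult.assoc)
  then have "V \<notin> km p" using u by (metis kmD)
  ultimately have "\<phi> * V \<notin> km p" using Suc.prems(2) by blast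
  then obtain k l where kl: "ent (\<phi> * V) k l \<notin> p" by (auto simp: km_def)
  have VN: "V * ?N = V" by (simp add: V_def mat_simps E_N)
  have "ent (\<phi> * V) k l = ent (\<phi> * V * ?N) k l" by (simp add: mult.assoc VN)
  also have "\<dots> = (if l = a then ent (\<phi> * V) k a else 0)" by (simp del: mult.assoc)
  finally have "l = a" using kl idl_zero[OF prim_idl[OF p]] by (auto split: if_splits)
  define w where "w = ent (\<phi> * V) k a"
  have w: "w \<notin> p" using kl \<open>l = a\<close> by (simp add: w_def)
  define U where "U = (un a k :: 'a fmat)"
  have "U * (\<phi> * V) * ?N = w *\<^sub>m ?N"
    by (rule fmat_eqI) (simp add: U_def w_def ent_un)
  then have UV: "U * (\<phi> * V) = w *\<^sub>m ?N" by (simp add: mult.assoc VN)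
  \<comment> \<open>The pivot row with the first \<open>a\<close> columns eliminated: composed with
    \<open>\<phi>\<close> it vanishes on them and returns the pivot \<open>w\<close> on the last
    one.\<close>
  define \<rho> where "\<rho> = u *\<^sub>m U - U * \<phi> * ?E * \<psi>"
  have \<rho>E: "\<rho> * \<phi> * ?E = 0" using \<psi> by (simp add: \<rho>_def mat_simps)
  have \<rho>N: "\<rho> * \<phi> * ?N = w *\<^sub>m ?N" unfolding UV[symmetric] by (simp add: \<rho>_def V_def mat_simps)
  define \<psi>' where "\<psi>' = w *\<^sub>m (?E * \<psi>) - ?E * \<psi> * \<phi> * ?N * \<rho> + u *\<^sub>m \<rho>"
  have 1: "\<psi>' * \<phi> * ?E = (u * w) *\<^sub>m ?E"
    using \<psi> \<rho>E by (simp add: \<psi>'_def mat_simps)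
  have 2: "\<psi>' * \<phi> * ?N = (u * w) *\<^sub>m ?N"
    using \<rho>N by (simp add: \<psi>'_def mat_simps E_N)
  have "\<psi>' * \<phi> = \<psi>' * \<phi> * ?E + \<psi>' * \<phi> * ?N"
    using Suc.prems(1) unfolding EN by (metis distrib_left mult.assoc)
  also have "\<dots> = (u * w) *\<^sub>m idm (Suc a)" unfolding 1 2 EN by (simp add: mat_simps)
  finally show ?case using prim_mult[OF p u w] by blast
qed

text \<open>The contraction to the ring of the extension of \<open>K\<close> to the localization at
  \<open>p\<close>: congruence modulo \<open>sat p K\<close> is equality in the localized
  quotient.\<close>

definition sat :: "'a::comm_ring_1 set \<Rightarrow> 'a set \<Rightarrow> 'a set" where
  "sat p K = {a. \<exists>u. u \<notin> p \<and> u * a \<in> K}"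

definition adj :: "'a::comm_ring_1 set \<Rightarrow> 'a \<Rightarrow> 'a set" where
  "adj K x = {k + x * y | k y. k \<in> K}"

lemma idl_sat:
  assumes p: "prim p" and K: "idl K"
  shows "idl (sat p K)"
  unfolding idl_def[of "sat p K"]
proof (intro conjI ballI allI)
  show "0 \<in> sat p K" using prim_one[OF p] idl_zero[OF K] by (auto simp: sat_def)
next
  fix a b assume "a \<in> sat p K" "b \<in> sat p K"
  then obtain u v where uv: "u \<notin> p" "u * a \<in> K" "v \<notin> p" "v * b \<in> K" by (auto simp: sat_def)
  have "(u * v) * (a + b) = v * (u * a) + u * (v * b)" by (simp add: algebra_simps)
  then have "(u * v) * (a + b) \<in> K" using idl_add[OF K idl_mult[OF K] idl_mult[OF K]] uv by simp
  then show "a + b \<in> sat p K" using prim_mult[OF p] uv unfolding sat_def by blast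
next
  fix a b assume "b \<in> sat p K"
  then obtain u where u: "u \<notin> p" "u * b \<in> K" by (auto simp: sat_def)
  have "u * (a * b) = a * (u * b)" by (simp add: algebra_simps)
  then have "u * (a * b) \<in> K" using idl_mult[OF K u(2), of a] by metis
  then show "a * b \<in> sat p K" using u(1) unfolding sat_def by blast
qed

lemma sat_superset: "prim p \<Longrightarrow> K \<subseteq> sat p K"
  unfolding sat_def using prim_one by (auto intro!: exI[of _ 1])

lemma sat_sat: "prim p \<Longrightarrow> u \<notin> p \<Longrightarrow> u * a \<in> sat p K \<Longrightarrow> a \<in> sat p K"
  unfolding sat_def mem_Collect_eq by (metis mult.assoc prim_mult)

lemma local_saturated:
  fixes K :: "'p::comm_ring_1 set"
  assumes unit: "\<And>u. u \<notin> m \<Longrightarrow> \<exists>v. v * u - 1 \<in> K" and J: "idl J" "K \<subseteq> J" and u: "u \<notin> m" "u * a \<in> J"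
  shows "a \<in> J"
proof -
  obtain v where v: "v * u - 1 \<in> K" using unit[OF u(1)] by blast
  have "a = v * (u * a) - a * (v * u - 1)" by (simp add: algebra_simps)
  then show ?thesis using idl_diff[OF J(1) idl_mult[OF J(1) u(2), of v] idl_mult[OF J(1) subsetD[OF J(2) v], of a]] by simp
qed

lemma sat_local:
  assumes p: "prim p" and unit: "\<And>u. u \<notin> p \<Longrightarrow> \<exists>v. v * u - 1 \<in> K" and J: "idl J" "K \<subseteq> J"
  shows "sat p J = J"
  using local_saturated[of p K J, OF unit J] sat_superset[OF p, of J] by (auto simp: sat_def)

lemma ideal_below_local:
  fixes K :: "'p::comm_ring_1 set"
  assumes unit: "\<And>u. u \<notin> m \<Longrightarrow> \<exists>v. v * u - 1 \<in> K" and J: "idl J" "K \<subseteq> J" "1 \<notin> J"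
  shows "J \<subseteq> m"
proof
  fix u assume "u \<in> J"
  then show "u \<in> m" using local_saturated[of m K J u 1, OF unit J(1,2)] J(3) by auto
qed

lemma sat_subset: "prim p \<Longrightarrow> idl p \<Longrightarrow> K \<subseteq> p \<Longrightarrow> sat p K \<subseteq> p"
  unfolding sat_def prim_def by auto

lemma idl_adj:
  assumes K: "idl K"
  shows "idl (adj K x)"
  unfolding idl_def[of "adj K x"]
proof (intro conjI ballI allI)
  show "0 \<in> adj K x" using idl_zero[OF K] unfolding adj_def by (simp, metis add_0 mult_zero_right)
next
  fix a b assume "a \<in> adj K x" "b \<in> adj K x"
  then obtain k k' y y' where k: "a = k + x * y" "b = k' + x * y'" "k \<in> K" "k' \<in> K" by (auto simp: adj_def)
  have "a + b = (k + k') + x * (y + y')" using k by (simp add: algebra_simps)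
  then show "a + b \<in> adj K x" using idl_add[OF K k(3,4)] unfolding adj_def by blast
next
  fix a b assume "b \<in> adj K x"
  then obtain k y where k: "b = k + x * y" "k \<in> K" by (auto simp: adj_def)
  have "a * b = a * k + x * (a * y)" using k by (simp add: algebra_simps)
  then show "a * b \<in> adj K x" using idl_mult[OF K k(2)] unfolding adj_def by blast
qed

lemma adj_superset: "K \<subseteq> adj K x"
  unfolding adj_def by (simp add: subset_iff) (metis add.right_neutral mult_zero_right)
lemma adj_mem: "idl K \<Longrightarrow> x \<in> adj K x"
  unfolding adj_def by (simp, metis add_0 mult.right_neutral idl_zero)
lemma adj_least: "idl J \<Longrightarrow> K \<subseteq> J \<Longrightarrow> x \<in> J \<Longrightarrow> adj K x \<subseteq> J"
  unfolding adj_def by (auto intro!: idl_add idl_mult')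

lemma finite_common_denominator:
  assumes p: "prim p" and K: "idl K" and "finite X" "\<And>x. x \<in> X \<Longrightarrow> \<exists>u. u \<notin> p \<and> u * f x \<in> K"
  shows "\<exists>u. u \<notin> p \<and> (\<forall>x\<in>X. u * f x \<in> K)"
  using assms(3,4)
proof (induction X rule: finite_induct)
  case empty
  then show ?case using prim_one[OF p] by auto
next
  case (insert y X)
  obtain u where u1: "u \<notin> p" "\<forall>x\<in>X. u * f x \<in> K" using insert by auto
  obtain v where "v \<notin> p" "v * f y \<in> K" using insert.prems[of y] by auto
  note u = u1 this
  have "u * v * f y = u * (v * f y)" "\<And>x. u * v * f x = v * (u * f x)" by (simp_all add: algebra_simps)
  then have "u * v * f y \<in> K" "\<forall>x\<in>X. u * v * f x \<in> K" using u idl_mult[OF K] by metis+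
  then show ?case using prim_mult[OF p u(1,3)] by auto
qed

text \<open>Finite support allows one common denominator for all entries.\<close>

lemma km_sat:
  assumes p: "prim p" and K: "idl K"
  shows "A \<in> km (sat p K) \<longleftrightarrow> (\<exists>u. u \<notin> p \<and> u *\<^sub>m A \<in> km K)"
proof
  assume A: "A \<in> km (sat p K)"
  obtain N where N: "\<And>i j. N \<le> i \<or> N \<le> j \<Longrightarrow> ent A i j = 0" using ent_bound by blast
  have "\<exists>u. u \<notin> p \<and> (\<forall>x\<in>{..<N} \<times> {..<N}. u * ent A (fst x) (snd x) \<in> K)"
    using A by (intro finite_common_denominator[OF p K]) (auto simp: km_def sat_def)
  then obtain u where u: "u \<notin> p" "\<And>i j. i < N \<Longrightarrow> j < N \<Longrightarrow> u * ent A i j \<in> K" by auto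
  have "u * ent A i j \<in> K" for i j
    using u(2)[of i j] N[of i j] idl_zero[OF K] by (cases "i < N \<and> j < N") auto
  then show "\<exists>u. u \<notin> p \<and> u *\<^sub>m A \<in> km K" using u(1) by (auto simp: km_def)
next
  assume "\<exists>u. u \<notin> p \<and> u *\<^sub>m A \<in> km K"
  then show "A \<in> km (sat p K)" by (auto simp: km_def sat_def)
qed

text \<open>For saturated \<open>K\<close> these are the regular sequences in \<open>p\<close> on
  the localized quotient, written with numerators only. Saturating again after each element keeps
  the ideal a contraction from the localization; \<open>rsid\<close> is the ideal reached at the
  end.\<close>

fun rsq :: "'a::comm_ring_1 set \<Rightarrow> 'a set \<Rightarrow> 'a list \<Rightarrow> bool" where
  "rsq p K [] \<longleftrightarrow> True"
| "rsq p K (x # xs) \<longleftrightarrow> x \<in> p \<and> (\<forall>y. x * y \<in> K \<longrightarrow> y \<in> K) \<and> rsq p (sat p (adj K x)) xs"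

fun rsid :: "'a::comm_ring_1 set \<Rightarrow> 'a set \<Rightarrow> 'a list \<Rightarrow> 'a set" where
  "rsid p K [] = K"
| "rsid p K (x # xs) = rsid p (sat p (adj K x)) xs"

text \<open>Exactness in degree \<open>Suc i\<close> of the complex reduced modulo \<open>K\<close>
  and localized at \<open>p\<close>.\<close>

definition pexact :: "'a::comm_ring_1 set \<Rightarrow> 'a set \<Rightarrow> (nat \<Rightarrow> nat) \<Rightarrow> (nat \<Rightarrow> 'a fmat) \<Rightarrow> nat \<Rightarrow> bool" where
  "pexact p K n D i \<longleftrightarrow> (\<forall>V. idm (n (Suc i)) * V = V \<longrightarrow> D i * V \<in> km K \<longrightarrow>
     (\<exists>u W. u \<notin> p \<and> u *\<^sub>m V - D (Suc i) * W \<in> km K))"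

lemma idl_rsid: "prim p \<Longrightarrow> idl K \<Longrightarrow> idl (rsid p K xs)"
  by (induction xs arbitrary: K) (auto intro: idl_sat idl_adj)
lemma rsid_superset: "prim p \<Longrightarrow> K \<subseteq> rsid p K xs"
  using adj_superset sat_superset by (induction xs arbitrary: K) fastforce+
lemma rsid_sat:
  assumes p: "prim p" and "\<And>u a. u \<notin> p \<Longrightarrow> u * a \<in> K \<Longrightarrow> a \<in> K" "u \<notin> p" "u * a \<in> rsid p K xs"
  shows "a \<in> rsid p K xs"
  using assms(2-)
proof (induction xs arbitrary: K)
  case Nil
  from Nil.prems(1)[OF Nil.prems(2)] Nil.prems(3) show ?case by simp
next
  case (Cons x xs)
  have "a \<in> rsid p (sat p (adj K x)) xs"
  proof (rule Cons.IH[OF _ Cons.prems(2)])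
    show "a \<in> sat p (adj K x)" if "u \<notin> p" "u * a \<in> sat p (adj K x)" for u a
      using that by (rule sat_sat[OF p])
    show "u * a \<in> rsid p (sat p (adj K x)) xs" using Cons.prems(3) by simp
  qed
  then show ?case by simp
qed

lemma km_adj:
  assumes K: "idl K" and "A \<in> km (adj K x)"
  shows "\<exists>Y. A - x *\<^sub>m Y \<in> km K"
proof -
  obtain N where N: "\<And>i j. N \<le> i \<or> N \<le> j \<Longrightarrow> ent A i j = 0" using ent_bound by blast
  have "\<exists>y. ent A i j - x * y \<in> K" for i j
    using kmD[OF assms(2), of i j] unfolding adj_def by (auto, metis add_diff_cancel_right')
  then obtain y where y: "\<And>i j. ent A i j - x * y i j \<in> K" by metis
  have "ent (A - x *\<^sub>m mk N N y) i j \<in> K" for i j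
    using N[of i j] y[of i j] idl_zero[OF K] by (cases "i < N \<and> j < N") auto
  then have "A - x *\<^sub>m mk N N y \<in> km K" by (rule kmI)
  then show ?thesis by blast
qed

text \<open>Dividing by a regular element costs one degree of exactness; iterating this replaces the usual
  computation of Tor with a Koszul complex.\<close>

lemma pexact_rsq:
  assumes p: "prim p" and K: "idl K" and C: "cpx K n D"
  shows "idl L \<Longrightarrow> K \<subseteq> L \<Longrightarrow> (\<And>u a. u \<notin> p \<Longrightarrow> u * a \<in> L \<Longrightarrow> a \<in> L) \<Longrightarrow> rsq p L xs \<Longrightarrow>
    (\<And>i. d \<le> i \<Longrightarrow> pexact p L n D i) \<Longrightarrow> d + length xs \<le> i \<Longrightarrow> pexact p (rsid p L xs) n D i"
proof (induction xs arbitrary: L d i)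
  case Nil
  then show ?case by simp
next
  case (Cons x xs)
  let ?L = "sat p (adj L x)"
  note L = Cons.prems(1)
  have sub: "L \<subseteq> ?L" using adj_superset sat_superset[OF p] by blast
  have iL: "idl ?L" by (intro idl_sat idl_adj p L)
  have xL: "x \<in> ?L" using adj_mem[OF L] sat_superset[OF p] by blast
  have "pexact p (rsid p ?L xs) n D i"
  proof (rule Cons.IH[where d = "Suc d"])
    show "idl ?L" by (rule iL)
    show "K \<subseteq> ?L" using Cons.prems(2) sub by blast
    show "a \<in> ?L" if "u \<notin> p" "u * a \<in> ?L" for u a using sat_sat[OF p that] .
    show "rsq p ?L xs" using Cons.prems(4) by simp
    show "Suc d + length xs \<le> i" using Cons.prems(6) by simp
    fix i' assume "Suc d \<le> i'"
    then obtain i where i': "i' = Suc i" and i: "d \<le> i" by (metis Suc_le_D Suc_le_mono)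
    show "pexact p ?L n D i'"
      unfolding pexact_def i'
    proof (intro allI impI)
      fix V assume V: "idm (n (Suc (Suc i))) * V = V" and DV: "D (Suc i) * V \<in> km ?L"
      obtain u where u: "u \<notin> p" "u *\<^sub>m (D (Suc i) * V) \<in> km (adj L x)"
        using DV km_sat[OF p idl_adj[OF L]] by blast
      \<comment> \<open>Modulo \<open>L\<close> the boundary of \<open>V\<close> is \<open>x\<close>
        times some \<open>Y\<close>, and \<open>Y\<close> is a cycle because \<open>x\<close> is
        regular. A preimage of \<open>Y\<close> corrects \<open>V\<close> by a multiple of
        \<open>x\<close> to a cycle modulo \<open>L\<close>. Exactness is used in two consecutive
        degrees, hence the loss of one.\<close>
      obtain Y0 where Y0: "u *\<^sub>m (D (Suc i) * V) - x *\<^sub>m Y0 \<in> km L" using km_adj[OF L u(2)] by blast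
      define Y where "Y = idm (n (Suc i)) * Y0"
      have "idm (n (Suc i)) * (u *\<^sub>m (D (Suc i) * V) - x *\<^sub>m Y0) \<in> km L" by (rule km_left[OF L Y0])
      moreover have "idm (n (Suc i)) * (D (Suc i) * V) = D (Suc i) * V"
        using cpxD(1)[OF C, of "Suc i"] by (metis mult.assoc)
      ultimately have Y: "u *\<^sub>m (D (Suc i) * V) - x *\<^sub>m Y \<in> km L" by (simp add: right_diff_distrib Y_def)
      have "D i * D (Suc i) * (u *\<^sub>m V) \<in> km L"
        using km_right[OF L] cpxD(3)[OF C, of i] km_mono[OF Cons.prems(2)] by blast
      from km_diff[OF L this km_left[OF L Y, of "D i"]] have "x *\<^sub>m (D i * Y) \<in> km L"
        by (simp add: mat_simps)
      then have "D i * Y \<in> km L" using Cons.prems(4) by (auto simp: km_def)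
      moreover have "idm (n (Suc i)) * Y = Y" by (simp add: Y_def)
      ultimately obtain v W where v: "v \<notin> p" "v *\<^sub>m Y - D (Suc i) * W \<in> km L"
        using Cons.prems(5)[OF i] unfolding pexact_def by blast
      define W' where "W' = idm (n (Suc (Suc i))) * W"
      have DW: "D (Suc i) * W' = D (Suc i) * W"
        unfolding W'_def using cpxD(2)[OF C, of "Suc i"] by (metis mult.assoc)
      have "v *\<^sub>m (u *\<^sub>m (D (Suc i) * V) - x *\<^sub>m Y) + x *\<^sub>m (v *\<^sub>m Y - D (Suc i) * W) \<in> km L"
        by (intro km_add km_scm L Y v)
      then have "D (Suc i) * ((v * u) *\<^sub>m V - x *\<^sub>m W') \<in> km L"
        by (simp add: mat_simps DW)
      moreover have "idm (n (Suc (Suc i))) * ((v * u) *\<^sub>m V - x *\<^sub>m W') = (v * u) *\<^sub>m V - x *\<^sub>m W'"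
        by (simp add: right_diff_distrib V W'_def)
      ultimately obtain w Z where w: "w \<notin> p" "w *\<^sub>m ((v * u) *\<^sub>m V - x *\<^sub>m W') - D (Suc (Suc i)) * Z \<in> km L"
        using Cons.prems(5)[of "Suc i"] i unfolding pexact_def by auto
      have "(w *\<^sub>m ((v * u) *\<^sub>m V - x *\<^sub>m W') - D (Suc (Suc i)) * Z) + (x * w) *\<^sub>m W' \<in> km ?L"
        using w(2) km_mono[OF sub] by (intro km_add[OF iL] km_scm'[OF iL] idl_mult'[OF iL] xL) auto
      then have "(w * (v * u)) *\<^sub>m V - D (Suc (Suc i)) * Z \<in> km ?L" by (simp add: mat_simps)
      moreover have "w * (v * u) \<notin> p" by (intro prim_mult[OF p] w v u)
      ultimately show "\<exists>u W. u \<notin> p \<and> u *\<^sub>m V - D (Suc (Suc i)) * W \<in> km ?L" by blast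
    qed
  qed
  then show ?case by simp
qed

lemma cpx_pexact:
  assumes p: "prim p" and K: "idl K" and C: "cpx K n D"
  shows "pexact p (sat p K) n D i"
  unfolding pexact_def
proof (intro allI impI)
  fix V assume V: "idm (n (Suc i)) * V = V" and "D i * V \<in> km (sat p K)"
  then obtain u where u: "u \<notin> p" "u *\<^sub>m (D i * V) \<in> km K" using km_sat[OF p K] by blast
  then obtain W where "u *\<^sub>m V - D (Suc i) * W \<in> km K"
    using cpxD(4)[OF C, of i "u *\<^sub>m V"] V by auto
  then show "\<exists>u W. u \<notin> p \<and> u *\<^sub>m V - D (Suc i) * W \<in> km (sat p K)"
    using u km_mono[OF sat_superset[OF p]] by blast
qed

text \<open>Von Neumann regularity up to an element outside \<open>p\<close>: locally at \<open>p\<close> the image of \<open>D\<close> splits off,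
  so its cokernel is projective.\<close>

definition vreg :: "'a::comm_ring_1 set \<Rightarrow> 'a set \<Rightarrow> 'a fmat \<Rightarrow> bool" where
  "vreg p K D \<longleftrightarrow> (\<exists>t u. u \<notin> p \<and> D * t * D - u *\<^sub>m D \<in> km K)"

text \<open>If \<open>s\<close> is a quasi-inverse of \<open>D\<close>, then
  \<open>s * D * s\<close> is a reflexive one, at the cost of squaring the denominator. The
  reflexive identity is what cancels the contribution of \<open>t\<close> in
  \<open>auslander_buchsbaum\<close>.\<close>

lemma vreg_normalized:
  assumes p: "prim p" and K: "idl K" and D: "idm m * D = D" "D * idm n = D" and "vreg p K D"
  obtains t u where "u \<notin> p" "D * t * D - u *\<^sub>m D \<in> km K" "t * D * t - u *\<^sub>m t \<in> km K"
    "idm n * t = t" "t * idm m = t"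
proof -
  obtain s v where v: "v \<notin> p" and s: "D * s * D - v *\<^sub>m D \<in> km K"
    using assms(5) by (auto simp: vreg_def)
  define t where "t = idm n * s * D * s * idm m"
  have sD: "D * (idm n * X) = D * X" "idm m * (D * X) = D * X" for X using D by (metis mult.assoc)+
  have e1: "D * t * D - (v * v) *\<^sub>m D = (D * s * D - v *\<^sub>m D) * s * D + v *\<^sub>m (D * s * D - v *\<^sub>m D)"
    by (simp add: t_def mat_simps sD D)
  have e2: "t * D * t - (v * v) *\<^sub>m t = idm n * s * (D * s * D - v *\<^sub>m D) * s * D * s * idm m
      + v *\<^sub>m (idm n * s * (D * s * D - v *\<^sub>m D) * s * idm m)"
    by (simp add: t_def mat_simps sD D)
  show ?thesis
  proof (rule that[of "v * v" t])
    show "v * v \<notin> p" by (rule prim_mult[OF p v v])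
    show "D * t * D - (v * v) *\<^sub>m D \<in> km K" unfolding e1 by (intro km_add km_scm km_right K s)
    show "t * D * t - (v * v) *\<^sub>m t \<in> km K" unfolding e2 by (intro km_add km_scm km_right km_left K s)
    show "idm n * t = t" by (simp add: t_def mult.assoc)
    show "t * idm m = t" by (simp add: t_def mult.assoc)
  qed
qed

text \<open>Moves \<open>b\<close> rows down by \<open>a\<close>: if \<open>A\<close> has
  \<open>a\<close> rows, then \<open>A + shiftm a b * B\<close> is \<open>A\<close> stacked above
  \<open>B\<close>, and multiplication by the transpose of \<open>shiftm a b\<close> recovers the
  lower block.\<close>

definition shiftm :: "nat \<Rightarrow> nat \<Rightarrow> 'a::comm_ring_1 fmat" where
  "shiftm a b = mk (a + b) b (\<lambda>i j. if i = a + j then 1 else 0)"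

lemma shiftm_simps:
  fixes a b
  defines "S \<equiv> shiftm a b :: 'a::comm_ring_1 fmat"
  shows "idm a * S = 0" "tr S * idm a = 0" "tr S * S = idm b"
proof -
  show 1: "idm a * S = 0"
    by (rule fmat_eqI) (auto simp: shiftm_def S_def)
  from arg_cong[OF this, of tr] show "tr S * idm a = 0"
    by (simp add: fmat_eqI)
  show "tr S * S = idm b"
  proof (rule fmat_eqI)
    fix i j
    have "ent (tr S * S) i j = (\<Sum>k<a + b. ent S k i * ent S k j)"
      by (subst ent_times_bound'[of "a + b"]) (auto simp: shiftm_def S_def)
    also have "\<dots> = (\<Sum>k<a + b. if k = a + i then (if i < b \<and> i = j then 1 else 0) else 0)"
      by (rule sum.cong) (auto simp: shiftm_def S_def)
    also have "\<dots> = ent (idm b) i j" by (auto simp: ent_idm)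
    finally show "ent (tr S * S) i j = ent (idm b) i j" .
  qed
qed

text \<open>The cokernel of \<open>D j\<close> is the syzygy in degree \<open>j\<close>, and
  \<open>s\<close> is a socle element modulo the regular sequence \<open>xs\<close>, so the
  conclusion bounds the projective dimension at \<open>p\<close> by the depth. Descending induction:
  if \<open>t\<close> is a quasi-inverse of \<open>D (Suc i)\<close>, then \<open>D i\<close> and
  \<open>t\<close> together are injective modulo \<open>p\<close>, and a left inverse of this pair
  splits \<open>D i\<close>.\<close>

theorem auslander_buchsbaum:
  assumes p: "prim p" and K: "idl K" and C: "cpx K n D"
    and xs: "rsq p (sat p K) xs" and s: "s \<notin> rsid p (sat p K) xs" "\<And>a. a \<in> p \<Longrightarrow> s * a \<in> rsid p (sat p K) xs"
    and N: "vreg p K (D N)" and j: "length xs \<le> j" "j \<le> N"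
  shows "vreg p K (D j)"
  using j(2)
proof (induction rule: inc_induct)
  case base
  show ?case by (rule N)
next
  case (step i)
  let ?L = "rsid p (sat p K) xs"
  have L: "idl ?L" by (intro idl_rsid idl_sat p K)
  have KL: "K \<subseteq> ?L" using rsid_superset[OF p, of "sat p K" xs] sat_superset[OF p, of K] by blast
  have Lsat: "a \<in> ?L" if "u \<notin> p" "u * a \<in> ?L" for u a
    by (rule rsid_sat[OF p _ that]) (rule sat_sat[OF p])
  have ex: "pexact p ?L n D i"
    by (rule pexact_rsq[OF p K C idl_sat[OF p K] sat_superset[OF p] _ xs cpx_pexact[OF p K C], where d = 0])
      (use sat_sat[OF p] step.hyps(1) j(1) in auto)
  let ?k = "n (Suc i)" and ?D = "D (Suc i)" and ?S = "shiftm (n i) (n (Suc (Suc i))) :: 'a fmat"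
  obtain t u where u: "u \<notin> p" and t1: "?D * t * ?D - u *\<^sub>m ?D \<in> km K" and t2: "t * ?D * t - u *\<^sub>m t \<in> km K"
    and t3: "idm (n (Suc (Suc i))) * t = t" "t * idm ?k = t"
    using vreg_normalized[OF p K cpxD(1,2)[OF C] step.IH] by metis
  have iD2: "idm ?k * (?D * X) = ?D * X" "D i * (idm ?k * X) = D i * X" "t * (idm ?k * X) = t * X" for X
    using cpxD(1,2)[OF C] t3 by (metis mult.assoc)+
  \<comment> \<open>\<open>D i\<close> stacked above \<open>t\<close>.\<close>
  define \<phi> where "\<phi> = D i + ?S * t"
  have iD: "idm (n i) * \<phi> = D i" "tr ?S * \<phi> = t"
  proof -
    have "idm (n i) * \<phi> = idm (n i) * D i + idm (n i) * ?S * t" by (simp add: \<phi>_def mat_simps)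
    then show "idm (n i) * \<phi> = D i" by (simp add: shiftm_simps cpxD[OF C])
    have "tr ?S * \<phi> = tr ?S * idm (n i) * D i + tr ?S * ?S * t" by (simp add: \<phi>_def mat_simps cpxD[OF C])
    then show "tr ?S * \<phi> = t" by (simp add: shiftm_simps t3)
  qed
  have "\<exists>\<psi> v. v \<notin> p \<and> \<psi> * \<phi> = v *\<^sub>m idm ?k"
  proof (rule left_inverse_mod_prime[OF p])
    show "\<phi> * idm ?k = \<phi>" by (simp add: \<phi>_def mat_simps cpxD[OF C] t3)
    fix V assume V: "idm ?k * V = V" "\<phi> * V \<in> km p"
    have DV: "D i * V \<in> km p" using km_left[OF prim_idl[OF p] V(2), of "idm (n i)"] iD by (simp flip: mult.assoc)
    have tV: "t * V \<in> km p" using km_left[OF prim_idl[OF p] V(2), of "tr ?S"] iD by (simp flip: mult.assoc)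
    \<comment> \<open>The socle element turns a congruence modulo \<open>p\<close> into one modulo
      the ideal of the regular sequence. There the complex is exact in this degree, so
      \<open>s\<close> times \<open>V\<close> is a boundary up to a denominator.\<close>
    have "D i * (s *\<^sub>m V) \<in> km ?L" using DV s(2) by (auto simp: km_def)
    moreover have "idm ?k * (s *\<^sub>m V) = s *\<^sub>m V" by (simp add: V)
    ultimately obtain w W where w: "w \<notin> p" and W: "w *\<^sub>m (s *\<^sub>m V) - ?D * W \<in> km ?L"
      using ex unfolding pexact_def by blast
    \<comment> \<open>\<open>u *\<^sub>m idm ?k - ?D * t\<close> annihilates the image of
      \<open>?D\<close> modulo \<open>K\<close>, hence \<open>w * s\<close> annihilates
      \<open>?X\<close> modulo \<open>?L\<close>. As \<open>?L\<close> is saturated, an entry of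
      \<open>?X\<close> outside \<open>p\<close> would put \<open>s\<close> into
      \<open>?L\<close>.\<close>
    let ?X = "u *\<^sub>m V - ?D * (t * V)"
    have "(w * s) *\<^sub>m ?X = (u *\<^sub>m idm ?k - ?D * t) * (w *\<^sub>m (s *\<^sub>m V) - ?D * W) - (?D * t * ?D - u *\<^sub>m ?D) * W"
      by (simp add: mat_simps V iD2)
    also have "\<dots> \<in> km ?L"
      using km_mono[OF KL] t1 by (intro km_diff[OF L km_left[OF L W] km_right[OF L]]) auto
    finally have X: "ent ?X a b * s * w \<in> ?L" for a b by (auto simp: km_def ac_simps)
    have "ent ?X a b \<in> p" for a b
    proof (rule ccontr)
      assume "ent ?X a b \<notin> p"
      moreover have "w * (ent ?X a b * s) \<in> ?L" using X[of a b] by (simp add: ac_simps)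
      ultimately show False using Lsat w s(1) by blast
    qed
    then have "?X \<in> km p" by (rule kmI)
    from km_add[OF prim_idl[OF p] this km_left[OF prim_idl[OF p] tV, of ?D]] have "u *\<^sub>m V \<in> km p" by simp
    then show "V \<in> km p" using u p by (auto simp: km_def prim_def)
  qed
  then obtain \<psi> v where v: "v \<notin> p" and \<psi>: "\<psi> * \<phi> = v *\<^sub>m idm ?k" by blast
  have \<psi>': "\<psi> * D i + \<psi> * ?S * t = v *\<^sub>m idm ?k" using \<psi> by (simp add: \<phi>_def mat_simps)
  \<comment> \<open>Multiplying the left inverse identity by the same projection removes the part
    involving \<open>t\<close>, because \<open>t * ?D * t\<close> agrees with
    \<open>u *\<^sub>m t\<close> modulo \<open>K\<close>.\<close>
  have "(D i * (\<psi> * D i + \<psi> * ?S * t)) * (u *\<^sub>m idm ?k - ?D * t)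
      = (D i * (v *\<^sub>m idm ?k)) * (u *\<^sub>m idm ?k - ?D * t)" unfolding \<psi>' ..
  then have "D i * (u *\<^sub>m \<psi>) * D i - (v * u) *\<^sub>m D i = D i * \<psi> * (D i * ?D) * t
       + D i * \<psi> * ?S * (t * ?D * t - u *\<^sub>m t) - v *\<^sub>m (D i * ?D * t)"
    by (simp add: mat_simps iD2 cpxD[OF C] t3)
  also have "\<dots> \<in> km K" 
    by (rule km_diff[OF K km_add[OF K km_right[OF K km_left[OF K]] km_left[OF K t2]]
        km_scm[OF K km_right[OF K]]]; rule cpxD[OF C])
  finally have "D i * (u *\<^sub>m \<psi>) * D i - (v * u) *\<^sub>m D i \<in> km K" .
  then show ?case using prim_mult[OF p v u] unfolding vreg_def by blast
qed

section \<open>Annihilators and prime avoidance\<close>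

text \<open>Zorn's lemma: the union of a chain is generated modulo \<open>K\<close> by finitely many
  elements, and these already lie in one member of the chain.\<close>

lemma noeth_maximal:
  assumes K: "noeth K" and F: "F \<noteq> {}" "\<And>J. J \<in> F \<Longrightarrow> idl J \<and> K \<subseteq> J"
  shows "\<exists>M\<in>F. \<forall>J\<in>F. M \<subseteq> J \<longrightarrow> J = M"
proof -
  have "\<exists>U\<in>F. \<forall>X\<in>C. X \<subseteq> U" if C: "subset.chain F C" for C
  proof (cases "C = {}")
    case True
    then show ?thesis using F(1) by blast
  next
    case False
    have CF: "C \<subseteq> F" and lin: "\<And>X Y. X \<in> C \<Longrightarrow> Y \<in> C \<Longrightarrow> X \<subseteq> Y \<or> Y \<subseteq> X"
      using C by (auto simp: subset.chain_def)
    have C': "idl J \<and> K \<subseteq> J" if "J \<in> C" for J using that CF F(2) by blast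
    have "idl (\<Union>C)"
      unfolding idl_def
    proof (intro conjI ballI allI)
      show "0 \<in> \<Union>C" using False C' idl_zero by blast
      show "a + b \<in> \<Union>C" if ab: "a \<in> \<Union>C" "b \<in> \<Union>C" for a b
      proof -
        obtain X Y where XY: "X \<in> C" "a \<in> X" "Y \<in> C" "b \<in> Y" using ab by blast
        with lin[of X Y] C' idl_add show ?thesis by blast
      qed
      show "a * b \<in> \<Union>C" if "b \<in> \<Union>C" for a b using that C' idl_mult by blast
    qed
    moreover have "K \<subseteq> \<Union>C" using False C' by blast
    ultimately obtain n a where a: "\<And>i. i < (n::nat) \<Longrightarrow> a i \<in> \<Union>C"
      and g: "\<And>y. y \<in> \<Union>C \<Longrightarrow> \<exists>c. y - (\<Sum>i<n. c i * a i) \<in> K" by (rule noeth_gens[OF K]) blast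
    have "\<exists>J\<in>C. \<forall>i<m. a i \<in> J" if "m \<le> n" for m
      using that
    proof (induction m)
      case 0
      then show ?case using False by blast
    next
      case (Suc m)
      then obtain J where J: "J \<in> C" "\<forall>i<m. a i \<in> J" by auto
      obtain J' where J': "J' \<in> C" "a m \<in> J'" using a[of m] Suc.prems by auto
      show ?case using lin[OF J(1) J'(1)] J J' by (auto simp: less_Suc_eq)
    qed
    then obtain J where J: "J \<in> C" "\<forall>i<n. a i \<in> J" by blast
    have "y \<in> J" if y: "y \<in> \<Union>C" for y
    proof -
      obtain c where c: "y - (\<Sum>i<n. c i * a i) \<in> K" using g[OF y] by blast
      have "(\<Sum>i<n. c i * a i) \<in> J" using C'[OF J(1)] J(2) by (intro idl_sum idl_mult) auto
      moreover have "y - (\<Sum>i<n. c i * a i) \<in> J" using c C'[OF J(1)] by blast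
      ultimately show "y \<in> J" using idl_add[of J "y - (\<Sum>i<n. c i * a i)" "\<Sum>i<n. c i * a i"] C'[OF J(1)] by simp
    qed
    then show ?thesis using J(1) CF by blast
  qed
  from subset_Zorn[OF this] show ?thesis by blast
qed

text \<open>Multiply an element of \<open>J\<close> outside \<open>q\<close> by one element of each
  \<open>r\<close> outside \<open>q\<close>; primality keeps the product outside
  \<open>q\<close>.\<close>

lemma prim_prod_avoid:
  assumes q: "prim q" and Q: "finite Q" "\<And>r. r \<in> Q \<Longrightarrow> idl r \<and> \<not> r \<subseteq> q" and J: "idl J" "\<not> J \<subseteq> q"
  shows "\<exists>c\<in>J. c \<notin> q \<and> (\<forall>r\<in>Q. c \<in> r)"
  using Q
proof (induction Q rule: finite_induct)
  case empty
  then show ?case using J by auto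
next
  case (insert r Q)
  then obtain c where c: "c \<in> J" "c \<notin> q" "\<forall>r\<in>Q. c \<in> r" by auto
  obtain d where d: "d \<in> r" "d \<notin> q" using insert.prems[of r] by auto
  have "d * c \<in> J" using c J idl_mult by blast
  moreover have "d * c \<notin> q" by (rule prim_mult[OF q d(2) c(2)])
  moreover have "d * c \<in> r'" if "r' \<in> insert r Q" for r'
  proof (cases "r' = r")
    case True
    then show ?thesis using insert.prems[of r] idl_mult'[OF _ d(1)] by simp
  next
    case False
    then have "r' \<in> Q" using that by simp
    then show ?thesis using insert.prems[of r'] idl_mult[of r' c d] c(3) by simp
  qed
  ultimately show ?case by blast
qed

text \<open>When a new prime \<open>q\<close> contains the element \<open>x + j\<close> found so
  far, \<open>j\<close> is changed by an element of \<open>J\<close> that lies in all the earlier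
  primes but not in \<open>q\<close>. Such an element exists because the primes are pairwise
  incomparable. The coset form is essential later: the regular element must also be part of a
  minimal set of generators.\<close>

lemma prime_avoidance_coset:
  assumes Q: "finite Q" "\<And>q. q \<in> Q \<Longrightarrow> prim q \<and> \<not> J \<subseteq> q" "\<And>q r. q \<in> Q \<Longrightarrow> r \<in> Q \<Longrightarrow> q \<subseteq> r \<Longrightarrow> q = r"
    and J: "idl J"
  shows "\<exists>j\<in>J. \<forall>q\<in>Q. x + j \<notin> q"
  using Q
proof (induction Q rule: finite_induct)
  case empty
  then show ?case using idl_zero[OF J] by auto
next
  case (insert q Q)
  obtain j where j: "j \<in> J" "\<And>r. r \<in> Q \<Longrightarrow> x + j \<notin> r" using insert.IH insert.prems by auto
  show ?case
  proof (cases "x + j \<in> q")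
    case False
    then show ?thesis using j by auto
  next
    case True
    have q: "prim q" "\<not> J \<subseteq> q" using insert.prems(1)[of q] by auto
    have "idl r \<and> \<not> r \<subseteq> q" if "r \<in> Q" for r
      using insert.prems(1)[of r] insert.prems(2)[of r q] that insert.hyps(2) prim_idl by auto
    from prim_prod_avoid[OF q(1) insert.hyps(1) this J q(2)] obtain c
      where c: "c \<in> J" "c \<notin> q" "\<And>r. r \<in> Q \<Longrightarrow> c \<in> r" by blast
    have "x + (j + c) \<notin> r" if r: "r \<in> insert q Q" for r
    proof
      assume m: "x + (j + c) \<in> r"
      have ir: "idl r" using insert.prems(1)[OF r] prim_idl by blast
      show False
      proof (cases "r = q")
        case True
        have "c = (x + (j + c)) - (x + j)" by simp
        then have "c \<in> q" using idl_diff[OF ir m] \<open>x + j \<in> q\<close> True by metis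
        then show False using c by simp
      next
        case False
        then have rQ: "r \<in> Q" using r by simp
        have "x + j = (x + (j + c)) - c" by simp
        then have "x + j \<in> r" using idl_diff[OF ir m c(3)[OF rQ]] by metis
        then show False using j(2)[OF rQ] by simp
      qed
    qed
    moreover have "j + c \<in> J" by (rule idl_add[OF J j(1) c(1)])
    ultimately show ?thesis by blast
  qed
qed

text \<open>The elements of \<open>X\<close> modulo \<open>B\<close> as a module over the quotient
  by \<open>K\<close>. Instances are the ring, columns of fixed length, and row cocycles modulo
  coboundaries.\<close>

locale pmod =
  fixes sc :: "'p::comm_ring_1 \<Rightarrow> 'm::ab_group_add \<Rightarrow> 'm" and K :: "'p set" and X B :: "'m set"
  assumes K: "noeth K"
    and sc_mult: "sc (a * b) f = sc a (sc b f)" and sc_one: "sc 1 f = f"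
    and sc_add: "sc (a + b) f = sc a f + sc b f" and sc_add': "sc a (f + g) = sc a f + sc a g"
    and X_sc: "f \<in> X \<Longrightarrow> sc a f \<in> X"
    and B_zero: "0 \<in> B" and B_add: "f \<in> B \<Longrightarrow> g \<in> B \<Longrightarrow> f + g \<in> B" and B_sc: "f \<in> B \<Longrightarrow> sc a f \<in> B"
    and K_sc: "a \<in> K \<Longrightarrow> f \<in> X \<Longrightarrow> sc a f \<in> B"
begin

definition ann :: "'m \<Rightarrow> 'p set" where "ann f = {a. sc a f \<in> B}"

lemma idl_ann: "f \<in> X \<Longrightarrow> idl (ann f)"
  unfolding idl_def ann_def mem_Collect_eq
  using sc_add B_add sc_mult B_sc K_sc[OF idl_zero[OF noeth_idl[OF K]]] by auto

lemma K_ann: "f \<in> X \<Longrightarrow> K \<subseteq> ann f" using K_sc by (auto simp: ann_def)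

text \<open>The maximal members among the annihilators of nonzero elements. They are primes, and
  every zero divisor lies in one of them.\<close>

definition max_ann :: "'p set \<Rightarrow> bool" where
  "max_ann q \<longleftrightarrow> (\<exists>f\<in>X - B. q = ann f) \<and> (\<forall>g\<in>X - B. q \<subseteq> ann g \<longrightarrow> ann g = q)"

lemma prim_max:
  assumes g: "g \<in> X - B" and max: "\<And>a. sc a g \<notin> B \<Longrightarrow> ann (sc a g) = ann g"
  shows "prim (ann g)"
  unfolding prim_def
proof (intro conjI allI impI)
  show "idl (ann g)" using g idl_ann by blast
  show "1 \<notin> ann g" using g by (simp add: ann_def sc_one)
  fix a b assume ab: "a * b \<in> ann g"
  show "a \<in> ann g \<or> b \<in> ann g"
  proof (cases "b \<in> ann g")
    case False
    then have "sc b g \<notin> B" by (simp add: ann_def)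
    then have "ann (sc b g) = ann g" by (rule max)
    moreover have "a \<in> ann (sc b g)" using ab by (simp add: ann_def sc_mult)
    ultimately show ?thesis by simp
  qed simp
qed

lemma ann_sc: "ann g \<subseteq> ann (sc a g)"
  by (auto simp: ann_def mult.commute[of _ a] sc_mult[symmetric]) (metis B_sc mult.commute sc_mult)

lemma max_ann_prim: "max_ann q \<Longrightarrow> prim q"
  unfolding max_ann_def
proof (elim conjE bexE)
  fix f assume "\<forall>g\<in>X - B. q \<subseteq> ann g \<longrightarrow> ann g = q" "f \<in> X - B" "q = ann f"
  then show "prim q" using prim_max[of f] ann_sc X_sc by auto
qed

lemma max_ann_exists:
  assumes f: "f \<in> X - B"
  obtains g where "g \<in> X - B" "ann f \<subseteq> ann g" "max_ann (ann g)"
proof -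
  have "ann ` {g\<in>X - B. ann f \<subseteq> ann g} \<noteq> {}" using f by blast
  moreover have "idl J \<and> K \<subseteq> J" if "J \<in> ann ` {g\<in>X - B. ann f \<subseteq> ann g}" for J
    using that idl_ann K_ann by auto
  ultimately have "\<exists>M\<in>ann ` {g\<in>X - B. ann f \<subseteq> ann g}. \<forall>J\<in>ann ` {g\<in>X - B. ann f \<subseteq> ann g}. M \<subseteq> J \<longrightarrow> J = M"
    by (rule noeth_maximal[OF K])
  then obtain M where M: "M \<in> ann ` {g\<in>X - B. ann f \<subseteq> ann g}"
    "\<forall>J\<in>ann ` {g\<in>X - B. ann f \<subseteq> ann g}. M \<subseteq> J \<longrightarrow> J = M"
    by (rule bexE)
  from M(1) obtain g where g: "g \<in> X - B" "ann f \<subseteq> ann g" "M = ann g" by auto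
  have "ann h = ann g" if h: "h \<in> X - B" "ann g \<subseteq> ann h" for h
  proof -
    have "ann f \<subseteq> ann h" using h g(2) by blast
    then show ?thesis using M(2) g(3) h by auto
  qed
  then have "max_ann (ann g)" unfolding max_ann_def using g(1) by auto
  then show ?thesis by (rule that[OF g(1,2)])
qed

lemma prime_ann:
  assumes "f \<in> X - B"
  obtains g where "g \<in> X - B" "ann f \<subseteq> ann g" "prim (ann g)"
  using max_ann_exists[OF assms] max_ann_prim by metis

end

lemma prim_Inter:
  assumes "prim q" "(\<Inter>i\<in>{..<n::nat}. J i) \<subseteq> q" "\<And>i. i < n \<Longrightarrow> idl (J i)"
  shows "\<exists>i<n. J i \<subseteq> q"
proof (rule ccontr)
  assume "\<not> (\<exists>i<n. J i \<subseteq> q)"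
  moreover have "idl (UNIV :: 'a set)" "\<not> UNIV \<subseteq> q" using prim_one[OF assms(1)] by (auto simp: idl_def)
  ultimately obtain c where "c \<notin> q" "\<forall>r\<in>J ` {..<n}. c \<in> r"
    using prim_prod_avoid[OF assms(1), of "J ` {..<n}" UNIV] assms(3) by blast
  then show False using assms(2) by auto
qed

text \<open>The generators are taken from \<open>Y\<close> itself, which need not be a submodule. In
  \<open>finite_max_ann\<close> the set \<open>Y\<close> consists of witnesses, and the generators
  have to be witnesses again.\<close>

locale pmod_fg = pmod +
  assumes fg: "Y \<subseteq> X \<Longrightarrow> \<exists>n y. (\<forall>i<(n::nat). y i \<in> Y) \<and> (\<forall>z\<in>Y. \<exists>c. z - (\<Sum>i<n. sc (c i) (y i)) \<in> B)"
begin

lemma sc_sum: "sc a (sum h I) = (\<Sum>i\<in>I. sc a (h i))"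
proof -
  have "sc a 0 = 0" using sc_add'[of a 0 0] by simp
  then show ?thesis by (induction I rule: infinite_finite_induct) (auto simp: sc_add')
qed

lemma B_sum: "(\<And>i. i \<in> I \<Longrightarrow> h i \<in> B) \<Longrightarrow> sum h I \<in> B"
  by (induction I rule: infinite_finite_induct) (auto intro: B_zero B_add)

text \<open>One witness is chosen for each maximal annihilator, and finitely many of the witnesses
  generate all of them. The intersection of the annihilators of these generators lies in every
  maximal annihilator \<open>q\<close>; by primality one of them lies in \<open>q\<close>, and by
  maximality it equals \<open>q\<close>.\<close>

lemma finite_max_ann: "finite {q. max_ann q}"
proof -
  have "\<forall>q. \<exists>f. max_ann q \<longrightarrow> f \<in> X - B \<and> q = ann f" unfolding max_ann_def by blast
  then obtain f where f: "\<And>q. max_ann q \<Longrightarrow> f q \<in> X - B" "\<And>q. max_ann q \<Longrightarrow> ann (f q) = q" by metis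
  have "f ` {q. max_ann q} \<subseteq> X" using f by blast
  from fg[OF this] obtain n y where y: "\<And>i. i < (n::nat) \<Longrightarrow> y i \<in> f ` {q. max_ann q}"
    and gen: "\<And>z. z \<in> f ` {q. max_ann q} \<Longrightarrow> \<exists>c. z - (\<Sum>i<n. sc (c i) (y i)) \<in> B" by blast
  have "q \<in> (\<lambda>i. ann (y i)) ` {..<n}" if q: "max_ann q" for q
  proof -
    obtain c where c: "f q - (\<Sum>i<n. sc (c i) (y i)) \<in> B" using gen q by blast
    have "(\<Inter>i\<in>{..<n}. ann (y i)) \<subseteq> q"
    proof
      fix a assume a: "a \<in> (\<Inter>i\<in>{..<n}. ann (y i))"
      have "sc a (sc (c i) (y i)) \<in> B" if "i < n" for i
      proof -
        have "sc (c i) (sc a (y i)) \<in> B" using a that by (auto simp: ann_def intro: B_sc)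
        then show ?thesis by (metis sc_mult mult.commute)
      qed
      then have "sc a (\<Sum>i<n. sc (c i) (y i)) \<in> B" unfolding sc_sum by (intro B_sum) auto
      from B_add[OF B_sc[OF c, of a] this] have "sc a (f q) \<in> B"
        unfolding sc_add'[symmetric] by simp
      then show "a \<in> q" using f(2)[OF q] by (auto simp: ann_def)
    qed
    moreover have "idl (ann (y i))" if "i < n" for i
    proof (rule idl_ann)
      show "y i \<in> X" using y[OF that] f(1) by auto
    qed
    ultimately have "\<exists>i<n. ann (y i) \<subseteq> q"
      by (intro prim_Inter[OF max_ann_prim[OF q]])
    then obtain i where i: "i < n" "ann (y i) \<subseteq> q" by blast
    obtain q' where q': "max_ann q'" "ann (y i) = q'" using y[OF i(1)] f(2) by auto
    have "q' = q" using q' i(2) q f[OF q] unfolding max_ann_def by auto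
    then show ?thesis using i(1) q'(2) by auto
  qed
  then have "{q. max_ann q} \<subseteq> (\<lambda>i. ann (y i)) ` {..<n}" by (intro subsetI) simp
  then show ?thesis by (rule finite_subset) simp
qed

text \<open>The maximal annihilators are finitely many pairwise incomparable primes, and none
  contains \<open>J\<close>, because \<open>J\<close> kills no nonzero element. An element of the
  coset outside all of them is regular.\<close>

theorem regular_in_coset:
  assumes J: "idl J" "\<And>g. g \<in> X - B \<Longrightarrow> \<exists>j\<in>J. sc j g \<notin> B"
  shows "\<exists>j\<in>J. \<forall>g\<in>X. sc (x + j) g \<in> B \<longrightarrow> g \<in> B"
proof -
  have "\<exists>j\<in>J. \<forall>q\<in>{q. max_ann q}. x + j \<notin> q"
  proof (rule prime_avoidance_coset[OF finite_max_ann _ _ J(1)])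
    fix q assume "q \<in> {q. max_ann q}"
    then have q: "max_ann q" by simp
    then obtain g where g: "g \<in> X - B" "q = ann g" by (auto simp: max_ann_def)
    show "prim q \<and> \<not> J \<subseteq> q" using max_ann_prim[OF q] J(2)[OF g(1)] unfolding g(2) ann_def by auto
    fix r assume "r \<in> {q. max_ann q}" "q \<subseteq> r"
    then show "q = r" using q unfolding max_ann_def by auto
  qed
  then obtain j where j: "j \<in> J" "\<And>q. max_ann q \<Longrightarrow> x + j \<notin> q" by blast
  have "g \<in> B" if g: "g \<in> X" "sc (x + j) g \<in> B" for g
  proof (rule ccontr)
    assume "g \<notin> B"
    then obtain h where h: "ann g \<subseteq> ann h" "max_ann (ann h)" using max_ann_exists[of g] g by blast
    have "x + j \<in> ann g" using g by (simp add: ann_def)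
    then show False using h j(2) by blast
  qed
  then show ?thesis using j(1) by blast
qed

end

section \<open>Finite generation of modules of columns\<close>

definition colm :: "nat \<Rightarrow> 'a::comm_ring_1 fmat set" where
  "colm n = {A. idm n * A = A \<and> A * idm 1 = A}"

lemma idm1_conj: "idm 1 * A * idm 1 = ent A 0 0 *\<^sub>m idm 1"
  by (rule fmat_eqI) (auto simp: ent_idm)

text \<open>The right ideal generated by \<open>Y\<close> has a generating matrix modulo
  \<open>K\<close>, and this single matrix involves only finitely many members of
  \<open>Y\<close>.\<close>

lemma columns_generated:
  assumes K: "noeth K" and Y: "Y \<subseteq> colm n"
  shows "\<exists>k y. (\<forall>i<(k::nat). y i \<in> Y) \<and> (\<forall>z\<in>Y. \<exists>c. z - (\<Sum>i<k. c i *\<^sub>m y i) \<in> km K)"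
proof -
  have iK: "idl K" by (rule noeth_idl[OF K])
  define S where "S = {A. \<exists>k y C. (\<forall>i<(k::nat). y i \<in> Y) \<and> A = (\<Sum>i<k. y i * C i)}"
  have "rid n S"
    unfolding rid_def
  proof (intro conjI ballI allI)
    fix A assume "A \<in> S"
    then obtain k :: nat and y C where y: "\<forall>i<k. y i \<in> Y" "A = (\<Sum>i<k. y i * C i)" by (auto simp: S_def)
    have "idm n * (y i * C i) = y i * C i" if "i < k" for i
      using y(1) that Y by (auto simp: colm_def simp flip: mult.assoc)
    then show "idm n * A = A" unfolding y(2) sum_distrib_left by (intro sum.cong) auto
    show "A * C' \<in> S" for C'
    proof -
      have "A * C' = (\<Sum>i<k. y i * (C i * C'))" unfolding y(2) sum_distrib_right by (simp add: mult.assoc)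
      then show ?thesis using y(1) unfolding S_def by (intro CollectI exI[of _ k] exI[of _ y] exI[of _ "\<lambda>i. C i * C'"]) simp
    qed
  next
    show "0 \<in> S" unfolding S_def by (intro CollectI exI[of _ 0]) simp
  next
    fix A A' assume "A \<in> S" "A' \<in> S"
    then obtain k k' :: nat and y C y' C' where y: "\<forall>i<k. y i \<in> Y" "A = (\<Sum>i<k. y i * C i)"
       and y': "\<forall>i<k'. y' i \<in> Y" "A' = (\<Sum>i<k'. y' i * C' i)" by (auto simp: S_def)
    define y'' where "y'' i = (if i < k then y i else y' (i - k))" for i
    define C'' where "C'' i = (if i < k then C i else C' (i - k))" for i
    have "A + A' = (\<Sum>i<k + k'. y'' i * C'' i)" unfolding sum_lessThan_add y y' by (simp add: y''_def C''_def)
    moreover have "\<forall>i<k + k'. y'' i \<in> Y" using y(1) y'(1) by (auto simp: y''_def)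
    ultimately show "A + A' \<in> S" unfolding S_def by (intro CollectI exI[of _ "k + k'"] exI[of _ y''] exI[of _ C'']) simp
  qed
  then obtain k0 D where D: "D \<in> S" "\<And>A. A \<in> S \<Longrightarrow> \<exists>W. A - D * W \<in> km K"
    using rid_fg[OF K] by metis
  then obtain k :: nat and y C where y: "\<forall>i<k. y i \<in> Y" and Dy: "D = (\<Sum>i<k. y i * C i)" by (auto simp: S_def)
  have "\<exists>c. z - (\<Sum>i<k. c i *\<^sub>m y i) \<in> km K" if z: "z \<in> Y" for z
  proof -
    have z1: "z * idm 1 = z" using z Y by (auto simp: colm_def)
    then have "z = (\<Sum>i<(1::nat). z * idm 1)" by simp
    then have "z \<in> S" unfolding S_def using z by (intro CollectI exI[of _ 1] exI[of _ "\<lambda>_. z"] exI[of _ "\<lambda>_. idm 1"]) simp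
    then obtain W where W: "z - D * W \<in> km K" using D(2) by blast
    \<comment> \<open>Since \<open>y i\<close> and \<open>z\<close> have one column, only the entry
      at (0,0) of the matrix coefficient matters, and it acts as a scalar.\<close>
    have "y i * C i * W * idm 1 = ent (C i * W) 0 0 *\<^sub>m y i" if "i < k" for i
    proof -
      have yi: "y i = y i * idm 1" using y that Y by (auto simp: colm_def)
      have "y i * C i * W * idm 1 = y i * (idm 1 * (C i * W) * idm 1)" by (subst yi) (simp add: mult.assoc)
      also have "\<dots> = ent (C i * W) 0 0 *\<^sub>m (y i * idm 1)" unfolding idm1_conj by simp
      finally show ?thesis using yi by simp
    qed
    then have "(z - D * W) * idm 1 = z - (\<Sum>i<k. ent (C i * W) 0 0 *\<^sub>m y i)"
      unfolding Dy left_diff_distrib sum_distrib_right z1 by simp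
    then have "z - (\<Sum>i<k. ent (C i * W) 0 0 *\<^sub>m y i) \<in> km K"
      using km_right[OF iK W, of "idm 1"] by simp
    then show ?thesis by (intro exI[of _ "\<lambda>i. ent (C i * W) 0 0"])
  qed
  then show ?thesis
    using y by (intro exI[of _ k] exI[of _ y]) blast
qed

lemma noeth_subset_gens:
  assumes K: "noeth K"
  shows "\<exists>n y. (\<forall>i<(n::nat). y i \<in> Y) \<and> (\<forall>z\<in>Y. \<exists>c. z - (\<Sum>i<n. c i * y i) \<in> K)"
proof -
  let ?c = "\<lambda>y. y *\<^sub>m idm 1 :: 'a fmat"
  have "?c ` Y \<subseteq> colm 1" by (auto simp: colm_def)
  from columns_generated[OF K this] obtain n w where w: "\<forall>i<(n::nat). w i \<in> ?c ` Y"
    and gen: "\<forall>z\<in>?c ` Y. \<exists>c. z - (\<Sum>i<n. c i *\<^sub>m w i) \<in> km K" by blast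
  have "\<forall>i. \<exists>v. i < n \<longrightarrow> v \<in> Y \<and> w i = ?c v" using w by blast
  from choice[OF this] obtain y where y: "\<And>i. i < n \<Longrightarrow> y i \<in> Y" "\<And>i. i < n \<Longrightarrow> w i = ?c (y i)" by blast
  have "\<exists>c. z - (\<Sum>i<n. c i * y i) \<in> K" if z: "z \<in> Y" for z
  proof -
    obtain c where c: "?c z - (\<Sum>i<n. c i *\<^sub>m w i) \<in> km K" using bspec[OF gen imageI[OF z]] by blast
    have "(\<Sum>i<n. c i *\<^sub>m w i) = ?c (\<Sum>i<n. c i * y i)"
      using y(2) by (induction n) (simp_all add: scm_add_left)
    then have "?c (z - (\<Sum>i<n. c i * y i)) \<in> km K" using c by (simp add: mat_simps)
    from kmD[OF this, of 0 0] show ?thesis by (auto simp: ent_idm)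
  qed
  then show ?thesis using y(1) by blast
qed

lemma pmod_ring:
  assumes "noeth K" "idl K'" "K \<subseteq> K'"
  shows "pmod_fg (*) K UNIV K'"
proof unfold_locales
  fix Y :: "'a set"
  obtain n y where "\<forall>i<(n::nat). y i \<in> Y" "\<forall>z\<in>Y. \<exists>c. z - (\<Sum>i<n. c i * y i) \<in> K"
    using noeth_subset_gens[OF assms(1), of Y] by blast
  then show "\<exists>n y. (\<forall>i<(n::nat). y i \<in> Y) \<and> (\<forall>z\<in>Y. \<exists>c. z - (\<Sum>i<n. c i * y i) \<in> K')"
    using assms(3) by (intro exI[of _ n] exI[of _ y]) blast
next
  show "a * f \<in> K'" if "a \<in> K" for a f using that assms(2,3) idl_mult'[of K' a f] by blast
qed (use assms idl_zero[of K'] idl_add[of K'] idl_mult[of K'] in \<open>auto simp: algebra_simps\<close>)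

text \<open>If no nonzero class modulo \<open>K'\<close> is killed by \<open>J\<close>, prime
  avoidance in the coset of 0 gives a regular element of \<open>J\<close>. Otherwise a killed class
  can be replaced by one whose annihilator is prime.\<close>

lemma regular_or_socle:
  assumes "noeth K" "idl K'" "K \<subseteq> K'" "idl J"
  obtains x where "x \<in> J" "\<And>y. x * y \<in> K' \<Longrightarrow> y \<in> K'"
  | s where "s \<notin> K'" "\<And>x. x \<in> J \<Longrightarrow> x * s \<in> K'" "prim {a. a * s \<in> K'}"
proof -
  interpret pmod_fg "(*)" K UNIV K' by (rule pmod_ring[OF assms(1-3)])
  show ?thesis
  proof (cases "\<exists>g. g \<notin> K' \<and> (\<forall>j\<in>J. j * g \<in> K')")
    case True
    then obtain g where g: "g \<notin> K'" "\<And>j. j \<in> J \<Longrightarrow> j * g \<in> K'" by blast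
    obtain s where "s \<notin> K'" "ann g \<subseteq> ann s" "prim (ann s)" using prime_ann[of g] g(1) by blast
    then show ?thesis using that(2)[of s] g(2) by (auto simp: ann_def)
  next
    case False
    then have "\<exists>j\<in>J. \<forall>g\<in>UNIV. (0 + j) * g \<in> K' \<longrightarrow> g \<in> K'" by (intro regular_in_coset assms(4)) auto
    then show ?thesis using that(1) by auto
  qed
qed

text \<open>Noetherian induction on saturated ideals between \<open>K\<close> and \<open>p\<close>.
  In a maximal counterexample \<open>M\<close>, a regular element of \<open>p\<close> would lead to
  a strictly larger counterexample, and without one there is a socle element, so that the empty
  sequence works. The length of \<open>xs\<close> stands for the depth at \<open>p\<close> from here
  on.\<close>

lemma maximal_rsq:
  assumes K: "noeth K" and p: "prim p" "K \<subseteq> p"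
  obtains xs s where "rsq p (sat p K) xs" "s \<notin> rsid p (sat p K) xs" "\<And>a. a \<in> p \<Longrightarrow> s * a \<in> rsid p (sat p K) xs"
proof -
  define good where "good L \<longleftrightarrow> idl L \<and> K \<subseteq> L \<and> L \<subseteq> p \<and> (\<forall>u a. u \<notin> p \<longrightarrow> u * a \<in> L \<longrightarrow> a \<in> L)" for L
  define fin where "fin L \<longleftrightarrow> (\<exists>xs s. rsq p L xs \<and> s \<notin> rsid p L xs \<and> (\<forall>a\<in>p. s * a \<in> rsid p L xs))" for L
  have "fin L" if "good L" for L
  proof (rule ccontr)
    assume "\<not> fin L"
    then have "{L. good L \<and> \<not> fin L} \<noteq> {}" using that by blast
    moreover have "idl L \<and> K \<subseteq> L" if "L \<in> {L. good L \<and> \<not> fin L}" for L using that by (auto simp: good_def)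
    ultimately have "\<exists>M\<in>{L. good L \<and> \<not> fin L}. \<forall>L\<in>{L. good L \<and> \<not> fin L}. M \<subseteq> L \<longrightarrow> L = M"
      by (rule noeth_maximal[OF K])
    then obtain M where M: "good M" "\<not> fin M" "\<And>L. good L \<Longrightarrow> \<not> fin L \<Longrightarrow> M \<subseteq> L \<Longrightarrow> L = M" by blast
    have M': "idl M" "K \<subseteq> M" "M \<subseteq> p" "\<And>u a. u \<notin> p \<Longrightarrow> u * a \<in> M \<Longrightarrow> a \<in> M" using M(1) by (auto simp: good_def)
    show False
    proof (rule regular_or_socle[OF K M'(1,2) prim_idl[OF p(1)]])
      fix x assume x: "x \<in> p" "\<And>y. x * y \<in> M \<Longrightarrow> y \<in> M"
      let ?L = "sat p (adj M x)"
      have "M \<subseteq> ?L" using adj_superset sat_superset[OF p(1)] by blast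
      moreover have "x \<in> ?L" using adj_mem[OF M'(1)] sat_superset[OF p(1)] by blast
      moreover have "x \<notin> M" using x(2)[of 1] M'(3) prim_one[OF p(1)] by auto
      moreover have "good ?L"
        unfolding good_def
      proof (intro conjI allI impI)
        show "idl ?L" by (intro idl_sat idl_adj p M')
        show "K \<subseteq> ?L" using M'(2) \<open>M \<subseteq> ?L\<close> by blast
        show "?L \<subseteq> p"
          by (rule sat_subset[OF p(1) prim_idl[OF p(1)] adj_least[OF prim_idl[OF p(1)] M'(3) x(1)]])
        show "a \<in> ?L" if "u \<notin> p" "u * a \<in> ?L" for u a using sat_sat[OF p(1) that] .
      qed
      ultimately have "fin ?L" using M(3)[of ?L] by blast
      then obtain xs s where "rsq p ?L xs" "s \<notin> rsid p ?L xs" "\<forall>a\<in>p. s * a \<in> rsid p ?L xs" by (auto simp: fin_def)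
      then have "rsq p M (x # xs)" "s \<notin> rsid p M (x # xs)" "\<forall>a\<in>p. s * a \<in> rsid p M (x # xs)"
        using x by auto
      then have "fin M" unfolding fin_def by blast
      then show False using M(2) by blast
    next
      fix s assume "s \<notin> M" "\<And>x. x \<in> p \<Longrightarrow> x * s \<in> M"
      then have "rsq p M []" "s \<notin> rsid p M []" "\<forall>a\<in>p. s * a \<in> rsid p M []" by (auto simp: mult.commute)
      then have "fin M" unfolding fin_def by blast
      then show False using M(2) by blast
    qed
  qed
  moreover have "good (sat p K)"
    unfolding good_def
    using idl_sat[OF p(1) noeth_idl[OF K]] sat_superset[OF p(1), of K] sat_subset[OF p(1) prim_idl[OF p(1)] p(2)]
      sat_sat[OF p(1)] by blast
  ultimately obtain xs s where "rsq p (sat p K) xs" "s \<notin> rsid p (sat p K) xs" "\<forall>a\<in>p. s * a \<in> rsid p (sat p K) xs"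
    unfolding fin_def by blast
  then show ?thesis using that by blast
qed

section \<open>Comparison of projective resolutions\<close>

text \<open>Complexes of projective modules: the module in degree \<open>i\<close> is the image of the idempotent \<open>e i\<close>.\<close>

definition pcx :: "'a::comm_ring_1 set \<Rightarrow> (nat \<Rightarrow> 'a fmat) \<Rightarrow> (nat \<Rightarrow> 'a fmat) \<Rightarrow> bool" where
  "pcx K e D \<longleftrightarrow> (\<forall>i. e i * e i - e i \<in> km K \<and> e i * D i - D i \<in> km K \<and> D i * e (Suc i) - D i \<in> km K \<and>
     D i * D (Suc i) \<in> km K \<and>
     (\<forall>V. e (Suc i) * V - V \<in> km K \<longrightarrow> D i * V \<in> km K \<longrightarrow> (\<exists>W. V - D (Suc i) * W \<in> km K)))"

lemma pcxD:
  assumes "pcx K e D"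
  shows "e i * e i - e i \<in> km K" "e i * D i - D i \<in> km K" "D i * e (Suc i) - D i \<in> km K"
    "D i * D (Suc i) \<in> km K"
    "e (Suc i) * V - V \<in> km K \<Longrightarrow> D i * V \<in> km K \<Longrightarrow> \<exists>W. V - D (Suc i) * W \<in> km K"
  using assms unfolding pcx_def by auto

lemma cpx_pcx:
  assumes K: "idl K" and C: "cpx K n D"
  shows "pcx K (\<lambda>i. idm (n i)) D"
  unfolding pcx_def
proof (intro allI conjI impI)
  fix i V
  assume V: "idm (n (Suc i)) * V - V \<in> km K" "D i * V \<in> km K"
  have "D i * (idm (n (Suc i)) * V) = D i * V" using cpxD(2)[OF C, of i] by (metis mult.assoc)
  then obtain W where "idm (n (Suc i)) * V - D (Suc i) * W \<in> km K"
    using cpxD(4)[OF C, of i "idm (n (Suc i)) * V"] V(2) by auto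
  from km_diff[OF K this V(1)] show "\<exists>W. V - D (Suc i) * W \<in> km K"
    by (auto intro: exI[of _ W])
qed (simp_all add: cpxD[OF C] km_zero[OF K])

text \<open>The usual comparison argument: exactness of \<open>F\<close> provides the next
  component. Multiplying it by the idempotent \<open>f (Suc i)\<close> keeps it inside the
  projective module in that degree.\<close>

lemma chain_lift:
  assumes K: "idl K" and D: "\<And>i. D i * D (Suc i) \<in> km K" and F: "pcx K f F"
    and A0: "A0 * D 0 - F 0 * B0 \<in> km K"
  obtains A where "A 0 = A0" "\<And>i. A i * D i - F i * A (Suc i) \<in> km K"
    "\<And>i. f (Suc i) * A (Suc i) - A (Suc i) \<in> km K"
proof -
  define P where "P i x \<longleftrightarrow> fst x * D i - F i * snd x \<in> km K \<and> f (Suc i) * snd x - snd x \<in> km K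
     \<and> (i = 0 \<longrightarrow> fst x = A0)" for i and x :: "'a fmat \<times> 'a fmat"
  have adjust: "X - F i * (f (Suc i) * B) \<in> km K" "f (Suc i) * (f (Suc i) * B) - f (Suc i) * B \<in> km K"
    if "X - F i * B \<in> km K" for X B i
  proof -
    have "X - F i * (f (Suc i) * B) = (X - F i * B) - (F i * f (Suc i) - F i) * B" by (simp add: mat_simps)
    also have "\<dots> \<in> km K" by (rule km_diff[OF K that km_right[OF K pcxD(3)[OF F]]])
    finally show "X - F i * (f (Suc i) * B) \<in> km K" .
    have "f (Suc i) * (f (Suc i) * B) - f (Suc i) * B = (f (Suc i) * f (Suc i) - f (Suc i)) * B"
      by (simp add: mat_simps)
    also have "\<dots> \<in> km K" by (rule km_right[OF K pcxD(1)[OF F]])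
    finally show "f (Suc i) * (f (Suc i) * B) - f (Suc i) * B \<in> km K" .
  qed
  have "\<exists>g. \<forall>i. P i (g i) \<and> fst (g (Suc i)) = snd (g i)"
  proof (rule dependent_nat_choice)
    show "\<exists>x. P 0 x" using adjust[OF A0] by (intro exI[of _ "(A0, f (Suc 0) * B0)"]) (auto simp: P_def)
  next
    fix x i assume P: "P i x"
    let ?X = "snd x * D (Suc i)"
    have "F i * ?X = fst x * (D i * D (Suc i)) - (fst x * D i - F i * snd x) * D (Suc i)" by (simp add: mat_simps)
    also have "\<dots> \<in> km K"
      using P unfolding P_def by (intro km_diff[OF K km_left[OF K D] km_right[OF K]]) simp
    finally have "F i * ?X \<in> km K" .
    moreover have "f (Suc i) * ?X - ?X = (f (Suc i) * snd x - snd x) * D (Suc i)" by (simp add: mat_simps)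
    then have "f (Suc i) * ?X - ?X \<in> km K" using P unfolding P_def by (auto intro: km_right[OF K])
    ultimately obtain B where "?X - F (Suc i) * B \<in> km K" using pcxD(5)[OF F, of i ?X] by blast
    from adjust[OF this] show "\<exists>y. P (Suc i) y \<and> fst y = snd x"
      by (intro exI[of _ "(snd x, f (Suc (Suc i)) * B)"]) (auto simp: P_def)
  qed
  then obtain g where g: "\<And>i. P i (g i)" "\<And>i. fst (g (Suc i)) = snd (g i)" by blast
  show ?thesis
    by (rule that[of "\<lambda>i. fst (g i)"]) (use g in \<open>auto simp: P_def\<close>)
qed

text \<open>\<open>T\<close> holds the second summand of the homotopy formula, the one coming from
  the previous degree. It is a separate sequence because it is 0 in degree 0, where no previous
  degree exists.\<close>

lemma nullhomotopy:
  assumes K: "idl K" and F: "pcx K f F" and \<phi>: "\<And>i. \<phi> i * F i - F i * \<phi> (Suc i) \<in> km K"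
    "\<And>i. f (Suc i) * \<phi> (Suc i) - \<phi> (Suc i) \<in> km K" and h0: "\<phi> 0 - F 0 * h0 \<in> km K"
  obtains h T where "T 0 = 0" "\<And>i. T (Suc i) = h i * F i" "\<And>i. \<phi> i - T i - F i * h i \<in> km K"
proof -
  define P where "P i x \<longleftrightarrow> \<phi> i - fst x - F i * snd x \<in> km K \<and> f (Suc i) * snd x - snd x \<in> km K
     \<and> fst x * F i \<in> km K \<and> (i = 0 \<longrightarrow> fst x = 0)" for i and x :: "'a fmat \<times> 'a fmat"
  have adjust: "X - F i * (f (Suc i) * B) \<in> km K" "f (Suc i) * (f (Suc i) * B) - f (Suc i) * B \<in> km K"
    if "X - F i * B \<in> km K" for X B i
  proof -
    have "X - F i * (f (Suc i) * B) = (X - F i * B) - (F i * f (Suc i) - F i) * B" by (simp add: mat_simps)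
    also have "\<dots> \<in> km K" by (rule km_diff[OF K that km_right[OF K pcxD(3)[OF F]]])
    finally show "X - F i * (f (Suc i) * B) \<in> km K" .
    have "f (Suc i) * (f (Suc i) * B) - f (Suc i) * B = (f (Suc i) * f (Suc i) - f (Suc i)) * B"
      by (simp add: mat_simps)
    also have "\<dots> \<in> km K" by (rule km_right[OF K pcxD(1)[OF F]])
    finally show "f (Suc i) * (f (Suc i) * B) - f (Suc i) * B \<in> km K" .
  qed
  have "\<exists>g. \<forall>i. P i (g i) \<and> fst (g (Suc i)) = snd (g i) * F i"
  proof (rule dependent_nat_choice)
    show "\<exists>x. P 0 x" using adjust[OF h0]
      by (intro exI[of _ "(0, f (Suc 0) * h0)"]) (auto simp: P_def km_zero[OF K])
  next
    fix x i assume P: "P i x"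
    let ?X = "\<phi> (Suc i) - snd x * F i"
    have "F i * ?X = (\<phi> i - fst x - F i * snd x) * F i + fst x * F i - (\<phi> i * F i - F i * \<phi> (Suc i))"
      by (simp add: mat_simps)
    also have "\<dots> \<in> km K"
      using P unfolding P_def by (intro km_diff[OF K km_add[OF K km_right[OF K]] \<phi>(1)]) auto
    finally have FX: "F i * ?X \<in> km K" .
    have "f (Suc i) * ?X - ?X = (f (Suc i) * \<phi> (Suc i) - \<phi> (Suc i)) - (f (Suc i) * snd x - snd x) * F i"
      by (simp add: mat_simps)
    also have "\<dots> \<in> km K"
      using P unfolding P_def by (intro km_diff[OF K \<phi>(2) km_right[OF K]]) simp
    finally obtain B where B: "?X - F (Suc i) * B \<in> km K" using pcxD(5)[OF F, of i ?X] FX by blast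
    have "snd x * F i * F (Suc i) \<in> km K"
      using km_left[OF K pcxD(4)[OF F, of i], of "snd x"] by (simp add: mult.assoc)
    with adjust[OF B] show "\<exists>y. P (Suc i) y \<and> fst y = snd x * F i"
      by (intro exI[of _ "(snd x * F i, f (Suc (Suc i)) * B)"]) (auto simp: P_def)
  qed
  then obtain g where g: "\<And>i. P i (g i)" "\<And>i. fst (g (Suc i)) = snd (g i) * F i" by blast
  show ?thesis
    by (rule that[of "\<lambda>i. fst (g i)" "\<lambda>i. snd (g i)"]) (use g in \<open>auto simp: P_def\<close>)
qed

text \<open>\<open>D\<close> resolves a module of which the module resolved by \<open>F\<close> is a retract, via
  \<open>a0\<close> and \<open>b0\<close>; the identity of \<open>F\<close> then factors through \<open>D\<close> up to homotopy.\<close>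

lemma comparison:
  assumes K: "idl K" and D: "pcx K e D" and F: "pcx K f F"
    and a0: "a0 * D 0 - F 0 * a1 \<in> km K" and b0: "b0 * F 0 - D 0 * b1 \<in> km K"
    and ab: "a0 * b0 - f 0 - F 0 * h0 \<in> km K"
  obtains a b h T where "\<And>i. a i * D i - F i * a (Suc i) \<in> km K" "\<And>i. b i * F i - D i * b (Suc i) \<in> km K"
    "\<And>i. e (Suc i) * b (Suc i) - b (Suc i) \<in> km K" "T 0 = 0" "\<And>i. T (Suc i) = h i * F i"
    "\<And>i. a i * b i - f i - T i - F i * h i \<in> km K"
proof -
  obtain a where a: "a 0 = a0" "\<And>i. a i * D i - F i * a (Suc i) \<in> km K"
    "\<And>i. f (Suc i) * a (Suc i) - a (Suc i) \<in> km K"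
    using chain_lift[OF K pcxD(4)[OF D] F a0] by metis
  obtain b where b: "b 0 = b0" "\<And>i. b i * F i - D i * b (Suc i) \<in> km K"
    "\<And>i. e (Suc i) * b (Suc i) - b (Suc i) \<in> km K"
    using chain_lift[OF K pcxD(4)[OF F] D b0] by metis
  have 1: "(a i * b i - f i) * F i - F i * (a (Suc i) * b (Suc i) - f (Suc i)) \<in> km K" for i
  proof -
    have "(a i * b i - f i) * F i - F i * (a (Suc i) * b (Suc i) - f (Suc i))
      = a i * (b i * F i - D i * b (Suc i)) + (a i * D i - F i * a (Suc i)) * b (Suc i)
        + (F i * f (Suc i) - F i) - (f i * F i - F i)" by (simp add: mat_simps)
    also have "\<dots> \<in> km K"
      by (rule km_diff[OF K km_add[OF K km_add[OF K km_left[OF K b(2)] km_right[OF K a(2)]] pcxD(3)[OF F]] pcxD(2)[OF F]])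
    finally show ?thesis .
  qed
  have 2: "f (Suc i) * (a (Suc i) * b (Suc i) - f (Suc i)) - (a (Suc i) * b (Suc i) - f (Suc i)) \<in> km K" for i
  proof -
    have "f (Suc i) * (a (Suc i) * b (Suc i) - f (Suc i)) - (a (Suc i) * b (Suc i) - f (Suc i))
      = (f (Suc i) * a (Suc i) - a (Suc i)) * b (Suc i) - (f (Suc i) * f (Suc i) - f (Suc i))" by (simp add: mat_simps)
    also have "\<dots> \<in> km K" by (rule km_diff[OF K km_right[OF K a(3)] pcxD(1)[OF F]])
    finally show ?thesis .
  qed
  have 3: "a 0 * b 0 - f 0 - F 0 * h0 \<in> km K" using ab a(1) b(1) by simp
  obtain h T where "T 0 = 0" "\<And>i. T (Suc i) = h i * F i" "\<And>i. a i * b i - f i - T i - F i * h i \<in> km K"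
    using nullhomotopy[OF K F, of "\<lambda>i. a i * b i - f i", OF 1 2 3] by metis
  then show ?thesis using that a(2) b(2,3) by blast
qed

text \<open>The quasi-inverse of \<open>D N\<close> is transported through the two chain maps, and
  the homotopy is subtracted. Hence finiteness of the projective dimension neither depends on the
  resolution nor is lost on passing to a retract.\<close>

lemma comparison_vreg:
  assumes K: "idl K" and D: "pcx K e D" and F: "pcx K f F"
    and a0: "a0 * D 0 - F 0 * a1 \<in> km K" and b0: "b0 * F 0 - D 0 * b1 \<in> km K"
    and ab: "a0 * b0 - f 0 - F 0 * h0 \<in> km K" and N: "vreg p K (D N)"
  shows "vreg p K (F N)"
proof -
  obtain a b h T where a: "\<And>i. a i * D i - F i * a (Suc i) \<in> km K" and b: "\<And>i. b i * F i - D i * b (Suc i) \<in> km K"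
    and T: "T 0 = 0" "\<And>i. T (Suc i) = h i * F i" and h: "\<And>i. a i * b i - f i - T i - F i * h i \<in> km K"
    using comparison[OF K D F a0 b0 ab] by metis
  obtain t u where u: "u \<notin> p" and t: "D N * t * D N - u *\<^sub>m D N \<in> km K" using N by (auto simp: vreg_def)
  have TF: "T N * F N \<in> km K"
  proof (cases N)
    case 0
    then show ?thesis using T(1) km_zero[OF K] by simp
  next
    case (Suc i)
    then show ?thesis using km_left[OF K pcxD(4)[OF F, of i], of "h i"] by (simp add: T mult.assoc)
  qed
  let ?s = "a (Suc N) * t * b N - u *\<^sub>m h N"
  have "F N * ?s * F N - u *\<^sub>m F N =
      - ((a N * D N - F N * a (Suc N)) * (t * b N * F N))
      + a N * D N * t * (b N * F N - D N * b (Suc N)) + a N * (D N * t * D N - u *\<^sub>m D N) * b (Suc N)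
      - u *\<^sub>m (a N * (b N * F N - D N * b (Suc N)))
      + u *\<^sub>m ((a N * b N - f N - T N - F N * h N) * F N + T N * F N + (f N * F N - F N))"
    by (simp add: mat_simps)
  also have "\<dots> \<in> km K"
    by (rule km_add[OF K km_diff[OF K km_add[OF K km_add[OF K km_minus[OF K km_right[OF K a]] km_left[OF K b]]
        km_right[OF K km_left[OF K t]]] km_scm[OF K km_left[OF K b]]]
        km_scm[OF K km_add[OF K km_add[OF K km_right[OF K h] TF] pcxD(2)[OF F]]]])
  finally show ?thesis using u unfolding vreg_def by blast
qed

text \<open>A cocycle on \<open>F\<close> is pulled back to \<open>D\<close>, bounded there, and
  pulled back again; the homotopy accounts for the difference. This makes the vanishing of Ext
  independent of the resolution used to compute it.\<close>

lemma comparison_dual_exact: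
  assumes K: "idl K" and D: "pcx K e D" and F: "pcx K f F"
    and a0: "a0 * D 0 - F 0 * a1 \<in> km K" and b0: "b0 * F 0 - D 0 * b1 \<in> km K"
    and ab: "a0 * b0 - f 0 - F 0 * h0 \<in> km K"
    and ex: "\<And>V. V * e (Suc i) - V \<in> km K \<Longrightarrow> V * D (Suc i) \<in> km K \<Longrightarrow> \<exists>W. V - W * D i \<in> km K"
    and V: "V * f (Suc i) - V \<in> km K" "V * F (Suc i) \<in> km K"
  shows "\<exists>W. V - W * F i \<in> km K"
proof -
  obtain a b h T where a: "\<And>i. a i * D i - F i * a (Suc i) \<in> km K" and b: "\<And>i. b i * F i - D i * b (Suc i) \<in> km K"
    and eb: "\<And>i. e (Suc i) * b (Suc i) - b (Suc i) \<in> km K"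
    and T: "\<And>i. T (Suc i) = h i * F i" and h: "\<And>i. a i * b i - f i - T i - F i * h i \<in> km K"
    using comparison[OF K D F a0 b0 ab] by metis
  let ?j = "Suc i"
  let ?V = "V * a ?j * e ?j"
  have "?V * e ?j - ?V = V * a ?j * (e ?j * e ?j - e ?j)" by (simp add: mat_simps)
  then have 1: "?V * e ?j - ?V \<in> km K" using km_left[OF K pcxD(1)[OF D]] by simp
  have "?V * D ?j = V * a ?j * (e ?j * D ?j - D ?j) + V * (a ?j * D ?j - F ?j * a (Suc ?j)) + V * F ?j * a (Suc ?j)"
    by (simp add: mat_simps)
  also have "\<dots> \<in> km K"
    by (rule km_add[OF K km_add[OF K km_left[OF K pcxD(2)[OF D]] km_left[OF K a]] km_right[OF K V(2)]])
  finally obtain W where W: "?V - W * D i \<in> km K" using ex[OF 1] by blast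
  let ?W = "W * b i - V * h i"
  have "V - ?W * F i = (?V - W * D i) * b ?j - W * (b i * F i - D i * b ?j) - V * a ?j * (e ?j * b ?j - b ?j)
     - V * (a ?j * b ?j - f ?j - T ?j - F ?j * h ?j) - V * F ?j * h ?j - (V * f ?j - V)"
    by (simp add: mat_simps T)
  also have "\<dots> \<in> km K"
    by (rule km_diff[OF K km_diff[OF K km_diff[OF K km_diff[OF K km_diff[OF K km_right[OF K W] km_left[OF K b]]
        km_left[OF K eb]] km_left[OF K h]] km_right[OF K V(2)]] V(1)])
  finally show ?thesis by blast
qed

text \<open>If \<open>t\<close> is a quasi-inverse of \<open>D k\<close>, the complementary
  projection \<open>?V\<close> has its image in the kernel of \<open>D k\<close>. By exactness it
  factors through \<open>D (Suc k)\<close>, and the factor \<open>W\<close> is a quasi-inverse of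
  \<open>D (Suc k)\<close>.\<close>

lemma vreg_up:
  assumes p: "prim p" and K: "idl K" and D: "cpx K n D" and "vreg p K (D i)" "i \<le> j"
  shows "vreg p K (D j)"
  using assms(5,4)
proof (induction rule: dec_induct)
  case (step k)
  let ?E = "idm (n (Suc k)) :: 'a fmat"
  obtain t u where u: "u \<notin> p" and t: "D k * t * D k - u *\<^sub>m D k \<in> km K" using step by (auto simp: vreg_def)
  let ?V = "u *\<^sub>m ?E - ?E * t * D k"
  have DE: "D k * (?E * X) = D k * X" "?E * (D (Suc k) * X) = D (Suc k) * X" "D k * ?E = D k" "?E * D (Suc k) = D (Suc k)" for X
    using cpxD(1,2)[OF D] by (metis mult.assoc)+
  have "D k * ?V = - (D k * t * D k - u *\<^sub>m D k)" by (simp add: mat_simps DE)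
  then have "D k * ?V \<in> km K" using km_minus[OF K t] by simp
  moreover have "?E * ?V = ?V" by (simp add: mat_simps)
  ultimately obtain W where W: "?V - D (Suc k) * W \<in> km K" using cpxD(4)[OF D] by blast
  have "D (Suc k) * W * D (Suc k) - u *\<^sub>m D (Suc k) = - ((?V - D (Suc k) * W) * D (Suc k)) - ?E * t * (D k * D (Suc k))"
    by (simp add: mat_simps DE)
  also have "\<dots> \<in> km K"
    by (rule km_diff[OF K km_minus[OF K km_right[OF K W]] km_left[OF K cpxD(3)[OF D]]])
  finally show ?case using u unfolding vreg_def by blast
qed

text \<open>Modulo \<open>p\<close> the matrix is \<open>u\<close> times the identity, hence
  injective there. This replaces the determinant trick in Nakayama's lemma.\<close>

lemma nakayama_inverse:
  assumes p: "prim p" and u: "u \<notin> p" and A: "A \<in> km p" "idm n * A = A" "A * idm n = A"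
  obtains \<psi> w where "w \<notin> p" "\<psi> * (u *\<^sub>m idm n - A) = w *\<^sub>m idm n"
proof -
  have "\<exists>\<psi> w. w \<notin> p \<and> \<psi> * (u *\<^sub>m idm n - A) = w *\<^sub>m idm n"
  proof (rule left_inverse_mod_prime[OF p])
    show "(u *\<^sub>m idm n - A) * idm n = u *\<^sub>m idm n - A" by (simp add: mat_simps A)
    fix V assume V: "idm n * V = V" "(u *\<^sub>m idm n - A) * V \<in> km p"
    have "u *\<^sub>m V = (u *\<^sub>m idm n - A) * V + A * V" by (simp add: mat_simps V)
    also have "\<dots> \<in> km p" by (rule km_add[OF prim_idl[OF p] V(2) km_right[OF prim_idl[OF p] A(1)]])
    finally show "V \<in> km p" using u p by (auto simp: km_def prim_def)
  qed
  then show ?thesis using that by blast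
qed

text \<open>The identity \<open>D * t * D = u *\<^sub>m D\<close> says that \<open>u - D * t\<close>
  annihilates \<open>D\<close>. Since \<open>D\<close> has entries in \<open>p\<close>, this factor
  is invertible at \<open>p\<close>, so \<open>D\<close> vanishes.\<close>

lemma vreg_minimal:
  assumes p: "prim p" and K: "idl K" and sat: "\<And>u a. u \<notin> p \<Longrightarrow> u * a \<in> K \<Longrightarrow> a \<in> K"
    and D: "D \<in> km p" "idm n * D = D" and "vreg p K D"
  shows "D \<in> km K"
proof -
  obtain t u where u: "u \<notin> p" and t: "D * t * D - u *\<^sub>m D \<in> km K" using assms(6) by (auto simp: vreg_def)
  let ?A = "D * t * idm n"
  have "?A \<in> km p" by (rule km_right[OF prim_idl[OF p] km_right[OF prim_idl[OF p] D(1)]])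
  moreover have "idm n * ?A = ?A" using D(2) by (metis mult.assoc)
  moreover have "?A * idm n = ?A" by (simp add: mult.assoc)
  ultimately obtain \<psi> w where w: "w \<notin> p" and \<psi>: "\<psi> * (u *\<^sub>m idm n - ?A) = w *\<^sub>m idm n"
    by (rule nakayama_inverse[OF p u])
  have "w *\<^sub>m D = w *\<^sub>m idm n * D" by (simp add: D)
  also have "\<dots> = - (\<psi> * (D * t * D - u *\<^sub>m D))" unfolding \<psi>[symmetric] by (simp add: mat_simps D)
  also have "\<dots> \<in> km K" by (rule km_minus[OF K km_left[OF K t]])
  finally show ?thesis using sat[OF w] by (simp add: km_def)
qed

section \<open>Depth at a prime via Ext\<close>

text \<open>A module over the localization at \<open>p\<close> is a free module of infinite rank modulo a \<open>p\<close>-saturated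
  submodule \<open>B\<close>, which again is encoded as a right ideal.\<close>

definition psub :: "'a::comm_ring_1 set \<Rightarrow> 'a set \<Rightarrow> 'a fmat set \<Rightarrow> bool" where
  "psub p K B \<longleftrightarrow> (\<forall>A\<in>B. \<forall>C\<in>B. A + C \<in> B) \<and> (\<forall>A\<in>B. \<forall>C. A * C \<in> B) \<and> km K \<subseteq> B \<and>
     (\<forall>u A. u \<notin> p \<longrightarrow> u *\<^sub>m A \<in> B \<longrightarrow> A \<in> B)"

text \<open>Scalars act by right multiplication with a truncated scalar matrix, so right ideals and
  right linear maps respect them.\<close>

lemma scm_as_mult:
  obtains n where "\<And>a. a *\<^sub>m A = A * (a *\<^sub>m idm n)" "A * idm n = A"
proof -
  obtain n where n: "\<And>i j. n \<le> i \<or> n \<le> j \<Longrightarrow> ent A i j = 0" using ent_bound by blast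
  have "A * idm n = A" by (rule fmat_eqI) (auto simp: n)
  then show ?thesis using that[of n] by simp
qed

lemma psubD:
  assumes "psub p K B"
  shows "A \<in> B \<Longrightarrow> C \<in> B \<Longrightarrow> A + C \<in> B" "A \<in> B \<Longrightarrow> A * C \<in> B" "A \<in> km K \<Longrightarrow> A \<in> B"
    "u \<notin> p \<Longrightarrow> u *\<^sub>m A \<in> B \<Longrightarrow> A \<in> B"
  using assms unfolding psub_def by auto

lemma psub_scm: "psub p K B \<Longrightarrow> A \<in> B \<Longrightarrow> a *\<^sub>m A \<in> B"
  by (metis scm_as_mult psubD(2))
lemma psub_minus: "psub p K B \<Longrightarrow> A \<in> B \<Longrightarrow> - A \<in> B"
  using psub_scm[of p K B A "- 1"] by simp
lemma psub_diff: "psub p K B \<Longrightarrow> A \<in> B \<Longrightarrow> C \<in> B \<Longrightarrow> A - C \<in> B"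
  using psubD(1)[of p K B A "- C"] psub_minus[of p K B C] by simp

definition lin :: "('a::comm_ring_1 fmat \<Rightarrow> 'a fmat) \<Rightarrow> bool" where
  "lin \<phi> \<longleftrightarrow> (\<forall>A C. \<phi> (A + C) = \<phi> A + \<phi> C) \<and> (\<forall>A C. \<phi> (A * C) = \<phi> A * C)"

lemma linD: "lin \<phi> \<Longrightarrow> \<phi> (A + C) = \<phi> A + \<phi> C" "lin \<phi> \<Longrightarrow> \<phi> (A * C) = \<phi> A * C" by (auto simp: lin_def)
lemma lin_scm: "lin \<phi> \<Longrightarrow> \<phi> (a *\<^sub>m A) = a *\<^sub>m \<phi> A"
proof -
  assume l: "lin \<phi>"
  obtain n where n: "\<And>a. a *\<^sub>m A = A * (a *\<^sub>m idm n)" "A * idm n = A" using scm_as_mult by blast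
  have "\<phi> A = \<phi> A * idm n" using linD(2)[OF l, of A "idm n"] n(2) by simp
  then show ?thesis using n(1)[of a] linD(2)[OF l, of A "a *\<^sub>m idm n"] by simp
qed
lemma lin_diff: "lin \<phi> \<Longrightarrow> \<phi> (A - C) = \<phi> A - \<phi> C"
  using linD(1)[of \<phi> "A - C" C] by (simp add: algebra_simps)
lemma lin_left: "lin (\<lambda>A. H * A)" by (simp add: lin_def mat_simps)
lemma lin_scalar: "lin (\<lambda>A. x *\<^sub>m A)" by (simp add: lin_def mat_simps)

text \<open>The saturation at \<open>p\<close> of \<open>B\<close> plus the image of
  \<open>\<phi>\<close>; dividing by it gives the localized cokernel.\<close>

definition coker :: "'a::comm_ring_1 set \<Rightarrow> ('a fmat \<Rightarrow> 'a fmat) \<Rightarrow> 'a fmat set \<Rightarrow> 'a fmat set" where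
  "coker p \<phi> B = {A. \<exists>u C. u \<notin> p \<and> u *\<^sub>m A - \<phi> C \<in> B}"

lemma cokerI: "u \<notin> p \<Longrightarrow> u *\<^sub>m A - \<phi> C \<in> B \<Longrightarrow> A \<in> coker p \<phi> B"
  by (auto simp: coker_def)

lemma coker_superset: "prim p \<Longrightarrow> lin \<phi> \<Longrightarrow> A \<in> B \<Longrightarrow> A \<in> coker p \<phi> B"
  using cokerI[of 1 p A \<phi> 0 B] prim_one[of p] lin_diff[of \<phi> 0 0] by simp

lemma coker_image: "idl K \<Longrightarrow> prim p \<Longrightarrow> psub p K B \<Longrightarrow> \<phi> A \<in> coker p \<phi> B"
  using cokerI[of 1 p "\<phi> A" \<phi> A B] prim_one[of p] psubD(3)[OF _ km_zero[of K], of p B] by simp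

lemma psub_coker:
  assumes p: "prim p" and B: "psub p K B" and l: "lin \<phi>"
  shows "psub p K (coker p \<phi> B)"
  unfolding psub_def
proof (intro conjI ballI allI impI subsetI)
  fix A C assume "A \<in> coker p \<phi> B" "C \<in> coker p \<phi> B"
  then obtain u X v Y where u: "u \<notin> p" "u *\<^sub>m A - \<phi> X \<in> B" and v: "v \<notin> p" "v *\<^sub>m C - \<phi> Y \<in> B"
    by (auto simp: coker_def)
  have "v *\<^sub>m (u *\<^sub>m A - \<phi> X) + u *\<^sub>m (v *\<^sub>m C - \<phi> Y) \<in> B"
    by (rule psubD(1)[OF B psub_scm[OF B u(2)] psub_scm[OF B v(2)]])
  then have "(u * v) *\<^sub>m (A + C) - \<phi> (v *\<^sub>m X + u *\<^sub>m Y) \<in> B"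
    by (simp add: linD[OF l] lin_scm[OF l] mat_simps)
  then show "A + C \<in> coker p \<phi> B" by (rule cokerI[OF prim_mult[OF p u(1) v(1)]])
next
  fix A C assume "A \<in> coker p \<phi> B"
  then obtain u X where u: "u \<notin> p" "u *\<^sub>m A - \<phi> X \<in> B" by (auto simp: coker_def)
  have "(u *\<^sub>m A - \<phi> X) * C \<in> B" by (rule psubD(2)[OF B u(2)])
  then have "u *\<^sub>m (A * C) - \<phi> (X * C) \<in> B" by (simp add: linD[OF l] mat_simps)
  then show "A * C \<in> coker p \<phi> B" by (rule cokerI[OF u(1)])
next
  fix A assume "A \<in> km K"
  then show "A \<in> coker p \<phi> B" by (intro coker_superset p l psubD(3)[OF B])
next
  fix u A assume u: "u \<notin> p" "u *\<^sub>m A \<in> coker p \<phi> B"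
  then obtain v X where v: "v \<notin> p" "v *\<^sub>m (u *\<^sub>m A) - \<phi> X \<in> B" by (auto simp: coker_def)
  then have "(v * u) *\<^sub>m A - \<phi> X \<in> B" by simp
  then show "A \<in> coker p \<phi> B" by (rule cokerI[OF prim_mult[OF p v(1) u(1)]])
qed

text \<open>A free resolution of the cyclic module defined by \<open>p\<close> over the quotient by
  \<open>K\<close>: the row \<open>L 0\<close> lists generators of \<open>p\<close>. Besides primes,
  \<open>p\<close> is also taken to be the ideal \<open>I\<close> of the theorem.\<close>

definition pres :: "'a::comm_ring_1 set \<Rightarrow> 'a set \<Rightarrow> (nat \<Rightarrow> nat) \<Rightarrow> (nat \<Rightarrow> 'a fmat) \<Rightarrow> bool" where
  "pres K p l L \<longleftrightarrow> cpx K l L \<and> l 0 = 1 \<and> L 0 \<in> km p \<and> (\<forall>a\<in>p. \<exists>W. a *\<^sub>m idm 1 - L 0 * W \<in> km K)"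

lemma presD:
  assumes "pres K p l L"
  shows "cpx K l L" "l 0 = 1" "L 0 \<in> km p" "a \<in> p \<Longrightarrow> \<exists>W. a *\<^sub>m idm 1 - L 0 * W \<in> km K"
  using assms by (auto simp: pres_def)

lemma pres_exists:
  assumes K: "noeth K" and p: "idl p" "K \<subseteq> p"
  obtains l L where "pres K p l L"
proof -
  obtain n a where a: "\<And>i. i < (n::nat) \<Longrightarrow> a i \<in> p" and gen: "\<And>y. y \<in> p \<Longrightarrow> \<exists>c. y - (\<Sum>i<n. c i * a i) \<in> K"
    using noeth_gens[OF K p] by metis
  define L0 where "L0 = mk 1 n (\<lambda>_ j. a j)"
  have "idm 1 * L0 = L0" "L0 * idm n = L0" by (rule fmat_eqI, simp add: L0_def)+
  then obtain l L where L: "cpx K l L" "L 0 = L0" "l 0 = 1"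
    using cpx_exists[OF K, of 1 L0 n] by metis
  have "\<exists>W. b *\<^sub>m idm 1 - L0 * W \<in> km K" if b: "b \<in> p" for b
  proof -
    obtain c where c: "b - (\<Sum>i<n. c i * a i) \<in> K" using gen[OF b] by blast
    have "ent (L0 * mk n 1 (\<lambda>i _. c i)) i j = (if i = 0 \<and> j = 0 then (\<Sum>i<n. c i * a i) else 0)" for i j
      by (subst ent_times_bound[of n]) (auto simp: L0_def mult.commute)
    then have "ent (b *\<^sub>m idm 1 - L0 * mk n 1 (\<lambda>i _. c i)) i j \<in> K" for i j
      using c idl_zero[OF noeth_idl[OF K]] by (auto simp: ent_idm)
    then show ?thesis using kmI by blast
  qed
  moreover have "L0 \<in> km p" using a idl_zero[OF p(1)] by (intro kmI) (auto simp: L0_def)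
  ultimately show ?thesis using that L unfolding pres_def by metis
qed

definition EV :: "'a::comm_ring_1 set \<Rightarrow> (nat \<Rightarrow> nat) \<Rightarrow> (nat \<Rightarrow> 'a fmat) \<Rightarrow> 'a fmat set \<Rightarrow> nat \<Rightarrow> bool" where
  "EV p l L B h \<longleftrightarrow> (\<forall>j<h. \<forall>f. f * idm (l j) = f \<longrightarrow> f * L j \<in> B \<longrightarrow>
     (\<exists>u f'. u \<notin> p \<and> u *\<^sub>m f - f' * (case j of 0 \<Rightarrow> 0 | Suc i \<Rightarrow> L i) \<in> B))"

text \<open>\<open>EV\<close> expresses that \<open>Ext\<^sup>j(R/p, M)\<close> vanishes locally at \<open>p\<close> for \<open>j < h\<close>, where \<open>L\<close> resolves \<open>R/p\<close>.\<close>

lemma EV_mono: "EV p l L B h \<Longrightarrow> h' \<le> h \<Longrightarrow> EV p l L B h'"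
  unfolding EV_def by auto

text \<open>The part of the long exact sequence of Ext in which the cokernel sits between
  \<open>Q\<close> in degree \<open>j\<close> and \<open>B\<close> in degree \<open>j + 1\<close>,
  carried out on cochains.\<close>

lemma EV_coker:
  assumes p: "prim p" and K: "idl K" and L: "pres K p l L" and B: "psub p K B" and Q: "psub p K Q"
    and l: "lin \<phi>" and inj: "\<And>A. \<phi> A \<in> Q \<longleftrightarrow> A \<in> B"
    and EB: "EV p l L B (Suc h)" and EQ: "EV p l L Q h"
  shows "EV p l L (coker p \<phi> Q) h"
  unfolding EV_def
proof (intro allI impI)
  note C = presD(1)[OF L]
  fix j f assume j: "j < h" and f: "f * idm (l j) = f" "f * L j \<in> coker p \<phi> Q"
  obtain u c0 where u: "u \<notin> p" and c0: "u *\<^sub>m (f * L j) - \<phi> c0 \<in> Q" using f(2) by (auto simp: coker_def)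
  \<comment> \<open>The value of the connecting homomorphism on \<open>f\<close>, cut to the right
    size; it is a cocycle modulo \<open>B\<close>.\<close>
  define c where "c = c0 * idm (l (Suc j))"
  have LL: "L j * idm (l (Suc j)) = L j" "idm (l j) * L j = L j" for j using cpxD(1,2)[OF C] by auto
  have cQ: "u *\<^sub>m (f * L j) - \<phi> c \<in> Q"
    using psubD(2)[OF Q c0, of "idm (l (Suc j))"] by (simp add: c_def linD[OF l] mat_simps LL)
  have "(u *\<^sub>m (f * L j) - \<phi> c) * L (Suc j) \<in> Q" by (rule psubD(2)[OF Q cQ])
  moreover have "u *\<^sub>m (f * (L j * L (Suc j))) \<in> Q"
    by (rule psubD(3)[OF Q km_scm[OF K km_left[OF K cpxD(3)[OF C]]]])
  ultimately have "u *\<^sub>m (f * (L j * L (Suc j))) - (u *\<^sub>m (f * L j) - \<phi> c) * L (Suc j) \<in> Q"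
    by (intro psub_diff[OF Q])
  then have "\<phi> (c * L (Suc j)) \<in> Q" by (simp add: linD[OF l] mat_simps)
  then have "c * L (Suc j) \<in> B" using inj by blast
  moreover have "c * idm (l (Suc j)) = c" by (simp add: c_def mult.assoc)
  ultimately obtain v c1 where v: "v \<notin> p" and c1: "v *\<^sub>m c - c1 * L j \<in> B"
    using EB j unfolding EV_def by (metis Suc_mono nat.case(2))
  define c' where "c' = c1 * idm (l j)"
  have "c' * L j = c1 * L j" by (simp add: c'_def mult.assoc LL)
  then have "\<phi> (v *\<^sub>m c - c' * L j) \<in> Q" using c1 inj by simp
  from psubD(1)[OF Q this psub_scm[OF Q cQ, of v]]
  have "(v *\<^sub>m (u *\<^sub>m f) - \<phi> c') * L j \<in> Q"
    by (simp add: linD[OF l] lin_diff[OF l] lin_scm[OF l] mat_simps)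
  moreover have "(v *\<^sub>m (u *\<^sub>m f) - \<phi> c') * idm (l j) = v *\<^sub>m (u *\<^sub>m f) - \<phi> c'"
    using linD(2)[OF l, of c' "idm (l j)"] by (simp add: c'_def mat_simps f)
  ultimately obtain w f' where w: "w \<notin> p"
    and f': "w *\<^sub>m (v *\<^sub>m (u *\<^sub>m f) - \<phi> c') - f' * (case j of 0 \<Rightarrow> 0 | Suc i \<Rightarrow> L i) \<in> Q"
    using EQ j unfolding EV_def by blast
  define z where "z = (case j of 0 \<Rightarrow> 0 | Suc i \<Rightarrow> L i)"
  have "1 *\<^sub>m ((w * (v * u)) *\<^sub>m f - f' * z) - \<phi> (w *\<^sub>m c') \<in> Q"
    using f' by (simp add: z_def lin_scm[OF l] mat_simps)
  then have "(w * (v * u)) *\<^sub>m f - f' * z \<in> coker p \<phi> Q" by (rule cokerI[OF prim_one[OF p]])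
  moreover have "w * (v * u) \<notin> p" by (intro prim_mult[OF p] w v u)
  ultimately show "\<exists>u f'. u \<notin> p \<and> u *\<^sub>m f - f' * (case j of 0 \<Rightarrow> 0 | Suc i \<Rightarrow> L i) \<in> coker p \<phi> Q"
    unfolding z_def by blast
qed

text \<open>Multiplication by \<open>x\<close> is zero on the module resolved by \<open>L\<close>,
  hence null-homotopic on \<open>L\<close>. So \<open>x\<close> times a cocycle is a coboundary, and
  dividing the bounding cochain by \<open>x\<close> reduces degree \<open>j\<close> for
  \<open>B\<close> to degree \<open>j - 1\<close> for the quotient by \<open>x\<close>.\<close>

lemma EV_regular:
  assumes p: "prim p" and K: "idl K" and L: "pres K p l L" and B: "psub p K B"
    and x: "x \<in> p" and reg: "\<And>A. x *\<^sub>m A \<in> B \<Longrightarrow> A \<in> B"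
    and E: "EV p l L (coker p (\<lambda>A. x *\<^sub>m A) B) h"
  shows "EV p l L B (Suc h)"
  unfolding EV_def
proof (intro allI impI)
  note C = presD(1)[OF L]
  obtain h0 where h0: "x *\<^sub>m idm (l 0) - L 0 * h0 \<in> km K" using presD(2,4)[OF L] x by metis
  obtain H T where T: "T 0 = 0" "\<And>i. T (Suc i) = H i * L i"
    and H: "\<And>i. x *\<^sub>m idm (l i) - T i - L i * H i \<in> km K"
    by (rule nullhomotopy[OF K cpx_pcx[OF K C], of "\<lambda>i. x *\<^sub>m idm (l i)" h0])
      (simp_all add: cpxD[OF C] km_zero[OF K] h0)
  fix j f assume j: "j < Suc h" and f: "f * idm (l j) = f" "f * L j \<in> B"
  have xf: "x *\<^sub>m f - f * T j \<in> B"
  proof -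
    have "f * (x *\<^sub>m idm (l j) - T j - L j * H j) + (f * L j) * H j \<in> B"
      by (rule psubD(1)[OF B psubD(3)[OF B km_left[OF K H]] psubD(2)[OF B f(2)]])
    then show ?thesis by (simp add: mat_simps f)
  qed
  show "\<exists>u f'. u \<notin> p \<and> u *\<^sub>m f - f' * (case j of 0 \<Rightarrow> 0 | Suc i \<Rightarrow> L i) \<in> B"
  proof (cases j)
    case 0
    then have "f \<in> B" using xf T(1) reg by simp
    then show ?thesis using 0 prim_one[OF p] by (intro exI[of _ 1] exI[of _ 0]) simp
  next
    case (Suc i)
    define g where "g = f * H i * idm (l i)"
    have gL: "g * L i = f * T j" by (simp add: g_def mult.assoc cpxD[OF C] T(2) Suc)
    have "1 *\<^sub>m (g * L i) - x *\<^sub>m f \<in> B" using psub_minus[OF B xf] by (simp add: gL)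
    then have "g * L i \<in> coker p (\<lambda>A. x *\<^sub>m A) B" by (rule cokerI[OF prim_one[OF p]])
    moreover have "g * idm (l i) = g" by (simp add: g_def mult.assoc)
    moreover have "i < h" using j Suc by simp
    ultimately obtain u g' where u: "u \<notin> p"
      and g': "u *\<^sub>m g - g' * (case i of 0 \<Rightarrow> 0 | Suc i \<Rightarrow> L i) \<in> coker p (\<lambda>A. x *\<^sub>m A) B"
      using E unfolding EV_def by blast
    define z where "z = (case i of 0 \<Rightarrow> 0 | Suc i \<Rightarrow> L i)"
    obtain v c where v: "v \<notin> p" and c: "v *\<^sub>m (u *\<^sub>m g - g' * z) - x *\<^sub>m c \<in> B"
      using g' by (auto simp: coker_def z_def)
    have zL: "z * L i \<in> km K" using cpxD(3)[OF C] km_zero[OF K] by (auto simp: z_def split: nat.split)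
    have zB: "v *\<^sub>m (g' * (z * L i)) \<in> B" 
      by (rule psubD(3)[OF B km_scm[OF K km_left[OF K zL]]])
    have "(v *\<^sub>m (u *\<^sub>m g - g' * z) - x *\<^sub>m c) * L i + v *\<^sub>m (g' * (z * L i)) + (v * u) *\<^sub>m (x *\<^sub>m f - f * T j) \<in> B"
      by (rule psubD(1)[OF B psubD(1)[OF B psubD(2)[OF B c] zB] psub_scm[OF B xf]])
    then have "x *\<^sub>m ((v * u) *\<^sub>m f - c * L i) \<in> B"
      by (simp add: mat_simps gL)
    then have "(v * u) *\<^sub>m f - c * L i \<in> B" by (rule reg)
    then show ?thesis using prim_mult[OF p v u] Suc by auto
  qed
qed

lemma psub_column:
  assumes K: "idl K" and B: "psub p' K B" and f: "f * idm 1 = f" and pf: "\<And>a. a \<in> p \<Longrightarrow> a *\<^sub>m f \<in> B" and A: "A \<in> km p"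
  shows "f * A \<in> B"
proof -
  obtain N where N: "\<And>i j. N \<le> i \<or> N \<le> j \<Longrightarrow> ent A i j = 0" using ent_bound by blast
  have fmat_sum: "ent (\<Sum>j<n. F j) i k = (\<Sum>j<n. ent (F j) i k)" for n :: nat and F :: "nat \<Rightarrow> 'a fmat" and i k
    by (induction n) auto
  have "idm 1 * A = (\<Sum>j<N. ent A 0 j *\<^sub>m un 0 j)"
  proof (rule fmat_eqI)
    fix i k
    have "ent (\<Sum>j<N. ent A 0 j *\<^sub>m un 0 j) i k = (\<Sum>j<N. if j = k then (if i = 0 then ent A 0 j else 0) else 0)"
      unfolding fmat_sum by (rule sum.cong) (auto simp: ent_un)
    then show "ent (idm 1 * A) i k = ent (\<Sum>j<N. ent A 0 j *\<^sub>m un 0 j) i k" using N by auto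
  qed
  then have "f * A = (\<Sum>j<N. ent A 0 j *\<^sub>m (f * un 0 j))"
    using f by (metis (no_types, lifting) mult.assoc sum_distrib_left scm_mult_right sum.cong)
  also have "\<dots> \<in> B"
  proof -
    have "ent A 0 j *\<^sub>m (f * un 0 j) \<in> B" for j
      using psubD(2)[OF B pf[OF kmD[OF A, of 0 j]], of "un 0 j"] by simp
    then show ?thesis
      by (induction N) (auto intro: psubD(1)[OF B] psubD(3)[OF B km_zero[OF K]])
  qed
  finally show ?thesis .
qed

text \<open>Degree 0 of the Ext condition: a column killed by \<open>p\<close> is a homomorphism
  from the cyclic module resolved by \<open>L\<close>.\<close>

lemma EV_socle:
  assumes p: "prim p" and K: "idl K" and L: "pres K p l L" and B: "psub p K B" and E: "EV p l L B (Suc h)"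
    and f: "f * idm 1 = f" "\<And>a. a \<in> p \<Longrightarrow> a *\<^sub>m f \<in> B"
  shows "f \<in> B"
proof -
  have "f * L 0 \<in> B" by (rule psub_column[OF K B f presD(3)[OF L]])
  then obtain u f' where "u \<notin> p" "u *\<^sub>m f - f' * 0 \<in> B"
    using E f(1) presD(2)[OF L] unfolding EV_def by (metis nat.case(1) zero_less_Suc)
  then show ?thesis using psubD(4)[OF B] by simp
qed

text \<open>The free module of rank \<open>n\<close> over the quotient by \<open>K\<close> in the
  encoding of \<open>psub\<close>; coordinates from \<open>n\<close> on are ignored.\<close>

definition ringm :: "nat \<Rightarrow> 'a::comm_ring_1 set \<Rightarrow> 'a fmat set" where
  "ringm n K = {A. idm n * A \<in> km K}"

lemma psub_ringm:
  assumes K: "idl K'" "K \<subseteq> K'" and sat: "\<And>u a. u \<notin> p \<Longrightarrow> u * a \<in> K' \<Longrightarrow> a \<in> K'"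
  shows "psub p K (ringm n K')"
  unfolding psub_def ringm_def mem_Collect_eq Ball_def
proof (intro conjI allI impI subsetI CollectI)
  fix A C assume "idm n * A \<in> km K'"
  then show "idm n * (A * C) \<in> km K'" using km_right[OF K(1)] by (simp flip: mult.assoc)
next
  fix u A assume u: "u \<notin> p" "idm n * u *\<^sub>m A \<in> km K'"
  then have 1: "u * ent (idm n * A) i j \<in> K'" for i j by (metis ent_scm kmD scm_mult_right)
  show "idm n * A \<in> km K'" by (rule kmI, rule sat[OF u(1)], rule 1)
qed (use km_mono[OF K(2)] in \<open>auto simp: mat_simps intro: km_add[OF K(1)] km_left[OF K(1)]\<close>)

lemma ringm_scalar: "(\<And>y. x * y \<in> K \<Longrightarrow> y \<in> K) \<Longrightarrow> x *\<^sub>m A \<in> ringm n K \<Longrightarrow> A \<in> ringm n K"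
  unfolding ringm_def mem_Collect_eq scm_mult_right by (simp add: km_def)

lemma coker_ringm:
  assumes p: "prim p" and K: "idl K"
  shows "coker p (\<lambda>A. x *\<^sub>m A) (ringm n K) = ringm n (sat p (adj K x))"
proof (intro Set.set_eqI iffI)
  fix A assume "A \<in> coker p (\<lambda>A. x *\<^sub>m A) (ringm n K)"
  then obtain u C where u: "u \<notin> p" "idm n * (u *\<^sub>m A - x *\<^sub>m C) \<in> km K" by (auto simp: coker_def ringm_def)
  have "u *\<^sub>m (idm n * A) \<in> km (adj K x)"
  proof (rule kmI)
    fix i j
    have "ent (u *\<^sub>m (idm n * A)) i j = ent (idm n * (u *\<^sub>m A - x *\<^sub>m C)) i j + x * ent (idm n * C) i j" by simp
    then show "ent (u *\<^sub>m (idm n * A)) i j \<in> adj K x" using kmD[OF u(2)] unfolding adj_def by blast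
  qed
  then show "A \<in> ringm n (sat p (adj K x))"
    unfolding ringm_def using km_sat[OF p idl_adj[OF K]] u(1) by blast
next
  fix A assume "A \<in> ringm n (sat p (adj K x))"
  then obtain u where u: "u \<notin> p" "u *\<^sub>m (idm n * A) \<in> km (adj K x)"
    unfolding ringm_def using km_sat[OF p idl_adj[OF K]] by blast
  obtain C where "u *\<^sub>m (idm n * A) - x *\<^sub>m C \<in> km K" using km_adj[OF K u(2)] by blast
  from km_left[OF K this, of "idm n"] have "u *\<^sub>m A - x *\<^sub>m C \<in> ringm n K" by (simp add: ringm_def mat_simps)
  then show "A \<in> coker p (\<lambda>A. x *\<^sub>m A) (ringm n K)" by (rule cokerI[OF u(1)])
qed

text \<open>One half of the Rees characterization of depth: each regular element gains one degree by
  \<open>EV_regular\<close>.\<close>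

lemma EV_rsq:
  assumes p: "prim p" and K: "idl K" and L: "pres K p l L"
  shows "idl K' \<Longrightarrow> K \<subseteq> K' \<Longrightarrow> (\<And>u a. u \<notin> p \<Longrightarrow> u * a \<in> K' \<Longrightarrow> a \<in> K') \<Longrightarrow> rsq p K' xs \<Longrightarrow>
    EV p l L (ringm n K') (length xs)"
proof (induction xs arbitrary: K')
  case Nil
  then show ?case by (simp add: EV_def)
next
  case (Cons x xs)
  let ?K = "sat p (adj K' x)"
  have "EV p l L (ringm n ?K) (length xs)"
  proof (rule Cons.IH)
    show "idl ?K" by (intro idl_sat idl_adj p Cons.prems)
    show "K \<subseteq> ?K" using adj_superset sat_superset[OF p] Cons.prems(2) by blast
    show "rsq p ?K xs" using Cons.prems(4) by simp
  qed (rule sat_sat[OF p])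
  then have E: "EV p l L (coker p (\<lambda>A. x *\<^sub>m A) (ringm n K')) (length xs)"
    unfolding coker_ringm[OF p Cons.prems(1)] .
  have "EV p l L (ringm n K') (Suc (length xs))"
  proof (rule EV_regular[OF p K L psub_ringm[OF Cons.prems(1,2,3)] _ _ E])
    show "x \<in> p" using Cons.prems(4) by simp
    show "A \<in> ringm n K'" if "x *\<^sub>m A \<in> ringm n K'" for A
      by (rule ringm_scalar[OF _ that]) (use Cons.prems(4) in simp)
  qed
  then show ?case by simp
qed

section \<open>Modules whose dual has finite projective dimension\<close>

text \<open>The complex \<open>\<Delta>\<close> runs through the transposes of \<open>D q\<close>
  down to \<open>D 1\<close> and continues with \<open>G\<close>, whose first map is the transpose
  of \<open>D 0\<close>. Exactness of the first stretch is the vanishing of Ext in degrees 1 to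
  \<open>q\<close>. A syzygy of \<open>G\<close> thus sits \<open>q\<close> places later in
  \<open>\<Delta>\<close>, which is what improves the Auslander-Buchsbaum bound by
  \<open>q\<close>.\<close>

lemma splice_dual:
  assumes K: "idl K" and D: "cpx K n D" and G: "cpx K g G" and G0: "G 0 = tr (D 0)" "g 0 = n 1" "g 1 = n 0"
    and dual: "\<And>i V. Suc i \<le> q \<Longrightarrow> V * idm (n (Suc i)) = V \<Longrightarrow> V * D (Suc i) \<in> km K \<Longrightarrow> \<exists>W. V - W * D i \<in> km K"
  obtains \<delta> \<Delta> where "cpx K \<delta> \<Delta>" "\<And>i. \<Delta> (q + i) = G i"
proof -
  define \<Delta> where "\<Delta> i = (if i < q then tr (D (q - i)) else G (i - q))" for i
  define \<delta> where "\<delta> i = (if i \<le> q then n (Suc q - i) else g (i - q))" for i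
  have trD: "idm (n (Suc i)) * tr (D i) = tr (D i)" "tr (D i) * idm (n i) = tr (D i)" "tr (D (Suc i)) * tr (D i) \<in> km K" for i
    using arg_cong[OF cpxD(2)[OF D], of tr] arg_cong[OF cpxD(1)[OF D], of tr] cpxD(3)[OF D, of i]
    by (simp_all add: km_tr[of "D i * D (Suc i)", symmetric])
  have "cpx K \<delta> \<Delta>"
    unfolding cpx_def
  proof (intro allI)
    fix i
    show "idm (\<delta> i) * \<Delta> i = \<Delta> i \<and> \<Delta> i * idm (\<delta> (Suc i)) = \<Delta> i \<and> \<Delta> i * \<Delta> (Suc i) \<in> km K \<and>
      (\<forall>V. idm (\<delta> (Suc i)) * V = V \<longrightarrow> \<Delta> i * V \<in> km K \<longrightarrow> (\<exists>W. V - \<Delta> (Suc i) * W \<in> km K))"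
    proof (cases "i < q")
      case True
      then obtain k where k: "q - i = Suc k" by (metis Suc_pred zero_less_diff)
      have d: "\<delta> i = n (Suc (Suc k))" "\<delta> (Suc i) = n (Suc k)" "\<Delta> i = tr (D (Suc k))"
        using True k by (auto simp: \<delta>_def \<Delta>_def Suc_diff_le)
      have d': "\<Delta> (Suc i) = tr (D k)"
      proof (cases "Suc i < q")
        case True
        then show ?thesis using k by (auto simp: \<Delta>_def) (metis Suc_diff_Suc Suc_lessD old.nat.inject)
      next
        case False
        then have "Suc i = q" "k = 0" using \<open>i < q\<close> k by auto
        then show ?thesis by (simp add: \<Delta>_def G0)
      qed
      have "\<exists>W. V - tr (D k) * W \<in> km K" if V: "idm (n (Suc k)) * V = V" "tr (D (Suc k)) * V \<in> km K" for V
      proof -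
        have "tr V * idm (n (Suc k)) = tr V" using arg_cong[OF V(1), of tr] by simp
        moreover have "tr V * D (Suc k) \<in> km K" using V(2) km_tr[of "tr (D (Suc k)) * V" K] by simp
        moreover have "Suc k \<le> q" using k by simp
        ultimately obtain W where "tr V - W * D k \<in> km K" using dual by blast
        then show ?thesis using km_tr[of "tr V - W * D k" K] by auto
      qed
      then show ?thesis unfolding d d' using trD by blast
    next
      case False
      then obtain k where k: "i = q + k" by (metis le_Suc_ex not_less)
      have "\<delta> i = g k" "\<delta> (Suc i) = g (Suc k)" "\<Delta> i = G k" "\<Delta> (Suc i) = G (Suc k)"
        using k G0 by (auto simp: \<delta>_def \<Delta>_def Suc_diff_le)
      then show ?thesis using cpxD[OF G] by simp
    qed
  qed
  moreover have "\<Delta> (q + i) = G i" for i by (simp add: \<Delta>_def)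
  ultimately show ?thesis using that by blast
qed

lemma row_combination:
  assumes K: "idl K" and "\<And>j. \<exists>W. un 0 j * V - W * H \<in> km K"
  shows "\<exists>W. V - W * H \<in> km K"
proof -
  obtain W where W: "\<And>j. un 0 j * V - W j * H \<in> km K" using assms(2) by metis
  obtain N where N: "\<And>i j. N \<le> i \<or> N \<le> j \<Longrightarrow> ent V i j = 0" using ent_bound by blast
  have "\<exists>W'. idm n * V - W' * H \<in> km K" for n
  proof (induction n)
    case 0
    have "idm 0 * V = 0" by (rule fmat_eqI) simp
    then show ?case using km_zero[OF K] by (intro exI[of _ 0]) simp
  next
    case (Suc n)
    then obtain W' where W': "idm n * V - W' * H \<in> km K" by blast
    have "idm (Suc n) * V = idm n * V + un n 0 * (un 0 n * V)"
      by (rule fmat_eqI) auto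
    then have "idm (Suc n) * V - (W' + un n 0 * W n) * H = (idm n * V - W' * H) + un n 0 * (un 0 n * V - W n * H)"
      by (simp add: mat_simps)
    also have "\<dots> \<in> km K" by (rule km_add[OF K W' km_left[OF K W]])
    finally show ?case by blast
  qed
  moreover have "idm N * V = V" by (rule fmat_eqI) (auto simp: N)
  ultimately show ?thesis by metis
qed

lemma psub_cok:
  assumes p: "prim p" and K: "idl K"
  shows "psub p K (coker p (\<lambda>A. H * A) (ringm n (sat p K)))"
  by (rule psub_coker[OF p psub_ringm[OF idl_sat[OF p K] sat_superset[OF p]] lin_left]) (rule sat_sat[OF p])

lemma cok_iff:
  assumes p: "prim p" and K: "idl K" and H: "idm n * H = H"
  shows "A \<in> coker p (\<lambda>A. H * A) (ringm n (sat p K)) \<longleftrightarrow> (\<exists>u W. u \<notin> p \<and> u *\<^sub>m (idm n * A) - H * W \<in> km K)"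
proof
  assume "A \<in> coker p (\<lambda>A. H * A) (ringm n (sat p K))"
  then obtain u C where u: "u \<notin> p" "idm n * (u *\<^sub>m A - H * C) \<in> km (sat p K)" by (auto simp: coker_def ringm_def)
  then obtain v where v: "v \<notin> p" "v *\<^sub>m (idm n * (u *\<^sub>m A - H * C)) \<in> km K" using km_sat[OF p K] by blast
  have "idm n * (H * C) = H * C" using H by (metis mult.assoc)
  then have "(v * u) *\<^sub>m (idm n * A) - H * (v *\<^sub>m C) \<in> km K" using v(2) by (simp add: mat_simps)
  then show "\<exists>u W. u \<notin> p \<and> u *\<^sub>m (idm n * A) - H * W \<in> km K" using prim_mult[OF p v(1) u(1)] by blast
next
  assume "\<exists>u W. u \<notin> p \<and> u *\<^sub>m (idm n * A) - H * W \<in> km K"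
  then obtain u W where u: "u \<notin> p" "u *\<^sub>m (idm n * A) - H * W \<in> km K" by blast
  have "idm n * (u *\<^sub>m A - H * W) = idm n * (u *\<^sub>m (idm n * A) - H * W)" by (simp add: mat_simps)
  also have "\<dots> \<in> km (sat p K)" using km_left[OF K u(2)] km_mono[OF sat_superset[OF p]] by blast
  finally show "A \<in> coker p (\<lambda>A. H * A) (ringm n (sat p K))" unfolding coker_def ringm_def using u(1) by blast
qed

text \<open>\<open>HS\<close> bounds from below the depth of the cokernel of
  \<open>tr (G 0)\<close>, the module whose transpose \<open>G\<close> resolves. Strong induction
  makes the dual complex exact in the earlier degrees, so the cokernels of the transposes embed into
  free modules and each passage to the next one costs one degree of Ext vanishing.\<close>

lemma dual_exactness:
  assumes K: "noeth K" and G: "cpx K g G" and m: "prim m" "K \<subseteq> m" and V0: "vreg m K (G r)"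
    and vp: "\<And>p. prim p \<Longrightarrow> K \<subseteq> p \<Longrightarrow> p \<subseteq> m"
    and HS: "\<And>p xs s l L. prim p \<Longrightarrow> K \<subseteq> p \<Longrightarrow> rsq p (sat p K) xs \<Longrightarrow> pres K p l L \<Longrightarrow>
      EV p l L (coker p (\<lambda>A. tr (G 0) * A) (ringm (g 1) (sat p K))) (min r (length xs))"
  shows "Suc i \<le> r \<Longrightarrow> V * idm (g (Suc i)) = V \<Longrightarrow> V * G (Suc i) \<in> km K \<Longrightarrow> \<exists>W. V - W * G i \<in> km K"
proof (induction i arbitrary: V rule: less_induct)
  case (less i)
  have iK: "idl K" by (rule noeth_idl[OF K])
  \<comment> \<open>Cocycles and coboundaries in degree \<open>Suc i\<close> that consist of one
    row; \<open>row_combination\<close> extends the result to all matrices.\<close>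
  define X where "X = {Z. idm 1 * Z = Z \<and> Z * idm (g (Suc i)) = Z \<and> Z * G (Suc i) \<in> km K}"
  define B where "B = {Z. Z \<in> X \<and> (\<exists>W. Z - W * G i \<in> km K)}"
  have XB: "Z \<in> B" if Z: "Z \<in> X" for Z
  proof (rule ccontr)
    assume ZB: "Z \<notin> B"
    interpret pmod "(*\<^sub>m)" K X B
    proof unfold_locales
      show "0 \<in> B" by (auto simp: B_def X_def km_zero[OF iK] intro!: exI[of _ 0])
      fix f h assume "f \<in> B" "h \<in> B"
      then obtain W W' where W: "f \<in> X" "f - W * G i \<in> km K" "h \<in> X" "h - W' * G i \<in> km K" by (auto simp: B_def)
      have "f + h - (W + W') * G i \<in> km K" using km_add[OF iK W(2,4)] by (simp add: mat_simps)
      moreover have "f + h \<in> X" using W(1,3) by (auto simp: X_def mat_simps intro: km_add[OF iK])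
      ultimately show "f + h \<in> B" unfolding B_def by blast
    next
      show Xs: "a *\<^sub>m f \<in> X" if "f \<in> X" for a f using that by (auto simp: X_def km_scm[OF iK])
      fix a f assume "f \<in> B"
      then obtain W where W: "f \<in> X" "f - W * G i \<in> km K" by (auto simp: B_def)
      have "a *\<^sub>m f - (a *\<^sub>m W) * G i \<in> km K" using km_scm[OF iK W(2), of a] by (simp add: mat_simps)
      then show "a *\<^sub>m f \<in> B" unfolding B_def using Xs[OF W(1)] by blast
    next
      fix a f assume a: "a \<in> K" "f \<in> X"
      have "a *\<^sub>m f - 0 * G i \<in> km K" using km_scm'[OF iK a(1)] by simp
      moreover have "a *\<^sub>m f \<in> X" using a(2) by (auto simp: X_def km_scm[OF iK])
      ultimately show "a *\<^sub>m f \<in> B" unfolding B_def by blast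
    qed (use K in \<open>auto simp: mat_simps\<close>)
    obtain z where z: "z \<in> X - B" and p: "prim (ann z)" using prime_ann[of Z] Z ZB by blast
    let ?p = "ann z"
    have Kp: "K \<subseteq> ?p" using K_ann z by blast
    have zX: "idm 1 * z = z" "z * idm (g (Suc i)) = z" "z * G (Suc i) \<in> km K" using z by (auto simp: X_def)
    have annI: "a \<in> ?p" if "a *\<^sub>m z - W * G i \<in> km K" for a W
    proof -
      have "a *\<^sub>m z \<in> B" using that X_sc[of z a] z unfolding B_def by blast
      then show ?thesis by (simp add: ann_def)
    qed
    obtain xs s where xs: "rsq ?p (sat ?p K) xs" "s \<notin> rsid ?p (sat ?p K) xs" "\<And>a. a \<in> ?p \<Longrightarrow> s * a \<in> rsid ?p (sat ?p K) xs"
      using maximal_rsq[OF K p Kp] by metis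
    \<comment> \<open>The denominator lies outside \<open>m\<close> and therefore outside the
      smaller prime.\<close>
    have vr: "vreg ?p K (G r)"
      using V0 vp[OF p Kp] unfolding vreg_def by blast
    \<comment> \<open>Otherwise the depth at \<open>?p\<close> is at most \<open>i\<close>, and the
      Auslander-Buchsbaum bound splits \<open>G i\<close> at \<open>?p\<close>. The complementary
      projection then shows that some \<open>u\<close> outside \<open>?p\<close> turns
      \<open>z\<close> into a coboundary, although \<open>?p\<close> is the annihilator of its
      class.\<close>
    have ix: "Suc i \<le> length xs"
    proof (rule ccontr)
      assume "\<not> Suc i \<le> length xs"
      then have "vreg ?p K (G i)"
        using auslander_buchsbaum[OF p iK G xs vr] less.prems(1) by simp
      then obtain t u where u: "u \<notin> ?p" and t: "G i * t * G i - u *\<^sub>m G i \<in> km K" by (auto simp: vreg_def)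
      let ?E = "idm (g (Suc i)) :: 'a fmat"
      let ?U = "u *\<^sub>m ?E - ?E * t * G i"
      have GE: "G i * (?E * Y) = G i * Y" "G i * ?E = G i" for Y using cpxD(2)[OF G, of i] by (metis mult.assoc)+
      have "G i * ?U = - (G i * t * G i - u *\<^sub>m G i)" by (simp add: mat_simps GE)
      then have "G i * ?U \<in> km K" using km_minus[OF iK t] by simp
      moreover have "?E * ?U = ?U" by (simp add: mat_simps)
      ultimately obtain W where W: "?U - G (Suc i) * W \<in> km K" using cpxD(4)[OF G] by blast
      have zE: "z * (?E * Y) = z * Y" for Y using zX(2) by (metis mult.assoc)
      have "u *\<^sub>m z - (z * t) * G i = z * (?U - G (Suc i) * W) + z * G (Suc i) * W"
        by (simp add: mat_simps zE zX)
      also have "\<dots> \<in> km K" by (rule km_add[OF iK km_left[OF iK W] km_right[OF iK zX(3)]])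
      finally show False using annI u by blast
    qed
    obtain l L where L: "pres K ?p l L" using pres_exists[OF K prim_idl[OF p] Kp] by blast
    define Q where "Q k = ringm (g k) (sat ?p K)" for k
    define C where "C k = coker ?p (\<lambda>A. tr (G k) * A) (Q (Suc k))" for k
    have psQ: "psub ?p K (Q k)" for k
      unfolding Q_def by (rule psub_ringm[OF idl_sat[OF p iK] sat_superset[OF p]]) (rule sat_sat[OF p])
    have psC: "psub ?p K (C k)" for k
      unfolding C_def Q_def by (rule psub_cok[OF p iK])
    have EQ: "EV ?p l L (Q k) (length xs)" for k
      unfolding Q_def
      by (rule EV_rsq[OF p iK L idl_sat[OF p iK] sat_superset[OF p] _ xs(1)]) (rule sat_sat[OF p])
    have trG: "idm (g (Suc k)) * tr (G k) = tr (G k)" "tr (G (Suc k)) * idm (g (Suc k)) = tr (G (Suc k))"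
       "tr (G (Suc k)) * tr (G k) \<in> km K" for k
      using arg_cong[OF cpxD(2)[OF G, of k], of tr] arg_cong[OF cpxD(1)[OF G, of "Suc k"], of tr] cpxD(3)[OF G, of k]
      by (simp_all add: km_tr[of "G k * G (Suc k)", symmetric])
    have C_iff: "A \<in> C k \<longleftrightarrow> (\<exists>u W. u \<notin> ?p \<and> u *\<^sub>m (idm (g (Suc k)) * A) - tr (G k) * W \<in> km K)" for A k
      unfolding C_def Q_def by (rule cok_iff[OF p iK trG(1)])
    \<comment> \<open>Exactness of the dual complex in the earlier degree says that the next
      transpose is injective on the cokernel \<open>C k\<close>.\<close>
    have inj: "tr (G (Suc k)) * A \<in> Q (Suc (Suc k)) \<longleftrightarrow> A \<in> C k" if k: "k < i" for k A
    proof
      assume "tr (G (Suc k)) * A \<in> Q (Suc (Suc k))"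
      then have "idm (g (Suc (Suc k))) * tr (G (Suc k)) * A \<in> km (sat ?p K)" by (simp add: Q_def ringm_def mult.assoc)
      then obtain u where u: "u \<notin> ?p" "u *\<^sub>m (tr (G (Suc k)) * A) \<in> km K"
        unfolding trG using km_sat[OF p iK] by blast
      let ?V = "tr (u *\<^sub>m (idm (g (Suc k)) * A))"
      have "tr (?V * G (Suc k)) \<in> km K"
        using u(2) by (simp add: trG flip: mult.assoc)
      then have "?V * G (Suc k) \<in> km K" by (simp only: km_tr)
      moreover have "?V * idm (g (Suc k)) = ?V" by (simp add: mult.assoc)
      ultimately obtain W where "?V - W * G k \<in> km K" using less.IH[OF k] less.prems(1) k by fastforce
      then have "tr (?V - W * G k) \<in> km K" by (simp only: km_tr)
      then show "A \<in> C k" unfolding C_iff using u(1) by auto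
    next
      assume "A \<in> C k"
      then obtain u W where u: "u \<notin> ?p" "u *\<^sub>m (idm (g (Suc k)) * A) - tr (G k) * W \<in> km K" unfolding C_iff by blast
      have "u *\<^sub>m (tr (G (Suc k)) * A) = tr (G (Suc k)) * (u *\<^sub>m (idm (g (Suc k)) * A) - tr (G k) * W) + tr (G (Suc k)) * tr (G k) * W"
        by (simp add: mat_simps) (simp add: trG flip: mult.assoc)
      also have "\<dots> \<in> km K" by (rule km_add[OF iK km_left[OF iK u(2)] km_right[OF iK trG(3)]])
      finally have "tr (G (Suc k)) * A \<in> km (sat ?p K)" using km_sat[OF p iK] u(1) by blast
      then show "tr (G (Suc k)) * A \<in> Q (Suc (Suc k))"
        unfolding Q_def ringm_def using km_left[OF idl_sat[OF p iK]] by blast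
    qed
    \<comment> \<open>\<open>C (Suc k)\<close> is the cokernel of an embedding of \<open>C k\<close>
      into the free module \<open>Q (Suc (Suc k))\<close>, and the depth of the free module is at
      least \<open>Suc i\<close> by \<open>ix\<close>.\<close>
    have "EV ?p l L (C k) (Suc i - k)" if "k \<le> i" for k
      using that
    proof (induction k)
      case 0
      have "EV ?p l L (C 0) (min r (length xs))"
        using HS[OF p Kp xs(1) L] by (simp add: C_def Q_def)
      then show ?case by (rule EV_mono) (use ix less.prems(1) in simp)
    next
      case (Suc k)
      then have "EV ?p l L (C k) (Suc (i - k))" by (simp add: Suc_diff_le)
      moreover have "EV ?p l L (Q (Suc (Suc k))) (i - k)" by (rule EV_mono[OF EQ]) (use ix in simp)
      ultimately have "EV ?p l L (coker ?p (\<lambda>A. tr (G (Suc k)) * A) (Q (Suc (Suc k)))) (i - k)"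
        using inj[of k] Suc.prems by (intro EV_coker[OF p iK L psC psQ lin_left]) auto
      then show ?case by (simp add: C_def)
    qed
    from this[of i] have E1: "EV ?p l L (C i) (Suc 0)" by simp
    \<comment> \<open>The class of \<open>z\<close>, read as a column, is killed by
      \<open>?p\<close> in \<open>C i\<close>; so it vanishes there, which makes \<open>z\<close> a
      coboundary up to a denominator.\<close>
    have "tr z \<in> C i"
    proof (rule EV_socle[OF p iK L psC E1])
      show "tr z * idm 1 = tr z" using arg_cong[OF zX(1), of tr] by simp
      fix a assume "a \<in> ?p"
      then have "a *\<^sub>m z \<in> B" by (simp add: ann_def)
      then obtain W where W: "a *\<^sub>m z - W * G i \<in> km K" unfolding B_def by blast
      then have "tr (a *\<^sub>m z - W * G i) \<in> km K" by (simp only: km_tr)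
      moreover have "idm (g (Suc i)) * tr z = tr z" using arg_cong[OF zX(2), of tr] by simp
      ultimately have "1 *\<^sub>m (idm (g (Suc i)) * (a *\<^sub>m tr z)) - tr (G i) * tr W \<in> km K" by simp
      then show "a *\<^sub>m tr z \<in> C i" unfolding C_iff using prim_one[OF p] by blast
    qed
    then obtain u W where u: "u \<notin> ?p" "u *\<^sub>m (idm (g (Suc i)) * tr z) - tr (G i) * W \<in> km K" unfolding C_iff by blast
    from u(2) have "tr (u *\<^sub>m (idm (g (Suc i)) * tr z) - tr (G i) * W) \<in> km K" by (simp only: km_tr)
    then have "u *\<^sub>m z - tr W * G i \<in> km K" by (simp add: zX)
    then show False using annI u(1) by blast
  qed
  show ?case
  proof (rule row_combination[OF iK])
    fix j
    have "un 0 j * V \<in> X"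
      unfolding X_def mem_Collect_eq
    proof (intro conjI)
      show "idm 1 * (un 0 j * V) = un 0 j * V" by (rule fmat_eqI) simp
      show "un 0 j * V * idm (g (Suc i)) = un 0 j * V" by (simp add: mult.assoc less.prems)
      show "un 0 j * V * G (Suc i) \<in> km K" using km_left[OF iK less.prems(3)] by (simp add: mult.assoc)
    qed
    then show "\<exists>W. un 0 j * V - W * G i \<in> km K" using XB by (auto simp: B_def)
  qed
qed

theorem free_of_dual_pd_finite:
  assumes K: "noeth K" and m: "prim m" "K \<subseteq> m" and local: "\<And>u. u \<notin> m \<Longrightarrow> \<exists>v. v * u - 1 \<in> K"
    and D: "cpx K n D" "D 0 \<in> km m"
    and G: "cpx K g G" and G0: "G 0 = tr (D 0)" "g 0 = n 1" "g 1 = n 0" and N: "vreg m K (G N)"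
    and xs: "rsq m K xs" "s \<notin> rsid m K xs" "\<And>a. a \<in> m \<Longrightarrow> s * a \<in> rsid m K xs"
    and dual: "\<And>i V. Suc i \<le> length xs - r \<Longrightarrow> V * idm (n (Suc i)) = V \<Longrightarrow> V * D (Suc i) \<in> km K \<Longrightarrow> \<exists>W. V - W * D i \<in> km K"
    and HS: "\<And>p xs l L. prim p \<Longrightarrow> K \<subseteq> p \<Longrightarrow> rsq p (sat p K) xs \<Longrightarrow> pres K p l L \<Longrightarrow>
      EV p l L (coker p (\<lambda>A. D 0 * A) (ringm (n 0) (sat p K))) (min r (length xs))"
  shows "D 0 \<in> km K"
proof -
  have iK: "idl K" by (rule noeth_idl[OF K])
  have Ksat: "a \<in> K" if "u \<notin> m" "u * a \<in> K" for u a
    by (rule local_saturated[of m K K, OF local iK subset_refl that])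
  have satK: "sat m K = K" by (rule sat_local[OF m(1) local iK subset_refl])
  obtain \<delta> \<Delta> where \<Delta>: "cpx K \<delta> \<Delta>" "\<And>i. \<Delta> (length xs - r + i) = G i"
    using splice_dual[OF iK D(1) G G0 dual, of "length xs - r"] by metis
  define N' where "N' = max N r"
  have "vreg m K (G N')" by (rule vreg_up[OF m(1) iK G N]) (simp add: N'_def)
  then have "vreg m K (\<Delta> (length xs - r + N'))" by (simp add: \<Delta>)
  \<comment> \<open>The index is at least \<open>length xs\<close> also when \<open>r\<close>
    exceeds \<open>length xs\<close>, since then the truncated difference is 0 and the index is
    \<open>r\<close>.\<close>
  then have "vreg m K (\<Delta> (length xs - r + r))"
  proof (rule auslander_buchsbaum[OF m(1) iK \<Delta>(1), rotated 3])
    show "rsq m (sat m K) xs" "s \<notin> rsid m (sat m K) xs" using xs satK by auto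
    show "s * a \<in> rsid m (sat m K) xs" if "a \<in> m" for a using xs(3)[OF that] satK by simp
  qed (auto simp: N'_def)
  then have Gr: "vreg m K (G r)" by (simp add: \<Delta>)
  have vp: "p \<subseteq> m" if p: "prim p" "K \<subseteq> p" for p
    by (rule ideal_below_local[OF local prim_idl[OF p(1)] p(2) prim_one[OF p(1)]])
  have ex: "\<exists>W. V - W * G i \<in> km K" if "Suc i \<le> r" "V * idm (g (Suc i)) = V" "V * G (Suc i) \<in> km K" for i V
    by (rule dual_exactness[OF K G m Gr vp _ that]) (use HS G0 in auto)
  \<comment> \<open>Splittings move down the complex once its dual is exact: the projection
    complementary to the image of \<open>G (Suc i)\<close> is a cocycle of the dual, hence factors
    through \<open>G i\<close>, and the factor is a quasi-inverse of \<open>G i\<close>.\<close>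
  have "vreg m K (G (r - j))" if "j \<le> r" for j
    using that
  proof (induction j)
    case 0
    then show ?case using Gr by simp
  next
    case (Suc j)
    define i where "i = r - Suc j"
    have ij: "r - j = Suc i" "Suc i \<le> r" using Suc.prems by (auto simp: i_def)
    let ?E = "idm (g (Suc i)) :: 'a fmat"
    obtain t u where u: "u \<notin> m" and t: "G (Suc i) * t * G (Suc i) - u *\<^sub>m G (Suc i) \<in> km K"
      using Suc ij by (auto simp: vreg_def)
    let ?V = "u *\<^sub>m ?E - G (Suc i) * t * ?E"
    have GE: "?E * (G (Suc i) * Y) = G (Suc i) * Y" "?E * G (Suc i) = G (Suc i)" "G i * ?E = G i" "G i * (?E * Y) = G i * Y" for Y
      using cpxD(1)[OF G, of "Suc i"] cpxD(2)[OF G, of i] by (metis mult.assoc)+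
    have "?V * G (Suc i) = - (G (Suc i) * t * G (Suc i) - u *\<^sub>m G (Suc i))" by (simp add: mat_simps GE)
    then have "?V * G (Suc i) \<in> km K" using km_minus[OF iK t] by simp
    moreover have "?V * ?E = ?V" by (simp add: mat_simps)
    ultimately obtain W where W: "?V - W * G i \<in> km K" using ex[OF ij(2)] by blast
    have "G i * W * G i - u *\<^sub>m G i = - (G i * (?V - W * G i)) - G i * G (Suc i) * t * ?E"
      by (simp add: mat_simps GE)
    also have "\<dots> \<in> km K"
      by (rule km_diff[OF iK km_minus[OF iK km_left[OF iK W]] km_right[OF iK km_right[OF iK cpxD(3)[OF G]]]])
    finally show ?case using u unfolding vreg_def i_def by blast
  qed
  from this[of r] obtain t u where u: "u \<notin> m" and t: "tr (D 0) * t * tr (D 0) - u *\<^sub>m tr (D 0) \<in> km K"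
    by (auto simp: vreg_def G0)
  from t have "tr (tr (D 0) * t * tr (D 0) - u *\<^sub>m tr (D 0)) \<in> km K" by (simp only: km_tr)
  then have "D 0 * tr t * D 0 - u *\<^sub>m D 0 \<in> km K" by (simp add: mult.assoc)
  then have "vreg m K (D 0)" using u unfolding vreg_def by blast
  with Ksat D(2) cpxD(1)[OF D(1)] show ?thesis by (rule vreg_minimal[OF m(1) iK])
qed

section \<open>Maximal Cohen-Macaulay modules over Cohen-Macaulay rings\<close>

lemma pmod_columns:
  assumes K: "noeth K" and B: "psub p K B"
  shows "pmod_fg (*\<^sub>m) K (colm n) B"
proof unfold_locales
  have iK: "idl K" by (rule noeth_idl[OF K])
  show "0 \<in> B" by (rule psubD(3)[OF B km_zero[OF iK]])
  show "f + g \<in> B" if "f \<in> B" "g \<in> B" for f g by (rule psubD(1)[OF B that])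
  show "a *\<^sub>m f \<in> B" if "f \<in> B" for a f by (rule psub_scm[OF B that])
  show "a *\<^sub>m f \<in> B" if "a \<in> K" for a f by (rule psubD(3)[OF B km_scm'[OF iK that]])
  show "a *\<^sub>m f \<in> colm n" if "f \<in> colm n" for a f using that by (simp add: colm_def)
  show "\<exists>k y. (\<forall>i<(k::nat). y i \<in> Y) \<and> (\<forall>z\<in>Y. \<exists>c. z - (\<Sum>i<k. c i *\<^sub>m y i) \<in> B)" if "Y \<subseteq> colm n" for Y
    using columns_generated[OF K that] psubD(3)[OF B] by meson
qed (use K in \<open>auto simp: mat_simps\<close>)

lemma psub_by_columns:
  assumes K: "idl K" and B: "psub p K B" and "\<And>j. A * un j 0 \<in> B"
  shows "A \<in> B"
proof -
  obtain N where N: "\<And>i j. N \<le> i \<or> N \<le> j \<Longrightarrow> ent A i j = 0" using ent_bound by blast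
  have "A * idm n \<in> B" for n
  proof (induction n)
    case 0
    have "A * idm 0 = 0" by (rule fmat_eqI) simp
    then show ?case using psubD(3)[OF B km_zero[OF K]] by simp
  next
    case (Suc n)
    have "A * idm (Suc n) = A * idm n + A * un n 0 * un 0 n"
      by (rule fmat_eqI) (auto simp: less_Suc_eq)
    then show ?case using psubD(1)[OF B Suc psubD(2)[OF B assms(3), of n "un 0 n"]] by simp
  qed
  moreover have "A * idm N = A" by (rule fmat_eqI) (auto simp: N)
  ultimately show ?thesis by metis
qed

text \<open>Nakayama's lemma for a module generated by the columns of \<open>D\<close>: the inverse
  acts on the coefficients, that is from the right, so \<open>nakayama_inverse\<close> is applied to
  the transpose.\<close>

lemma nakayama_right:
  assumes K: "idl K" and m: "prim m" and B: "psub m K B" and x: "x \<in> m" and D: "D * idm k = D"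
    and u: "u \<notin> m" "u *\<^sub>m D - x *\<^sub>m (D * W) \<in> B"
  shows "D \<in> B"
proof -
  let ?A = "x *\<^sub>m (idm k * W * idm k)"
  have "tr ?A \<in> km m" unfolding km_tr by (rule km_scm'[OF prim_idl[OF m] x])
  moreover have "idm k * tr ?A = tr ?A" "tr ?A * idm k = tr ?A" by (simp_all add: mult.assoc)
  ultimately obtain \<psi> w where w: "w \<notin> m" and \<psi>: "\<psi> * (u *\<^sub>m idm k - tr ?A) = w *\<^sub>m idm k"
    by (rule nakayama_inverse[OF m u(1)])
  have "tr (\<psi> * (u *\<^sub>m idm k - tr ?A)) = tr (w *\<^sub>m idm k)" unfolding \<psi> ..
  then have \<psi>': "(u *\<^sub>m idm k - ?A) * tr \<psi> = w *\<^sub>m idm k" by simp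
  have Dk: "D * (idm k * Y) = D * Y" for Y using D by (metis mult.assoc)
  have "w *\<^sub>m D = D * (w *\<^sub>m idm k)" by (simp add: D)
  also have "\<dots> = (u *\<^sub>m D - x *\<^sub>m (D * W)) * idm k * tr \<psi>"
    unfolding \<psi>'[symmetric] by (simp add: mat_simps Dk)
  also have "\<dots> \<in> B" by (rule psubD(2)[OF B psubD(2)[OF B u(2)]])
  finally show ?thesis using psubD(4)[OF B w] by blast
qed

section \<open>Chains of primes and the dimension of associated primes\<close>

definition pchain :: "'a::comm_ring_1 set \<Rightarrow> nat \<Rightarrow> (nat \<Rightarrow> 'a set) \<Rightarrow> bool" where
  "pchain K N c \<longleftrightarrow> (\<forall>i\<le>N. prim (c i) \<and> K \<subseteq> c i) \<and> (\<forall>i<N. c i \<subset> c (Suc i))"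

lemma pchain_prepend:
  assumes "pchain K N c" "prim q" "K \<subseteq> q" "q \<subset> c 0"
  shows "pchain K (Suc N) (case_nat q c)"
  using assms unfolding pchain_def by (auto split: nat.split simp: less_Suc_eq_0_disj)

lemma psub_regular_columns:
  assumes K: "idl K" and B: "psub p K B" and row: "\<And>A. idm n * A \<in> B \<longleftrightarrow> A \<in> B"
    and reg: "\<And>g. g \<in> colm n \<Longrightarrow> x *\<^sub>m g \<in> B \<Longrightarrow> g \<in> B" and A: "x *\<^sub>m A \<in> B"
  shows "A \<in> B"
proof (rule psub_by_columns[OF K B])
  fix j
  have "x *\<^sub>m (A * un j 0) \<in> B" using psubD(2)[OF B A, of "un j 0"] by simp
  then have "idm n * (x *\<^sub>m (A * un j 0)) \<in> B" unfolding row .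
  then have "x *\<^sub>m (idm n * (A * un j 0)) \<in> B" by simp
  moreover have "idm n * (A * un j 0) \<in> colm n"
    unfolding colm_def mem_Collect_eq by (intro conjI; rule fmat_eqI) auto
  ultimately have "idm n * (A * un j 0) \<in> B" using reg by blast
  then show "A * un j 0 \<in> B" unfolding row .
qed

lemma coker_rows:
  assumes B: "psub p K B" and row: "\<And>A. idm n * A \<in> B \<longleftrightarrow> A \<in> B"
  shows "idm n * A \<in> coker p (\<lambda>A. x *\<^sub>m A) B \<longleftrightarrow> A \<in> coker p (\<lambda>A. x *\<^sub>m A) B"
proof
  assume "idm n * A \<in> coker p (\<lambda>A. x *\<^sub>m A) B"
  then obtain u C where u: "u \<notin> p" "u *\<^sub>m (idm n * A) - x *\<^sub>m C \<in> B" by (auto simp: coker_def)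
  then have "idm n * (u *\<^sub>m (idm n * A) - x *\<^sub>m C) \<in> B" unfolding row by simp
  then have "idm n * (u *\<^sub>m A - x *\<^sub>m C) \<in> B" by (simp add: mat_simps)
  then show "A \<in> coker p (\<lambda>A. x *\<^sub>m A) B" unfolding row by (rule cokerI[OF u(1)])
next
  assume "A \<in> coker p (\<lambda>A. x *\<^sub>m A) B"
  then obtain u C where u: "u \<notin> p" "u *\<^sub>m A - x *\<^sub>m C \<in> B" by (auto simp: coker_def)
  then have "idm n * (u *\<^sub>m A - x *\<^sub>m C) \<in> B" unfolding row by simp
  then have "u *\<^sub>m (idm n * A) - x *\<^sub>m (idm n * C) \<in> B" by (simp add: mat_simps)
  then show "idm n * A \<in> coker p (\<lambda>A. x *\<^sub>m A) B" by (rule cokerI[OF u(1)])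
qed

text \<open>Dividing by a regular element lowers the depth by at most one; both terms of the exact
  sequence are the same module.\<close>

lemma EV_coker_scalar:
  assumes p: "prim p" and K: "idl K" and L: "pres K p l L" and B: "psub p K B"
    and reg: "\<And>A. x *\<^sub>m A \<in> B \<Longrightarrow> A \<in> B" and E: "EV p l L B (Suc h)"
  shows "EV p l L (coker p (\<lambda>A. x *\<^sub>m A) B) h"
proof (rule EV_coker[OF p K L B B lin_scalar _ E EV_mono[OF E]])
  show "x *\<^sub>m A \<in> B \<longleftrightarrow> A \<in> B" for A using reg[of A] psub_scm[OF B, of A x] by blast
qed simp

text \<open>An associated prime of a module of depth \<open>N\<close> has dimension at least \<open>N\<close>.\<close>

lemma chain_from_associated_prime:
  assumes K: "noeth K" and m: "prim m" and L: "pres K m l L"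
  shows "psub m K B \<Longrightarrow> (\<And>A. idm n * A \<in> B \<longleftrightarrow> A \<in> B) \<Longrightarrow> EV m l L B N \<Longrightarrow>
    z \<in> colm n \<Longrightarrow> z \<notin> B \<Longrightarrow> prim {a. a *\<^sub>m z \<in> B} \<Longrightarrow>
    \<exists>c. c 0 = {a. a *\<^sub>m z \<in> B} \<and> pchain {} N c"
proof (induction N arbitrary: B z)
  case 0
  then show ?case by (intro exI[of _ "\<lambda>_. {a. a *\<^sub>m z \<in> B}"]) (auto simp: pchain_def)
next
  case (Suc N)
  note B = Suc.prems(1) and row = Suc.prems(2) and E = Suc.prems(3)
  have iK: "idl K" by (rule noeth_idl[OF K])
  let ?q = "{a. a *\<^sub>m z \<in> B}"
  interpret M: pmod_fg "(*\<^sub>m)" K "colm n" B by (rule pmod_columns[OF K B])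
  have "\<exists>j\<in>m. \<forall>g\<in>colm n. (0 + j) *\<^sub>m g \<in> B \<longrightarrow> g \<in> B"
  proof (rule M.regular_in_coset[OF prim_idl[OF m]])
    fix g assume g: "g \<in> colm n - B"
    show "\<exists>j\<in>m. j *\<^sub>m g \<notin> B"
    proof (rule ccontr)
      assume "\<not> (\<exists>j\<in>m. j *\<^sub>m g \<notin> B)"
      then have "a *\<^sub>m g \<in> B" if "a \<in> m" for a using that by blast
      moreover have "g * idm 1 = g" using g unfolding colm_def by blast
      ultimately have "g \<in> B" using EV_socle[OF m iK L B E] by blast
      then show False using g by simp
    qed
  qed
  then obtain x where x: "x \<in> m" "\<And>g. g \<in> colm n \<Longrightarrow> x *\<^sub>m g \<in> B \<Longrightarrow> g \<in> B" by auto
  have reg: "A \<in> B" if "x *\<^sub>m A \<in> B" for A by (rule psub_regular_columns[OF iK B row x(2) that])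
  have xq: "x \<notin> ?q" using reg Suc.prems(5) by auto
  let ?B = "coker m (\<lambda>A. x *\<^sub>m A) B"
  have B1: "psub m K ?B" by (rule psub_coker[OF m B lin_scalar])
  have row1: "idm n * A \<in> ?B \<longleftrightarrow> A \<in> ?B" for A by (rule coker_rows[OF B row])
  have E1: "EV m l L ?B N" by (rule EV_coker_scalar[OF m iK L B reg E])
  \<comment> \<open>The submodule of elements killed by the prime \<open>?q\<close>;
    \<open>D\<close> below lists its generators as columns.\<close>
  define Z where "Z = {A. idm n * A = A \<and> (\<forall>a\<in>?q. a *\<^sub>m A \<in> B)}"
  have "rid n Z"
    unfolding rid_def Z_def
  proof (intro conjI ballI allI; (elim CollectE conjE)?)
    show "0 \<in> {A. idm n * A = A \<and> (\<forall>a\<in>?q. a *\<^sub>m A \<in> B)}" by (simp add: M.B_zero)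
    fix A assume A: "idm n * A = A" "\<forall>a\<in>?q. a *\<^sub>m A \<in> B"
    show "idm n * A = A" by (rule A(1))
    have "a *\<^sub>m (A * C) \<in> B" if "a \<in> ?q" for a C using psubD(2)[OF B, of "a *\<^sub>m A" C] A(2) that by simp
    then show "A * C \<in> {A. idm n * A = A \<and> (\<forall>a\<in>?q. a *\<^sub>m A \<in> B)}" for C
      using A(1) by (simp flip: mult.assoc)
    fix C assume C: "idm n * C = C" "\<forall>a\<in>?q. a *\<^sub>m C \<in> B"
    have "a *\<^sub>m (A + C) \<in> B" if "a \<in> ?q" for a
      unfolding scm_add_right by (rule psubD(1)[OF B]) (use A C that in blast)+
    then show "A + C \<in> {A. idm n * A = A \<and> (\<forall>a\<in>?q. a *\<^sub>m A \<in> B)}"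
      using A(1) C(1) by (simp add: distrib_left)
  qed
  from rid_fg[OF K this] obtain k D where D: "D \<in> Z" "D * idm k = D" "\<And>A. A \<in> Z \<Longrightarrow> \<exists>W. A - D * W \<in> km K"
    by metis
  \<comment> \<open>If all generators of \<open>Z\<close> were multiples of \<open>x\<close>, the
    quotients would again be killed by \<open>?q\<close> because \<open>x\<close> is regular. Then
    \<open>Z\<close> would equal \<open>x\<close> times \<open>Z\<close> and vanish by Nakayama's
    lemma, although it contains \<open>z\<close>.\<close>
  have "\<exists>j. D * un j 0 \<notin> ?B"
  proof (rule ccontr)
    assume "\<not> (\<exists>j. D * un j 0 \<notin> ?B)"
    then have "D \<in> ?B" using psub_by_columns[OF iK B1] by blast
    then obtain u C0 where u: "u \<notin> m" "u *\<^sub>m D - x *\<^sub>m C0 \<in> B" by (auto simp: coker_def)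
    define C where "C = idm n * C0"
    have "idm n * (u *\<^sub>m D - x *\<^sub>m C0) \<in> B" using u(2) unfolding row .
    moreover have "idm n * D = D" using D(1) by (simp add: Z_def)
    ultimately have uC: "u *\<^sub>m D - x *\<^sub>m C \<in> B" by (simp add: mat_simps C_def)
    have "C \<in> Z"
      unfolding Z_def mem_Collect_eq
    proof (intro conjI ballI)
      show "idm n * C = C" by (simp add: C_def)
      fix a assume a: "a \<in> {a. a *\<^sub>m z \<in> B}"
      have "a *\<^sub>m D \<in> B" using D(1) a by (simp add: Z_def)
      from psub_diff[OF B psub_scm[OF B this, of u] psub_scm[OF B uC, of a]]
      have "u *\<^sub>m (a *\<^sub>m D) - a *\<^sub>m (u *\<^sub>m D - x *\<^sub>m C) \<in> B" .
      then have "x *\<^sub>m (a *\<^sub>m C) \<in> B" by (simp add: mat_simps)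
      then show "a *\<^sub>m C \<in> B" by (rule reg)
    qed
    then obtain W where W: "C - D * W \<in> km K" using D(3) by blast
    have "(u *\<^sub>m D - x *\<^sub>m C) + x *\<^sub>m (C - D * W) \<in> B"
      by (rule psubD(1)[OF B uC psub_scm[OF B psubD(3)[OF B W]]])
    then have "u *\<^sub>m D - x *\<^sub>m (D * W) \<in> B" by (simp add: mat_simps)
    then have DB: "D \<in> B" by (rule nakayama_right[OF iK m B x(1) D(2) u(1)])
    have "z \<in> Z" using Suc.prems(4) by (auto simp: Z_def colm_def)
    then obtain W' where "z - D * W' \<in> km K" using D(3) by blast
    from psubD(1)[OF B psubD(3)[OF B this] psubD(2)[OF B DB, of W']] have "z \<in> B" by simp
    then show False using Suc.prems(5) by simp
  qed
  then obtain j where j: "D * un j 0 \<notin> ?B" by blast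
  let ?z = "D * un j 0"
  have zc: "?z \<in> colm n"
  proof -
    have "idm n * D = D" using D(1) by (simp add: Z_def)
    then have "idm n * ?z = ?z" by (simp flip: mult.assoc)
    moreover have "?z * idm 1 = ?z" by (rule fmat_eqI) auto
    ultimately show ?thesis by (simp add: colm_def)
  qed
  interpret M1: pmod_fg "(*\<^sub>m)" K "colm n" ?B by (rule pmod_columns[OF K B1])
  \<comment> \<open>An associated prime of the quotient by \<open>x\<close> that contains
    \<open>?q\<close> and \<open>x\<close>. It is strictly larger than \<open>?q\<close>, and the
    induction hypothesis starts a chain at it.\<close>
  obtain y where y: "y \<in> colm n - ?B" "M1.ann ?z \<subseteq> M1.ann y" "prim (M1.ann y)"
    using M1.prime_ann[of ?z] zc j by blast
  have "\<exists>c. c 0 = {a. a *\<^sub>m y \<in> ?B} \<and> pchain {} N c"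
    by (rule Suc.IH[OF B1 row1 E1]) (use y in \<open>auto simp: M1.ann_def\<close>)
  then obtain c where c: "c 0 = M1.ann y" "pchain {} N c" by (auto simp: M1.ann_def)
  have "?q \<subseteq> M1.ann ?z"
  proof
    fix a assume a: "a \<in> ?q"
    have "a *\<^sub>m D \<in> B" using D(1) a by (auto simp: Z_def)
    from psubD(2)[OF B this, of "un j 0"] have "a *\<^sub>m ?z \<in> B" by simp
    then show "a \<in> M1.ann ?z" unfolding M1.ann_def using coker_superset[OF m lin_scalar] by blast
  qed
  moreover have "x \<in> M1.ann ?z"
    unfolding M1.ann_def mem_Collect_eq by (rule coker_image[OF iK m B])
  ultimately have "?q \<subset> c 0" using xq y(2) c(1) by blast
  from pchain_prepend[OF c(2) Suc.prems(6) _ this] have "pchain {} (Suc N) (case_nat ?q c)" by simp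
  then show ?case by (intro exI[of _ "case_nat ?q c"]) simp
qed

text \<open>The hypothesis \<open>soc\<close> says that the localized quotient has no socle at
  \<open>p\<close>. An associated prime of that localization is contained in \<open>p\<close> and
  differs from it.\<close>

lemma prime_below:
  assumes K: "noeth K" and K': "idl K'" "K \<subseteq> K'" and p: "prim p" "K' \<subseteq> p"
    and soc: "\<And>a. (\<And>y. y \<in> p \<Longrightarrow> y * a \<in> sat p K') \<Longrightarrow> a \<in> sat p K'"
  obtains q where "prim q" "K' \<subseteq> q" "q \<subset> p"
proof -
  have "K \<subseteq> sat p K'" using K'(2) sat_superset[OF p(1)] by blast
  then interpret M: pmod_fg "(*)" K UNIV "sat p K'" by (rule pmod_ring[OF K idl_sat[OF p(1) K'(1)]])
  have "1 \<notin> sat p K'" using sat_subset[OF p(1) prim_idl[OF p(1)] p(2)] prim_one[OF p(1)] by blast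
  then obtain g where g: "g \<notin> sat p K'" "prim (M.ann g)" using M.prime_ann[of 1] by blast
  have "M.ann g \<subseteq> p"
  proof
    fix a assume "a \<in> M.ann g"
    then show "a \<in> p" using sat_sat[OF p(1), of a g K'] g(1) by (auto simp: M.ann_def)
  qed
  moreover have "M.ann g \<noteq> p" using soc[of g] g(1) by (auto simp: M.ann_def)
  moreover have "K' \<subseteq> M.ann g"
    using sat_superset[OF p(1), of K'] idl_mult'[OF K'(1)] by (auto simp: M.ann_def)
  ultimately show ?thesis using that[OF g(2)] by blast
qed

section \<open>Localizing Cohen-Macaulay modules at a smaller prime\<close>

definition satm :: "'a::comm_ring_1 set \<Rightarrow> 'a fmat set \<Rightarrow> 'a fmat set" where
  "satm p B = {A. \<exists>u. u \<notin> p \<and> u *\<^sub>m A \<in> B}"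

lemma psub_satm:
  assumes p: "prim p" and B: "psub m K B"
  shows "psub p K (satm p B)"
  unfolding psub_def
proof (intro conjI ballI allI impI subsetI)
  fix A C assume "A \<in> satm p B" "C \<in> satm p B"
  then obtain u v where u: "u \<notin> p" "u *\<^sub>m A \<in> B" and v: "v \<notin> p" "v *\<^sub>m C \<in> B" by (auto simp: satm_def)
  have "v *\<^sub>m (u *\<^sub>m A) + u *\<^sub>m (v *\<^sub>m C) \<in> B"
    by (rule psubD(1)[OF B psub_scm[OF B u(2)] psub_scm[OF B v(2)]])
  then have "(u * v) *\<^sub>m (A + C) \<in> B" by (simp add: mat_simps)
  then show "A + C \<in> satm p B" unfolding satm_def using prim_mult[OF p u(1) v(1)] by blast
next
  fix A C assume "A \<in> satm p B"
  then obtain u where u: "u \<notin> p" "u *\<^sub>m A \<in> B" by (auto simp: satm_def)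
  have "u *\<^sub>m (A * C) \<in> B" using psubD(2)[OF B u(2), of C] by simp
  then show "A * C \<in> satm p B" unfolding satm_def using u(1) by blast
next
  fix A assume "A \<in> km K"
  then have "1 *\<^sub>m A \<in> B" using psubD(3)[OF B] by simp
  then show "A \<in> satm p B" unfolding satm_def using prim_one[OF p] by blast
next
  fix u A assume u: "u \<notin> p" "u *\<^sub>m A \<in> satm p B"
  then obtain v where v: "v \<notin> p" "v *\<^sub>m (u *\<^sub>m A) \<in> B" by (auto simp: satm_def)
  then have "(v * u) *\<^sub>m A \<in> B" by simp
  then show "A \<in> satm p B" unfolding satm_def using prim_mult[OF p v(1) u(1)] by blast
qed

lemma satm_coker:
  assumes p: "prim p" "p \<subseteq> m" and m: "prim m"
  shows "satm p (coker m (\<lambda>A. x *\<^sub>m A) B) = coker p (\<lambda>A. x *\<^sub>m A) (satm p B)"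
proof (intro Set.set_eqI iffI)
  fix A assume "A \<in> satm p (coker m (\<lambda>A. x *\<^sub>m A) B)"
  then obtain u v C where u: "u \<notin> p" "v \<notin> m" "v *\<^sub>m (u *\<^sub>m A) - x *\<^sub>m C \<in> B" by (auto simp: satm_def coker_def)
  then have "1 *\<^sub>m ((v * u) *\<^sub>m A - x *\<^sub>m C) \<in> B" by simp
  then have "(v * u) *\<^sub>m A - x *\<^sub>m C \<in> satm p B" unfolding satm_def using prim_one[OF p(1)] by blast
  moreover have "v * u \<notin> p" using u p by (intro prim_mult) auto
  ultimately show "A \<in> coker p (\<lambda>A. x *\<^sub>m A) (satm p B)" by (intro cokerI)
next
  fix A assume "A \<in> coker p (\<lambda>A. x *\<^sub>m A) (satm p B)"
  then obtain u w C where u: "u \<notin> p" "w \<notin> p" "w *\<^sub>m (u *\<^sub>m A - x *\<^sub>m C) \<in> B" by (auto simp: satm_def coker_def)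
  then have "1 *\<^sub>m ((w * u) *\<^sub>m A) - x *\<^sub>m (w *\<^sub>m C) \<in> B" by (simp add: mat_simps)
  then have "(w * u) *\<^sub>m A \<in> coker m (\<lambda>A. x *\<^sub>m A) B" by (rule cokerI[OF prim_one[OF m]])
  moreover have "w * u \<notin> p" using u p by (intro prim_mult) auto
  ultimately show "A \<in> satm p (coker m (\<lambda>A. x *\<^sub>m A) B)" unfolding satm_def by blast
qed

lemma sat_adj_sat:
  assumes p: "prim p" and K: "idl K"
  shows "sat p (adj (sat p K) x) = sat p (adj K x)"
proof (intro Set.set_eqI iffI)
  fix a assume "a \<in> sat p (adj (sat p K) x)"
  then obtain u k y v where u: "u \<notin> p" "u * a = k + x * y" "v \<notin> p" "v * k \<in> K"
    by (auto simp: sat_def adj_def)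
  have "(v * u) * a = v * (k + x * y)" unfolding u(2)[symmetric] by (rule mult.assoc)
  then have "(v * u) * a = v * k + x * (v * y)" by (simp add: algebra_simps)
  then have "(v * u) * a \<in> adj K x" unfolding adj_def using u(4) by blast
  then show "a \<in> sat p (adj K x)" unfolding sat_def using prim_mult[OF p u(3,1)] by blast
next
  fix a assume "a \<in> sat p (adj K x)"
  moreover have "adj K x \<subseteq> adj (sat p K) x" using sat_superset[OF p, of K] unfolding adj_def by blast
  ultimately show "a \<in> sat p (adj (sat p K) x)" unfolding sat_def by blast
qed

text \<open>Induction on the depth \<open>i\<close> of the ring at \<open>p\<close>. An element of
  \<open>p\<close> that is regular on the ring and on the module is divided out; this lowers the
  dimension \<open>N\<close>, both depths at \<open>m\<close> and the depth at \<open>p\<close> by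
  one, so all assumptions persist for the quotients.\<close>

theorem cm_localizes:
  assumes K: "noeth K" and m: "prim m" and msat: "\<And>u a J. u \<notin> m \<Longrightarrow> idl J \<Longrightarrow> K \<subseteq> J \<Longrightarrow> u * a \<in> J \<Longrightarrow> a \<in> J"
    and Lm: "pres K m lm Lm" and p: "prim p" "p \<subseteq> m" and L: "pres K p l L"
  shows "idl K' \<Longrightarrow> K \<subseteq> K' \<Longrightarrow> K' \<subseteq> p \<Longrightarrow> psub m K B \<Longrightarrow> (\<And>A. idm n * A \<in> B \<longleftrightarrow> A \<in> B) \<Longrightarrow>
    (\<And>a A. a \<in> K' \<Longrightarrow> a *\<^sub>m A \<in> B) \<Longrightarrow> (\<And>c. \<not> pchain K' (Suc N) c) \<Longrightarrow>
    EV m lm Lm (ringm 1 K') N \<Longrightarrow> EV m lm Lm B N \<Longrightarrow> EV p l L (ringm 1 (sat p K')) i \<Longrightarrow>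
    EV p l L (satm p B) i"
proof (induction i arbitrary: K' B N)
  case 0
  then show ?case by (simp add: EV_def)
next
  case (Suc i)
  note K' = Suc.prems(1-3) and B = Suc.prems(4) and row = Suc.prems(5) and KB = Suc.prems(6)
    and dim = Suc.prems(7) and ER = Suc.prems(8) and EB = Suc.prems(9) and Ep = Suc.prems(10)
  have iK: "idl K" by (rule noeth_idl[OF K])
  have psK: "psub p K (ringm 1 (sat p K'))"
    by (rule psub_ringm[OF idl_sat[OF p(1) K'(1)]]) (use K'(2) sat_superset[OF p(1), of K'] sat_sat[OF p(1)] in blast)+
  have K'sat: "a \<in> K'" if "u \<notin> m" "u * a \<in> K'" for u a by (rule msat[OF that(1) K'(1,2) that(2)])
  have psKm: "psub m K (ringm 1 K')" by (rule psub_ringm[OF K'(1,2) K'sat])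
  have ring1: "a *\<^sub>m idm 1 \<in> ringm 1 J \<longleftrightarrow> a \<in> J" if "idl J" for a J
  proof -
    have "a \<in> J" if "a *\<^sub>m idm 1 \<in> ringm 1 J"
      using kmD[of "idm 1 * (a *\<^sub>m idm 1)" J 0 0] that by (simp add: ringm_def ent_idm)
    then show ?thesis using km_scm'[OF that] by (auto simp: ringm_def)
  qed
  have soc: "a \<in> sat p K'" if a: "\<And>y. y \<in> p \<Longrightarrow> y * a \<in> sat p K'" for a
  proof -
    have iS: "idl (sat p K')" by (rule idl_sat[OF p(1) K'(1)])
    have "a *\<^sub>m idm 1 \<in> ringm 1 (sat p K')"
    proof (rule EV_socle[OF p(1) iK L psK Ep])
      fix y assume "y \<in> p"
      then have "(y * a) *\<^sub>m idm 1 \<in> ringm 1 (sat p K')" using a ring1[OF iS] by blast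
      then show "y *\<^sub>m (a *\<^sub>m idm 1) \<in> ringm 1 (sat p K')" by simp
    qed simp
    then show ?thesis using ring1[OF iS] by simp
  qed
  \<comment> \<open>The depth of the ring at \<open>p\<close> is positive, so \<open>p\<close> is
    not minimal over \<open>K'\<close>; in particular \<open>N\<close> is not 0.\<close>
  obtain q1 where q1: "prim q1" "K' \<subseteq> q1" "q1 \<subset> p" by (rule prime_below[OF K K'(1,2) p(1) K'(3) soc])
  have "pchain K' (Suc 0) (case_nat q1 (\<lambda>_. p))"
    by (rule pchain_prepend) (use q1 p K' in \<open>auto simp: pchain_def\<close>)
  then obtain N' where N: "N = Suc N'" using dim by (cases N) auto
  \<comment> \<open>An element killed by \<open>p\<close> would have an associated prime containing
    \<open>p\<close>. By depth \<open>N\<close> at \<open>m\<close> a chain of length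
    \<open>N\<close> starts there, and \<open>q1\<close> below \<open>p\<close> prolongs it beyond
    the dimension.\<close>
  have no_ann: "\<exists>j\<in>p. j *\<^sub>m g \<notin> B'" if B': "psub m K B'" and row': "\<And>A. idm n' * A \<in> B' \<longleftrightarrow> A \<in> B'"
    and KB': "\<And>a A. a \<in> K' \<Longrightarrow> a *\<^sub>m A \<in> B'" and E': "EV m lm Lm B' N" and g: "g \<in> colm n'" "g \<notin> B'" for B' n' g
  proof (rule ccontr)
    assume "\<not> (\<exists>j\<in>p. j *\<^sub>m g \<notin> B')"
    then have pg: "p \<subseteq> {a. a *\<^sub>m g \<in> B'}" by blast
    interpret M: pmod_fg "(*\<^sub>m)" K "colm n'" B' by (rule pmod_columns[OF K B'])
    obtain z where z: "z \<in> colm n' - B'" "M.ann g \<subseteq> M.ann z" "prim (M.ann z)" using M.prime_ann[of g] g by blast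
    obtain c where c: "c 0 = M.ann z" "pchain {} N c"
      using chain_from_associated_prime[OF K m Lm B' row' E', of z] z by (auto simp: M.ann_def)
    have "K' \<subseteq> c 0" using KB' c(1) by (auto simp: M.ann_def)
    have "K' \<subseteq> c i" if "i \<le> N" for i
      using that
    proof (induction i)
      case (Suc i)
      then show ?case using c(2) unfolding pchain_def by (metis Suc_leD Suc_le_eq order.trans psubset_imp_subset)
    qed (rule \<open>K' \<subseteq> c 0\<close>)
    then have "pchain K' N c" using c(2) by (auto simp: pchain_def)
    moreover have "q1 \<subset> c 0" using q1(3) pg z(2) c(1) by (auto simp: M.ann_def)
    ultimately have "pchain K' (Suc N) (case_nat q1 c)" using pchain_prepend q1 by blast
    then show False using dim by blast
  qed
  \<comment> \<open>The direct sum of the module with the ring modulo \<open>K'\<close>, the ring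
    occupying coordinate \<open>n\<close>. Prime avoidance on this sum yields one element that is
    regular on both summands.\<close>
  define B' where "B' = {A. idm n * A \<in> B \<and> (\<forall>j. ent A n j \<in> K')}"
  have entm: "ent (A * C) n j \<in> K'" if "\<forall>j. ent A n j \<in> K'" for A C j
    unfolding times_fmat.rep_eq by (rule idl_sum[OF K'(1)]) (use that idl_mult'[OF K'(1)] in blast)
  have psB': "psub m K B'"
    unfolding psub_def
  proof (intro conjI ballI allI impI subsetI)
    show "A + C \<in> B'" if "A \<in> B'" "C \<in> B'" for A C
      using that psubD(1)[OF B] idl_add[OF K'(1)] by (auto simp: B'_def distrib_left)
    show "A * C \<in> B'" if "A \<in> B'" for A C
      using that psubD(2)[OF B, of "idm n * A" C] entm by (auto simp: B'_def mult.assoc)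
    show "A \<in> B'" if "A \<in> km K" for A
      using psubD(3)[OF B km_left[OF iK that]] kmD[OF that] K'(2) by (auto simp: B'_def)
    show "A \<in> B'" if u: "u \<notin> m" "u *\<^sub>m A \<in> B'" for u A
      using psubD(4)[OF B u(1), of "idm n * A"] K'sat[OF u(1)] u(2) by (auto simp: B'_def)
  qed
  interpret M': pmod_fg "(*\<^sub>m)" K "colm (Suc n)" B' by (rule pmod_columns[OF K psB'])
  have "\<exists>j\<in>p. \<forall>g\<in>colm (Suc n). (0 + j) *\<^sub>m g \<in> B' \<longrightarrow> g \<in> B'"
  proof (rule M'.regular_in_coset[OF prim_idl[OF p(1)]])
    fix g assume g: "g \<in> colm (Suc n) - B'"
    show "\<exists>j\<in>p. j *\<^sub>m g \<notin> B'"
    proof (cases "idm n * g \<in> B")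
      case False
      have "idm n * g \<in> colm n" using g by (auto simp: colm_def mult.assoc)
      from no_ann[OF B row KB EB this False] obtain j where "j \<in> p" "j *\<^sub>m (idm n * g) \<notin> B" by auto
      then show ?thesis by (intro bexI[of _ j]) (auto simp: B'_def)
    next
      case True
      then obtain k where k: "ent g n k \<notin> K'" using g by (auto simp: B'_def)
      have "ent g n k = ent (g * idm 1) n k" using g by (simp add: colm_def)
      then have k0: "k = 0" using k idl_zero[OF K'(1)] by (auto split: if_splits)
      let ?f = "ent g n 0 *\<^sub>m idm 1 :: 'a fmat"
      have "\<exists>j\<in>p. j *\<^sub>m ?f \<notin> ringm 1 K'"
      proof (rule no_ann[OF psKm _ _ ER])
        show "idm 1 * A \<in> ringm 1 K' \<longleftrightarrow> A \<in> ringm 1 K'" for A by (simp add: ringm_def)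
        show "a *\<^sub>m A \<in> ringm 1 K'" if "a \<in> K'" for a A using km_scm'[OF K'(1) that] by (simp add: ringm_def)
        show "?f \<in> colm 1" by (simp add: colm_def)
        show "?f \<notin> ringm 1 K'" using ring1[OF K'(1)] k k0 by simp
      qed
      then obtain j where j: "j \<in> p" "j * ent g n 0 \<notin> K'" using ring1[OF K'(1)] by auto
      then show ?thesis by (intro bexI[of _ j]) (auto simp: B'_def)
    qed
  qed
  then obtain x where x: "x \<in> p" "\<And>g. g \<in> colm (Suc n) \<Longrightarrow> x *\<^sub>m g \<in> B' \<Longrightarrow> g \<in> B'" by auto
  have xm: "x \<in> m" using x(1) p(2) by blast
  have regB: "A \<in> B" if "x *\<^sub>m A \<in> B" for A
  proof (rule psub_regular_columns[OF iK B row _ that])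
    fix g assume g: "g \<in> colm n" "x *\<^sub>m g \<in> B"
    have gn: "idm n * g = g" using g(1) by (simp add: colm_def)
    have "ent g n j = 0" for j using arg_cong[OF gn, of "\<lambda>A. ent A n j"] by simp
    then have "x *\<^sub>m g \<in> B'" using g(2) gn idl_zero[OF K'(1)] by (simp add: B'_def)
    moreover have "idm (Suc n) * (idm n * g) = idm n * g" by (rule fmat_eqI) simp
    then have "idm (Suc n) * g = g" unfolding gn .
    then have "g \<in> colm (Suc n)" using g(1) by (simp add: colm_def)
    ultimately have "g \<in> B'" using x(2) by blast
    then show "g \<in> B" using gn by (simp add: B'_def)
  qed
  have regK: "y \<in> K'" if "x * y \<in> K'" for y
  proof -
    let ?g = "y *\<^sub>m un n 0 :: 'a fmat"
    have z: "idm n * un n 0 = (0 :: 'a fmat)" by (rule fmat_eqI) (auto simp: ent_un ent_idm)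
    have "x *\<^sub>m ?g \<in> B'"
      using that idl_zero[OF K'(1)] M'.B_zero z by (auto simp: B'_def ent_un)
    moreover have "?g \<in> colm (Suc n)"
      unfolding colm_def mem_Collect_eq by (intro conjI; rule fmat_eqI) (auto simp: ent_un ent_idm)
    ultimately have "?g \<in> B'" using x(2) by blast
    then have "ent ?g n 0 \<in> K'" unfolding B'_def by blast
    then show "y \<in> K'" by (simp add: ent_un)
  qed
  let ?K = "adj K' x" and ?B = "coker m (\<lambda>A. x *\<^sub>m A) B"
  have iK1: "idl ?K" by (rule idl_adj[OF K'(1)])
  have KK1: "K \<subseteq> ?K" using K'(2) adj_superset by blast
  have sat_m: "sat m ?K = ?K"
    using sat_superset[OF m, of ?K] msat[OF _ iK1 KK1] by (auto simp: sat_def)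
  have regS: "y \<in> sat p K'" if xy: "x * y \<in> sat p K'" for y
  proof -
    obtain u where u: "u \<notin> p" "u * (x * y) \<in> K'" using xy by (auto simp: sat_def)
    then have "x * (u * y) \<in> K'" by (simp add: ac_simps)
    then show ?thesis using regK u(1) by (auto simp: sat_def)
  qed
  have regSm: "A \<in> satm p B" if xA: "x *\<^sub>m A \<in> satm p B" for A
  proof -
    obtain u where u: "u \<notin> p" "u *\<^sub>m (x *\<^sub>m A) \<in> B" using xA unfolding satm_def by blast
    then have "x *\<^sub>m (u *\<^sub>m A) \<in> B" by (simp add: ac_simps)
    then show ?thesis using regB u(1) by (auto simp: satm_def)
  qed
  have "EV p l L (satm p ?B) i"
  proof (rule Suc.IH[OF iK1 KK1, where N = N'])
    show "?K \<subseteq> p" by (rule adj_least[OF prim_idl[OF p(1)] K'(3) x(1)])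
    show "psub m K ?B" by (rule psub_coker[OF m B lin_scalar])
    show "idm n * A \<in> ?B \<longleftrightarrow> A \<in> ?B" for A by (rule coker_rows[OF B row])
    show "a *\<^sub>m A \<in> ?B" if "a \<in> ?K" for a A
    proof -
      obtain k y where ky: "a = k + x * y" "k \<in> K'" using \<open>a \<in> ?K\<close> by (auto simp: adj_def)
      have "1 *\<^sub>m (a *\<^sub>m A) - x *\<^sub>m (y *\<^sub>m A) \<in> B" using KB[OF ky(2)] by (simp add: ky(1) mat_simps)
      then show ?thesis by (rule cokerI[OF prim_one[OF m]])
    qed
    \<comment> \<open>A prime containing the regular element \<open>x\<close> strictly contains
      another prime above \<open>K'\<close>, so a chain above \<open>?K\<close> could be prolonged
      downwards.\<close>
    show "\<not> pchain ?K (Suc N') c" for c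
    proof
      assume c: "pchain ?K (Suc N') c"
      then have c0: "prim (c 0)" "?K \<subseteq> c 0" by (auto simp: pchain_def)
      have "a \<in> sat (c 0) K'" if "\<And>y. y \<in> c 0 \<Longrightarrow> y * a \<in> sat (c 0) K'" for a
      proof -
        have "x * a \<in> sat (c 0) K'" using that c0(2) adj_mem[OF K'(1)] by blast
        then obtain u where u: "u \<notin> c 0" "u * (x * a) \<in> K'" by (auto simp: sat_def)
        then have "x * (u * a) \<in> K'" by (simp add: ac_simps)
        then show ?thesis using regK u(1) by (auto simp: sat_def)
      qed
      moreover have "K' \<subseteq> c 0" using c0(2) adj_superset by blast
      ultimately obtain q where q: "prim q" "K' \<subseteq> q" "q \<subset> c 0"
        using prime_below[OF K K'(1,2) c0(1)] by metis
      have "pchain K' (Suc N') c" using c adj_superset[of K' x] unfolding pchain_def by blast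
      from pchain_prepend[OF this q] show False using dim N by blast
    qed
    show "EV m lm Lm (ringm 1 ?K) N'"
    proof -
      have "EV m lm Lm (coker m (\<lambda>A. x *\<^sub>m A) (ringm 1 K')) N'"
      proof (rule EV_coker_scalar[OF m iK Lm psKm])
        show "A \<in> ringm 1 K'" if "x *\<^sub>m A \<in> ringm 1 K'" for A by (rule ringm_scalar[OF regK that])
        show "EV m lm Lm (ringm 1 K') (Suc N')" using ER N by simp
      qed
      then show ?thesis unfolding coker_ringm[OF m K'(1)] sat_m .
    qed
    show "EV m lm Lm ?B N'"
      by (rule EV_coker_scalar[OF m iK Lm B regB]) (use EB N in simp_all)
    show "EV p l L (ringm 1 (sat p ?K)) i"
    proof -
      have "EV p l L (coker p (\<lambda>A. x *\<^sub>m A) (ringm 1 (sat p K'))) i"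
        by (rule EV_coker_scalar[OF p(1) iK L psK ringm_scalar[OF regS] Ep])
      then show ?thesis unfolding coker_ringm[OF p(1) idl_sat[OF p(1) K'(1)]] sat_adj_sat[OF p(1) K'(1)] .
    qed
  qed
  then have "EV p l L (coker p (\<lambda>A. x *\<^sub>m A) (satm p B)) i" unfolding satm_coker[OF p m] .
  with regSm show ?case by (rule EV_regular[OF p(1) iK L psub_satm[OF p(1) B] x(1)])
qed

section \<open>The theorem of Ferrand and Vasconcelos\<close>

lemma pres_lift:
  assumes K: "idl K" and L: "pres K I n D" and A: "A \<in> km I" "idm 1 * A = A"
  shows "\<exists>W. A - D 0 * W \<in> km K"
proof -
  have "\<exists>W. A * idm k - D 0 * W \<in> km K" for k
  proof (induction k)
    case 0
    have "A * idm 0 = 0" by (rule fmat_eqI) simp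
    then show ?case using km_zero[OF K] by (intro exI[of _ 0]) simp
  next
    case (Suc k)
    then obtain W where W: "A * idm k - D 0 * W \<in> km K" by blast
    obtain W' where W': "ent A 0 k *\<^sub>m idm 1 - D 0 * W' \<in> km K" using presD(4)[OF L kmD[OF A(1)]] by blast
    have "A * un k 0 = ent A 0 k *\<^sub>m un 0 0"
    proof (rule fmat_eqI)
      fix i j
      show "ent (A * un k 0) i j = ent (ent A 0 k *\<^sub>m un 0 0) i j"
        using arg_cong[OF A(2), of "\<lambda>A. ent A i k"] by (auto simp: ent_un)
    qed
    moreover have "idm 1 = (un 0 0 :: 'a fmat)" by (rule fmat_eqI) (auto simp: ent_idm ent_un)
    moreover have "A * idm (Suc k) = A * idm k + A * un k 0 * un 0 k"
      by (rule fmat_eqI) (auto simp: less_Suc_eq)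
    ultimately have "A * idm (Suc k) - D 0 * (W + W' * un 0 k) = (A * idm k - D 0 * W) + (ent A 0 k *\<^sub>m idm 1 - D 0 * W') * un 0 k"
      by (simp add: mat_simps)
    also have "\<dots> \<in> km K" by (rule km_add[OF K W km_right[OF K W']])
    finally show ?case by blast
  qed
  moreover obtain N where "\<And>i j. N \<le> i \<or> N \<le> j \<Longrightarrow> ent A i j = 0" using ent_bound by blast
  then have "A * idm N = A" by (intro fmat_eqI) auto
  ultimately show ?thesis by metis
qed

lemma sum_Suc_shift: "(\<Sum>i<Suc e. f i) = f 0 + (\<Sum>i<e. f (Suc i) :: 'a::comm_monoid_add)"
  by (rule sum.lessThan_Suc_shift)

text \<open>That relations among the \<open>x i\<close> modulo \<open>K\<close> have coefficients in
  \<open>I\<close> is the linear independence of their classes in the conormal module, since an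
  element of the square of \<open>I\<close> is itself a combination of the \<open>x i\<close> with
  coefficients in \<open>I\<close>. In the induction \<open>K\<close> grows by a regular element
  that replaces one generator.\<close>

theorem ferrand_vasconcelos:
  fixes I :: "'a::comm_ring_1 set" and e :: nat
  assumes m: "prim m" and I: "idl I" "I \<subseteq> m"
  shows "noeth K \<Longrightarrow> K \<subseteq> I \<Longrightarrow> (\<And>u. u \<notin> m \<Longrightarrow> \<exists>v. v * u - 1 \<in> K) \<Longrightarrow> (\<And>i. i < e \<Longrightarrow> x i \<in> I) \<Longrightarrow>
    (\<And>y. y \<in> I \<Longrightarrow> \<exists>c. y - (\<Sum>i<e. c i * x i) \<in> K) \<Longrightarrow>
    (\<And>c i. (\<Sum>i<e. c i * x i) \<in> K \<Longrightarrow> i < e \<Longrightarrow> c i \<in> I) \<Longrightarrow>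
    pres K I n D \<Longrightarrow> vreg m K (D N) \<Longrightarrow>
    \<exists>ys. rsq m K ys \<and> rsid m K ys = I"
proof (induction e arbitrary: K x n D N)
  case 0
  have "I \<subseteq> K"
  proof
    fix y assume "y \<in> I"
    then obtain c where "y - (\<Sum>i<0. c i * x i) \<in> K" using "0.prems"(5) by blast
    then show "y \<in> K" by simp
  qed
  then have "rsq m K [] \<and> rsid m K [] = I" using "0.prems"(2) by auto
  then show ?case by blast
next
  case (Suc e)
  note K = Suc.prems(1) and KI = Suc.prems(2) and local = Suc.prems(3) and xI = Suc.prems(4)
    and gen = Suc.prems(5) and basis = Suc.prems(6) and D = Suc.prems(7) and N = Suc.prems(8)
  have iK: "idl K" by (rule noeth_idl[OF K])
  note C = presD(1)[OF D]
  have im: "idl m" by (rule prim_idl[OF m])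
  \<comment> \<open>An element killed by \<open>I\<close> with prime annihilator means depth 0 at
    this prime, so already \<open>D 0\<close> splits there. Its quasi-inverse yields
    \<open>c\<close> in \<open>I\<close> and \<open>u\<close> outside the prime such that
    \<open>c - u\<close> kills \<open>I\<close>. Independence applied to the generator
    \<open>x 0\<close> puts \<open>c - u\<close>, and with it \<open>u\<close>, into
    \<open>I\<close>, which is contained in the prime.\<close>
  have faithful: False if s: "s \<notin> K" "prim {a. a * s \<in> K}" "I \<subseteq> {a. a * s \<in> K}" for s
  proof -
    let ?p = "{a. a * s \<in> K}"
    have Kp: "K \<subseteq> ?p" using idl_mult'[OF iK] by blast
    have "?p \<subseteq> m" by (rule ideal_below_local[OF local prim_idl[OF s(2)] Kp prim_one[OF s(2)]])
    then have "vreg ?p K (D N)" using N unfolding vreg_def by blast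
    moreover have "s \<notin> sat ?p K" by (auto simp: sat_def)
    moreover have "s * a \<in> sat ?p K" if "a \<in> ?p" for a
      using that sat_superset[OF s(2), of K] by (auto simp: mult.commute)
    ultimately have "vreg ?p K (D 0)"
      using auslander_buchsbaum[OF s(2) iK C, of "[]" s N 0] by simp
    then obtain t u where u: "u \<notin> ?p" and t: "D 0 * t * D 0 - u *\<^sub>m D 0 \<in> km K" by (auto simp: vreg_def)
    define c where "c = ent (D 0 * t) 0 0"
    have D1: "idm 1 * D 0 = D 0" using cpxD(1)[OF C, of 0] presD(2)[OF D] by simp
    have "D 0 * t \<in> km I" by (rule km_right[OF I(1) presD(3)[OF D]])
    then have cI: "c \<in> I" unfolding c_def by (rule kmD)
    have conj: "idm 1 * (D 0 * t) * idm 1 = c *\<^sub>m idm 1" unfolding c_def by (rule fmat_eqI) (auto simp: ent_idm)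
    have D2: "idm 1 * (D 0 * Z) = D 0 * Z" for Z using D1 by (metis mult.assoc)
    have "D 0 * t * D 0 = idm 1 * (D 0 * t) * idm 1 * D 0" using D1 D2 by (simp add: mult.assoc)
    also have "\<dots> = c *\<^sub>m D 0" unfolding conj using D1 by simp
    finally have uc: "(c - u) *\<^sub>m D 0 \<in> km K" using t by (simp add: mat_simps)
    obtain W where W: "x 0 *\<^sub>m idm 1 - D 0 * W \<in> km K" using presD(4)[OF D xI[of 0]] by auto
    have "(c - u) *\<^sub>m (x 0 *\<^sub>m idm 1 - D 0 * W) + ((c - u) *\<^sub>m D 0) * W \<in> km K"
      by (rule km_add[OF iK km_scm[OF iK W] km_right[OF iK uc]])
    then have "((c - u) * x 0) *\<^sub>m idm 1 \<in> km K" by (simp add: mat_simps)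
    from kmD[OF this, of 0 0] have cu: "(c - u) * x 0 \<in> K" by (simp add: ent_idm)
    have "(\<Sum>i<Suc e. (if i = 0 then c - u else 0) * x i) = (c - u) * x 0"
      unfolding sum_Suc_shift by simp
    then have "c - u \<in> I" using basis[of "\<lambda>i. if i = 0 then c - u else 0" 0] cu by simp
    from idl_diff[OF I(1) cI this] have "u \<in> I" by simp
    then show False using u s(3) by blast
  qed
  \<comment> \<open>The product of \<open>m\<close> with \<open>I\<close>, plus \<open>K\<close>.
    Changing \<open>x 0\<close> by an element of \<open>J\<close> leaves it a possible member of a
    minimal set of generators.\<close>
  define J where "J = {a. \<exists>c. (\<forall>i<Suc e. c i \<in> m) \<and> a - (\<Sum>i<Suc e. c i * x i) \<in> K}"
  have iJ: "idl J" unfolding J_def using idl_span[OF iK im, of "{..<Suc e}" x] by (simp only: Ball_def lessThan_iff)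
  have mIJ: "a * y \<in> J" if a: "a \<in> m" "y \<in> I" for a y
  proof -
    obtain c where c: "y - (\<Sum>i<Suc e. c i * x i) \<in> K" using gen[OF a(2)] by blast
    have "a * y - (\<Sum>i<Suc e. (a * c i) * x i) = a * (y - (\<Sum>i<Suc e. c i * x i))"
      by (simp add: right_diff_distrib sum_distrib_left mult.assoc distrib_left)
    then have "a * y - (\<Sum>i<Suc e. (a * c i) * x i) \<in> K" using idl_mult[OF iK c, of a] by (simp only:)
    moreover have "\<forall>i<Suc e. a * c i \<in> m" using idl_mult'[OF im a(1)] by blast
    ultimately show ?thesis unfolding J_def by (intro CollectI exI[of _ "\<lambda>i. a * c i"] conjI)
  qed
  interpret R: pmod_fg "(*)" K UNIV K by (rule pmod_ring[OF K iK order.refl])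
  \<comment> \<open>If \<open>J\<close> killed a nonzero element, an associated prime would contain
    the product of \<open>m\<close> and \<open>I\<close>, hence \<open>m\<close> or
    \<open>I\<close>, hence \<open>I\<close> in both cases; this is excluded by
    \<open>faithful\<close>.\<close>
  have "\<exists>j\<in>J. \<forall>g\<in>UNIV. (x 0 + j) * g \<in> K \<longrightarrow> g \<in> K"
  proof (rule R.regular_in_coset[OF iJ])
    fix g assume g: "g \<in> UNIV - K"
    show "\<exists>j\<in>J. j * g \<notin> K"
    proof (rule ccontr)
      assume neg: "\<not> (\<exists>j\<in>J. j * g \<notin> K)"
      obtain s where s: "s \<notin> K" "R.ann g \<subseteq> R.ann s" "prim (R.ann s)" using R.prime_ann[OF g] by blast
      have "J \<subseteq> R.ann g" using neg by (auto simp: R.ann_def)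
      then have Js: "J \<subseteq> R.ann s" using s(2) by blast
      have "I \<subseteq> R.ann s"
      proof (rule ccontr)
        assume "\<not> I \<subseteq> R.ann s"
        then obtain y where y: "y \<in> I" "y \<notin> R.ann s" by blast
        have "m \<subseteq> R.ann s"
        proof
          fix a assume "a \<in> m"
          then have "a * y \<in> R.ann s" using mIJ[of a y] y(1) Js by blast
          then show "a \<in> R.ann s" using prim_mult[OF s(3), of a y] y(2) by blast
        qed
        then show False using y I(2) by blast
      qed
      then show False using faithful[OF s(1)] s(3) unfolding R.ann_def by blast
    qed
  qed
  then obtain j where j: "j \<in> J" "\<And>g. (x 0 + j) * g \<in> K \<Longrightarrow> g \<in> K" by blast
  define x' where "x' = x 0 + j"
  have reg: "g \<in> K" if "x' * g \<in> K" for g using j(2) that unfolding x'_def .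
  obtain \<mu> where \<mu>: "\<And>i. i < Suc e \<Longrightarrow> \<mu> i \<in> m" "j - (\<Sum>i<Suc e. \<mu> i * x i) \<in> K" using j(1) unfolding J_def by blast
  have x': "x' - ((1 + \<mu> 0) * x 0 + (\<Sum>i<e. \<mu> (Suc i) * x (Suc i))) \<in> K"
    using \<mu>(2) unfolding sum_Suc_shift by (simp add: x'_def algebra_simps)
  have "1 + \<mu> 0 \<notin> m" using idl_diff[OF im, of "1 + \<mu> 0" "\<mu> 0"] \<mu>(1)[of 0] prim_one[OF m] by auto
  then obtain v where v: "v * (1 + \<mu> 0) - 1 \<in> K" using local by blast
  have x'I: "x' \<in> I"
  proof -
    have "(1 + \<mu> 0) * x 0 + (\<Sum>i<e. \<mu> (Suc i) * x (Suc i)) \<in> I"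
      using xI by (intro idl_add[OF I(1)] idl_mult[OF I(1)] idl_sum[OF I(1)]) auto
    then show ?thesis using idl_add[OF I(1) subsetD[OF KI x']] by fastforce
  qed
  \<comment> \<open>The independence of the old generators carries over to \<open>x'\<close> and the
    remaining ones, since the coefficient \<open>1 + \<mu> 0\<close> of \<open>x 0\<close> in
    \<open>x'\<close> is invertible.\<close>
  have basis': "b \<in> I \<and> (\<forall>i<e. c i \<in> I)" if rel: "b * x' + (\<Sum>i<e. c i * x (Suc i)) \<in> K" for b c
  proof -
    define d where "d i = (case i of 0 \<Rightarrow> b * (1 + \<mu> 0) | Suc i \<Rightarrow> c i + b * \<mu> (Suc i))" for i
    have "(\<Sum>i<Suc e. d i * x i) = b * x' + (\<Sum>i<e. c i * x (Suc i)) - b * (x' - ((1 + \<mu> 0) * x 0 + (\<Sum>i<e. \<mu> (Suc i) * x (Suc i))))"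
      unfolding sum_Suc_shift by (simp add: d_def algebra_simps sum.distrib sum_distrib_left)
    then have "(\<Sum>i<Suc e. d i * x i) \<in> K" using idl_diff[OF iK rel idl_mult[OF iK x', of b]] by (simp only:)
    then have d: "d i \<in> I" if "i < Suc e" for i using basis that by blast
    have "v * d 0 - b * (v * (1 + \<mu> 0) - 1) = b" by (simp add: d_def algebra_simps)
    then have b: "b \<in> I" using idl_diff[OF I(1) idl_mult[OF I(1) d[of 0], of v] idl_mult[OF I(1) subsetD[OF KI v], of b]] by simp
    have "c i \<in> I" if "i < e" for i
    proof -
      have "c i = d (Suc i) - b * \<mu> (Suc i)" by (simp add: d_def)
      then show ?thesis using idl_diff[OF I(1) d[of "Suc i"] idl_mult'[OF I(1) b]] that by simp
    qed
    then show ?thesis using b by blast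
  qed
  let ?K = "adj K x'"
  have iK1: "idl ?K" by (rule idl_adj[OF iK])
  have KK1: "K \<subseteq> ?K" by (rule adj_superset)
  have K1: "noeth ?K" by (rule noeth_mono[OF K iK1 KK1])
  have K1I: "?K \<subseteq> I" by (rule adj_least[OF I(1) KI x'I])
  have local1: "\<exists>v. v * u - 1 \<in> ?K" if "u \<notin> m" for u using local[OF that] KK1 by blast
  have sat1: "sat m ?K = ?K" by (rule sat_local[OF m local1 iK1 subset_refl])
  have gen': "\<exists>c. y - (\<Sum>i<e. c i * x (Suc i)) \<in> ?K" if y: "y \<in> I" for y
  proof -
    obtain c where c: "y - (\<Sum>i<Suc e. c i * x i) \<in> K" using gen[OF y] by blast
    define d where "d i = c (Suc i) - c 0 * v * \<mu> (Suc i)" for i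
    let ?s = "\<Sum>i<e. \<mu> (Suc i) * x (Suc i)" and ?t = "\<Sum>i<e. c (Suc i) * x (Suc i)"
    have ds: "(\<Sum>i<e. d i * x (Suc i)) = ?t - c 0 * v * ?s"
      by (simp add: d_def left_diff_distrib sum_subtractf sum_distrib_left mult.assoc)
    have "y - (\<Sum>i<e. d i * x (Suc i)) - x' * (c 0 * v)
       = (y - (c 0 * x 0 + ?t)) - c 0 * x 0 * (v * (1 + \<mu> 0) - 1) - c 0 * v * (x' - ((1 + \<mu> 0) * x 0 + ?s))"
      unfolding ds by (simp add: algebra_simps)
    also have "\<dots> \<in> K"
      using c unfolding sum_Suc_shift
      by (intro idl_diff[OF iK idl_diff[OF iK _ idl_mult[OF iK v]] idl_mult[OF iK x']])
    finally have "y - (\<Sum>i<e. d i * x (Suc i)) - x' * (c 0 * v) \<in> K" .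
    moreover have "y - (\<Sum>i<e. d i * x (Suc i)) = (y - (\<Sum>i<e. d i * x (Suc i)) - x' * (c 0 * v)) + x' * (c 0 * v)" by simp
    ultimately have "y - (\<Sum>i<e. d i * x (Suc i)) \<in> ?K" unfolding adj_def by blast
    then show ?thesis by blast
  qed
  define R0 where "R0 = mk 1 e (\<lambda>_ i. x (Suc i))"
  have R0: "idm 1 * R0 = R0" "R0 * idm e = R0" by (rule fmat_eqI, simp add: R0_def)+
  obtain n' D' where C': "cpx ?K n' D'" and D'0: "D' 0 = R0" "n' 0 = 1" "n' (Suc 0) = e"
    using cpx_exists[OF K1 R0] by metis
  have entR0: "ent (R0 * W) 0 k = (\<Sum>i<e. ent W i k * x (Suc i))" for W k
    by (subst ent_times_bound[of e]) (auto simp: R0_def mult.commute)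
  have D': "pres ?K I n' D'"
    unfolding pres_def
  proof (intro conjI ballI)
    show "D' 0 \<in> km I" unfolding D'0 R0_def using xI idl_zero[OF I(1)] by (intro kmI) auto
    fix y assume "y \<in> I"
    then obtain c where c: "y - (\<Sum>i<e. c i * x (Suc i)) \<in> ?K" using gen' by blast
    have E: "ent (R0 * mk e 1 (\<lambda>i _. c i)) i k = (if i = 0 \<and> k = 0 then (\<Sum>i<e. c i * x (Suc i)) else 0)" for i k
      by (subst ent_times_bound[of e]) (auto simp: R0_def mult.commute)
    have "ent (y *\<^sub>m idm 1 - D' 0 * mk e 1 (\<lambda>i _. c i)) i k = (if i = 0 \<and> k = 0 then y - (\<Sum>i<e. c i * x (Suc i)) else 0)" for i k
      unfolding D'0 ent_minus E by (auto simp: ent_idm)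
    then have "y *\<^sub>m idm 1 - D' 0 * mk e 1 (\<lambda>i _. c i) \<in> km ?K" using c idl_zero[OF iK1] by (intro kmI) simp
    then show "\<exists>W. y *\<^sub>m idm 1 - D' 0 * W \<in> km ?K" by blast
  qed (use C' D'0 in auto)
  \<comment> \<open>Reduction modulo the regular element \<open>x'\<close> keeps the resolution of
    \<open>I\<close> exact, so its reduction resolves the quotient of \<open>I\<close> by
    \<open>x'\<close> times \<open>I\<close>.\<close>
  have exD: "\<exists>W. V - D (Suc (Suc i)) * W \<in> km ?K" if V: "idm (n (Suc (Suc i))) * V = V" "D (Suc i) * V \<in> km ?K" for i V
  proof -
    have satK: "sat m K = K" by (rule sat_local[OF m local iK subset_refl])
    have "pexact m (rsid m K [x']) n D (Suc i)"
    proof (rule pexact_rsq[OF m iK C iK order.refl, where d = 0])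
      show "a \<in> K" if "u \<notin> m" "u * a \<in> K" for u a using that satK by (auto simp: sat_def)
      show "rsq m K [x']" using reg x'I I(2) by auto
      show "pexact m K n D i" for i using cpx_pexact[OF m iK C, of i] satK by simp
    qed simp
    then have "pexact m ?K n D (Suc i)" by (simp add: sat1)
    then obtain u W where u: "u \<notin> m" "u *\<^sub>m V - D (Suc (Suc i)) * W \<in> km ?K" using V unfolding pexact_def by blast
    obtain v where v: "v * u - 1 \<in> ?K" using local1[OF u(1)] by blast
    have "V - D (Suc (Suc i)) * (v *\<^sub>m W) = v *\<^sub>m (u *\<^sub>m V - D (Suc (Suc i)) * W) - (v * u - 1) *\<^sub>m V"
      by (simp add: mat_simps)
    also have "\<dots> \<in> km ?K" by (rule km_diff[OF iK1 km_scm[OF iK1 u(2)] km_scm'[OF iK1 v]])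
    finally show ?thesis by blast
  qed
  have Q: "cpx ?K (\<lambda>i. n (Suc i)) (\<lambda>i. D (Suc i))"
    unfolding cpx_def
  proof (intro allI conjI impI)
    show "D (Suc i) * D (Suc (Suc i)) \<in> km ?K" for i using cpxD(3)[OF C] km_mono[OF KK1] by blast
  qed (use cpxD(1,2)[OF C] exD in auto)
  have F: "cpx ?K (\<lambda>i. n' (Suc i)) (\<lambda>i. D' (Suc i))" using cpx_shift[OF C', of 1] by simp
  \<comment> \<open>\<open>a0\<close> lifts the projection from \<open>I\<close> modulo
    \<open>x'\<close> times \<open>I\<close> onto \<open>I\<close> modulo \<open>x'\<close>, and
    \<open>b0\<close> lifts a section of it that sends the class of each remaining generator to its
    own class.\<close>
  obtain b00 where b00: "D' 0 - D 0 * b00 \<in> km K"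
    using pres_lift[OF iK D presD(3)[OF D']] R0(1) D'0 by auto
  define b0 where "b0 = idm (n (Suc 0)) * b00"
  have b0: "D' 0 - D 0 * b0 \<in> km K" using b00 cpxD(2)[OF C, of 0] by (simp add: b0_def flip: mult.assoc)
  have "idm 1 * D 0 = D 0" using cpxD(1)[OF C, of 0] presD(2)[OF D] by simp
  then obtain a00 where a00: "D 0 - D' 0 * a00 \<in> km ?K"
    using pres_lift[OF iK1 D' presD(3)[OF D]] by auto
  define a0 where "a0 = idm (n' (Suc 0)) * a00"
  have a0: "D 0 - D' 0 * a0 \<in> km ?K" using a00 cpxD(2)[OF C', of 0] by (simp add: a0_def flip: mult.assoc)
  have b0': "D' 0 - D 0 * b0 \<in> km ?K" using b0 km_mono[OF KK1] by blast
  have "D' 0 * (a0 * D (Suc 0)) = D 0 * D (Suc 0) - (D 0 - D' 0 * a0) * D (Suc 0)" by (simp add: mat_simps)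
  also have "\<dots> \<in> km ?K"
    using cpxD(3)[OF C, of 0] km_mono[OF KK1] by (intro km_diff[OF iK1 _ km_right[OF iK1 a0]]) blast
  finally obtain a1 where a1: "a0 * D (Suc 0) - D' (Suc 0) * a1 \<in> km ?K"
    using cpxD(4)[OF C', of 0 "a0 * D (Suc 0)"] by (auto simp: a0_def mult.assoc)
  let ?E = "idm (n' (Suc 0)) :: 'a fmat"
  have D'E: "D' 0 * ?E = D' 0" by (rule cpxD(2)[OF C'])
  have "D' 0 * (a0 * b0 - ?E) = - (D' 0 - D 0 * b0) - (D 0 - D' 0 * a0) * b0" by (simp add: mat_simps D'E)
  also have "\<dots> \<in> km ?K" by (rule km_diff[OF iK1 km_minus[OF iK1 b0'] km_right[OF iK1 a0]])
  finally obtain h0 where h0: "a0 * b0 - ?E - D' (Suc 0) * h0 \<in> km ?K"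
    using cpxD(4)[OF C', of 0 "a0 * b0 - ?E"] by (auto simp: a0_def mat_simps)
  \<comment> \<open>The section has to respect relations. A relation of the remaining generators
    modulo \<open>x'\<close> equals \<open>x'\<close> times some \<open>Y\<close>. By
    \<open>basis'\<close> the entries of \<open>Y\<close> lie in \<open>I\<close>, so the product
    vanishes modulo \<open>x'\<close> times \<open>I\<close>.\<close>
  obtain Y0 where Y0: "D' 0 * D' (Suc 0) - x' *\<^sub>m Y0 \<in> km K" using km_adj[OF iK cpxD(3)[OF C', of 0]] by blast
  define Y where "Y = idm 1 * Y0"
  have "idm 1 * (D' 0 * D' (Suc 0) - x' *\<^sub>m Y0) \<in> km K" by (rule km_left[OF iK Y0])
  then have Y: "D' 0 * D' (Suc 0) - x' *\<^sub>m Y \<in> km K"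
    using R0(1) D'0(1) by (simp add: Y_def right_diff_distrib flip: mult.assoc)
  have "Y \<in> km I"
  proof (rule kmI)
    fix i k
    have "- ent Y 0 k \<in> I"
    proof -
      have "- ent Y 0 k * x' + (\<Sum>i<e. ent (D' (Suc 0)) i k * x (Suc i)) \<in> K"
        using kmD[OF Y, of 0 k] unfolding D'0(1) by (simp add: entR0 algebra_simps)
      from basis'[OF this] show ?thesis by (rule conjunct1)
    qed
    then have "ent Y 0 k \<in> I" using idl_minus[OF I(1), of "- ent Y 0 k"] by simp
    then show "ent Y i k \<in> I" using idl_zero[OF I(1)] unfolding Y_def by auto
  qed
  moreover have "idm 1 * Y = Y" unfolding Y_def by (rule idm_idem_left)
  ultimately obtain C0 where C0: "Y - D 0 * C0 \<in> km K" using pres_lift[OF iK D] by blast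
  let ?C = "idm (n (Suc 0)) * C0"
  have DC: "D 0 * ?C = D 0 * C0" using cpxD(2)[OF C, of 0] by (simp flip: mult.assoc)
  have "D 0 * (b0 * D' (Suc 0) - x' *\<^sub>m ?C) = (D' 0 * D' (Suc 0) - x' *\<^sub>m Y) + x' *\<^sub>m (Y - D 0 * C0) - (D' 0 - D 0 * b0) * D' (Suc 0)"
    by (simp add: mat_simps DC)
  also have "\<dots> \<in> km K" by (rule km_diff[OF iK km_add[OF iK Y km_scm[OF iK C0]] km_right[OF iK b0]])
  finally have "D 0 * (b0 * D' (Suc 0) - x' *\<^sub>m ?C) \<in> km K" .
  moreover have "idm (n (Suc 0)) * (b0 * D' (Suc 0) - x' *\<^sub>m ?C) = b0 * D' (Suc 0) - x' *\<^sub>m ?C"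
    by (simp add: b0_def mat_simps)
  ultimately obtain b1 where b1: "b0 * D' (Suc 0) - x' *\<^sub>m ?C - D (Suc 0) * b1 \<in> km K"
    using cpxD(4)[OF C, of 0] by blast
  have "b0 * D' (Suc 0) - D (Suc 0) * b1 = (b0 * D' (Suc 0) - x' *\<^sub>m ?C - D (Suc 0) * b1) + x' *\<^sub>m ?C" by simp
  also have "\<dots> \<in> km ?K"
    using b1 km_mono[OF KK1] by (intro km_add[OF iK1 _ km_scm'[OF iK1 adj_mem[OF iK]]]) blast
  finally have b1': "b0 * D' (Suc 0) - D (Suc 0) * b1 \<in> km ?K" .
  have "vreg m K (D (Suc N))" by (rule vreg_up[OF m iK C N]) simp
  then have "vreg m ?K (D (Suc N))" using km_mono[OF KK1] unfolding vreg_def by blast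
  from comparison_vreg[OF iK1 cpx_pcx[OF iK1 Q] cpx_pcx[OF iK1 F] a1 b1' h0 this]
  have "vreg m ?K (D' (Suc N))" .
  have "\<exists>ys. rsq m ?K ys \<and> rsid m ?K ys = I"
  proof (rule Suc.IH[OF K1 K1I local1])
    show "x (Suc i) \<in> I" if "i < e" for i using xI that by simp
    show "\<exists>c. y - (\<Sum>i<e. c i * x (Suc i)) \<in> ?K" if "y \<in> I" for y by (rule gen'[OF that])
    show "c i \<in> I" if c: "(\<Sum>i<e. c i * x (Suc i)) \<in> ?K" and i: "i < e" for c i
    proof -
      obtain k b where kb: "(\<Sum>i<e. c i * x (Suc i)) = k + x' * b" "k \<in> K" using c unfolding adj_def by blast
      then have "(- b) * x' + (\<Sum>i<e. c i * x (Suc i)) \<in> K" by (simp add: mult.commute)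
      from basis'[OF this] i show ?thesis by blast
    qed
    show "pres ?K I n' D'" by (rule D')
    show "vreg m ?K (D' (Suc N))" by fact
  qed
  then obtain ys where ys: "rsq m ?K ys" "rsid m ?K ys = I" by blast
  have "rsq m K (x' # ys)" "rsid m K (x' # ys) = I"
    using ys reg x'I I(2) by (auto simp: sat1)
  then show ?case by blast
qed

section \<open>Records of rings and modules presented by a type-class ring\<close>

text \<open>Statements about the record are pulled back along \<open>\<rho>\<close> to the
  type-class ring, with the kernel \<open>kr\<close> in the role of \<open>K\<close>.\<close>

locale rpres = cring A for A :: "('r, 'x) ring_scheme" (structure) +
  fixes \<rho> :: "'p::comm_ring_1 \<Rightarrow> 'r"
  assumes \<rho>_closed [simp]: "\<rho> a \<in> carrier A"
    and \<rho>_add: "\<rho> (a + b) = \<rho> a \<oplus> \<rho> b"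
    and \<rho>_mult: "\<rho> (a * b) = \<rho> a \<otimes> \<rho> b"
    and \<rho>_one: "\<rho> 1 = \<one>"
    and \<rho>_surj: "x \<in> carrier A \<Longrightarrow> \<exists>a. \<rho> a = x"
begin

definition kr :: "'p set" where "kr = {a. \<rho> a = \<zero>}"

lemma \<rho>_zero: "\<rho> 0 = \<zero>"
  using \<rho>_add[of 0 0] by (metis \<rho>_closed add.inv_solve_right add_0 r_neg a_minus_def add.r_cancel_one')

lemma \<rho>_minus: "\<rho> (- a) = \<ominus> \<rho> a"
  using \<rho>_add[of "- a" a] \<rho>_zero by (metis \<rho>_closed add.left_inverse minus_equality)

lemma \<rho>_diff: "\<rho> (a - b) = \<rho> a \<ominus> \<rho> b"
  using \<rho>_add[of a "- b"] by (simp add: \<rho>_minus a_minus_def)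

lemma \<rho>_eq_iff: "\<rho> a = \<rho> b \<longleftrightarrow> a - b \<in> kr"
proof -
  have "a - b \<in> kr \<longleftrightarrow> \<rho> a \<ominus> \<rho> b = \<zero>" by (simp add: kr_def \<rho>_diff)
  also have "\<dots> \<longleftrightarrow> \<rho> a = \<rho> b"
    by (metis \<rho>_closed a_minus_def minus_equality r_neg r_neg2 a_inv_closed minus_minus)
  finally show ?thesis by simp
qed

lemma idl_kr: "idl kr"
  unfolding idl_def kr_def by (auto simp: \<rho>_zero \<rho>_add \<rho>_mult)

end

section \<open>Matrices acting on coefficient vectors\<close>

definition mv :: "nat \<Rightarrow> 'p::comm_ring_1 fmat \<Rightarrow> (nat \<Rightarrow> 'p) \<Rightarrow> (nat \<Rightarrow> 'p)" where
  "mv n A v = (\<lambda>i. \<Sum>j<n. ent A i j * v j)"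

lemma mult_idm_bound: "A * idm n = A \<Longrightarrow> n \<le> j \<Longrightarrow> ent A i j = 0"
  by (metis ent_mult_idm not_less)
lemma idm_mult_bound: "idm n * A = A \<Longrightarrow> n \<le> i \<Longrightarrow> ent A i j = 0"
  by (metis ent_idm_mult not_less)

lemma mv_mult: "A * idm n = A \<Longrightarrow> mv k (A * B) v = mv n A (mv k B v)"
proof
  fix i assume A: "A * idm n = A"
  have "mv k (A * B) v i = (\<Sum>l<k. (\<Sum>j<n. ent A i j * ent B j l) * v l)"
    unfolding mv_def by (intro sum.cong refl arg_cong2[where f = "(*)"] ent_times_bound mult_idm_bound[OF A])
  also have "\<dots> = (\<Sum>j<n. ent A i j * (\<Sum>l<k. ent B j l * v l))"
    unfolding sum_distrib_left sum_distrib_right by (subst sum.swap) (simp add: mult.assoc)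
  finally show "mv k (A * B) v i = mv n A (mv k B v) i" by (simp add: mv_def)
qed

lemma mv_col: "A * idm n = A \<Longrightarrow> mv n A (\<lambda>i. ent B i c) = (\<lambda>i. ent (A * B) i c)"
  unfolding mv_def by (intro ext ent_times_bound[symmetric] mult_idm_bound)

lemma mv_add: "mv n A (\<lambda>i. v i + w i) = (\<lambda>i. mv n A v i + mv n A w i)"
  by (simp add: mv_def distrib_left sum.distrib)
lemma mv_diff: "mv n A (\<lambda>i. v i - w i) = (\<lambda>i. mv n A v i - mv n A w i)"
  by (simp add: mv_def right_diff_distrib sum_subtractf)
lemma mv_scale: "mv n A (\<lambda>i. a * v i) = (\<lambda>i. a * mv n A v i)"
  by (simp add: mv_def sum_distrib_left mult.left_commute)
lemma mv_fdiff: "mv n (A - B) v = (\<lambda>i. mv n A v i - mv n B v i)"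
  by (simp add: mv_def left_diff_distrib sum_subtractf)
lemma mv_cong: "(\<And>j. j < n \<Longrightarrow> v j = w j) \<Longrightarrow> mv n A v = mv n A w"
  by (simp add: mv_def)
lemma mv_idl: "idl K \<Longrightarrow> (\<And>j. j < n \<Longrightarrow> v j \<in> K) \<Longrightarrow> mv n A v i \<in> K"
  unfolding mv_def by (rule idl_sum) (auto intro: idl_mult)
lemma mv_km: "idl K \<Longrightarrow> A \<in> km K \<Longrightarrow> mv n A v i \<in> K"
  unfolding mv_def by (rule idl_sum) (auto intro: idl_mult' kmD)
lemma mv_idm: "i < n \<Longrightarrow> mv n (idm n) v i = v i"
proof -
  assume i: "i < n"
  have "mv n (idm n) v i = (\<Sum>j<n. if j = i then v j else 0)"
    unfolding mv_def by (rule sum.cong) (auto simp: ent_idm i)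
  then show ?thesis using i by simp
qed

lemma km_by_vectors:
  assumes K: "idl K" and A: "A * idm n = A" and "\<And>v i. mv n A v i \<in> K"
  shows "A \<in> km K"
proof (rule kmI)
  fix i c
  have "mv n A (\<lambda>i. ent (idm n) i c) i \<in> K" by (rule assms(3))
  then show "ent A i c \<in> K" unfolding mv_col[OF A] A .
qed

text \<open>The solutions for the basis vectors are the columns of \<open>W\<close>.\<close>

lemma factor_by_vectors:
  assumes K: "idl K" and A: "A * idm n = A" and B: "B * idm k = B"
    and ex: "\<And>v. \<exists>w. \<forall>i. mv n A v i - mv k B w i \<in> K"
  shows "\<exists>W. A - B * W \<in> km K"
proof -
  have "\<forall>c. \<exists>w. \<forall>i. mv n A (\<lambda>i. ent (idm n) i c) i - mv k B w i \<in> K" using ex by blast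
  then obtain w where w: "\<And>c i. mv n A (\<lambda>i. ent (idm n) i c) i - mv k B (w c) i \<in> K" by metis
  have "A - B * mk k n (\<lambda>i c. w c i) \<in> km K"
  proof (rule kmI)
    fix i c
    show "ent (A - B * mk k n (\<lambda>i c. w c i)) i c \<in> K"
    proof (cases "c < n")
      case True
      have "mv k B (w c) = mv k B (\<lambda>j. ent (mk k n (\<lambda>i c. w c i)) j c)" by (rule mv_cong) (simp add: True)
      then have "mv k B (w c) i = ent (B * mk k n (\<lambda>i c. w c i)) i c" unfolding mv_col[OF B] by simp
      then show ?thesis using w[of c i] unfolding mv_col[OF A] A by simp
    next
      case False
      have "ent (B * mk k n (\<lambda>i c. w c i)) i c = 0"
        by (subst ent_times_bound[of k]) (use False mult_idm_bound[OF B] in auto)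
      then show ?thesis using mult_idm_bound[OF A, of c i] False idl_zero[OF K] by simp
    qed
  qed
  then show ?thesis by blast
qed

text \<open>\<open>X\<close> is generated by \<open>n\<close> elements; \<open>\<theta>\<close> sends a coefficient vector to the combination of them.\<close>

definition (in rpres) prsn :: "('r, 'm) module \<Rightarrow> nat \<Rightarrow> ((nat \<Rightarrow> 'p) \<Rightarrow> 'm) \<Rightarrow> bool" where
  "prsn X n \<theta> \<longleftrightarrow> (\<forall>v. \<theta> v \<in> carrier X) \<and> (\<forall>v w. \<theta> (\<lambda>i. v i + w i) = \<theta> v \<oplus>\<^bsub>X\<^esub> \<theta> w) \<and>
     (\<forall>a v. \<theta> (\<lambda>i. a * v i) = \<rho> a \<odot>\<^bsub>X\<^esub> \<theta> v) \<and> (\<forall>v w. (\<forall>i<n. v i = w i) \<longrightarrow> \<theta> v = \<theta> w) \<and>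
     \<theta> (\<lambda>_. 0) = \<zero>\<^bsub>X\<^esub> \<and> (\<forall>x\<in>carrier X. \<exists>v. \<theta> v = x)"

text \<open>Homomorphisms without the extensionality built into \<open>module_hom\<close>, so that
  plain functions such as the identity qualify.\<close>

definition hom_like :: "('r, 's) ring_scheme \<Rightarrow> ('r, 'm) module \<Rightarrow> ('r, 'n) module \<Rightarrow> ('m \<Rightarrow> 'n) \<Rightarrow> bool" where
  "hom_like R M N f \<longleftrightarrow> (\<forall>x\<in>carrier M. f x \<in> carrier N) \<and>
     (\<forall>x\<in>carrier M. \<forall>y\<in>carrier M. f (x \<oplus>\<^bsub>M\<^esub> y) = f x \<oplus>\<^bsub>N\<^esub> f y) \<and>
     (\<forall>a\<in>carrier R. \<forall>x\<in>carrier M. f (a \<odot>\<^bsub>M\<^esub> x) = a \<odot>\<^bsub>N\<^esub> f x)"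

lemma module_hom_hom_like: "f \<in> module_hom R M N \<Longrightarrow> hom_like R M N f"
  unfolding module_hom_def hom_like_def by (auto simp: PiE_def)

lemma hom_likeD:
  assumes "hom_like R M N f" "x \<in> carrier M"
  shows "f x \<in> carrier N" "y \<in> carrier M \<Longrightarrow> f (x \<oplus>\<^bsub>M\<^esub> y) = f x \<oplus>\<^bsub>N\<^esub> f y"
    "a \<in> carrier R \<Longrightarrow> f (a \<odot>\<^bsub>M\<^esub> x) = a \<odot>\<^bsub>N\<^esub> f x"
  using assms unfolding hom_like_def by auto

context rpres
begin

lemma prsnD:
  assumes "prsn X n \<theta>"
  shows "\<theta> v \<in> carrier X" "\<theta> (\<lambda>i. v i + w i) = \<theta> v \<oplus>\<^bsub>X\<^esub> \<theta> w" "\<theta> (\<lambda>i. a * v i) = \<rho> a \<odot>\<^bsub>X\<^esub> \<theta> v"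
    "(\<And>i. i < n \<Longrightarrow> v i = w i) \<Longrightarrow> \<theta> v = \<theta> w" "\<theta> (\<lambda>_. 0) = \<zero>\<^bsub>X\<^esub>" "x \<in> carrier X \<Longrightarrow> \<exists>v. \<theta> v = x"
  using assms unfolding prsn_def by blast+

lemma prsn_eq_iff:
  assumes X: "prsn X n \<theta>"
  shows "\<theta> v = \<theta> w \<longleftrightarrow> \<theta> (\<lambda>i. v i - w i) = \<zero>\<^bsub>X\<^esub>"
proof
  assume e: "\<theta> v = \<theta> w"
  have "\<theta> (\<lambda>i. v i - w i) = \<theta> (\<lambda>i. v i + (- 1) * w i)" by simp
  also have "\<dots> = \<theta> v \<oplus>\<^bsub>X\<^esub> \<rho> (- 1) \<odot>\<^bsub>X\<^esub> \<theta> w" by (simp only: prsnD(2)[OF X] prsnD(3)[OF X])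
  also have "\<dots> = \<theta> (\<lambda>i. v i + (- 1) * v i)" by (simp only: e[symmetric] prsnD(2)[OF X] prsnD(3)[OF X])
  also have "\<dots> = \<zero>\<^bsub>X\<^esub>" using prsnD(5)[OF X] by simp
  finally show "\<theta> (\<lambda>i. v i - w i) = \<zero>\<^bsub>X\<^esub>" .
next
  assume e: "\<theta> (\<lambda>i. v i - w i) = \<zero>\<^bsub>X\<^esub>"
  have "\<theta> v = \<theta> (\<lambda>i. (v i - w i) + w i)" by simp
  also have "\<dots> = \<theta> (\<lambda>_. 0) \<oplus>\<^bsub>X\<^esub> \<theta> w" by (simp only: prsnD(2)[OF X] e prsnD(5)[OF X])
  also have "\<dots> = \<theta> (\<lambda>i. 0 + w i)" by (simp only: prsnD(2)[OF X])
  finally show "\<theta> v = \<theta> w" by simp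
qed

text \<open>All module laws hold for coefficient vectors and are carried over by the surjection
  \<open>\<theta>\<close>.\<close>

lemma prsn_module:
  assumes X: "prsn X n \<theta>"
  shows "module A X"
proof -
  note th = prsnD(1)[OF X] and op = prsnD(2)[OF X, symmetric] prsnD(3)[OF X, symmetric] prsnD(5)[OF X, symmetric]
  have rep: P if "x \<in> carrier X" "\<And>v. x = \<theta> v \<Longrightarrow> P" for x P using prsnD(6)[OF X that(1)] that(2) by blast
  have repA: P if "x \<in> carrier A" "\<And>a. x = \<rho> a \<Longrightarrow> P" for x P using \<rho>_surj[OF that(1)] that(2) by blast
  show ?thesis
  proof (rule moduleI[OF is_cring abelian_groupI])
    fix x assume "x \<in> carrier X"
    then obtain v where v: "x = \<theta> v" by (rule rep)
    have "\<theta> (\<lambda>i. - v i) \<oplus>\<^bsub>X\<^esub> x = \<zero>\<^bsub>X\<^esub>" by (simp add: v op)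
    then show "\<exists>y\<in>carrier X. y \<oplus>\<^bsub>X\<^esub> x = \<zero>\<^bsub>X\<^esub>" using th by blast
  qed ((elim rep repA)?, simp add: th op algebra_simps flip: \<rho>_add \<rho>_mult \<rho>_one)+
qed

lemma prsn_hom_zero:
  assumes X: "prsn X n \<theta>" and Y: "prsn Y k \<psi>" and f: "hom_like A X Y f"
  shows "f \<zero>\<^bsub>X\<^esub> = \<zero>\<^bsub>Y\<^esub>"
proof -
  obtain u where u: "\<psi> u = f (\<theta> (\<lambda>_. 0))" using prsnD(6)[OF Y hom_likeD(1)[OF f prsnD(1)[OF X]]] by blast
  have "f \<zero>\<^bsub>X\<^esub> = f (\<theta> (\<lambda>i. 0 * 0))" using prsnD(5)[OF X] by simp
  also have "\<dots> = \<rho> 0 \<odot>\<^bsub>Y\<^esub> \<psi> u"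
    unfolding prsnD(3)[OF X] u by (rule hom_likeD(3)[OF f prsnD(1)[OF X] \<rho>_closed])
  also have "\<dots> = \<psi> (\<lambda>i. 0 * u i)" by (simp only: prsnD(3)[OF Y])
  also have "\<dots> = \<zero>\<^bsub>Y\<^esub>" using prsnD(5)[OF Y] by simp
  finally show ?thesis .
qed

lemma prsn_comp:
  assumes X: "prsn X n \<theta>" and f: "hom_like A X Y f" "f ` carrier X = carrier Y" "f \<zero>\<^bsub>X\<^esub> = \<zero>\<^bsub>Y\<^esub>"
  shows "prsn Y n (\<lambda>v. f (\<theta> v))"
  unfolding prsn_def
proof (intro conjI allI impI ballI)
  show "f (\<theta> v) \<in> carrier Y" for v by (rule hom_likeD(1)[OF f(1) prsnD(1)[OF X]])
  show "f (\<theta> (\<lambda>i. v i + w i)) = f (\<theta> v) \<oplus>\<^bsub>Y\<^esub> f (\<theta> w)" for v w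
    unfolding prsnD(2)[OF X] by (rule hom_likeD(2)[OF f(1) prsnD(1)[OF X] prsnD(1)[OF X]])
  show "f (\<theta> (\<lambda>i. a * v i)) = \<rho> a \<odot>\<^bsub>Y\<^esub> f (\<theta> v)" for a v
    unfolding prsnD(3)[OF X] by (rule hom_likeD(3)[OF f(1) prsnD(1)[OF X] \<rho>_closed])
  show "f (\<theta> v) = f (\<theta> w)" if "\<forall>i<n. v i = w i" for v w
    using prsnD(4)[OF X, of v w] that by simp
  show "f (\<theta> (\<lambda>_. 0)) = \<zero>\<^bsub>Y\<^esub>" unfolding prsnD(5)[OF X] by (rule f(3))
  fix y assume "y \<in> carrier Y"
  then have "y \<in> f ` carrier X" using f(2) by simp
  then obtain x where x: "x \<in> carrier X" "f x = y" by auto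
  obtain v where "\<theta> v = x" using prsnD(6)[OF X x(1)] ..
  then show "\<exists>v. f (\<theta> v) = y" using x(2) by auto
qed

text \<open>The columns of \<open>M\<close> are coordinates of the images of the generators;
  additivity is applied along partial sums of the coefficient vector.\<close>

lemma prsn_lift:
  assumes X: "prsn X n \<theta>" and Y: "prsn Y k \<psi>" and f: "hom_like A X Y f"
  obtains M where "idm k * M = M" "M * idm n = M" "\<And>v. f (\<theta> v) = \<psi> (mv n M v)"
proof -
  define \<delta> where "\<delta> j = (\<lambda>i. if i = j then 1 else 0 :: 'p)" for j :: nat
  have "\<exists>w. \<psi> w = f (\<theta> (\<delta> j))" for j by (rule prsnD(6)[OF Y hom_likeD(1)[OF f prsnD(1)[OF X]]])
  then obtain w where w: "\<And>j. \<psi> (w j) = f (\<theta> (\<delta> j))" by metis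
  define M where "M = mk k n (\<lambda>i j. w j i)"
  have "f (\<theta> (\<lambda>i. if i < l then v i else 0)) = \<psi> (\<lambda>i. \<Sum>j<l. w j i * v j)" for l v
  proof (induction l)
    case 0
    then show ?case using prsnD(5)[OF X] prsnD(5)[OF Y] prsn_hom_zero[OF X Y f] by simp
  next
    case (Suc l)
    have "(\<lambda>i. if i < Suc l then v i else 0) = (\<lambda>i. (if i < l then v i else 0) + v l * \<delta> l i)"
      by (rule ext) (auto simp: \<delta>_def less_Suc_eq)
    then have "f (\<theta> (\<lambda>i. if i < Suc l then v i else 0)) = f (\<theta> (\<lambda>i. if i < l then v i else 0) \<oplus>\<^bsub>X\<^esub> \<rho> (v l) \<odot>\<^bsub>X\<^esub> \<theta> (\<delta> l))"
      by (simp only: prsnD(2)[OF X] prsnD(3)[OF X])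
    also have "\<dots> = f (\<theta> (\<lambda>i. if i < l then v i else 0)) \<oplus>\<^bsub>Y\<^esub> f (\<theta> (\<lambda>i. v l * \<delta> l i))"
      unfolding prsnD(3)[OF X, symmetric] by (rule hom_likeD(2)[OF f prsnD(1)[OF X] prsnD(1)[OF X]])
    also have "f (\<theta> (\<lambda>i. v l * \<delta> l i)) = \<rho> (v l) \<odot>\<^bsub>Y\<^esub> f (\<theta> (\<delta> l))"
      unfolding prsnD(3)[OF X] by (rule hom_likeD(3)[OF f prsnD(1)[OF X] \<rho>_closed])
    also have "f (\<theta> (\<lambda>i. if i < l then v i else 0)) \<oplus>\<^bsub>Y\<^esub> \<rho> (v l) \<odot>\<^bsub>Y\<^esub> f (\<theta> (\<delta> l))
       = \<psi> (\<lambda>i. (\<Sum>j<l. w j i * v j) + v l * w l i)"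
      unfolding Suc.IH w[symmetric] by (simp only: prsnD(2)[OF Y] prsnD(3)[OF Y])
    finally show ?case by (simp add: mult.commute)
  qed
  note sums = this
  have "f (\<theta> v) = \<psi> (mv n M v)" for v
  proof -
    have "\<theta> v = \<theta> (\<lambda>i. if i < n then v i else 0)" by (rule prsnD(4)[OF X]) simp
    then have "f (\<theta> v) = \<psi> (\<lambda>i. \<Sum>j<n. w j i * v j)" using sums by simp
    also have "\<dots> = \<psi> (mv n M v)" by (rule prsnD(4)[OF Y]) (simp add: mv_def M_def)
    finally show ?thesis .
  qed
  moreover have "idm k * M = M" "M * idm n = M" by (rule fmat_eqI, simp add: M_def)+
  ultimately show ?thesis using that by blast
qed

definition fvec :: "nat \<Rightarrow> (nat \<Rightarrow> 'p) \<Rightarrow> (nat \<Rightarrow> 'r)" where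
  "fvec n v = (\<lambda>i. if i < n then \<rho> (v i) else \<zero>)"

lemma prsn_free: "prsn (free_module A n) n (fvec n)"
  unfolding prsn_def
proof (intro conjI allI impI ballI)
  fix x assume x: "x \<in> carrier (free_module A n)"
  then have "\<forall>i. \<exists>a. i < n \<longrightarrow> \<rho> a = x i" using \<rho>_surj by (auto simp: free_module_def)
  then obtain v where "\<And>i. i < n \<Longrightarrow> \<rho> (v i) = x i" by metis
  then have "fvec n v = x" using x by (auto simp: fvec_def free_module_def fun_eq_iff)
  then show "\<exists>v. fvec n v = x" by blast
qed (auto simp: fvec_def free_module_def \<rho>_add \<rho>_mult \<rho>_zero fun_eq_iff)

lemma prsn_ring: "prsn (ring_as_module A) 1 (\<lambda>v. \<rho> (v 0))"
  unfolding prsn_def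
proof (intro conjI allI impI ballI)
  fix x assume "x \<in> carrier (ring_as_module A)"
  then obtain a where "\<rho> a = x" using \<rho>_surj by (auto simp: ring_as_module_def)
  then show "\<exists>v. \<rho> (v 0) = x" by (intro exI[of _ "\<lambda>_. a"])
qed (auto simp: ring_as_module_def \<rho>_add \<rho>_mult \<rho>_zero)

lemma fvec_zero_iff: "fvec n v = \<zero>\<^bsub>free_module A n\<^esub> \<longleftrightarrow> (\<forall>i<n. v i \<in> kr)"
  by (auto simp: fvec_def free_module_def fun_eq_iff kr_def)

text \<open>Projective modules correspond to idempotent matrices.\<close>

lemma projective_presentation:
  assumes P: "fg_projective A P"
  obtains n \<theta> E where "prsn P n \<theta>" "idm n * E = E" "E * idm n = E" "\<And>v. \<theta> (mv n E v) = \<theta> v"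
    "\<And>v. \<theta> v = \<zero>\<^bsub>P\<^esub> \<longleftrightarrow> (\<forall>i. mv n E v i \<in> kr)"
proof -
  obtain n s p where s: "s \<in> module_hom A P (free_module A n)" and p: "p \<in> module_hom A (free_module A n) P"
    and ps: "\<And>x. x \<in> carrier P \<Longrightarrow> p (s x) = x" and mP: "module A P"
    using P unfolding fg_projective_def by blast
  note s' = module_hom_hom_like[OF s] and p' = module_hom_hom_like[OF p]
  let ?F = "free_module A n"
  interpret mP: module A P by (rule mP)
  have z: "\<zero>\<^bsub>?F\<^esub> \<in> carrier ?F" using prsnD(1,5)[OF prsn_free] by metis
  have z2: "\<zero>\<^bsub>?F\<^esub> = \<zero> \<odot>\<^bsub>?F\<^esub> \<zero>\<^bsub>?F\<^esub>" by (auto simp: free_module_def)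
  have p0: "p \<zero>\<^bsub>?F\<^esub> = \<zero>\<^bsub>P\<^esub>"
    by (subst z2, subst hom_likeD(3)[OF p' z]) (use hom_likeD(1)[OF p' z] in auto)
  have img: "p ` carrier ?F = carrier P"
    using hom_likeD(1)[OF p'] hom_likeD(1)[OF s'] ps by (metis image_subset_iff subsetI subset_antisym image_eqI)
  define \<theta> where "\<theta> v = p (fvec n v)" for v
  have \<theta>: "prsn P n \<theta>" unfolding \<theta>_def
    using prsn_free p' img p0 by (rule prsn_comp[where X = ?F])
  obtain E where E: "idm n * E = E" "E * idm n = E" "\<And>v. s (\<theta> v) = fvec n (mv n E v)"
    using prsn_lift[OF \<theta> prsn_free s'] by metis
  have \<theta>E: "\<theta> (mv n E v) = \<theta> v" for v
  proof -
    have "\<theta> (mv n E v) = p (s (\<theta> v))" unfolding E(3) by (simp add: \<theta>_def)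
    then show ?thesis using ps[OF prsnD(1)[OF \<theta>]] by simp
  qed
  have s0: "s \<zero>\<^bsub>P\<^esub> = \<zero>\<^bsub>?F\<^esub>" by (rule prsn_hom_zero[OF \<theta> prsn_free s'])
  have ker: "\<theta> v = \<zero>\<^bsub>P\<^esub> \<longleftrightarrow> (\<forall>i. mv n E v i \<in> kr)" for v
  proof -
    have "\<theta> v = \<zero>\<^bsub>P\<^esub> \<longleftrightarrow> fvec n (mv n E v) = \<zero>\<^bsub>?F\<^esub>"
      using E(3)[of v] s0 \<theta>E[of v] p0 unfolding \<theta>_def by metis
    also have "\<dots> \<longleftrightarrow> (\<forall>i<n. mv n E v i \<in> kr)" by (rule fvec_zero_iff)
    also have "\<dots> \<longleftrightarrow> (\<forall>i. mv n E v i \<in> kr)"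
    proof -
      have "mv n E v i = 0" if "\<not> i < n" for i using idm_mult_bound[OF E(1)] that by (simp add: mv_def)
      then show ?thesis using idl_zero[OF idl_kr] by metis
    qed
    finally show ?thesis .
  qed
  show ?thesis by (rule that[OF \<theta> E(1,2) \<theta>E ker])
qed

end

lemma proj_resolutionD:
  assumes "proj_resolution R M (P, d, e)"
  shows "fg_projective R (P i)" "d i \<in> module_hom R (P (Suc i)) (P i)" "e \<in> module_hom R (P 0) M"
    "e ` carrier (P 0) = carrier M" "x \<in> carrier (P 0) \<Longrightarrow> e x = \<zero>\<^bsub>M\<^esub> \<longleftrightarrow> x \<in> d 0 ` carrier (P 1)"
    "x \<in> carrier (P (Suc i)) \<Longrightarrow> d i x = \<zero>\<^bsub>P i\<^esub> \<longleftrightarrow> x \<in> d (Suc i) ` carrier (P (Suc (Suc i)))"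
  using assms by auto

context rpres
begin

lemma resolution_matrices:
  assumes R: "proj_resolution A X (P, d, e)"
  obtains n \<theta> E D where "\<And>i. prsn (P i) (n i) (\<theta> i)" "\<And>i. idm (n i) * E i = E i" "\<And>i. E i * idm (n i) = E i"
    "\<And>i v. \<theta> i (mv (n i) (E i) v) = \<theta> i v" "\<And>i v. \<theta> i v = \<zero>\<^bsub>P i\<^esub> \<longleftrightarrow> (\<forall>j. mv (n i) (E i) v j \<in> kr)"
    "\<And>i v. d i (\<theta> (Suc i) v) = \<theta> i (mv (n (Suc i)) (D i) v)" "pcx kr E D"
    "\<And>i. idm (n i) * D i = D i" "\<And>i. D i * idm (n (Suc i)) = D i"
proof -
  have "\<forall>i. \<exists>n \<theta> E. prsn (P i) n \<theta> \<and> idm n * E = E \<and> E * idm n = E \<and> (\<forall>v. \<theta> (mv n E v) = \<theta> v) \<and>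
    (\<forall>v. \<theta> v = \<zero>\<^bsub>P i\<^esub> \<longleftrightarrow> (\<forall>j. mv n E v j \<in> kr))"
  proof
    fix i
    from projective_presentation[OF proj_resolutionD(1)[OF R, of i]] show "\<exists>n \<theta> E. prsn (P i) n \<theta> \<and> idm n * E = E \<and> E * idm n = E \<and> (\<forall>v. \<theta> (mv n E v) = \<theta> v) \<and>
      (\<forall>v. \<theta> v = \<zero>\<^bsub>P i\<^esub> \<longleftrightarrow> (\<forall>j. mv n E v j \<in> kr))" by metis
  qed
  then obtain n \<theta> E where \<theta>: "\<And>i. prsn (P i) (n i) (\<theta> i)" and E: "\<And>i. idm (n i) * E i = E i" "\<And>i. E i * idm (n i) = E i"
    and \<theta>E: "\<And>i v. \<theta> i (mv (n i) (E i) v) = \<theta> i v"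
    and ker: "\<And>i v. \<theta> i v = \<zero>\<^bsub>P i\<^esub> \<longleftrightarrow> (\<forall>j. mv (n i) (E i) v j \<in> kr)" by metis
  have hd: "hom_like A (P (Suc i)) (P i) (d i)" for i by (rule module_hom_hom_like[OF proj_resolutionD(2)[OF R]])
  have "\<forall>i. \<exists>D. idm (n i) * D = D \<and> D * idm (n (Suc i)) = D \<and> (\<forall>v. d i (\<theta> (Suc i) v) = \<theta> i (mv (n (Suc i)) D v))"
    using prsn_lift[OF \<theta> \<theta> hd] by metis
  then obtain D' where D': "\<And>i. idm (n i) * D' i = D' i" "\<And>i. D' i * idm (n (Suc i)) = D' i"
    "\<And>i v. d i (\<theta> (Suc i) v) = \<theta> i (mv (n (Suc i)) (D' i) v)" by metis
  \<comment> \<open>The lifted maps are cut with the idempotents on both sides. This does not change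
    the maps they represent, and it makes them compatible with the idempotents modulo
    \<open>kr\<close>.\<close>
  define D where "D i = E i * D' i * E (Suc i)" for i
  have Dr: "idm (n i) * D i = D i" "D i * idm (n (Suc i)) = D i" for i
    by (simp_all add: D_def mult.assoc E) (simp add: E flip: mult.assoc)
  have dD: "d i (\<theta> (Suc i) v) = \<theta> i (mv (n (Suc i)) (D i) v)" for i v
  proof -
    have "mv (n (Suc i)) (D i) v = mv (n i) (E i) (mv (n (Suc i)) (D' i) (mv (n (Suc i)) (E (Suc i)) v))"
      unfolding D_def mult.assoc by (simp only: mv_mult[OF E(2)] mv_mult[OF D'(2)])
    then show ?thesis using \<theta>E D'(3) by metis
  qed
  have E0: "(\<forall>j. mv (n i) (E i) v j \<in> kr)" if "\<theta> i v = \<zero>\<^bsub>P i\<^esub>" for i v using ker that by blast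
  have d0: "d i \<zero>\<^bsub>P (Suc i)\<^esub> = \<zero>\<^bsub>P i\<^esub>" for i by (rule prsn_hom_zero[OF \<theta> \<theta> hd])
  have EE: "E i * E i - E i \<in> km kr" for i
  proof (rule km_by_vectors[OF idl_kr])
    show "(E i * E i - E i) * idm (n i) = E i * E i - E i" by (simp add: left_diff_distrib mult.assoc E)
    fix v j
    have "\<theta> i (mv (n i) (E i) v) = \<theta> i v" by (rule \<theta>E)
    then have "\<theta> i (\<lambda>j. mv (n i) (E i) v j - v j) = \<zero>\<^bsub>P i\<^esub>" using prsn_eq_iff[OF \<theta>] by blast
    then have "mv (n i) (E i) (\<lambda>j. mv (n i) (E i) v j - v j) j \<in> kr" using E0 by blast
    then show "mv (n i) (E i * E i - E i) v j \<in> kr" unfolding mv_diff mv_fdiff mv_mult[OF E(2)] .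
  qed
  have ED: "E i * D i - D i \<in> km kr" for i
  proof -
    have "E i * D i - D i = (E i * E i - E i) * (D' i * E (Suc i))" by (simp add: D_def mat_simps)
    then show ?thesis using km_right[OF idl_kr EE] by simp
  qed
  have DE: "D i * E (Suc i) - D i \<in> km kr" for i
  proof -
    have "D i * E (Suc i) - D i = (E i * D' i) * (E (Suc i) * E (Suc i) - E (Suc i))" by (simp add: D_def mat_simps)
    then show ?thesis using km_left[OF idl_kr EE] by simp
  qed
  have DD: "D i * D (Suc i) \<in> km kr" for i
  proof -
    have "E i * (D i * D (Suc i)) \<in> km kr"
    proof (rule km_by_vectors[OF idl_kr])
      show "E i * (D i * D (Suc i)) * idm (n (Suc (Suc i))) = E i * (D i * D (Suc i))" by (simp add: mult.assoc Dr)
      fix v j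
      have "d (Suc i) (\<theta> (Suc (Suc i)) v) \<in> d (Suc i) ` carrier (P (Suc (Suc i)))" using prsnD(1)[OF \<theta>] by blast
      then have "d i (d (Suc i) (\<theta> (Suc (Suc i)) v)) = \<zero>\<^bsub>P i\<^esub>"
        using proj_resolutionD(6)[OF R] hom_likeD(1)[OF hd prsnD(1)[OF \<theta>]] by blast
      then have "\<theta> i (mv (n (Suc i)) (D i) (mv (n (Suc (Suc i))) (D (Suc i)) v)) = \<zero>\<^bsub>P i\<^esub>" by (simp add: dD)
      then show "mv (n (Suc (Suc i))) (E i * (D i * D (Suc i))) v j \<in> kr"
        using E0 by (simp add: mv_mult[OF E(2)] mv_mult[OF Dr(2)])
    qed
    moreover have "D i * D (Suc i) = E i * (D i * D (Suc i)) - (E i * D i - D i) * D (Suc i)" by (simp add: mat_simps)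
    ultimately show ?thesis using km_diff[OF idl_kr _ km_right[OF idl_kr ED]] by metis
  qed
  have "pcx kr E D"
    unfolding pcx_def
  proof (intro allI conjI impI EE ED DE DD)
    fix i V assume V: "E (Suc i) * V - V \<in> km kr" "D i * V \<in> km kr"
    let ?n = "n (Suc i)" and ?k = "n (Suc (Suc i))"
    obtain N where N: "\<And>i j. N \<le> i \<or> N \<le> j \<Longrightarrow> ent V i j = 0" using ent_bound by blast
    have VN: "V * idm N = V" by (rule fmat_eqI) (auto simp: N)
    have "\<exists>W. E (Suc i) * V - D (Suc i) * W \<in> km kr"
    proof (rule factor_by_vectors[OF idl_kr _ Dr(2)])
      show "E (Suc i) * V * idm N = E (Suc i) * V" by (simp add: mult.assoc VN)
      fix v
      define w where "w = mv N V v"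
      have "mv ?n (D i) w = mv N (D i * V) v" unfolding w_def by (rule mv_mult[OF Dr(2), symmetric])
      then have a: "mv ?n (D i) w j \<in> kr" for j using mv_km[OF idl_kr V(2)] by simp
      have "mv (n i) (E i) (mv ?n (D i) w) j \<in> kr" for j by (rule mv_idl[OF idl_kr], rule a)
      then have "\<theta> i (mv ?n (D i) w) = \<zero>\<^bsub>P i\<^esub>" using ker by blast
      then have "d i (\<theta> (Suc i) w) = \<zero>\<^bsub>P i\<^esub>" by (simp add: dD)
      then obtain y where y: "y \<in> carrier (P (Suc (Suc i)))" "\<theta> (Suc i) w = d (Suc i) y"
        using proj_resolutionD(6)[OF R prsnD(1)[OF \<theta>]] by blast
      obtain z where "\<theta> (Suc (Suc i)) z = y" using prsnD(6)[OF \<theta> y(1)] by blast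
      then have "\<theta> (Suc i) w = \<theta> (Suc i) (mv ?k (D (Suc i)) z)" using y(2) dD by metis
      then have "\<theta> (Suc i) (\<lambda>j. w j - mv ?k (D (Suc i)) z j) = \<zero>\<^bsub>P (Suc i)\<^esub>" using prsn_eq_iff[OF \<theta>] by blast
      then have "mv ?n (E (Suc i)) (\<lambda>j. w j - mv ?k (D (Suc i)) z j) j \<in> kr" for j using E0 by blast
      then have 1: "mv ?n (E (Suc i)) w j - mv ?k (E (Suc i) * D (Suc i)) z j \<in> kr" for j
        unfolding mv_diff mv_mult[OF E(2)] .
      have 2: "mv ?k (E (Suc i) * D (Suc i) - D (Suc i)) z j \<in> kr" for j by (rule mv_km[OF idl_kr ED])
      have "mv ?n (E (Suc i)) w j - mv ?k (D (Suc i)) z j \<in> kr" for j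
        using idl_add[OF idl_kr 1[of j] 2[of j]] unfolding mv_fdiff by simp
      then have "mv N (E (Suc i) * V) v j - mv ?k (D (Suc i)) z j \<in> kr" for j
        unfolding mv_mult[OF E(2)] w_def .
      then show "\<exists>z. \<forall>j. mv N (E (Suc i) * V) v j - mv ?k (D (Suc i)) z j \<in> kr" by blast
    qed
    then obtain W where W: "E (Suc i) * V - D (Suc i) * W \<in> km kr" by blast
    have "V - D (Suc i) * W = (E (Suc i) * V - D (Suc i) * W) - (E (Suc i) * V - V)" by simp
    then show "\<exists>W. V - D (Suc i) * W \<in> km kr" using km_diff[OF idl_kr W V(1)] by metis
  qed
  from that[OF \<theta> E \<theta>E ker dD this Dr] show ?thesis .
qed

text \<open>A free resolution in matrix form together with an augmentation. Vectors are restricted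
  to the first \<open>n 0\<close> coordinates because \<open>F 0\<close> has no rows beyond
  them.\<close>

definition resolves :: "(nat \<Rightarrow> nat) \<Rightarrow> (nat \<Rightarrow> 'p fmat) \<Rightarrow> ('r, 'm) module \<Rightarrow> ((nat \<Rightarrow> 'p) \<Rightarrow> 'm) \<Rightarrow> bool" where
  "resolves n F X \<psi> \<longleftrightarrow> cpx kr n F \<and> prsn X (n 0) \<psi> \<and>
     (\<forall>v. (\<forall>i\<ge>n 0. v i = 0) \<longrightarrow> (\<psi> v = \<zero>\<^bsub>X\<^esub> \<longleftrightarrow> (\<exists>w. \<forall>i. v i - mv (n 1) (F 0) w i \<in> kr)))"

lemma resolvesD:
  assumes "resolves n F X \<psi>"
  shows "cpx kr n F" "prsn X (n 0) \<psi>"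
    "(\<And>i. n 0 \<le> i \<Longrightarrow> v i = 0) \<Longrightarrow> \<psi> v = \<zero>\<^bsub>X\<^esub> \<longleftrightarrow> (\<exists>w. \<forall>i. v i - mv (n 1) (F 0) w i \<in> kr)"
  using assms unfolding resolves_def by auto

text \<open>The identity of \<open>X\<close> lifts in both directions between the given projective
  resolution and the free one. This supplies the initial data for the comparison lemmas.\<close>

lemma comparison_matrices:
  assumes R: "proj_resolution A X (P, d, e)" and F: "resolves n F X \<psi>"
  obtains k \<theta> E D a0 a1 b0 b1 h0 where "\<forall>i. prsn (P i) (k i) (\<theta> i)"
    "\<forall>i v. \<theta> i v = \<zero>\<^bsub>P i\<^esub> \<longleftrightarrow> (\<forall>j. mv (k i) (E i) v j \<in> kr)"
    "\<forall>i v. d i (\<theta> (Suc i) v) = \<theta> i (mv (k (Suc i)) (D i) v)" "pcx kr E D"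
    "\<forall>i. idm (k i) * E i = E i" "\<forall>i. E i * idm (k i) = E i"
    "\<forall>i. idm (k i) * D i = D i" "\<forall>i. D i * idm (k (Suc i)) = D i"
    "a0 * D 0 - F 0 * a1 \<in> km kr" "b0 * F 0 - D 0 * b1 \<in> km kr" "a0 * b0 - idm (n 0) - F 0 * h0 \<in> km kr"
proof -
  obtain k \<theta> E D where \<theta>: "\<And>i. prsn (P i) (k i) (\<theta> i)" and E: "\<And>i. idm (k i) * E i = E i" "\<And>i. E i * idm (k i) = E i"
    and \<theta>E: "\<And>i v. \<theta> i (mv (k i) (E i) v) = \<theta> i v"
    and ker: "\<And>i v. \<theta> i v = \<zero>\<^bsub>P i\<^esub> \<longleftrightarrow> (\<forall>j. mv (k i) (E i) v j \<in> kr)"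
    and dD: "\<And>i v. d i (\<theta> (Suc i) v) = \<theta> i (mv (k (Suc i)) (D i) v)" and pc: "pcx kr E D"
    and D: "\<And>i. idm (k i) * D i = D i" "\<And>i. D i * idm (k (Suc i)) = D i"
    using resolution_matrices[OF R] by metis
  note C = resolvesD(1)[OF F] and \<psi> = resolvesD(2)[OF F] and kF = resolvesD(3)[OF F]
  have he: "hom_like A (P 0) X e" by (rule module_hom_hom_like[OF proj_resolutionD(3)[OF R]])
  have e0: "e \<zero>\<^bsub>P 0\<^esub> = \<zero>\<^bsub>X\<^esub>" by (rule prsn_hom_zero[OF \<theta> \<psi> he])
  define \<eta> where "\<eta> v = e (\<theta> 0 v)" for v
  have \<eta>: "prsn X (k 0) \<eta>" unfolding \<eta>_def
    using \<theta>[of 0] he proj_resolutionD(4)[OF R] e0 by (rule prsn_comp[where X = "P 0"])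
  have idX: "hom_like A X X (\<lambda>x. x)" by (simp add: hom_like_def)
  obtain a0 where a0: "idm (n 0) * a0 = a0" "a0 * idm (k 0) = a0" "\<And>v. \<eta> v = \<psi> (mv (k 0) a0 v)"
    using prsn_lift[OF \<eta> \<psi> idX] by metis
  obtain b where b: "idm (k 0) * b = b" "b * idm (n 0) = b" "\<And>v. \<psi> v = \<eta> (mv (n 0) b v)"
    using prsn_lift[OF \<psi> \<eta> idX] by metis
  define b0 where "b0 = E 0 * b"
  have b0: "b0 * idm (n 0) = b0" by (simp add: b0_def mult.assoc b)
  have b0v: "\<psi> v = \<eta> (mv (n 0) b0 v)" for v
    unfolding b0_def mv_mult[OF E(2)] \<eta>_def \<theta>E using b(3) by (simp add: \<eta>_def)
  have rows: "mv l M v i = 0" if "idm (n 0) * M = M" "n 0 \<le> i" for M l v i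
    using idm_mult_bound[OF that] by (simp add: mv_def)
  have F0: "idm (n 0) * F 0 = F 0" "F 0 * idm (n 1) = F 0" using cpxD(1,2)[OF C, of 0] by auto
  have "\<exists>W. a0 * D 0 - F 0 * W \<in> km kr"
  proof (rule factor_by_vectors[OF idl_kr _ F0(2)])
    show "a0 * D 0 * idm (k 1) = a0 * D 0" using D(2)[of 0] by (simp add: mult.assoc)
    fix v
    have "e (d 0 (\<theta> 1 v)) = \<zero>\<^bsub>X\<^esub>"
      using proj_resolutionD(5)[OF R, of "d 0 (\<theta> 1 v)"] prsnD(1)[OF \<theta>[of 1]]
        hom_likeD(1)[OF module_hom_hom_like[OF proj_resolutionD(2)[OF R, of 0]]] by auto
    then have "\<eta> (mv (k 1) (D 0) v) = \<zero>\<^bsub>X\<^esub>" using dD[of 0 v] by (simp add: \<eta>_def)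
    then have "\<psi> (mv (k 1) (a0 * D 0) v) = \<zero>\<^bsub>X\<^esub>" unfolding a0(3) mv_mult[OF a0(2)] .
    moreover have "idm (n 0) * (a0 * D 0) = a0 * D 0" using a0(1) by (metis mult.assoc)
    ultimately show "\<exists>w. \<forall>i. mv (k 1) (a0 * D 0) v i - mv (n 1) (F 0) w i \<in> kr"
      using kF[of "mv (k 1) (a0 * D 0) v"] rows by blast
  qed
  then obtain a1 where a1: "a0 * D 0 - F 0 * a1 \<in> km kr" by blast
  have "\<exists>W. b0 * F 0 - D 0 * W \<in> km kr"
  proof (rule factor_by_vectors[OF idl_kr _ D(2)])
    show "b0 * F 0 * idm (n 1) = b0 * F 0" unfolding mult.assoc F0 ..
    fix v
    have "\<psi> (mv (n 1) (F 0) v) = \<zero>\<^bsub>X\<^esub>"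
      using kF[of "mv (n 1) (F 0) v"] rows[OF F0(1)] idl_zero[OF idl_kr] by (auto intro: exI[of _ v])
    then have "\<eta> (mv (n 0) b (mv (n 1) (F 0) v)) = \<zero>\<^bsub>X\<^esub>" using b(3) by metis
    then obtain y where y: "y \<in> carrier (P 1)" "\<theta> 0 (mv (n 0) b (mv (n 1) (F 0) v)) = d 0 y"
      using proj_resolutionD(5)[OF R prsnD(1)[OF \<theta>]] unfolding \<eta>_def by blast
    obtain z where z: "\<theta> 1 z = y" using prsnD(6)[OF \<theta>, of y 1] y(1) by auto
    then have "\<theta> 0 (mv (n 0) b (mv (n 1) (F 0) v)) = \<theta> 0 (mv (k 1) (D 0) z)" using y(2) dD[of 0 z] by simp
    then have "\<theta> 0 (\<lambda>j. mv (n 0) b (mv (n 1) (F 0) v) j - mv (k 1) (D 0) z j) = \<zero>\<^bsub>P 0\<^esub>" using prsn_eq_iff[OF \<theta>] by blast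
    then have "mv (k 0) (E 0) (\<lambda>j. mv (n 0) b (mv (n 1) (F 0) v) j - mv (k 1) (D 0) z j) j \<in> kr" for j using ker by blast
    then have 1: "mv (n 1) (b0 * F 0) v j - mv (k 1) (E 0 * D 0) z j \<in> kr" for j
      unfolding mv_diff b0_def mult.assoc mv_mult[OF E(2)] mv_mult[OF b(2)] .
    have 2: "mv (k 1) (E 0 * D 0 - D 0) z j \<in> kr" for j by (rule mv_km[OF idl_kr pcxD(2)[OF pc]])
    have "mv (n 1) (b0 * F 0) v j - mv (k 1) (D 0) z j \<in> kr" for j
      using idl_add[OF idl_kr 1[of j] 2[of j]] unfolding mv_fdiff by simp
    then show "\<exists>z. \<forall>j. mv (n 1) (b0 * F 0) v j - mv (k (Suc 0)) (D 0) z j \<in> kr" by auto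
  qed
  then obtain b1 where b1: "b0 * F 0 - D 0 * b1 \<in> km kr" by blast
  have "\<exists>W. (a0 * b0 - idm (n 0)) - F 0 * W \<in> km kr"
  proof (rule factor_by_vectors[OF idl_kr _ F0(2)])
    show "(a0 * b0 - idm (n 0)) * idm (n 0) = a0 * b0 - idm (n 0)" by (simp add: mat_simps b0)
    fix v
    have "\<psi> (mv (n 0) (a0 * b0) v) = \<psi> v" unfolding mv_mult[OF a0(2)] a0(3)[symmetric] b0v[symmetric] ..
    also have "\<psi> v = \<psi> (mv (n 0) (idm (n 0)) v)" by (rule prsnD(4)[OF \<psi>]) (simp add: mv_idm)
    finally have "\<psi> (mv (n 0) (a0 * b0 - idm (n 0)) v) = \<zero>\<^bsub>X\<^esub>" unfolding mv_fdiff using prsn_eq_iff[OF \<psi>] by blast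
    moreover have "idm (n 0) * (a0 * b0 - idm (n 0)) = a0 * b0 - idm (n 0)"
      using a0(1) by (simp add: right_diff_distrib flip: mult.assoc)
    ultimately show "\<exists>w. \<forall>i. mv (n 0) (a0 * b0 - idm (n 0)) v i - mv (n 1) (F 0) w i \<in> kr"
      using kF[of "mv (n 0) (a0 * b0 - idm (n 0)) v"] rows by blast
  qed
  then obtain h0 where "a0 * b0 - idm (n 0) - F 0 * h0 \<in> km kr" by blast
  then show ?thesis using that[of k \<theta> E D a0 a1 b0 b1 h0] \<theta> ker dD pc E D a1 b1 by simp
qed

text \<open>When the module in degree \<open>Suc N\<close> is trivial, its idempotent and hence the
  differential into that degree vanish modulo \<open>kr\<close>. A zero matrix has a quasi-inverse,
  and \<open>comparison_vreg\<close> carries this over to the free resolution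
  \<open>F\<close>.\<close>

theorem proj_dim_vreg:
  assumes pd: "proj_dim A X < \<infinity>" and F: "resolves n F X \<psi>" and p: "prim p"
  obtains N where "vreg p kr (F N)"
proof -
  have "{enat N |N. \<exists>P d e. proj_resolution A X (P, d, e) \<and> (\<forall>i>N. trivial_module (P i))} \<noteq> {}"
    using pd unfolding proj_dim_def by (metis Inf_enat_def less_irrefl)
  then obtain N P d e where R: "proj_resolution A X (P, d, e)" and tr: "\<And>i. i > N \<Longrightarrow> trivial_module (P i)" by auto
  obtain k \<theta> E D a0 a1 b0 b1 h0 where *: "\<forall>i. prsn (P i) (k i) (\<theta> i)"
      "\<forall>i v. \<theta> i v = \<zero>\<^bsub>P i\<^esub> \<longleftrightarrow> (\<forall>j. mv (k i) (E i) v j \<in> kr)"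
      "\<forall>i v. d i (\<theta> (Suc i) v) = \<theta> i (mv (k (Suc i)) (D i) v)"
    and pc: "pcx kr E D" and ED: "\<forall>i. idm (k i) * E i = E i" "\<forall>i. E i * idm (k i) = E i"
      "\<forall>i. idm (k i) * D i = D i" "\<forall>i. D i * idm (k (Suc i)) = D i"
    and c: "a0 * D 0 - F 0 * a1 \<in> km kr" "b0 * F 0 - D 0 * b1 \<in> km kr" "a0 * b0 - idm (n 0) - F 0 * h0 \<in> km kr"
    by (rule comparison_matrices[OF R F])
  note \<theta> = *(1)[rule_format] and ker = *(2)[THEN spec, THEN spec] and dD = *(3)[rule_format]
    and E = ED(1,2)[rule_format] and D = ED(3,4)[rule_format]
  have "E (Suc N) \<in> km kr"
  proof (rule km_by_vectors[OF idl_kr E(2)])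
    fix v j
    have "\<theta> (Suc N) v = \<zero>\<^bsub>P (Suc N)\<^esub>"
      using tr[of "Suc N"] prsnD(1)[OF \<theta>, of "Suc N" v] unfolding trivial_module_def by auto
    then show "mv (k (Suc N)) (E (Suc N)) v j \<in> kr" using ker by blast
  qed
  then have "E (Suc N) * D (Suc N) - (E (Suc N) * D (Suc N) - D (Suc N)) \<in> km kr"
    by (intro km_diff[OF idl_kr km_right[OF idl_kr] pcxD(2)[OF pc]])
  then have "D (Suc N) * 0 * D (Suc N) - 1 *\<^sub>m D (Suc N) \<in> km kr" using km_minus[OF idl_kr] by fastforce
  then have "vreg p kr (D (Suc N))" using prim_one[OF p] unfolding vreg_def by blast
  from comparison_vreg[OF idl_kr pc cpx_pcx[OF idl_kr resolvesD(1)[OF F]] c this] show ?thesis by (rule that)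
qed

text \<open>A one-row matrix killed by the next differential is a cocycle with values in the ring,
  so the Ext hypothesis bounds it on the given resolution. \<open>row_combination\<close> passes to
  all matrices and \<open>comparison_dual_exact\<close> to the free resolution.\<close>

theorem ext_dual_exact:
  assumes R: "proj_resolution A X (P, d, e)" and F: "resolves n F X \<psi>"
    and ext: "ext_cocycles A (P, d, e) (Suc i) (ring_as_module A) \<subseteq> ext_coboundaries A (P, d, e) (Suc i) (ring_as_module A)"
    and V: "V * idm (n (Suc i)) = V" "V * F (Suc i) \<in> km kr"
  shows "\<exists>W. V - W * F i \<in> km kr"
proof -
  obtain k \<theta> E D a0 a1 b0 b1 h0 where *: "\<forall>i. prsn (P i) (k i) (\<theta> i)"
      "\<forall>i v. \<theta> i v = \<zero>\<^bsub>P i\<^esub> \<longleftrightarrow> (\<forall>j. mv (k i) (E i) v j \<in> kr)"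
      "\<forall>i v. d i (\<theta> (Suc i) v) = \<theta> i (mv (k (Suc i)) (D i) v)"
    and pc: "pcx kr E D" and ED: "\<forall>i. idm (k i) * E i = E i" "\<forall>i. E i * idm (k i) = E i"
      "\<forall>i. idm (k i) * D i = D i" "\<forall>i. D i * idm (k (Suc i)) = D i"
    and c: "a0 * D 0 - F 0 * a1 \<in> km kr" "b0 * F 0 - D 0 * b1 \<in> km kr" "a0 * b0 - idm (n 0) - F 0 * h0 \<in> km kr"
    by (rule comparison_matrices[OF R F])
  note \<theta> = *(1)[rule_format] and ker = *(2)[THEN spec, THEN spec] and dD = *(3)[rule_format]
    and E = ED(1,2)[rule_format] and D = ED(3,4)[rule_format]
  let ?j = "Suc i" and ?R = "ring_as_module A"
  have ex1: "\<exists>W. V - W * D i \<in> km kr"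
    if V: "idm 1 * V = V" "V * E ?j - V \<in> km kr" "V * D ?j \<in> km kr" for V :: "'p fmat"
  proof -
    \<comment> \<open>Multiplication by the idempotent makes the row constant on all coefficient
      vectors of the same element, so that it defines a function on the projective module.\<close>
    define V' where "V' = V * E ?j"
    have V': "V' * idm (k ?j) = V'" "V' - V \<in> km kr" using V(2) by (simp_all add: V'_def mult.assoc E)
    have V'E: "V' * E ?j - V' \<in> km kr"
    proof -
      have "V' * E ?j - V' = V * (E ?j * E ?j - E ?j)" by (simp add: V'_def mat_simps)
      then show ?thesis using km_left[OF idl_kr pcxD(1)[OF pc]] by simp
    qed
    define r where "r w = \<rho> (mv (k ?j) V' w 0)" for w
    have r_ker: "r w = r w'" if w: "\<theta> ?j w = \<theta> ?j w'" for w w'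
    proof -
      have "\<theta> ?j (\<lambda>j. w j - w' j) = \<zero>\<^bsub>P ?j\<^esub>" using w prsn_eq_iff[OF \<theta>] by blast
      then have a: "mv (k ?j) (E ?j) (\<lambda>j. w j - w' j) j \<in> kr" for j using ker by blast
      have "mv (k ?j) (V' * E ?j) (\<lambda>j. w j - w' j) 0 \<in> kr"
        unfolding mv_mult[OF V'(1)] by (rule mv_idl[OF idl_kr], rule a)
      moreover have "mv (k ?j) (V' * E ?j - V') (\<lambda>j. w j - w' j) 0 \<in> kr" by (rule mv_km[OF idl_kr V'E])
      ultimately have "mv (k ?j) V' (\<lambda>j. w j - w' j) 0 \<in> kr"
        using idl_diff[OF idl_kr, of "mv (k ?j) (V' * E ?j) (\<lambda>j. w j - w' j) 0" "mv (k ?j) (V' * E ?j - V') (\<lambda>j. w j - w' j) 0"]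
        unfolding mv_fdiff by simp
      then show ?thesis unfolding r_def \<rho>_eq_iff mv_diff .
    qed
    define f where "f = (\<lambda>y\<in>carrier (P ?j). r (SOME w. \<theta> ?j w = y))"
    have f\<theta>: "f (\<theta> ?j w) = r w" for w
    proof -
      have "\<theta> ?j (SOME w'. \<theta> ?j w' = \<theta> ?j w) = \<theta> ?j w"
        by (rule someI[of "\<lambda>w'. \<theta> ?j w' = \<theta> ?j w" w]) (rule refl)
      from r_ker[OF this] show ?thesis using prsnD(1)[OF \<theta>] by (simp add: f_def)
    qed
    have fhom: "f \<in> module_hom A (P ?j) ?R"
      unfolding module_hom_def
    proof (intro CollectI conjI ballI)
      show "f \<in> carrier (P ?j) \<rightarrow>\<^sub>E carrier ?R" by (auto simp: f_def r_def ring_as_module_def)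
    next
      fix x y assume "x \<in> carrier (P ?j)" "y \<in> carrier (P ?j)"
      then obtain w w' where w: "\<theta> ?j w = x" "\<theta> ?j w' = y" using prsnD(6)[OF \<theta>] by metis
      have "f (x \<oplus>\<^bsub>P ?j\<^esub> y) = r (\<lambda>i. w i + w' i)" unfolding w[symmetric] prsnD(2)[OF \<theta>, symmetric] by (rule f\<theta>)
      also have "\<dots> = r w \<oplus> r w'" by (simp add: r_def mv_add \<rho>_add)
      finally show "f (x \<oplus>\<^bsub>P ?j\<^esub> y) = f x \<oplus>\<^bsub>?R\<^esub> f y" unfolding w[symmetric] f\<theta> by (simp add: ring_as_module_def)
    next
      fix a x assume a: "a \<in> carrier A" and "x \<in> carrier (P ?j)"
      then obtain w where w: "\<theta> ?j w = x" using prsnD(6)[OF \<theta>] by metis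
      obtain b where b: "\<rho> b = a" using \<rho>_surj[OF a] by blast
      have "f (a \<odot>\<^bsub>P ?j\<^esub> x) = r (\<lambda>i. b * w i)" unfolding w[symmetric] b[symmetric] prsnD(3)[OF \<theta>, symmetric] by (rule f\<theta>)
      also have "\<dots> = a \<otimes> r w" by (simp add: r_def mv_scale \<rho>_mult b)
      finally show "f (a \<odot>\<^bsub>P ?j\<^esub> x) = a \<odot>\<^bsub>?R\<^esub> f x" unfolding w[symmetric] f\<theta> by (simp add: ring_as_module_def)
    qed
    have "f \<in> ext_cocycles A (P, d, e) ?j ?R"
      unfolding ext_cocycles_def split_conv
    proof (intro CollectI conjI fhom)
      show "compose (carrier (P (Suc ?j))) f (d ?j) = \<zero>\<^bsub>hom_module A (P (Suc ?j)) ?R\<^esub>"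
      proof
        fix y
        show "compose (carrier (P (Suc ?j))) f (d ?j) y = \<zero>\<^bsub>hom_module A (P (Suc ?j)) ?R\<^esub> y"
        proof (cases "y \<in> carrier (P (Suc ?j))")
          case True
          then obtain w where w: "\<theta> (Suc ?j) w = y" using prsnD(6)[OF \<theta>] by metis
          have "V' * D ?j = V * (E ?j * D ?j - D ?j) + V * D ?j" by (simp add: V'_def mat_simps)
          also have "\<dots> \<in> km kr" by (rule km_add[OF idl_kr km_left[OF idl_kr pcxD(2)[OF pc]] V(3)])
          finally have "mv (k (Suc ?j)) (V' * D ?j) w 0 \<in> kr" by (rule mv_km[OF idl_kr])
          then have "f (d ?j y) = \<zero>"
            unfolding w[symmetric] dD f\<theta> r_def mv_mult[OF V'(1), symmetric] by (simp add: kr_def)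
          then show ?thesis using True by (simp add: compose_def hom_module_def ring_as_module_def)
        qed (simp add: compose_def hom_module_def)
      qed
    qed
    then have "f \<in> ext_coboundaries A (P, d, e) ?j ?R" using ext by blast
    then obtain g where g: "g \<in> module_hom A (P i) ?R" "f = compose (carrier (P ?j)) g (d i)"
      by (auto simp: ext_coboundaries_def)
    obtain W where W: "W * idm (k i) = W" "\<And>v. g (\<theta> i v) = \<rho> (mv (k i) W v 0)" "idm 1 * W = W"
      using prsn_lift[OF \<theta> prsn_ring module_hom_hom_like[OF g(1)]] by metis
    have "V' - W * D i \<in> km kr"
    proof (rule km_by_vectors[OF idl_kr])
      show "(V' - W * D i) * idm (k ?j) = V' - W * D i" by (simp add: left_diff_distrib mult.assoc D V'(1))
      fix v j
      show "mv (k ?j) (V' - W * D i) v j \<in> kr"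
      proof (cases "j = 0")
        case True
        have "r v = g (d i (\<theta> ?j v))" using f\<theta>[of v] g(2) prsnD(1)[OF \<theta>] by (simp add: compose_def)
        also have "\<dots> = \<rho> (mv (k ?j) (W * D i) v 0)" unfolding dD W(2) mv_mult[OF W(1)] ..
        finally show ?thesis unfolding mv_fdiff True r_def \<rho>_eq_iff .
      next
        case False
        have "ent V' j c = 0" "ent (W * D i) j c = 0" for c
          using idm_mult_bound[of 1 V' j c] idm_mult_bound[of 1 "W * D i" j c] False V(1) W(3)
          by (simp_all add: V'_def flip: mult.assoc)
        then show ?thesis using idl_zero[OF idl_kr] by (simp add: mv_def)
      qed
    qed
    from km_diff[OF idl_kr this V'(2)] have "V - W * D i \<in> km kr" by simp
    then show ?thesis by blast
  qed
  have ex: "\<exists>W. V - W * D i \<in> km kr" if V: "V * E ?j - V \<in> km kr" "V * D ?j \<in> km kr" for V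
  proof (rule row_combination[OF idl_kr])
    fix j
    show "\<exists>W. un 0 j * V - W * D i \<in> km kr"
    proof (rule ex1)
      show "idm 1 * (un 0 j * V) = un 0 j * V" by (rule fmat_eqI) simp
      show "un 0 j * V * E ?j - un 0 j * V \<in> km kr"
        using km_left[OF idl_kr V(1), of "un 0 j"] by (simp add: right_diff_distrib mult.assoc)
      show "un 0 j * V * D ?j \<in> km kr" using km_left[OF idl_kr V(2), of "un 0 j"] by (simp add: mult.assoc)
    qed
  qed
  show ?thesis
    by (rule comparison_dual_exact[OF idl_kr pc cpx_pcx[OF idl_kr resolvesD(1)[OF F]] c ex])
      (use V km_zero[OF idl_kr] in auto)
qed

end

section \<open>Resolutions built from free modules and the chosen resolution in Ext\<close>

context rpres
begin

lemma module_free: "module A (free_module A n)" by (rule prsn_module[OF prsn_free])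

lemma projective_free: "fg_projective A (free_module A n)"
proof -
  let ?F = "free_module A n" and ?i = "\<lambda>x\<in>carrier (free_module A n). x"
  interpret F: module A ?F by (rule module_free)
  have "?i \<in> module_hom A ?F ?F" by (auto simp: module_hom_def)
  then show ?thesis unfolding fg_projective_def using module_free
    by (intro conjI exI[of _ n] bexI[of _ ?i]) auto
qed

definition lv :: "(nat \<Rightarrow> 'r) \<Rightarrow> (nat \<Rightarrow> 'p)" where "lv y = (\<lambda>i. SOME a. \<rho> a = y i)"

lemma \<rho>_some: "x \<in> carrier A \<Longrightarrow> \<rho> (SOME a. \<rho> a = x) = x"
  using \<rho>_surj[of x] by (auto intro: someI)

lemma fvec_lv: "y \<in> carrier (free_module A n) \<Longrightarrow> fvec n (lv y) = y"
  using \<rho>_some by (auto simp: fvec_def lv_def fun_eq_iff free_module_def)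

lemma fvec_eq_iff: "fvec n v = fvec n w \<longleftrightarrow> (\<forall>i<n. v i - w i \<in> kr)"
  by (auto simp: fvec_def fun_eq_iff \<rho>_eq_iff)

lemma fvec_carrier: "fvec n v \<in> carrier (free_module A n)" by (rule prsnD(1)[OF prsn_free])

lemma free_hom:
  assumes Y: "prsn Y k \<psi>" and wd: "\<And>v w. (\<And>i. i < n \<Longrightarrow> v i - w i \<in> kr) \<Longrightarrow> g v = g w"
    and g: "\<And>v. g v \<in> carrier Y" "\<And>v w. g (\<lambda>i. v i + w i) = g v \<oplus>\<^bsub>Y\<^esub> g w" "\<And>a v. g (\<lambda>i. a * v i) = \<rho> a \<odot>\<^bsub>Y\<^esub> g v"
  shows "(\<lambda>y\<in>carrier (free_module A n). g (lv y)) \<in> module_hom A (free_module A n) Y"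
    "(\<lambda>y\<in>carrier (free_module A n). g (lv y)) (fvec n v) = g v"
proof -
  let ?F = "free_module A n" and ?f = "\<lambda>y\<in>carrier (free_module A n). g (lv y)"
  show f: "?f (fvec n v) = g v" for v
  proof -
    have "fvec n (lv (fvec n v)) = fvec n v" by (rule fvec_lv[OF fvec_carrier])
    then have "g (lv (fvec n v)) = g v" using wd fvec_eq_iff by blast
    then show ?thesis using fvec_carrier by simp
  qed
  show "?f \<in> module_hom A ?F Y"
    unfolding module_hom_def
  proof (intro CollectI conjI ballI)
    show "?f \<in> carrier ?F \<rightarrow>\<^sub>E carrier Y" using g(1) by auto
  next
    fix x y assume "x \<in> carrier ?F" "y \<in> carrier ?F"
    then obtain v w where vw: "fvec n v = x" "fvec n w = y" using prsnD(6)[OF prsn_free] by metis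
    have "x \<oplus>\<^bsub>?F\<^esub> y = fvec n (\<lambda>i. v i + w i)" unfolding vw[symmetric] by (rule prsnD(2)[OF prsn_free, symmetric])
    then show "?f (x \<oplus>\<^bsub>?F\<^esub> y) = ?f x \<oplus>\<^bsub>Y\<^esub> ?f y" unfolding vw[symmetric] f by (simp only: f g(2))
  next
    fix a x assume a: "a \<in> carrier A" and "x \<in> carrier ?F"
    then obtain v where v: "fvec n v = x" using prsnD(6)[OF prsn_free] by metis
    obtain b where b: "\<rho> b = a" using \<rho>_surj[OF a] by blast
    have "a \<odot>\<^bsub>?F\<^esub> x = fvec n (\<lambda>i. b * v i)" unfolding v[symmetric] b[symmetric] by (rule prsnD(3)[OF prsn_free, symmetric])
    then show "?f (a \<odot>\<^bsub>?F\<^esub> x) = a \<odot>\<^bsub>Y\<^esub> ?f x" unfolding v[symmetric] f b[symmetric] by (simp only: f g(3))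
  qed
qed

lemma cpx_vectors:
  assumes C: "cpx kr n F" and v: "\<And>j. mv (n (Suc i)) (F i) v j \<in> kr"
  shows "\<exists>w. \<forall>j<n (Suc i). v j - mv (n (Suc (Suc i))) (F (Suc i)) w j \<in> kr"
proof -
  let ?V = "mk (n (Suc i)) 1 (\<lambda>j _. v j)"
  have "ent (F i * ?V) j c \<in> kr" for j c
  proof (cases "c = 0")
    case True
    have "ent (F i * ?V) j 0 = mv (n (Suc i)) (F i) (\<lambda>j. ent ?V j 0) j"
      unfolding mv_col[OF cpxD(2)[OF C]] ..
    also have "\<dots> = mv (n (Suc i)) (F i) v j" by (rule fun_cong[OF mv_cong]) simp
    finally show ?thesis using v True by simp
  next
    case False
    then have "ent (F i * ?V) j c = 0"
      by (subst ent_times_bound'[of 0]) auto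
    then show ?thesis using idl_zero[OF idl_kr] by simp
  qed
  then have "F i * ?V \<in> km kr" by (rule kmI)
  moreover have "idm (n (Suc i)) * ?V = ?V" by (rule fmat_eqI) simp
  ultimately obtain W where W: "?V - F (Suc i) * W \<in> km kr" using cpxD(4)[OF C] by blast
  have "v j - mv (n (Suc (Suc i))) (F (Suc i)) (\<lambda>j. ent W j 0) j \<in> kr" if "j < n (Suc i)" for j
    unfolding mv_col[OF cpxD(2)[OF C]] using kmD[OF W, of j 0] that by simp
  then show ?thesis by blast
qed

text \<open>This provides the witness for the \<open>SOME\<close> in \<open>ext_module\<close>;
  without it the chosen resolution would be arbitrary.\<close>

lemma resolution_exists:
  assumes F: "resolves n F X \<psi>"
  shows "\<exists>P d e. proj_resolution A X (P, d, e)"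
proof -
  note C = resolvesD(1)[OF F] and \<psi> = resolvesD(2)[OF F] and ker = resolvesD(3)[OF F]
  let ?P = "\<lambda>i. free_module A (n i)"
  define P where "P i = ?P i" for i
  define gd where "gd i v = fvec (n i) (mv (n (Suc i)) (F i) v)" for i v
  define d where "d i = (\<lambda>y\<in>carrier (?P (Suc i)). gd i (lv y))" for i
  define e where "e = (\<lambda>y\<in>carrier (?P 0). \<psi> (lv y))"
  have rows: "mv l (F i) v j = 0" if "n i \<le> j" for l i v j
    using idm_mult_bound[OF cpxD(1)[OF C] that] by (simp add: mv_def)
  have wd: "gd i v = gd i w" if vw: "\<And>j. j < n (Suc i) \<Longrightarrow> v j - w j \<in> kr" for i v w
  proof -
    have "mv (n (Suc i)) (F i) (\<lambda>j. v j - w j) l \<in> kr" for l by (rule mv_idl[OF idl_kr vw])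
    then show ?thesis unfolding gd_def fvec_eq_iff mv_diff by blast
  qed
  have gd: "gd i v \<in> carrier (?P i)" "gd i (\<lambda>j. v j + w j) = gd i v \<oplus>\<^bsub>?P i\<^esub> gd i w"
    "gd i (\<lambda>j. a * v j) = \<rho> a \<odot>\<^bsub>?P i\<^esub> gd i v" for i v w a
    by (simp_all only: gd_def fvec_carrier mv_add mv_scale prsnD(2)[OF prsn_free] prsnD(3)[OF prsn_free])
  have d: "d i \<in> module_hom A (?P (Suc i)) (?P i)" "d i (fvec (n (Suc i)) v) = gd i v" for i v
    unfolding d_def by (rule free_hom[OF prsn_free wd gd]; assumption)+
  have kr\<psi>: "\<psi> v = \<psi> w" if vw: "\<And>i. i < n 0 \<Longrightarrow> v i - w i \<in> kr" for v w
  proof -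
    let ?u = "\<lambda>i. if i < n 0 then v i - w i else 0"
    have "\<psi> (\<lambda>i. v i - w i) = \<psi> ?u" by (rule prsnD(4)[OF \<psi>]) simp
    also have "\<psi> ?u = \<zero>\<^bsub>X\<^esub>"
      using ker[of ?u] vw idl_zero[OF idl_kr] by (auto intro!: exI[of _ "\<lambda>_. 0"] simp: mv_def)
    finally show ?thesis using prsn_eq_iff[OF \<psi>] by blast
  qed
  have e: "e \<in> module_hom A (?P 0) X" "e (fvec (n 0) v) = \<psi> v" for v
    unfolding e_def
    by (rule free_hom[OF \<psi> kr\<psi> prsnD(1,2,3)[OF \<psi>]]; assumption)+
  have rep: "\<exists>v. fvec (n i) v = y" if "y \<in> carrier (?P i)" for i y
    by (rule prsnD(6)[OF prsn_free that])
  have "e ` carrier (?P 0) = carrier X"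
  proof (intro equalityI subsetI)
    fix x assume "x \<in> carrier X"
    then obtain v where "\<psi> v = x" using prsnD(6)[OF \<psi>] by blast
    then show "x \<in> e ` carrier (?P 0)" using e(2) fvec_carrier by (metis image_eqI)
  next
    fix x assume "x \<in> e ` carrier (?P 0)"
    then show "x \<in> carrier X" using hom_likeD(1)[OF module_hom_hom_like[OF e(1)]] by blast
  qed
  moreover have "e (fvec (n 0) v) = \<zero>\<^bsub>X\<^esub> \<longleftrightarrow> (\<exists>w. fvec (n 0) v = d 0 (fvec (n 1) w))" for v
  proof -
    let ?v = "\<lambda>i. if i < n 0 then v i else 0"
    have "\<psi> v = \<psi> ?v" by (rule prsnD(4)[OF \<psi>]) simp
    then have "e (fvec (n 0) v) = \<zero>\<^bsub>X\<^esub> \<longleftrightarrow> (\<exists>w. \<forall>i. ?v i - mv (n 1) (F 0) w i \<in> kr)"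
      using e(2) ker[of ?v] by simp
    also have "\<dots> \<longleftrightarrow> (\<exists>w. \<forall>i<n 0. v i - mv (n 1) (F 0) w i \<in> kr)"
    proof -
      have "(\<forall>i. ?v i - mv (n 1) (F 0) w i \<in> kr) \<longleftrightarrow> (\<forall>i<n 0. v i - mv (n 1) (F 0) w i \<in> kr)" for w
        using rows[of 0 _ "n 1" w] idl_zero[OF idl_kr] by (auto simp: not_less)
      then show ?thesis by simp
    qed
    also have "\<dots> \<longleftrightarrow> (\<exists>w. fvec (n 0) v = d 0 (fvec (n 1) w))"
      using d(2)[of 0] by (simp add: gd_def fvec_eq_iff)
    finally show ?thesis .
  qed
  then have "d 0 ` carrier (?P 1) = {x \<in> carrier (?P 0). e x = \<zero>\<^bsub>X\<^esub>}"
  proof (intro equalityI subsetI CollectI conjI; (elim imageE CollectE conjE)?)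
    assume h: "\<And>v. (e (fvec (n 0) v) = \<zero>\<^bsub>X\<^esub>) = (\<exists>w. fvec (n 0) v = d 0 (fvec (n 1) w))"
    fix x y assume y: "x = d 0 y" "y \<in> carrier (?P 1)"
    then obtain w where w: "fvec (n 1) w = y" using rep by blast
    show "x \<in> carrier (?P 0)"
      unfolding y(1) using hom_likeD(1)[OF module_hom_hom_like[OF d(1)[of 0]]] y(2) by simp
    have "x = fvec (n 0) (mv (n 1) (F 0) w)" unfolding y(1) w[symmetric] using d(2)[of 0 w] by (simp add: gd_def)
    then show "e x = \<zero>\<^bsub>X\<^esub>" using h y(1) w by blast
  next
    assume h: "\<And>v. (e (fvec (n 0) v) = \<zero>\<^bsub>X\<^esub>) = (\<exists>w. fvec (n 0) v = d 0 (fvec (n 1) w))"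
    fix x assume x: "x \<in> carrier (?P 0)" "e x = \<zero>\<^bsub>X\<^esub>"
    then obtain v where "fvec (n 0) v = x" using rep by blast
    then obtain w where "x = d 0 (fvec (n 1) w)" using h x(2) by blast
    then show "x \<in> d 0 ` carrier (?P 1)" using fvec_carrier by blast
  qed
  moreover have "d (Suc i) ` carrier (?P (Suc (Suc i))) =
     {x \<in> carrier (?P (Suc i)). d i x = \<zero>\<^bsub>?P i\<^esub>}" for i
  proof (intro equalityI subsetI CollectI conjI; (elim imageE CollectE conjE)?)
    fix x y assume y: "x = d (Suc i) y" "y \<in> carrier (?P (Suc (Suc i)))"
    then obtain w where w: "fvec (n (Suc (Suc i))) w = y" using rep by blast
    show "x \<in> carrier (?P (Suc i))"
      unfolding y(1) by (rule hom_likeD(1)[OF module_hom_hom_like[OF d(1)] y(2)])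
    have "x = fvec (n (Suc i)) (mv (n (Suc (Suc i))) (F (Suc i)) w)" unfolding y(1) w[symmetric] d(2) gd_def ..
    then have "d i x = fvec (n i) (mv (n (Suc (Suc i))) (F i * F (Suc i)) w)"
      using d(2) by (simp add: gd_def mv_mult[OF cpxD(2)[OF C]])
    then show "d i x = \<zero>\<^bsub>?P i\<^esub>"
      using mv_km[OF idl_kr cpxD(3)[OF C]] by (simp add: fvec_zero_iff)
  next
    fix x assume x: "x \<in> carrier (?P (Suc i))" "d i x = \<zero>\<^bsub>?P i\<^esub>"
    then obtain v where v: "fvec (n (Suc i)) v = x" using rep by blast
    have z: "\<forall>j<n i. mv (n (Suc i)) (F i) v j \<in> kr"
      using x(2) unfolding v[symmetric] d(2) gd_def fvec_zero_iff .
    have "mv (n (Suc i)) (F i) v j \<in> kr" for j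
      using z rows[of i j] idl_zero[OF idl_kr] by (cases "j < n i") (auto simp: not_less)
    then obtain w where "\<forall>j<n (Suc i). v j - mv (n (Suc (Suc i))) (F (Suc i)) w j \<in> kr" using cpx_vectors[OF C] by blast
    then have "x = d (Suc i) (fvec (n (Suc (Suc i))) w)" unfolding v[symmetric] d(2) gd_def fvec_eq_iff .
    then show "x \<in> d (Suc i) ` carrier (?P (Suc (Suc i)))" using fvec_carrier by blast
  qed
  ultimately have "proj_resolution A X (P, d, e)"
    using d(1) e(1) projective_free unfolding proj_resolution.simps P_def by auto
  then show ?thesis by blast
qed

text \<open>The resolution obtained is the one chosen inside \<open>ext_module\<close>. Triviality
  makes the coset of a cocycle \<open>f\<close> equal to the set of coboundaries, and
  \<open>f\<close> lies in its coset because zero is a coboundary.\<close>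

lemma ext_trivial_cocycles:
  assumes R: "\<exists>P d e. proj_resolution A X (P, d, e)"
    and triv: "\<And>i. 1 \<le> i \<Longrightarrow> i \<le> q \<Longrightarrow> trivial_module (ext_module A i X (ring_as_module A))"
  obtains P d e where "proj_resolution A X (P, d, e)"
    "\<And>i. Suc i \<le> q \<Longrightarrow> ext_cocycles A (P, d, e) (Suc i) (ring_as_module A) \<subseteq> ext_coboundaries A (P, d, e) (Suc i) (ring_as_module A)"
proof -
  let ?F = "SOME F. proj_resolution A X F" and ?R = "ring_as_module A"
  have F: "proj_resolution A X ?F" using R someI_ex[of "\<lambda>F. proj_resolution A X F"] by blast
  obtain P d e where Pde: "?F = (P, d, e)" using prod_cases3 by blast
  have R': "proj_resolution A X (P, d, e)" using F Pde by simp
  have "ext_cocycles A (P, d, e) (Suc i) ?R \<subseteq> ext_coboundaries A (P, d, e) (Suc i) ?R" if i: "Suc i \<le> q" for i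
  proof
    let ?B = "ext_coboundaries A (P, d, e) (Suc i) ?R" and ?Z = "ext_cocycles A (P, d, e) (Suc i) ?R"
    let ?H = "(hom_module A (P (Suc i)) ?R)\<lparr>carrier := ?Z\<rparr>"
    fix f assume f: "f \<in> ?Z"
    have "trivial_module (quot_module ?H ?B)"
      using triv[of "Suc i"] i Pde unfolding ext_module_def by (simp add: Let_def)
    then have "a_rcosets\<^bsub>?H\<^esub> ?B = {?B}" by (simp add: trivial_module_def quot_module_def)
    moreover have "?B +>\<^bsub>?H\<^esub> f \<in> a_rcosets\<^bsub>?H\<^esub> ?B"
      using f unfolding A_RCOSETS_def RCOSETS_def a_r_coset_def by auto
    ultimately have eq: "?B +>\<^bsub>?H\<^esub> f = ?B" by simp
    let ?z = "\<lambda>x\<in>carrier (P i). \<zero>"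
    have hd: "hom_like A (P (Suc i)) (P i) (d i)" by (rule module_hom_hom_like[OF proj_resolutionD(2)[OF R']])
    have mP: "module A (P i)" using proj_resolutionD(1)[OF R', of i] by (simp add: fg_projective_def)
    interpret mP: module A "P i" by (rule mP)
    have "?z \<in> module_hom A (P i) ?R" by (auto simp: module_hom_def ring_as_module_def)
    moreover have "compose (carrier (P (Suc i))) ?z (d i) = (\<lambda>x\<in>carrier (P (Suc i)). \<zero>)"
      using hom_likeD(1)[OF hd] by (auto simp: compose_def fun_eq_iff)
    ultimately have "(\<lambda>x\<in>carrier (P (Suc i)). \<zero>) \<in> ?B" unfolding ext_coboundaries_def split_conv nat.case by (intro image_eqI[of _ _ ?z]) (rule sym)
    then have "(\<lambda>x\<in>carrier (P (Suc i)). \<zero>) \<oplus>\<^bsub>?H\<^esub> f \<in> ?B +>\<^bsub>?H\<^esub> f"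
      unfolding a_r_coset_def r_coset_def by auto
    moreover have "(\<lambda>x\<in>carrier (P (Suc i)). \<zero>) \<oplus>\<^bsub>?H\<^esub> f = f"
    proof -
      have "f \<in> carrier (P (Suc i)) \<rightarrow>\<^sub>E carrier A"
        using f by (auto simp: ext_cocycles_def module_hom_def ring_as_module_def)
      then show ?thesis by (auto simp: hom_module_def ring_as_module_def fun_eq_iff PiE_iff extensional_def)
    qed
    ultimately show "f \<in> ?B" using eq by simp
  qed
  then show ?thesis using that R' by blast
qed

end

section \<open>Ideals of the record and ideals of the presenting ring\<close>

lemma (in cring) max_ideal_eqI:
  assumes N: "ideal N R" "\<one> \<notin> N" and unit: "\<And>a. a \<in> carrier R \<Longrightarrow> a \<notin> N \<Longrightarrow> \<exists>b\<in>carrier R. b \<otimes> a = \<one>"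
  shows "maximalideal N R" "max_ideal R = N"
proof -
  have full: "J = carrier R" if J: "ideal J R" "\<not> J \<subseteq> N" for J
  proof -
    obtain a where a: "a \<in> J" "a \<notin> N" using J(2) by blast
    have ac: "a \<in> carrier R" using ideal.Icarr[OF J(1) a(1)] .
    obtain b where b: "b \<in> carrier R" "b \<otimes> a = \<one>" using unit[OF ac a(2)] by blast
    have "\<one> \<in> J" using ideal.I_l_closed[OF J(1) a(1) b(1)] b(2) by simp
    then show ?thesis by (rule ideal.one_imp_carrier[OF J(1)])
  qed
  show m: "maximalideal N R"
  proof (rule maximalidealI[OF N(1)])
    show "carrier R \<noteq> N" using N(2) by auto
    fix J assume "ideal J R" "N \<subseteq> J" "J \<subseteq> carrier R"
    then show "J = N \<or> J = carrier R" using full[of J] by blast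
  qed
  show "max_ideal R = N"
    unfolding max_ideal_def
  proof (rule the_equality, rule m)
    fix M assume M: "maximalideal M R"
    then have "ideal M R" by (rule maximalideal.axioms(1))
    moreover have "M \<noteq> carrier R" using maximalideal.I_notcarr[OF M] by auto
    ultimately have "M \<subseteq> N" using full by blast
    then show "M = N" using maximalideal.I_maximal[OF M N(1)] ideal.Icarr[OF N(1)] N(2) by blast
  qed
qed

context rpres
begin

lemma ideal_image: "idl J \<Longrightarrow> ideal (\<rho> ` J) A"
proof (rule idealI[OF ring_axioms])
  assume J: "idl J"
  show "subgroup (\<rho> ` J) (add_monoid A)"
  proof (rule add.subgroupI)
    show "\<rho> ` J \<noteq> {}" using idl_zero[OF J] by blast
    show "\<ominus> a \<in> \<rho> ` J" if "a \<in> \<rho> ` J" for a using that idl_minus[OF J] by (auto simp flip: \<rho>_minus)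
    show "a \<oplus> b \<in> \<rho> ` J" if "a \<in> \<rho> ` J" "b \<in> \<rho> ` J" for a b
      using that idl_add[OF J] by (auto simp flip: \<rho>_add)
  qed auto
  show l: "x \<otimes> a \<in> \<rho> ` J" if "a \<in> \<rho> ` J" "x \<in> carrier A" for a x
    using that idl_mult[OF J] \<rho>_surj[OF that(2)] by (auto simp flip: \<rho>_mult)
  show "a \<otimes> x \<in> \<rho> ` J" if "a \<in> \<rho> ` J" "x \<in> carrier A" for a x
    using that idl_mult'[OF J] \<rho>_surj[OF that(2)] by (auto simp flip: \<rho>_mult)
qed

lemma ideal_vimage:
  assumes "ideal Q A"
  shows "idl (\<rho> -` Q)"
proof -
  interpret Q: ideal Q A by (rule assms)
  show ?thesis unfolding idl_def by (auto simp: \<rho>_zero \<rho>_add \<rho>_mult intro: Q.I_l_closed)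
qed

lemma kr_vimage:
  assumes "ideal Q A"
  shows "kr \<subseteq> \<rho> -` Q"
proof -
  interpret Q: ideal Q A by (rule assms)
  show ?thesis by (auto simp: kr_def)
qed

lemma image_vimage:
  assumes "ideal Q A"
  shows "\<rho> ` (\<rho> -` Q) = Q"
proof -
  interpret Q: ideal Q A by (rule assms)
  have "\<exists>a. \<rho> a = x" if "x \<in> Q" for x using that by (intro \<rho>_surj Q.Icarr)
  then show ?thesis by (metis subset_antisym image_vimage_subset vimage_eq subsetI image_eqI)
qed

lemma vimage_image: "idl J \<Longrightarrow> kr \<subseteq> J \<Longrightarrow> \<rho> a \<in> \<rho> ` J \<longleftrightarrow> a \<in> J"
proof
  assume J: "idl J" "kr \<subseteq> J" and "\<rho> a \<in> \<rho> ` J"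
  then obtain b where b: "b \<in> J" "\<rho> a = \<rho> b" by blast
  then have "a - b \<in> J" using \<rho>_eq_iff J(2) by blast
  from idl_add[OF J(1) this b(1)] show "a \<in> J" by simp
qed blast

lemma noeth_kr:
  assumes "noetherian_ring A"
  shows "noeth kr"
  unfolding noeth_def
proof (intro conjI allI impI idl_kr)
  fix J assume "idl J \<and> kr \<subseteq> J"
  then have J: "idl J" "kr \<subseteq> J" by auto
  obtain X where X: "X \<subseteq> carrier A" "finite X" "\<rho> ` J = Idl X"
    using noetherian_ring.finetely_gen[OF assms ideal_image[OF J(1)]] by blast
  have XJ: "X \<subseteq> \<rho> ` J" unfolding X(3) by (rule genideal_self[OF X(1)])
  obtain xs where xs: "set xs = X" using finite_list[OF X(2)] by blast
  have "\<forall>i. \<exists>a. i < length xs \<longrightarrow> a \<in> J \<and> \<rho> a = xs ! i" using XJ xs nth_mem by fastforce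
  then obtain a where a: "\<And>i. i < length xs \<Longrightarrow> a i \<in> J" "\<And>i. i < length xs \<Longrightarrow> \<rho> (a i) = xs ! i" by metis
  define T where "T = {y. \<exists>c. y - (\<Sum>i<length xs. c i * a i) \<in> kr}"
  have "idl UNIV" by (simp add: idl_def)
  from idl_span[OF idl_kr this, of "{..<length xs}" a] have "idl T" by (simp add: T_def)
  moreover have "X \<subseteq> \<rho> ` T"
  proof
    fix x assume "x \<in> X"
    then obtain i where i: "i < length xs" "xs ! i = x" using xs by (metis in_set_conv_nth)
    have "a i \<in> T"
      unfolding T_def using sum_delta_mult[of "{..<length xs}" i a] i(1) idl_zero[OF idl_kr]
      by (intro CollectI exI[of _ "\<lambda>k. if k = i then 1 else 0"]) simp
    then show "x \<in> \<rho> ` T" using a(2)[OF i(1)] i(2) by (metis image_eqI)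
  qed
  ultimately have "\<rho> ` J \<subseteq> \<rho> ` T" unfolding X(3) by (intro genideal_minimal ideal_image)
  have "\<exists>c. y - (\<Sum>i<length xs. c i * a i) \<in> kr" if y: "y \<in> J" for y
  proof -
    have "\<rho> y \<in> \<rho> ` T" using \<open>\<rho> ` J \<subseteq> \<rho> ` T\<close> y by blast
    then obtain t where t: "t \<in> T" "\<rho> y = \<rho> t" by blast
    then obtain c where "t - (\<Sum>i<length xs. c i * a i) \<in> kr" unfolding T_def by blast
    moreover have "y - t \<in> kr" using t(2) \<rho>_eq_iff by simp
    ultimately show ?thesis using idl_add[OF idl_kr, of "y - t"] by fastforce
  qed
  then show "\<exists>n a. (\<forall>i<n. a i \<in> J) \<and> (\<forall>y\<in>J. \<exists>c. y - (\<Sum>i<(n::nat). c i * a i) \<in> kr)"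
    using a(1) by (intro exI[of _ "length xs"] exI[of _ a]) blast
qed

lemma prim_vimage:
  assumes "primeideal Q A"
  shows "prim (\<rho> -` Q)"
proof -
  interpret Q: primeideal Q A by (rule assms)
  have "\<one> \<notin> Q" using Q.I_notcarr Q.one_imp_carrier by auto
  then show ?thesis
    unfolding prim_def using ideal_vimage[OF Q.is_ideal] Q.I_prime by (auto simp: \<rho>_one \<rho>_mult)
qed

lemma primeideal_image:
  assumes q: "prim q" "kr \<subseteq> q"
  shows "primeideal (\<rho> ` q) A"
proof (rule primeidealI[OF ideal_image[OF prim_idl[OF q(1)]] is_cring])
  note vi = vimage_image[OF prim_idl[OF q(1)] q(2)]
  show "carrier A \<noteq> \<rho> ` q" using vi[of 1] prim_one[OF q(1)] by (metis \<rho>_closed)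
  fix a b assume ab: "a \<in> carrier A" "b \<in> carrier A" "a \<otimes> b \<in> \<rho> ` q"
  obtain x y where xy: "\<rho> x = a" "\<rho> y = b" using \<rho>_surj ab by metis
  have "x * y \<in> q" using vi[of "x * y"] ab(3) xy by (simp add: \<rho>_mult)
  then have "x \<in> q \<or> y \<in> q" using q(1) by (auto simp: prim_def)
  then show "a \<in> \<rho> ` q \<or> b \<in> \<rho> ` q" using xy by blast
qed

text \<open>\<open>m\<close> is the preimage of the maximal ideal. An element without an inverse
  modulo \<open>kr\<close> lies in a maximal proper ideal above \<open>kr\<close>; the image of that
  ideal is maximal, so it is the unique maximal ideal of the record.\<close>

lemma local_data:
  assumes "noetherian_local_ring A"
  obtains m where "prim m" "kr \<subseteq> m" "\<And>u. u \<notin> m \<Longrightarrow> \<exists>v. v * u - 1 \<in> kr"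
proof -
  have N: "noetherian_ring A" and ex1: "\<exists>!M. maximalideal M A" using assms by (auto simp: noetherian_local_ring_def)
  then obtain M where M: "maximalideal M A" "\<And>M'. maximalideal M' A \<Longrightarrow> M' = M" by blast
  note K = noeth_kr[OF N]
  let ?m = "\<rho> -` M"
  have pM: "primeideal M A" by (rule maximalideal_prime[OF M(1)])
  have iM: "ideal M A" by (rule maximalideal.axioms(1)[OF M(1)])
  have "\<exists>v. v * u - 1 \<in> kr" if u: "u \<notin> ?m" for u
  proof (rule ccontr)
    assume no: "\<not> (\<exists>v. v * u - 1 \<in> kr)"
    let ?F = "{J. idl J \<and> adj kr u \<subseteq> J \<and> 1 \<notin> J}"
    have "1 \<notin> adj kr u"
    proof
      assume "1 \<in> adj kr u"
      then obtain k y where ky: "1 = k + u * y" "k \<in> kr" by (auto simp: adj_def)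
      have "y * u - 1 = - k" using ky(1) by (simp add: algebra_simps)
      then show False using no idl_minus[OF idl_kr ky(2)] by metis
    qed
    then have "?F \<noteq> {}" using idl_adj[OF idl_kr] by blast
    moreover have "idl J \<and> kr \<subseteq> J" if "J \<in> ?F" for J using that adj_superset by blast
    ultimately have "\<exists>M\<in>?F. \<forall>J\<in>?F. M \<subseteq> J \<longrightarrow> J = M" by (rule noeth_maximal[OF K])
    then obtain J where JF: "J \<in> ?F" and Jmax: "\<forall>J'\<in>?F. J \<subseteq> J' \<longrightarrow> J' = J" by (rule bexE)
    have J: "idl J" "adj kr u \<subseteq> J" "1 \<notin> J" "J' \<in> ?F \<Longrightarrow> J \<subseteq> J' \<Longrightarrow> J' = J" for J'
      using JF bspec[OF Jmax, of J'] by simp_all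
    have krJ: "kr \<subseteq> J" by (rule subset_trans[OF adj_superset J(2)])
    have "maximalideal (\<rho> ` J) A"
    proof (rule maximalidealI[OF ideal_image[OF J(1)]])
      show "carrier A \<noteq> \<rho> ` J" using vimage_image[OF J(1) krJ, of 1] J(3) by (metis \<rho>_closed)
      fix Q assume Q: "ideal Q A" "\<rho> ` J \<subseteq> Q" "Q \<subseteq> carrier A"
      show "Q = \<rho> ` J \<or> Q = carrier A"
      proof (cases "\<one> \<in> Q")
        case True
        then show ?thesis using ideal.one_imp_carrier[OF Q(1)] by simp
      next
        case False
        have JQ: "J \<subseteq> \<rho> -` Q" using Q(2) by blast
        then have "\<rho> -` Q \<in> ?F" using ideal_vimage[OF Q(1)] subset_trans[OF J(2)] False by (simp add: \<rho>_one)
        from J(4)[OF this JQ] have "\<rho> -` Q = J" .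
        then show ?thesis using image_vimage[OF Q(1)] by auto
      qed
    qed
    then have "\<rho> ` J = M" by (rule M(2))
    moreover have "u \<in> J" by (rule subsetD[OF J(2) adj_mem[OF idl_kr]])
    ultimately show False using u by blast
  qed
  then show ?thesis using that prim_vimage[OF pM] kr_vimage[OF iM] by blast
qed

lemma max_ideal_image:
  assumes m: "prim m" "kr \<subseteq> m" and unit: "\<And>u. u \<notin> m \<Longrightarrow> \<exists>v. v * u - 1 \<in> kr"
  shows "max_ideal A = \<rho> ` m"
proof (rule max_ideal_eqI(2)[OF ideal_image[OF prim_idl[OF m(1)]]])
  note vi = vimage_image[OF prim_idl[OF m(1)] m(2)]
  show "\<one> \<notin> \<rho> ` m" using vi[of 1] prim_one[OF m(1)] by (simp add: \<rho>_one)
  fix a assume a: "a \<in> carrier A" "a \<notin> \<rho> ` m"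
  obtain u where u: "\<rho> u = a" using \<rho>_surj[OF a(1)] by blast
  then obtain v where "v * u - 1 \<in> kr" using unit[of u] a(2) by blast
  then have "\<rho> v \<otimes> a = \<one>" using \<rho>_eq_iff[of "v * u" 1] u by (simp add: \<rho>_mult \<rho>_one)
  then show "\<exists>b\<in>carrier A. b \<otimes> a = \<one>" by (intro bexI[of _ "\<rho> v"]) auto
qed

lemma krull_dim_chain:
  assumes "pchain kr N c"
  shows "enat N \<le> krull_dim A"
  unfolding krull_dim_def
proof (rule Sup_upper, intro CollectI exI conjI, rule refl)
  have c: "prim (c i)" "kr \<subseteq> c i" if "i \<le> N" for i using assms that by (auto simp: pchain_def)
  show "\<forall>i\<le>N. primeideal (\<rho> ` c i) A" using primeideal_image c by blast
  show "\<forall>i<N. \<rho> ` c i \<subset> \<rho> ` c (Suc i)"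
  proof (intro allI impI psubsetI)
    fix i assume i: "i < N"
    then have lt: "c i \<subset> c (Suc i)" using assms by (auto simp: pchain_def)
    then show "\<rho> ` c i \<subseteq> \<rho> ` c (Suc i)" by blast
    obtain a where a: "a \<in> c (Suc i)" "a \<notin> c i" using lt by blast
    have "\<rho> a \<notin> \<rho> ` c i" using vimage_image[OF prim_idl[OF c(1)] c(2), of i a] i a(2) by simp
    then show "\<rho> ` c i \<noteq> \<rho> ` c (Suc i)" using a(1) by blast
  qed
qed

end

section \<open>Regular sequences on modules of fractions\<close>

text \<open>With \<open>adjm\<close>, \<open>msq\<close> and \<open>mid\<close> this repeats
  \<open>sat\<close>, \<open>adj\<close>, \<open>rsq\<close> and \<open>rsid\<close> for a quotient
  of ideals \<open>C\<close> by \<open>B\<close>. The ring and the conormal module are both of this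
  form, so depth can be handled for the two at once.\<close>

definition csat :: "'p::comm_ring_1 set \<Rightarrow> 'p set \<Rightarrow> 'p set \<Rightarrow> 'p set" where
  "csat p C B = {a \<in> C. \<exists>u. u \<notin> p \<and> u * a \<in> B}"

definition adjm :: "'p::comm_ring_1 set \<Rightarrow> 'p set \<Rightarrow> 'p \<Rightarrow> 'p set" where
  "adjm C B r = {b + r * c | b c. b \<in> B \<and> c \<in> C}"

fun msq :: "'p::comm_ring_1 set \<Rightarrow> 'p set \<Rightarrow> 'p set \<Rightarrow> 'p list \<Rightarrow> bool" where
  "msq p C B [] \<longleftrightarrow> True"
| "msq p C B (r # rs) \<longleftrightarrow> r \<in> p \<and> (\<forall>a\<in>C. r * a \<in> B \<longrightarrow> a \<in> B) \<and> msq p C (csat p C (adjm C B r)) rs"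

fun mid :: "'p::comm_ring_1 set \<Rightarrow> 'p set \<Rightarrow> 'p set \<Rightarrow> 'p list \<Rightarrow> 'p set" where
  "mid p C B [] = B"
| "mid p C B (r # rs) = mid p C (csat p C (adjm C B r)) rs"

lemma csat_UNIV: "csat p UNIV (adjm UNIV K r) = sat p (adj K r)"
  by (auto simp: csat_def adjm_def sat_def adj_def)

lemma msq_UNIV: "msq p UNIV K rs \<longleftrightarrow> rsq p K rs"
  by (induction rs arbitrary: K) (auto simp: csat_UNIV)

lemma mid_UNIV: "mid p UNIV K rs = rsid p K rs"
  by (induction rs arbitrary: K) (auto simp: csat_UNIV)

lemma idl_csat:
  assumes p: "prim p" and C: "idl C" and B: "idl B"
  shows "idl (csat p C B)"
proof -
  have "csat p C B = C \<inter> sat p B" by (auto simp: csat_def sat_def)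
  then show ?thesis using idl_sat[OF p B] C by (auto simp: idl_def)
qed

lemma csat_superset: "prim p \<Longrightarrow> B \<subseteq> C \<Longrightarrow> B \<subseteq> csat p C B"
  using prim_one by (fastforce simp: csat_def)

lemma csat_csat: "prim p \<Longrightarrow> u \<notin> p \<Longrightarrow> a \<in> C \<Longrightarrow> u * a \<in> csat p C B \<Longrightarrow> a \<in> csat p C B"
  unfolding csat_def prim_def by (auto simp: mult.assoc[symmetric])

lemma idl_adjm:
  assumes C: "idl C" and B: "idl B"
  shows "idl (adjm C B r)"
  unfolding idl_def
proof (intro conjI ballI allI)
  show "0 \<in> adjm C B r" unfolding adjm_def using idl_zero[OF C] idl_zero[OF B] by force
next
  fix x y assume "x \<in> adjm C B r" "y \<in> adjm C B r"
  then obtain b c b' c' where *: "b \<in> B" "c \<in> C" "b' \<in> B" "c' \<in> C" "x = b + r * c" "y = b' + r * c'"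
    by (auto simp: adjm_def)
  then have "x + y = (b + b') + r * (c + c')" by (simp add: algebra_simps)
  then show "x + y \<in> adjm C B r" unfolding adjm_def using idl_add[OF B *(1,3)] idl_add[OF C *(2,4)] by blast
next
  fix x y assume "y \<in> adjm C B r"
  then obtain b c where *: "b \<in> B" "c \<in> C" "y = b + r * c" by (auto simp: adjm_def)
  then have "x * y = x * b + r * (x * c)" by (simp add: algebra_simps)
  then show "x * y \<in> adjm C B r" unfolding adjm_def using idl_mult[OF B *(1), of x] idl_mult[OF C *(2), of x] by blast
qed

lemma adjm_bounds:
  assumes C: "idl C" and B: "idl B" "B \<subseteq> C"
  shows "B \<subseteq> adjm C B r" "adjm C B r \<subseteq> C" "a \<in> C \<Longrightarrow> r * a \<in> adjm C B r"
proof -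
  show "B \<subseteq> adjm C B r"
  proof
    fix b assume "b \<in> B"
    then show "b \<in> adjm C B r" unfolding adjm_def using idl_zero[OF C] by (intro CollectI exI[of _ b] exI[of _ 0]) simp
  qed
  show "adjm C B r \<subseteq> C" unfolding adjm_def using idl_mult[OF C] idl_add[OF C] B(2) by auto
  show "r * a \<in> adjm C B r" if "a \<in> C"
    unfolding adjm_def using that idl_zero[OF B(1)] by (intro CollectI exI[of _ 0] exI[of _ a]) simp
qed

definition ssub :: "'p::comm_ring_1 set \<Rightarrow> 'p set \<Rightarrow> 'p set \<Rightarrow> 'p set \<Rightarrow> bool" where
  "ssub p C B M \<longleftrightarrow> idl M \<and> B \<subseteq> M \<and> M \<subseteq> C \<and> (\<forall>u a. u \<notin> p \<longrightarrow> a \<in> C \<longrightarrow> u * a \<in> M \<longrightarrow> a \<in> M)"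

lemma ssub_step:
  assumes p: "prim p" and C: "idl C" and B: "ssub p C B B"
  shows "ssub p C (csat p C (adjm C B r)) (csat p C (adjm C B r))" "B \<subseteq> csat p C (adjm C B r)"
    "a \<in> C \<Longrightarrow> r * a \<in> csat p C (adjm C B r)"
    "ssub p C B M \<Longrightarrow> (\<And>a. a \<in> C \<Longrightarrow> r * a \<in> M) \<Longrightarrow> csat p C (adjm C B r) \<subseteq> M"
proof -
  let ?B = "csat p C (adjm C B r)"
  have iB: "idl B" and BC: "B \<subseteq> C" using B by (auto simp: ssub_def)
  note ab = adjm_bounds[OF C iB BC]
  note cs = csat_superset[OF p ab(2)]
  have "?B \<subseteq> C" by (auto simp: csat_def)
  then show "ssub p C ?B ?B"
    unfolding ssub_def using idl_csat[OF p C idl_adjm[OF C iB]] csat_csat[OF p] by auto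
  show "B \<subseteq> ?B" using ab(1) cs by blast
  show "r * a \<in> ?B" if "a \<in> C" using ab(3)[OF that] cs by blast
  show "?B \<subseteq> M" if M: "ssub p C B M" "\<And>a. a \<in> C \<Longrightarrow> r * a \<in> M"
  proof
    fix a assume "a \<in> ?B"
    then obtain u b c where *: "a \<in> C" "u \<notin> p" "u * a = b + r * c" "b \<in> B" "c \<in> C"
      by (auto simp: csat_def adjm_def)
    have iM: "idl M" using M(1) by (simp add: ssub_def)
    have "b \<in> M" using M(1) *(4) by (auto simp: ssub_def)
    then have "u * a \<in> M" unfolding *(3) by (rule idl_add[OF iM _ M(2)[OF *(5)]])
    then show "a \<in> M" using M(1) *(1,2) by (auto simp: ssub_def)
  qed
qed

text \<open>\<open>mid\<close> is built step by step, whereas the submodule in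
  \<open>regular_sequence\<close> is generated all at once. This universal property identifies the
  two.\<close>

lemma mid_least:
  assumes p: "prim p" and C: "idl C"
  shows "ssub p C B B \<Longrightarrow> ssub p C B (mid p C B rs) \<and> (\<forall>r\<in>set rs. \<forall>a\<in>C. r * a \<in> mid p C B rs) \<and>
    (\<forall>M. ssub p C B M \<longrightarrow> (\<forall>r\<in>set rs. \<forall>a\<in>C. r * a \<in> M) \<longrightarrow> mid p C B rs \<subseteq> M)"
proof (induction rs arbitrary: B)
  case Nil
  then show ?case by (auto simp: ssub_def)
next
  case (Cons r rs)
  let ?B = "csat p C (adjm C B r)"
  note st = ssub_step[OF p C Cons.prems, where r = r]
  note IH = Cons.IH[OF st(1)]
  have up: "?B \<subseteq> mid p C ?B rs" using IH by (auto simp: ssub_def)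
  have 1: "ssub p C B (mid p C ?B rs)" using IH subset_trans[OF st(2) up] by (auto simp: ssub_def)
  have 2: "\<forall>q\<in>set (r # rs). \<forall>a\<in>C. q * a \<in> mid p C ?B rs"
    using IH subsetD[OF up st(3)] by simp
  have 3: "mid p C ?B rs \<subseteq> M" if M: "ssub p C B M" "\<forall>q\<in>set (r # rs). \<forall>a\<in>C. q * a \<in> M" for M
  proof -
    have "?B \<subseteq> M" by (rule st(4)[OF M(1)]) (use M(2) in simp)
    then have "ssub p C ?B M" using M(1) by (simp add: ssub_def)
    then show ?thesis using IH M(2) by simp
  qed
  show ?case using 1 2 3 by simp
qed

lemma msq_nth: "msq p C B rs \<longleftrightarrow>
    (\<forall>i<length rs. rs ! i \<in> p \<and> (\<forall>a\<in>C. rs ! i * a \<in> mid p C B (take i rs) \<longrightarrow> a \<in> mid p C B (take i rs)))"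
proof (induction rs arbitrary: B)
  case (Cons r rs)
  show ?case by (simp only: msq.simps Cons.IH length_Cons All_less_Suc2 nth_Cons_0 nth_Cons_Suc take_Suc_Cons take_0 mid.simps conj_assoc)
qed simp


text \<open>Fractions with numerators in \<open>C\<close> and denominators in \<open>D\<close>. The
  rule \<open>fcong\<close> compares by plain cross multiplication, which suffices for the group and
  module laws; the exact equality criterion follows in \<open>lpres\<close>.\<close>

locale fracs =
  fixes X :: "('m, 'z) ring_scheme" and D C :: "'p::comm_ring_1 set" and \<nu> :: "'p \<Rightarrow> 'p \<Rightarrow> 'm"
  assumes D: "1 \<in> D" "\<And>s t. s \<in> D \<Longrightarrow> t \<in> D \<Longrightarrow> s * t \<in> D" and C: "idl C"
    and fcar: "carrier X = {\<nu> a s |a s. a \<in> C \<and> s \<in> D}"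
    and fzero: "\<zero>\<^bsub>X\<^esub> = \<nu> 0 1"
    and fadd: "\<And>a b s t. a \<in> C \<Longrightarrow> b \<in> C \<Longrightarrow> s \<in> D \<Longrightarrow> t \<in> D \<Longrightarrow> \<nu> a s \<oplus>\<^bsub>X\<^esub> \<nu> b t = \<nu> (t * a + s * b) (s * t)"
    and fcong: "\<And>a b s t. a \<in> C \<Longrightarrow> b \<in> C \<Longrightarrow> s \<in> D \<Longrightarrow> t \<in> D \<Longrightarrow> t * a = s * b \<Longrightarrow> \<nu> a s = \<nu> b t"
begin

lemma fclosed: "a \<in> C \<Longrightarrow> s \<in> D \<Longrightarrow> \<nu> a s \<in> carrier X"
  unfolding fcar by blast

lemma frep: "x \<in> carrier X \<Longrightarrow> (\<And>a s. a \<in> C \<Longrightarrow> s \<in> D \<Longrightarrow> x = \<nu> a s \<Longrightarrow> P) \<Longrightarrow> P"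
  unfolding fcar by blast

lemmas fC = idl_zero[OF C] idl_add[OF C] idl_mult[OF C] idl_minus[OF C] idl_mult'[OF C]

lemma frac_group: "abelian_group X"
proof (rule abelian_groupI)
  show "\<zero>\<^bsub>X\<^esub> \<in> carrier X" unfolding fzero by (intro fclosed fC D)
next
  fix x y assume "x \<in> carrier X" "y \<in> carrier X"
  then show "x \<oplus>\<^bsub>X\<^esub> y \<in> carrier X" by (elim frep) (simp add: fadd fclosed fC D)
next
  fix x y z assume "x \<in> carrier X" "y \<in> carrier X" "z \<in> carrier X"
  then show "x \<oplus>\<^bsub>X\<^esub> y \<oplus>\<^bsub>X\<^esub> z = x \<oplus>\<^bsub>X\<^esub> (y \<oplus>\<^bsub>X\<^esub> z)"
    by (elim frep) (simp add: fadd fC D, rule fcong, simp_all add: fC D algebra_simps)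
next
  fix x y assume "x \<in> carrier X" "y \<in> carrier X"
  then show "x \<oplus>\<^bsub>X\<^esub> y = y \<oplus>\<^bsub>X\<^esub> x"
    by (elim frep) (simp add: fadd fC D, rule fcong, simp_all add: fC D algebra_simps)
next
  fix x assume "x \<in> carrier X"
  then show "\<zero>\<^bsub>X\<^esub> \<oplus>\<^bsub>X\<^esub> x = x" by (elim frep) (simp add: fzero fadd fC D)
next
  fix x assume x: "x \<in> carrier X"
  then show "\<exists>y\<in>carrier X. y \<oplus>\<^bsub>X\<^esub> x = \<zero>\<^bsub>X\<^esub>"
  proof (rule frep)
    fix a s assume a: "a \<in> C" "s \<in> D" "x = \<nu> a s"
    have "\<nu> (- a) s \<oplus>\<^bsub>X\<^esub> x = \<zero>\<^bsub>X\<^esub>"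
      unfolding a(3) fzero fadd[OF idl_minus[OF C a(1)] a(1) a(2) a(2)] by (rule fcong) (simp_all add: fC D a)
    then show ?thesis using fclosed[OF idl_minus[OF C a(1)] a(2)] by blast
  qed
qed

end

lemma fractions_cring:
  assumes F: "fracs A D UNIV \<phi>" and one: "\<one>\<^bsub>A\<^esub> = \<phi> 1 1"
    and mult: "\<And>a b s t. s \<in> D \<Longrightarrow> t \<in> D \<Longrightarrow> \<phi> a s \<otimes>\<^bsub>A\<^esub> \<phi> b t = \<phi> (a * b) (s * t)"
  shows "cring A"
proof -
  interpret fracs A D UNIV \<phi> by (rule F)
  show ?thesis
  proof (rule cringI[OF frac_group])
    show "comm_monoid A"
    proof (rule comm_monoidI)
      fix x y assume "x \<in> carrier A" "y \<in> carrier A"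
      then show "x \<otimes>\<^bsub>A\<^esub> y \<in> carrier A" by (elim frep) (simp add: mult fclosed D)
    next
      show "\<one>\<^bsub>A\<^esub> \<in> carrier A" unfolding one by (simp add: fclosed D)
    next
      fix x y z assume "x \<in> carrier A" "y \<in> carrier A" "z \<in> carrier A"
      then show "x \<otimes>\<^bsub>A\<^esub> y \<otimes>\<^bsub>A\<^esub> z = x \<otimes>\<^bsub>A\<^esub> (y \<otimes>\<^bsub>A\<^esub> z)" by (elim frep) (simp add: mult D mult.assoc)
    next
      fix x assume "x \<in> carrier A"
      then show "\<one>\<^bsub>A\<^esub> \<otimes>\<^bsub>A\<^esub> x = x" by (elim frep) (simp add: one mult D)
    next
      fix x y assume "x \<in> carrier A" "y \<in> carrier A"
      then show "x \<otimes>\<^bsub>A\<^esub> y = y \<otimes>\<^bsub>A\<^esub> x" by (elim frep) (simp add: mult D mult.commute)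
    qed
  next
    fix x y z assume "x \<in> carrier A" "y \<in> carrier A" "z \<in> carrier A"
    then show "(x \<oplus>\<^bsub>A\<^esub> y) \<otimes>\<^bsub>A\<^esub> z = x \<otimes>\<^bsub>A\<^esub> z \<oplus>\<^bsub>A\<^esub> y \<otimes>\<^bsub>A\<^esub> z"
      by (elim frep) (simp add: mult fadd D, rule fcong, simp_all add: D algebra_simps)
  qed
qed

lemma fractions_module:
  fixes A :: "('r, 'y) ring_scheme" and X :: "('r, 'm) module"
  assumes A: "cring A" and FA: "fracs A D UNIV \<phi>" and one: "\<one>\<^bsub>A\<^esub> = \<phi> 1 1"
    and mult: "\<And>a b s t. s \<in> D \<Longrightarrow> t \<in> D \<Longrightarrow> \<phi> a s \<otimes>\<^bsub>A\<^esub> \<phi> b t = \<phi> (a * b) (s * t)"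
    and FX: "fracs X D C \<nu>"
    and smult: "\<And>r a s t. a \<in> C \<Longrightarrow> s \<in> D \<Longrightarrow> t \<in> D \<Longrightarrow> \<phi> r s \<odot>\<^bsub>X\<^esub> \<nu> a t = \<nu> (r * a) (s * t)"
  shows "module A X"
proof -
  interpret A: fracs A D UNIV \<phi> by (rule FA)
  interpret X: fracs X D C \<nu> by (rule FX)
  show ?thesis
  proof (rule moduleI[OF A X.frac_group])
    fix a x assume "a \<in> carrier A" "x \<in> carrier X"
    then show "a \<odot>\<^bsub>X\<^esub> x \<in> carrier X" by (elim A.frep X.frep) (simp add: smult X.fclosed X.fC A.D)
  next
    fix a b x assume "a \<in> carrier A" "b \<in> carrier A" "x \<in> carrier X"
    then show "(a \<oplus>\<^bsub>A\<^esub> b) \<odot>\<^bsub>X\<^esub> x = a \<odot>\<^bsub>X\<^esub> x \<oplus>\<^bsub>X\<^esub> b \<odot>\<^bsub>X\<^esub> x"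
      by (elim A.frep X.frep) (simp add: smult A.fadd X.fadd X.fC A.D, rule X.fcong, simp_all add: X.fC A.D algebra_simps)
  next
    fix a x y assume "a \<in> carrier A" "x \<in> carrier X" "y \<in> carrier X"
    then show "a \<odot>\<^bsub>X\<^esub> (x \<oplus>\<^bsub>X\<^esub> y) = a \<odot>\<^bsub>X\<^esub> x \<oplus>\<^bsub>X\<^esub> a \<odot>\<^bsub>X\<^esub> y"
      by (elim A.frep X.frep) (simp add: smult X.fadd X.fC A.D, rule X.fcong, simp_all add: X.fC A.D algebra_simps)
  next
    fix a b x assume "a \<in> carrier A" "b \<in> carrier A" "x \<in> carrier X"
    then show "(a \<otimes>\<^bsub>A\<^esub> b) \<odot>\<^bsub>X\<^esub> x = a \<odot>\<^bsub>X\<^esub> (b \<odot>\<^bsub>X\<^esub> x)"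
      by (elim A.frep X.frep) (simp add: smult mult X.fC A.D mult.assoc)
  next
    fix x assume "x \<in> carrier X"
    then show "\<one>\<^bsub>A\<^esub> \<odot>\<^bsub>X\<^esub> x = x" by (elim X.frep) (simp add: one smult A.D)
  qed
qed

text \<open>\<open>X\<close> consists of the fractions \<open>\<nu> a s\<close> of elements of \<open>C / B\<close>; the ring itself, without
  localization, is the case \<open>D = {1}\<close>.\<close>

locale lpres = module A X + FX: fracs X D C \<nu>
  for A :: "('r, 'y) ring_scheme" and X :: "('r, 'm) module" and D C :: "'p::comm_ring_1 set" and \<nu> +
  fixes \<phi> :: "'p \<Rightarrow> 'p \<Rightarrow> 'r" and p B :: "'p set"
  assumes p: "prim p" and Dp: "s \<in> D \<Longrightarrow> s \<notin> p" and B: "ssub p C B B"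
    and Acar: "carrier A = {\<phi> r s |r s. s \<in> D}"
    and maxA: "max_ideal A = {\<phi> r s |r s. r \<in> p \<and> s \<in> D}"
    and \<phi>_smult: "\<And>r a s t. a \<in> C \<Longrightarrow> s \<in> D \<Longrightarrow> t \<in> D \<Longrightarrow> \<phi> r s \<odot>\<^bsub>X\<^esub> \<nu> a t = \<nu> (r * a) (s * t)"
    and \<nu>_eq: "\<And>a b s t. a \<in> C \<Longrightarrow> b \<in> C \<Longrightarrow> s \<in> D \<Longrightarrow> t \<in> D \<Longrightarrow> \<nu> a s = \<nu> b t \<Longrightarrow> t * a - s * b \<in> B"
    and \<nu>_eqI: "\<And>a b s t. a \<in> C \<Longrightarrow> b \<in> C \<Longrightarrow> s \<in> D \<Longrightarrow> t \<in> D \<Longrightarrow> t * a - s * b \<in> B \<Longrightarrow> \<nu> a s = \<nu> b t"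
    and unit: "\<And>u. u \<notin> p \<Longrightarrow> \<exists>r s. s \<in> D \<and> (\<forall>a\<in>C. r * (u * a) - s * a \<in> B)"
begin

definition fr :: "'p set \<Rightarrow> 'm set" where "fr M = {\<nu> a s |a s. a \<in> M \<and> s \<in> D}"

lemma mem_fr:
  assumes M: "ssub p C B M" and a: "a \<in> C" "s \<in> D"
  shows "\<nu> a s \<in> fr M \<longleftrightarrow> a \<in> M"
proof
  have iM: "idl M" "B \<subseteq> M" "M \<subseteq> C" using M by (auto simp: ssub_def)
  assume "\<nu> a s \<in> fr M"
  then obtain b t where b: "b \<in> M" "t \<in> D" "\<nu> a s = \<nu> b t" by (auto simp: fr_def)
  have "t * a - s * b \<in> B" by (rule \<nu>_eq) (use a b iM in auto)
  then have "t * a - s * b + s * b \<in> M" using iM idl_add[OF iM(1) _ idl_mult[OF iM(1) b(1), of s]] by blast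
  then show "a \<in> M" using M a(1) Dp[OF b(2)] by (simp add: ssub_def)
qed (use a in \<open>auto simp: fr_def\<close>)

lemma fr_inject: "ssub p C B M \<Longrightarrow> fr M = carrier X \<longleftrightarrow> M = C"
proof
  assume M: "ssub p C B M" and e: "fr M = carrier X"
  have "a \<in> M" if "a \<in> C" for a
    using mem_fr[OF M that FX.D(1)] FX.fclosed[OF that FX.D(1)] unfolding e by blast
  then show "M = C" using M by (auto simp: ssub_def)
qed (auto simp: fr_def FX.fcar)

lemma \<nu>_minus: "a \<in> C \<Longrightarrow> s \<in> D \<Longrightarrow> \<ominus>\<^bsub>X\<^esub> \<nu> a s = \<nu> (- a) s"
proof (rule minus_equality)
  assume a: "a \<in> C" "s \<in> D"
  show "\<nu> (- a) s \<oplus>\<^bsub>X\<^esub> \<nu> a s = \<zero>\<^bsub>X\<^esub>"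
    unfolding FX.fzero FX.fadd[OF idl_minus[OF FX.C a(1)] a(1) a(2) a(2)] by (rule FX.fcong) (simp_all add: FX.fC FX.D a)
qed (auto intro: FX.fclosed FX.fC)

lemma fr_submodule:
  assumes M: "ssub p C B M"
  shows "submodule (fr M) A X"
proof (rule submoduleI)
  have iM: "idl M" "B \<subseteq> M" "M \<subseteq> C" using M by (auto simp: ssub_def)
  show "fr M \<subseteq> carrier X" using iM(3) by (auto simp: fr_def FX.fcar)
  show "\<zero>\<^bsub>X\<^esub> \<in> fr M" unfolding FX.fzero fr_def using idl_zero[OF iM(1)] FX.D by blast
  fix x assume "x \<in> fr M"
  then obtain a s where a: "a \<in> M" "s \<in> D" "x = \<nu> a s" by (auto simp: fr_def)
  have aC: "a \<in> C" using a(1) iM(3) by blast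
  show "\<ominus>\<^bsub>X\<^esub> x \<in> fr M"
    unfolding a(3) \<nu>_minus[OF aC a(2)] using idl_minus[OF iM(1) a(1)] a(2) by (auto simp: fr_def)
  show "r \<odot>\<^bsub>X\<^esub> x \<in> fr M" if "r \<in> carrier A" for r
  proof -
    have "\<exists>q t. t \<in> D \<and> r = \<phi> q t" using that unfolding Acar by blast
    then obtain q t where "t \<in> D" "r = \<phi> q t" by blast
    then show ?thesis using \<phi>_smult[OF aC] a idl_mult[OF iM(1) a(1), of q] FX.D(2)[of t s]
      unfolding fr_def by (intro CollectI exI[of _ "q * a"] exI[of _ "t * s"]) simp
  qed
  fix y assume "y \<in> fr M"
  then obtain b t where b: "b \<in> M" "t \<in> D" "y = \<nu> b t" by (auto simp: fr_def)
  have bC: "b \<in> C" using b(1) iM(3) by blast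
  have "t * a + s * b \<in> M" by (intro idl_add[OF iM(1)] idl_mult[OF iM(1)] a b)
  then show "x \<oplus>\<^bsub>X\<^esub> y \<in> fr M"
    unfolding a(3) b(3) FX.fadd[OF aC bC a(2) b(2)] using FX.D(2)[OF a(2) b(2)] by (auto simp: fr_def)
qed

lemma submodule_ssub:
  assumes H: "submodule H A X"
  shows "ssub p C B {a \<in> C. \<nu> a 1 \<in> H}"
proof -
  note HE = submoduleE[OF H]
  have sc: "\<nu> (r * a) (s * t) \<in> H" if "\<nu> a t \<in> H" "a \<in> C" "s \<in> D" "t \<in> D" for r a s t
    using HE(4)[of "\<phi> r s" "\<nu> a t"] that \<phi>_smult[of a s t r] Acar by auto
  have "\<nu> (r * a) 1 \<in> H" if "\<nu> a 1 \<in> H" "a \<in> C" for r a using sc[OF that FX.D(1) FX.D(1), of r] by simp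
  moreover have "\<nu> (a + b) 1 \<in> H" if "\<nu> a 1 \<in> H" "\<nu> b 1 \<in> H" "a \<in> C" "b \<in> C" for a b
    using HE(5)[OF that(1,2)] FX.fadd[OF that(3,4) FX.D(1) FX.D(1)] by simp
  moreover have z: "\<nu> 0 1 \<in> H"
    unfolding FX.fzero[symmetric] by (rule subgroup.one_closed[OF submodule.axioms(1)[OF H], simplified])
  ultimately have i: "idl {a \<in> C. \<nu> a 1 \<in> H}" by (simp add: idl_def FX.fC)
  have "a \<in> C \<and> \<nu> a 1 \<in> H" if "a \<in> B" for a
  proof -
    have aC: "a \<in> C" using that B by (auto simp: ssub_def)
    have "\<nu> a 1 = \<nu> 0 1" by (rule \<nu>_eqI) (use aC FX.D FX.fC that in auto)
    then show ?thesis using aC z by simp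
  qed
  moreover have "\<nu> a 1 \<in> H" if u: "u \<notin> p" "a \<in> C" "\<nu> (u * a) 1 \<in> H" for u a
  proof -
    obtain r s where s: "s \<in> D" "r * (u * a) - s * a \<in> B" using unit[OF u(1)] u(2) by blast
    have "\<nu> (r * (u * a)) (s * 1) \<in> H" by (rule sc[OF u(3) _ s(1) FX.D(1)]) (simp add: FX.fC u)
    moreover have "\<nu> (r * (u * a)) s = \<nu> a 1" by (rule \<nu>_eqI) (use u s FX.D in \<open>simp_all add: FX.fC\<close>)
    ultimately show ?thesis by simp
  qed
  ultimately show ?thesis unfolding ssub_def using i by blast
qed

text \<open>One inclusion holds because \<open>fr\<close> of a saturated submodule is a submodule.
  For the other, the contraction of any submodule is saturated, so the minimality of
  \<open>mid\<close> applies.\<close>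

lemma ideal_times_eq:
  assumes "list_all2 (\<lambda>x r. \<exists>s\<in>D. x = \<phi> r s) xs rs"
  shows "ideal_times A (set xs) X = fr (mid p C B rs)"
proof
  let ?G = "{a \<odot>\<^bsub>X\<^esub> x |a x. a \<in> set xs \<and> x \<in> carrier X}"
  note ml = mid_least[OF p FX.C B, of rs]
  then have M: "ssub p C B (mid p C B rs)" by blast
  have "?G \<subseteq> fr (mid p C B rs)"
  proof
    fix z assume "z \<in> ?G"
    then obtain a x where z: "z = a \<odot>\<^bsub>X\<^esub> x" "a \<in> set xs" "x \<in> carrier X" by blast
    then obtain i where i: "i < length xs" "a = xs ! i" by (metis in_set_conv_nth)
    obtain s where s: "s \<in> D" "a = \<phi> (rs ! i) s" using list_all2_nthD[OF assms i(1)] i(2) by blast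
    obtain c t where c: "c \<in> C" "t \<in> D" "x = \<nu> c t" using z(3) by (auto simp: FX.fcar)
    have "rs ! i \<in> set rs" using i(1) list_all2_lengthD[OF assms] by simp
    then have "rs ! i * c \<in> mid p C B rs" using ml c(1) by blast
    then show "z \<in> fr (mid p C B rs)" unfolding z(1) s(2) c(3) \<phi>_smult[OF c(1) s(1) c(2)]
      using FX.D(2)[OF s(1) c(2)] by (auto simp: fr_def)
  qed
  then show "ideal_times A (set xs) X \<subseteq> fr (mid p C B rs)"
    unfolding ideal_times_def gen_submodule_def using fr_submodule[OF M] by blast
  show "fr (mid p C B rs) \<subseteq> ideal_times A (set xs) X"
    unfolding ideal_times_def gen_submodule_def
  proof (rule Inter_greatest)
    fix H assume "H \<in> {H. submodule H A X \<and> ?G \<subseteq> H}"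
    then have H: "submodule H A X" "?G \<subseteq> H" by auto
    have "mid p C B rs \<subseteq> {a \<in> C. \<nu> a 1 \<in> H}"
    proof -
      have "r * a \<in> C \<and> \<nu> (r * a) 1 \<in> H" if r: "r \<in> set rs" "a \<in> C" for r a
      proof -
        obtain i where i: "i < length rs" "r = rs ! i" using r(1) by (metis in_set_conv_nth)
        then have il: "i < length xs" using list_all2_lengthD[OF assms] by simp
        obtain s where s: "s \<in> D" "xs ! i = \<phi> r s" using list_all2_nthD[OF assms il] i(2) by blast
        have "\<phi> r s \<odot>\<^bsub>X\<^esub> \<nu> (s * a) 1 \<in> H"
          using H(2) s(2) il FX.fclosed[of "s * a" 1] FX.fC(3)[OF r(2)] FX.D(1) nth_mem by fastforce
        then have "\<nu> (r * (s * a)) (s * 1) \<in> H" using \<phi>_smult[of "s * a" s 1 r] FX.fC(3)[OF r(2)] s(1) FX.D(1) by simp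
        moreover have "\<nu> (r * (s * a)) (s * 1) = \<nu> (r * a) 1"
          by (rule FX.fcong) (simp_all add: FX.fC FX.D r s mult.left_commute)
        ultimately show ?thesis using FX.fC(3)[OF r(2)] by simp
      qed
      then show ?thesis using ml submodule_ssub[OF H(1)] by blast
    qed
    moreover have "\<nu> a s \<in> H" if a: "a \<in> C" "\<nu> a 1 \<in> H" "s \<in> D" for a s
    proof -
      have "\<phi> 1 s \<odot>\<^bsub>X\<^esub> \<nu> a 1 \<in> H" by (rule submoduleE(4)[OF H(1) _ a(2)]) (use Acar a(3) in auto)
      then show ?thesis using \<phi>_smult[OF a(1) a(3) FX.D(1)] by simp
    qed
    ultimately show "fr (mid p C B rs) \<subseteq> H" by (auto simp: fr_def)
  qed
qed

text \<open>Denominators act invertibly, so regularity of a sequence of fractions depends only on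
  the numerators.\<close>

lemma regular_sequence_iff:
  assumes l: "list_all2 (\<lambda>x r. r \<in> p \<and> (\<exists>s\<in>D. x = \<phi> r s)) xs rs"
  shows "regular_sequence A X xs \<longleftrightarrow> msq p C B rs \<and> mid p C B rs \<noteq> C"
proof -
  have l': "list_all2 (\<lambda>x r. \<exists>s\<in>D. x = \<phi> r s) xs rs" by (rule list_all2_mono[OF l]) blast
  have len: "length xs = length rs" using list_all2_lengthD[OF l] .
  have M: "ssub p C B (mid p C B rs)" for rs using mid_least[OF p FX.C B] by blast
  have it: "ideal_times A (set (take i xs)) X = fr (mid p C B (take i rs))" for i
    by (rule ideal_times_eq[OF list_all2_takeI[OF l']])
  have "set xs \<subseteq> carrier A"
  proof
    fix x assume "x \<in> set xs"
    then obtain i where "i < length xs" "x = xs ! i" by (metis in_set_conv_nth)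
    then show "x \<in> carrier A" using list_all2_nthD[OF l'] Acar by blast
  qed
  moreover have "(\<forall>y\<in>carrier X. xs ! i \<odot>\<^bsub>X\<^esub> y \<in> ideal_times A (set (take i xs)) X \<longrightarrow> y \<in> ideal_times A (set (take i xs)) X)
     \<longleftrightarrow> (\<forall>a\<in>C. rs ! i * a \<in> mid p C B (take i rs) \<longrightarrow> a \<in> mid p C B (take i rs))" (is "?L \<longleftrightarrow> ?R") if i: "i < length xs" for i
  proof -
    obtain s where s: "s \<in> D" "xs ! i = \<phi> (rs ! i) s" using list_all2_nthD[OF l i] by blast
    have e: "(xs ! i \<odot>\<^bsub>X\<^esub> \<nu> a t \<in> fr (mid p C B (take i rs)) \<longrightarrow> \<nu> a t \<in> fr (mid p C B (take i rs)))
       \<longleftrightarrow> (rs ! i * a \<in> mid p C B (take i rs) \<longrightarrow> a \<in> mid p C B (take i rs))" if a: "a \<in> C" "t \<in> D" for a t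
      unfolding s(2) \<phi>_smult[OF a(1) s(1) a(2)] mem_fr[OF M a] mem_fr[OF M FX.fC(3)[OF a(1)] FX.D(2)[OF s(1) a(2)]] ..
    show ?thesis unfolding it
    proof
      assume h: "\<forall>y\<in>carrier X. xs ! i \<odot>\<^bsub>X\<^esub> y \<in> fr (mid p C B (take i rs)) \<longrightarrow> y \<in> fr (mid p C B (take i rs))"
      show ?R
      proof
        fix a assume a: "a \<in> C"
        show "rs ! i * a \<in> mid p C B (take i rs) \<longrightarrow> a \<in> mid p C B (take i rs)"
          unfolding e[OF a FX.D(1), symmetric] by (rule bspec[OF h FX.fclosed[OF a FX.D(1)]])
      qed
    next
      assume h: ?R
      show "\<forall>y\<in>carrier X. xs ! i \<odot>\<^bsub>X\<^esub> y \<in> fr (mid p C B (take i rs)) \<longrightarrow> y \<in> fr (mid p C B (take i rs))"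
      proof
        fix y assume "y \<in> carrier X"
        then obtain a t where a: "a \<in> C" "t \<in> D" "y = \<nu> a t" by (auto simp: FX.fcar)
        show "xs ! i \<odot>\<^bsub>X\<^esub> y \<in> fr (mid p C B (take i rs)) \<longrightarrow> y \<in> fr (mid p C B (take i rs))"
          unfolding a(3) e[OF a(1,2)] by (rule bspec[OF h a(1)])
      qed
    qed
  qed
  moreover have "rs ! i \<in> p" if "i < length xs" for i using list_all2_nthD[OF l that] by blast
  ultimately show ?thesis
    unfolding regular_sequence_def msq_nth ideal_times_eq[OF l'] fr_inject[OF M] len by auto
qed

lemma trivial_iff: "trivial_module X \<longleftrightarrow> C \<subseteq> B"
proof -
  have BC: "B \<subseteq> C" using B by (simp add: ssub_def)
  have "x = \<zero>\<^bsub>X\<^esub>" if CB: "C \<subseteq> B" and x: "x \<in> carrier X" for x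
  proof -
    obtain a s where a: "a \<in> C" "s \<in> D" "x = \<nu> a s" using x FX.fcar by auto
    show ?thesis unfolding a(3) FX.fzero by (rule \<nu>_eqI) (use a CB FX.D FX.fC in auto)
  qed
  moreover have "a \<in> B" if "trivial_module X" "a \<in> C" for a
  proof -
    have "\<nu> a 1 = \<nu> 0 1" using that FX.fclosed[OF that(2) FX.D(1)] FX.fzero by (auto simp: trivial_module_def)
    from \<nu>_eq[OF that(2) FX.fC(1) FX.D(1) FX.D(1) this] show ?thesis by simp
  qed
  ultimately show ?thesis unfolding trivial_module_def using FX.frac_group abelian_group.axioms(1) abelian_monoid.zero_closed by blast
qed

lemma max_list:
  assumes "set xs \<subseteq> max_ideal A"
  obtains rs where "list_all2 (\<lambda>x r. r \<in> p \<and> (\<exists>s\<in>D. x = \<phi> r s)) xs rs"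
proof -
  have "\<exists>rs. list_all2 (\<lambda>x r. r \<in> p \<and> (\<exists>s\<in>D. x = \<phi> r s)) xs rs" using assms
  proof (induction xs)
    case Nil
    then show ?case by (intro exI[of _ "[]"]) simp
  next
    case (Cons x xs)
    then obtain rs where "list_all2 (\<lambda>x r. r \<in> p \<and> (\<exists>s\<in>D. x = \<phi> r s)) xs rs" by auto
    moreover obtain r s where "r \<in> p" "s \<in> D" "x = \<phi> r s" using Cons.prems maxA by auto
    ultimately have "list_all2 (\<lambda>x r. r \<in> p \<and> (\<exists>s\<in>D. x = \<phi> r s)) (x # xs) (r # rs)" by auto
    then show ?case by blast
  qed
  then show ?thesis using that by blast
qed

lemma depth_ge:
  assumes "enat i \<le> depth A X" "\<not> C \<subseteq> B" "0 < i"
  obtains rs where "msq p C B rs" "mid p C B rs \<noteq> C" "i \<le> length rs"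
proof -
  let ?S = "{enat (length xs) |xs. set xs \<subseteq> max_ideal A \<and> regular_sequence A X xs}"
  have "enat i \<le> Sup ?S" using assms(1,2) trivial_iff by (simp add: depth_def)
  \<comment> \<open>The supremum in \<open>enat\<close> need not be attained. As
    \<open>0 < i\<close>, a sequence longer than \<open>i - 1\<close> has length at least
    \<open>i\<close>.\<close>
  then have "\<not> Sup ?S \<le> enat (i - 1)" using order_trans[of "enat i" "Sup ?S" "enat (i - 1)"] assms(3) by auto
  then have "\<exists>z\<in>?S. \<not> z \<le> enat (i - 1)" using Sup_least[of ?S "enat (i - 1)"] by blast
  then obtain xs where xs: "set xs \<subseteq> max_ideal A" "regular_sequence A X xs" "\<not> length xs \<le> i - 1" by auto
  obtain rs where l: "list_all2 (\<lambda>x r. r \<in> p \<and> (\<exists>s\<in>D. x = \<phi> r s)) xs rs" using max_list[OF xs(1)] by blast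
  have "i \<le> length rs" using xs(3) list_all2_lengthD[OF l] by simp
  then show ?thesis using that regular_sequence_iff[OF l] xs(2) by blast
qed

lemma depth_le:
  assumes "msq p C B rs" "mid p C B rs \<noteq> C"
  shows "enat (length rs) \<le> depth A X"
proof (cases "trivial_module X")
  case False
  let ?xs = "map (\<lambda>r. \<phi> r 1) rs"
  have rp: "r \<in> p" if "r \<in> set rs" for r using assms(1) that unfolding msq_nth by (metis in_set_conv_nth)
  have "list_all2 (\<lambda>x r. r \<in> p \<and> (\<exists>s\<in>D. x = \<phi> r s)) ?xs rs"
    using rp FX.D(1) by (auto simp: list_all2_conv_all_nth)
  then have "regular_sequence A X ?xs" using regular_sequence_iff assms by blast
  moreover have "set ?xs \<subseteq> max_ideal A" using rp FX.D(1) unfolding maxA by auto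
  ultimately have "enat (length ?xs) \<in> {enat (length xs) |xs. set xs \<subseteq> max_ideal A \<and> regular_sequence A X xs}" by blast
  then have "enat (length ?xs) \<le> depth A X" unfolding depth_def using False by (simp only: if_False) (rule Sup_upper)
  then show ?thesis by simp
qed (simp add: depth_def)

end

section \<open>Localizations of presented modules\<close>

locale subq = rpres A \<rho> for A :: "('r, 'y) ring_scheme" (structure) and \<rho> :: "'p::comm_ring_1 \<Rightarrow> 'r" +
  fixes X :: "('r, 'm) module" and C B :: "'p set" and \<theta> :: "'p \<Rightarrow> 'm"
  assumes CB: "idl C" "idl B" "B \<subseteq> C"
    and \<theta>_closed: "a \<in> C \<Longrightarrow> \<theta> a \<in> carrier X" and \<theta>_surj: "x \<in> carrier X \<Longrightarrow> \<exists>a\<in>C. x = \<theta> a"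
    and \<theta>_add: "a \<in> C \<Longrightarrow> b \<in> C \<Longrightarrow> \<theta> (a + b) = \<theta> a \<oplus>\<^bsub>X\<^esub> \<theta> b"
    and \<theta>_smult: "a \<in> C \<Longrightarrow> \<theta> (r * a) = \<rho> r \<odot>\<^bsub>X\<^esub> \<theta> a"
    and \<theta>_eq: "a \<in> C \<Longrightarrow> b \<in> C \<Longrightarrow> \<theta> a = \<theta> b \<longleftrightarrow> a - b \<in> B"
    and \<theta>_zero: "\<theta> 0 = \<zero>\<^bsub>X\<^esub>"
begin

lemma kr_mult: "k \<in> kr \<Longrightarrow> a \<in> C \<Longrightarrow> k * a \<in> B"
proof -
  assume k: "k \<in> kr" and a: "a \<in> C"
  have "\<theta> (k * a) = \<theta> (0 * a)" unfolding \<theta>_smult[OF a] using k by (simp add: kr_def \<rho>_zero)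
  moreover have "k * a \<in> C" "0 * a \<in> C" by (intro idl_mult[OF CB(1) a])+
  ultimately show ?thesis using \<theta>_eq by fastforce
qed

end

lemma (in rpres) subq_ring: "subq A \<rho> (ring_as_module A) UNIV kr \<rho>"
  by unfold_locales (use \<rho>_surj in \<open>auto simp: idl_def idl_kr[unfolded idl_def] ring_as_module_def \<rho>_add \<rho>_mult \<rho>_eq_iff \<rho>_zero\<close>)

lemma (in subq) subq_fracs: "fracs X {1} C (\<lambda>a s. \<theta> a)"
  by unfold_locales (use CB \<theta>_closed \<theta>_surj \<theta>_zero \<theta>_add in auto)

lemma (in subq) subq_module: "module A X"
proof -
  interpret R: subq A \<rho> "ring_as_module A" UNIV kr \<rho> by (rule subq_ring)
  have "fracs A {1} UNIV (\<lambda>a s. \<rho> a)"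
    using R.subq_fracs by (simp add: fracs_def ring_as_module_def)
  then show ?thesis
    by (rule fractions_module[OF is_cring _ _ _ subq_fracs]) (auto simp: \<rho>_one \<rho>_mult \<theta>_smult)
qed

locale subq_prime = subq A \<rho> X C B \<theta> for A :: "('r, 'y) ring_scheme" (structure)
    and \<rho> :: "'p::comm_ring_1 \<Rightarrow> 'r" and X :: "('r, 'm) module" and C B \<theta> +
  fixes p :: "'p set"
  assumes p: "prim p" "kr \<subseteq> p"
begin

abbreviation "W \<equiv> carrier A - \<rho> ` p"
abbreviation "Bs \<equiv> csat p C B"
abbreviation "fr a s \<equiv> loc_frac W X (\<theta> a) (\<rho> s)"

lemma W_iff: "\<rho> u \<in> W \<longleftrightarrow> u \<notin> p"
  using vimage_image[OF prim_idl[OF p(1)] p(2)] by simp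

lemma W_rep: "w \<in> W \<Longrightarrow> \<exists>u. u \<notin> p \<and> w = \<rho> u"
  using \<rho>_surj by fastforce

lemma idl_Bs: "idl Bs" by (rule idl_csat[OF p(1) CB(1,2)])
lemma Bs_C: "Bs \<subseteq> C" by (auto simp: csat_def)

lemma mem_frac:
  assumes "a \<in> C" "b \<in> C" "v \<notin> p"
  shows "(\<theta> b, \<rho> v) \<in> fr a s \<longleftrightarrow> v * a - s * b \<in> Bs"
proof -
  have C: "v * a \<in> C" "s * b \<in> C" using idl_mult[OF CB(1)] assms by auto
  have e: "\<rho> u \<odot>\<^bsub>X\<^esub> (\<rho> v \<odot>\<^bsub>X\<^esub> \<theta> a) = \<rho> u \<odot>\<^bsub>X\<^esub> (\<rho> s \<odot>\<^bsub>X\<^esub> \<theta> b) \<longleftrightarrow> u * (v * a - s * b) \<in> B" for u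
    unfolding \<theta>_smult[OF assms(1), symmetric] \<theta>_smult[OF assms(2), symmetric] \<theta>_smult[OF C(1), symmetric] \<theta>_smult[OF C(2), symmetric]
      \<theta>_eq[OF idl_mult[OF CB(1) C(1)] idl_mult[OF CB(1) C(2)]] by (simp add: right_diff_distrib)
  have "(\<theta> b, \<rho> v) \<in> fr a s \<longleftrightarrow> (\<exists>u\<in>W. u \<odot>\<^bsub>X\<^esub> (\<rho> v \<odot>\<^bsub>X\<^esub> \<theta> a) = u \<odot>\<^bsub>X\<^esub> (\<rho> s \<odot>\<^bsub>X\<^esub> \<theta> b))"
    using \<theta>_closed[OF assms(2)] assms(3) W_iff by (simp add: loc_frac_def)
  also have "\<dots> \<longleftrightarrow> (\<exists>u. u \<notin> p \<and> \<rho> u \<odot>\<^bsub>X\<^esub> (\<rho> v \<odot>\<^bsub>X\<^esub> \<theta> a) = \<rho> u \<odot>\<^bsub>X\<^esub> (\<rho> s \<odot>\<^bsub>X\<^esub> \<theta> b))"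
    using W_iff W_rep by metis
  finally show ?thesis unfolding e csat_def using idl_diff[OF CB(1) C] by simp
qed

lemma frac_rep:
  assumes "z \<in> fr a s"
  obtains b v where "b \<in> C" "v \<notin> p" "z = (\<theta> b, \<rho> v)"
  using assms \<theta>_surj W_rep unfolding loc_frac_def by blast

lemma frac_self: "a \<in> C \<Longrightarrow> s \<notin> p \<Longrightarrow> (\<theta> a, \<rho> s) \<in> fr a s"
  unfolding mem_frac using idl_zero[OF idl_Bs] by simp

lemma frac_eq:
  assumes "a \<in> C" "b \<in> C" "s \<notin> p" "t \<notin> p"
  shows "fr a s = fr b t \<longleftrightarrow> t * a - s * b \<in> Bs"
proof
  assume "fr a s = fr b t"
  then have "(\<theta> b, \<rho> t) \<in> fr a s" using frac_self[OF assms(2,4)] by simp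
  then show "t * a - s * b \<in> Bs" using mem_frac assms by simp
next
  assume d: "t * a - s * b \<in> Bs"
  have "z \<in> fr a s \<longleftrightarrow> z \<in> fr b t" if zz: "\<exists>c v. c \<in> C \<and> v \<notin> p \<and> z = (\<theta> c, \<rho> v)" for z
  proof -
    obtain c v where z: "c \<in> C" "v \<notin> p" "z = (\<theta> c, \<rho> v)" using zz by blast
    have e: "t * (v * a - s * c) = v * (t * a - s * b) + s * (v * b - t * c)" by (simp add: algebra_simps)
    have cl: "v * a - s * c \<in> C" "v * b - t * c \<in> C" using idl_mult[OF CB(1)] assms z(1) idl_diff[OF CB(1)] by auto
    have "v * a - s * c \<in> Bs \<longleftrightarrow> v * b - t * c \<in> Bs"
    proof
      assume "v * a - s * c \<in> Bs"
      from idl_diff[OF idl_Bs idl_mult[OF idl_Bs this] idl_mult[OF idl_Bs d]]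
      have "t * (v * a - s * c) - v * (t * a - s * b) \<in> Bs" .
      then have "s * (v * b - t * c) \<in> Bs" unfolding e by simp
      then show "v * b - t * c \<in> Bs" by (rule csat_csat[OF p(1) assms(3) cl(2)])
    next
      assume "v * b - t * c \<in> Bs"
      then have "t * (v * a - s * c) \<in> Bs" unfolding e by (rule idl_add[OF idl_Bs idl_mult[OF idl_Bs d] idl_mult[OF idl_Bs]])
      then show "v * a - s * c \<in> Bs" by (rule csat_csat[OF p(1) assms(4) cl(1)])
    qed
    then show ?thesis unfolding z(3) mem_frac[OF assms(1) z(1,2)] mem_frac[OF assms(2) z(1,2)] .
  qed
  then show "fr a s = fr b t" using frac_rep by (metis Set.set_eqI)
qed

text \<open>The operations on classes are unions over representatives. If every representative gives
  the same value, the union is this value, because a class is never empty.\<close>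

lemma UN_frac:
  assumes a: "a \<in> C" "s \<notin> p"
    and F: "\<And>b v. b \<in> C \<Longrightarrow> v \<notin> p \<Longrightarrow> v * a - s * b \<in> Bs \<Longrightarrow> F (\<theta> b) (\<rho> v) = Z"
  shows "(\<Union>(x, t)\<in>fr a s. F x t) = Z"
proof -
  have "(case z of (x, t) \<Rightarrow> F x t) = Z" if "z \<in> fr a s" for z
    using frac_rep[OF that] that mem_frac[OF a(1)] F by (metis case_prod_conv)
  then show ?thesis using frac_self[OF a] by blast
qed

lemma frac_add:
  assumes "a \<in> C" "b \<in> C" "s \<notin> p" "t \<notin> p"
  shows "fr a s \<oplus>\<^bsub>loc_module A W X\<^esub> fr b t = fr (t * a + s * b) (s * t)"
proof -
  have "fr a s \<oplus>\<^bsub>loc_module A W X\<^esub> fr b t = (\<Union>(x, q)\<in>fr a s. \<Union>(y, r)\<in>fr b t. loc_frac W X (r \<odot>\<^bsub>X\<^esub> x \<oplus>\<^bsub>X\<^esub> q \<odot>\<^bsub>X\<^esub> y) (q \<otimes> r))"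
    by (simp add: loc_module_def)
  also have "\<dots> = fr (t * a + s * b) (s * t)"
  proof (rule UN_frac[OF assms(1,3)], rule UN_frac[OF assms(2,4)])
    fix a' s' b' t' assume *: "a' \<in> C" "s' \<notin> p" "s' * a - s * a' \<in> Bs" "b' \<in> C" "t' \<notin> p" "t' * b - t * b' \<in> Bs"
    have "\<rho> t' \<odot>\<^bsub>X\<^esub> \<theta> a' \<oplus>\<^bsub>X\<^esub> \<rho> s' \<odot>\<^bsub>X\<^esub> \<theta> b' = \<theta> (t' * a' + s' * b')"
      using * by (simp add: \<theta>_add \<theta>_smult idl_mult[OF CB(1)])
    moreover have "\<rho> s' \<otimes> \<rho> t' = \<rho> (s' * t')" by (simp add: \<rho>_mult)
    moreover have "fr (t' * a' + s' * b') (s' * t') = fr (t * a + s * b) (s * t)"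
    proof (subst frac_eq)
      have "s * t * (t' * a' + s' * b') - s' * t' * (t * a + s * b) = - (t' * t * (s' * a - s * a') + s * s' * (t' * b - t * b'))"
        by (simp add: algebra_simps)
      also have "\<dots> \<in> Bs" by (intro idl_minus[OF idl_Bs] idl_add[OF idl_Bs] idl_mult[OF idl_Bs] *)
      finally show "s * t * (t' * a' + s' * b') - s' * t' * (t * a + s * b) \<in> Bs" .
    qed (use assms * p(1) in \<open>auto simp: prim_def intro!: idl_add[OF CB(1)] idl_mult[OF CB(1)]\<close>)
    ultimately show "loc_frac W X (\<rho> t' \<odot>\<^bsub>X\<^esub> \<theta> a' \<oplus>\<^bsub>X\<^esub> \<rho> s' \<odot>\<^bsub>X\<^esub> \<theta> b') (\<rho> s' \<otimes> \<rho> t') = fr (t * a + s * b) (s * t)" by simp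
  qed
  finally show ?thesis .
qed

lemma carrier_loc: "carrier (loc_module A W X) = {fr a s |a s. a \<in> C \<and> s \<in> - p}"
proof -
  have "\<exists>a s. loc_frac W X x w = fr a s \<and> a \<in> C \<and> s \<in> - p" if "x \<in> carrier X" "w \<in> W" for x w
    using \<theta>_surj[OF that(1)] W_rep[OF that(2)] by auto
  moreover have "\<exists>x w. fr a s = loc_frac W X x w \<and> x \<in> carrier X \<and> w \<in> W" if "a \<in> C" "s \<in> - p" for a s
    using \<theta>_closed[OF that(1)] W_iff[of s] that(2) by blast
  ultimately show ?thesis unfolding loc_module_def by (simp add: set_eq_iff) metis
qed

lemma fracs_loc: "fracs (loc_module A W X) (- p) C (\<lambda>a s. fr a s)"
proof
  show "1 \<in> - p" using prim_one[OF p(1)] by simp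
  show "s * t \<in> - p" if "s \<in> - p" "t \<in> - p" for s t using that p(1) by (auto simp: prim_def)
  show "idl C" by (rule CB)
  show "carrier (loc_module A W X) = {fr a s |a s. a \<in> C \<and> s \<in> - p}" by (rule carrier_loc)
  show "\<zero>\<^bsub>loc_module A W X\<^esub> = fr 0 1" by (simp add: loc_module_def \<theta>_zero \<rho>_one)
  show "fr a s \<oplus>\<^bsub>loc_module A W X\<^esub> fr b t = fr (t * a + s * b) (s * t)"
    if "a \<in> C" "b \<in> C" "s \<in> - p" "t \<in> - p" for a b s t using frac_add that by simp
  show "fr a s = fr b t" if "a \<in> C" "b \<in> C" "s \<in> - p" "t \<in> - p" "t * a = s * b" for a b s t
    using frac_eq that idl_zero[OF idl_Bs] by simp
qed

abbreviation "rf r s \<equiv> loc_frac W (ring_as_module A) (\<rho> r) (\<rho> s)"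

lemma frac_smult:
  assumes "a \<in> C" "s \<notin> p" "t \<notin> p"
  shows "rf r s \<odot>\<^bsub>loc_module A W X\<^esub> fr a t = fr (r * a) (s * t)"
proof -
  interpret R: subq_prime A \<rho> "ring_as_module A" UNIV kr \<rho> p
    by (intro subq_prime.intro subq_prime_axioms.intro subq_ring p)
  have "rf r s \<odot>\<^bsub>loc_module A W X\<^esub> fr a t = (\<Union>(b, q)\<in>rf r s. \<Union>(x, u)\<in>fr a t. loc_frac W X (b \<odot>\<^bsub>X\<^esub> x) (q \<otimes> u))"
    by (simp add: loc_module_def)
  also have "\<dots> = fr (r * a) (s * t)"
  proof (rule R.UN_frac[OF UNIV_I assms(2)], rule UN_frac[OF assms(1,3)])
    fix r' s' a' t' assume *: "s' \<notin> p" "s' * r - s * r' \<in> csat p UNIV kr" "a' \<in> C" "t' \<notin> p" "t' * a - t * a' \<in> Bs"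
    have "\<rho> r' \<odot>\<^bsub>X\<^esub> \<theta> a' = \<theta> (r' * a')" using * by (simp add: \<theta>_smult)
    moreover have "\<rho> s' \<otimes> \<rho> t' = \<rho> (s' * t')" by (simp add: \<rho>_mult)
    moreover have "fr (r' * a') (s' * t') = fr (r * a) (s * t)"
    proof (subst frac_eq)
      obtain u where u: "u \<notin> p" "u * (s' * r - s * r') \<in> kr" using *(2) by (auto simp: csat_def)
      have "u * (s' * r - s * r') * (t' * a) \<in> B" by (rule kr_mult[OF u(2) idl_mult[OF CB(1) assms(1)]])
      then have "u * ((s' * r - s * r') * (t' * a)) \<in> B" by (simp add: mult.assoc)
      then have "(s' * r - s * r') * (t' * a) \<in> Bs"
        unfolding csat_def using u(1) idl_mult[OF CB(1) idl_mult[OF CB(1) assms(1)]] by blast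
      then have "- ((s' * r - s * r') * (t' * a) + s * r' * (t' * a - t * a')) \<in> Bs"
        by (intro idl_minus[OF idl_Bs] idl_add[OF idl_Bs] idl_mult[OF idl_Bs *(5)])
      moreover have "- ((s' * r - s * r') * (t' * a) + s * r' * (t' * a - t * a')) = s * t * (r' * a') - s' * t' * (r * a)"
        by (simp add: algebra_simps)
      ultimately show "s * t * (r' * a') - s' * t' * (r * a) \<in> Bs" by simp
    qed (use assms * p(1) in \<open>auto simp: prim_def intro!: idl_mult[OF CB(1)]\<close>)
    ultimately show "loc_frac W X (\<rho> r' \<odot>\<^bsub>X\<^esub> \<theta> a') (\<rho> s' \<otimes> \<rho> t') = fr (r * a) (s * t)" by simp
  qed
  finally show ?thesis .
qed

end

section \<open>The localized ring as a ring of fractions\<close>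

context rpres
begin

context
  fixes p :: "'p set"
  assumes p: "prim p" "kr \<subseteq> p"
begin

abbreviation "Wp \<equiv> carrier A - \<rho> ` p"
abbreviation "rfp r s \<equiv> loc_frac Wp (ring_as_module A) (\<rho> r) (\<rho> s)"

interpretation R: subq_prime A \<rho> "ring_as_module A" UNIV kr \<rho> p
  by (intro subq_prime.intro subq_prime_axioms.intro subq_ring p)

lemma loc_ring_fracs: "fracs (loc_ring A Wp) (- p) UNIV (\<lambda>r s. rfp r s)"
proof -
  have e: "carrier (loc_ring A Wp) = carrier (loc_module A Wp (ring_as_module A))"
    "\<zero>\<^bsub>loc_ring A Wp\<^esub> = \<zero>\<^bsub>loc_module A Wp (ring_as_module A)\<^esub>"
    "add (loc_ring A Wp) = add (loc_module A Wp (ring_as_module A))"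
    by (simp_all add: loc_ring_def Let_def)
  show ?thesis unfolding fracs_def e by (rule R.fracs_loc[unfolded fracs_def])
qed

lemma loc_ring_one: "\<one>\<^bsub>loc_ring A Wp\<^esub> = rfp 1 1"
  by (simp add: loc_ring_def Let_def \<rho>_one)

lemma loc_ring_mult: "s \<in> - p \<Longrightarrow> t \<in> - p \<Longrightarrow> rfp a s \<otimes>\<^bsub>loc_ring A Wp\<^esub> rfp b t = rfp (a * b) (s * t)"
  using R.frac_smult[of b s t a] by (simp add: loc_ring_def Let_def)

lemma loc_ring_cring: "cring (loc_ring A Wp)"
  by (rule fractions_cring[OF loc_ring_fracs loc_ring_one loc_ring_mult])

lemma loc_ring_max_ideal: "max_ideal (loc_ring A Wp) = {rfp r s |r s. r \<in> p \<and> s \<in> - p}"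
proof -
  let ?L = "loc_ring A Wp" and ?N = "{rfp r s |r s. r \<in> p \<and> s \<in> - p}"
  interpret L: cring ?L by (rule loc_ring_cring)
  interpret F: fracs ?L "- p" UNIV "\<lambda>r s. rfp r s" by (rule loc_ring_fracs)
  note ip = prim_idl[OF p(1)]
  have memN: "rfp r s \<in> ?N \<longleftrightarrow> r \<in> p" if s: "s \<in> - p" for r s
  proof
    assume "rfp r s \<in> ?N"
    then obtain q t where q: "rfp r s = rfp q t" "q \<in> p" "t \<in> - p" by blast
    then have "t * r - s * q \<in> csat p UNIV kr" using R.frac_eq s by simp
    then obtain u where u: "u \<notin> p" "u * (t * r - s * q) \<in> p" using p(2) by (auto simp: csat_def)
    have "t * r - s * q \<in> p" using p(1) u by (auto simp: prim_def)
    from idl_add[OF ip this idl_mult[OF ip q(2), of s]] have "t * r \<in> p" by simp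
    then show "r \<in> p" using p(1) q(3) by (auto simp: prim_def)
  qed (use s in blast)
  have mult: "x \<otimes>\<^bsub>?L\<^esub> a \<in> ?N" if a: "a \<in> ?N" and x: "x \<in> carrier ?L" for a x
  proof -
    obtain r s where r: "a = rfp r s" "r \<in> p" "s \<in> - p" using a by blast
    obtain q t where q: "x = rfp q t" "t \<in> - p" using F.frep[OF x] by metis
    show ?thesis unfolding r(1) q(1) loc_ring_mult[OF q(2) r(3)] memN[OF F.D(2)[OF q(2) r(3)]] by (rule idl_mult[OF ip r(2)])
  qed
  have N: "ideal ?N ?L"
  proof (rule idealI[OF L.ring_axioms])
    show "subgroup ?N (add_monoid ?L)"
    proof (rule L.add.subgroupI)
      show "?N \<subseteq> carrier ?L" using F.fclosed by blast
      show "?N \<noteq> {}" using idl_zero[OF ip] F.D(1) by blast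
      fix a assume a: "a \<in> ?N"
      then obtain r s where r: "a = rfp r s" "r \<in> p" "s \<in> - p" by blast
      have "rfp (- r) s \<oplus>\<^bsub>?L\<^esub> a = \<zero>\<^bsub>?L\<^esub>"
        unfolding r(1) F.fzero F.fadd[OF UNIV_I UNIV_I r(3) r(3)] by (rule F.fcong) (use r(3) F.D in \<open>auto\<close>)
      then have "\<ominus>\<^bsub>?L\<^esub> a = rfp (- r) s" unfolding r(1) by (intro L.minus_equality F.fclosed UNIV_I r)
      then show "\<ominus>\<^bsub>?L\<^esub> a \<in> ?N" using memN[OF r(3)] idl_minus[OF ip r(2)] by simp
      fix b assume "b \<in> ?N"
      then obtain q t where q: "b = rfp q t" "q \<in> p" "t \<in> - p" by blast
      show "a \<oplus>\<^bsub>?L\<^esub> b \<in> ?N"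
        unfolding r(1) q(1) F.fadd[OF UNIV_I UNIV_I r(3) q(3)] memN[OF F.D(2)[OF r(3) q(3)]]
        by (intro idl_add[OF ip] idl_mult[OF ip] r q)
    qed
    show "x \<otimes>\<^bsub>?L\<^esub> a \<in> ?N" if "a \<in> ?N" "x \<in> carrier ?L" for a x by (rule mult[OF that])
    show "a \<otimes>\<^bsub>?L\<^esub> x \<in> ?N" if a: "a \<in> ?N" and x: "x \<in> carrier ?L" for a x
    proof -
      have "a \<in> carrier ?L" using a F.fclosed by blast
      then have "a \<otimes>\<^bsub>?L\<^esub> x = x \<otimes>\<^bsub>?L\<^esub> a" by (rule L.m_comm[OF _ x])
      then show ?thesis using mult[OF a x] by simp
    qed
  qed
  show ?thesis
  proof (rule L.max_ideal_eqI(2)[OF N])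
    show "\<one>\<^bsub>?L\<^esub> \<notin> ?N" unfolding loc_ring_one memN[OF F.D(1)] using prim_one[OF p(1)] .
    fix a assume a: "a \<in> carrier ?L" "a \<notin> ?N"
    obtain r s where r: "a = rfp r s" "s \<in> - p" using F.frep[OF a(1)] by metis
    have rp: "r \<in> - p" using a(2) unfolding r(1) memN[OF r(2)] by simp
    have "rfp s r \<otimes>\<^bsub>?L\<^esub> a = \<one>\<^bsub>?L\<^esub>"
      unfolding r(1) loc_ring_one loc_ring_mult[OF rp r(2)] by (rule F.fcong) (use rp r(2) F.D in \<open>auto simp: mult.commute\<close>)
    then show "\<exists>b\<in>carrier ?L. b \<otimes>\<^bsub>?L\<^esub> a = \<one>\<^bsub>?L\<^esub>" using F.fclosed[OF UNIV_I rp] by blast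
  qed
qed

lemma loc_ring_as_module: "ring_as_module (loc_ring A Wp) = loc_module A Wp (ring_as_module A)"
  by (simp add: loc_ring_def Let_def ring_as_module_def loc_module_def)

end

end

theorem (in subq_prime) lpres_loc:
  "lpres (loc_ring A W) (loc_module A W X) (- p) C (\<lambda>a s. fr a s) (\<lambda>r s. rf r s) p Bs"
proof -
  interpret FR: fracs "loc_ring A W" "- p" UNIV "\<lambda>r s. rf r s" by (rule loc_ring_fracs[OF p])
  interpret FX: fracs "loc_module A W X" "- p" C "\<lambda>a s. fr a s" by (rule fracs_loc)
  have sm: "rf r s \<odot>\<^bsub>loc_module A W X\<^esub> fr a t = fr (r * a) (s * t)" if "a \<in> C" "s \<in> - p" "t \<in> - p" for r a s t
    using frac_smult that by simp
  have mod: "module (loc_ring A W) (loc_module A W X)"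
    by (rule fractions_module[OF loc_ring_cring[OF p] loc_ring_fracs[OF p] loc_ring_one[OF p] loc_ring_mult[OF p] fracs_loc sm])
  show ?thesis
  proof (intro lpres.intro mod fracs_loc lpres_axioms.intro)
    show "prim p" by (rule p)
    show "ssub p C Bs Bs" unfolding ssub_def using idl_Bs Bs_C csat_csat[OF p(1)] by auto
    show "carrier (loc_ring A W) = {rf r s |r s. s \<in> - p}" using FR.fcar by simp
    show "max_ideal (loc_ring A W) = {rf r s |r s. r \<in> p \<and> s \<in> - p}" by (rule loc_ring_max_ideal[OF p])
    show "\<exists>r s. s \<in> - p \<and> (\<forall>a\<in>C. r * (u * a) - s * a \<in> Bs)" if "u \<notin> p" for u
      using that idl_zero[OF idl_Bs] by (intro exI[of _ 1] exI[of _ u]) simp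
  qed (use sm frac_eq in auto)
qed

text \<open>Over a local ring the elements outside \<open>m\<close> are already invertible, so 1 is
  the only denominator required.\<close>

theorem (in subq) lpres_local:
  assumes m: "prim m" "kr \<subseteq> m" and unit: "\<And>u. u \<notin> m \<Longrightarrow> \<exists>v. v * u - 1 \<in> kr"
  shows "lpres A X {1} C (\<lambda>a s. \<theta> a) (\<lambda>r s. \<rho> r) m B"
proof -
  show ?thesis
  proof (intro lpres.intro subq_module subq_fracs lpres_axioms.intro)
    show "prim m" by (rule m)
    have "a \<in> B" if u: "u \<notin> m" "a \<in> C" "u * a \<in> B" for u a
    proof -
      obtain v where v: "v * u - 1 \<in> kr" using unit[OF u(1)] by blast
      have "a = v * (u * a) - (v * u - 1) * a" by (simp add: algebra_simps)
      then show ?thesis using idl_diff[OF CB(2) idl_mult[OF CB(2) u(3), of v] kr_mult[OF v u(2)]] by simp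
    qed
    then show "ssub m C B B" unfolding ssub_def by (intro conjI CB subset_refl allI impI)
    have "\<exists>r. x = \<rho> r" if "x \<in> carrier A" for x using \<rho>_surj[OF that] by blast
    then show "carrier A = {\<rho> r |r s. s \<in> {1}}" by auto
    have "max_ideal A = \<rho> ` m" by (rule max_ideal_image[OF m]) (rule unit)
    then show "max_ideal A = {\<rho> r |r s. r \<in> m \<and> s \<in> {1}}" by auto
    show "\<exists>r s. s \<in> {1} \<and> (\<forall>a\<in>C. r * (u * a) - s * a \<in> B)" if u: "u \<notin> m" for u
    proof -
      obtain v where v: "v * u - 1 \<in> kr" using unit[OF u] by blast
      have "v * (u * a) - 1 * a \<in> B" if "a \<in> C" for a
        using kr_mult[OF v that] by (simp add: algebra_simps)
      then show ?thesis by blast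
    qed
  qed (use m prim_one \<theta>_smult \<theta>_eq in auto)
qed

section \<open>Vanishing of local cohomology from regular sequences\<close>

text \<open>For \<open>M\<close> inside the ideal generated by the \<open>x\<^sub>i\<close>, the quotient by \<open>M\<close> of this ideal in the encoding of
  \<^const>\<open>psub\<close>.\<close>

definition rowm :: "nat \<Rightarrow> (nat \<Rightarrow> 'p::comm_ring_1) \<Rightarrow> 'p set \<Rightarrow> 'p fmat set" where
  "rowm e x M = {A. mk (Suc 0) e (\<lambda>_ j. x j) * A \<in> km M}"

lemma ent_row: "ent (mk (Suc 0) e (\<lambda>_ j. x j) * A) i k = (if i = 0 then \<Sum>j<e. x j * ent A j k else 0)"
  by (subst ent_times_bound[of e]) auto

lemma row_mem: "idl C \<Longrightarrow> (\<And>j. j < e \<Longrightarrow> x j \<in> C) \<Longrightarrow> ent (mk (Suc 0) e (\<lambda>_ j. x j) * A) i k \<in> C"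
  unfolding ent_row by (auto intro!: idl_sum idl_mult' idl_zero)

lemma psub_rowm:
  assumes C: "idl C" "\<And>j. j < e \<Longrightarrow> x j \<in> C" and M: "ssub p C B M" and KC: "\<And>k j. k \<in> K \<Longrightarrow> j < e \<Longrightarrow> k * x j \<in> M"
  shows "psub p K (rowm e x M)"
  unfolding psub_def
proof (intro conjI ballI allI impI subsetI)
  have iM: "idl M" using M by (simp add: ssub_def)
  show "A + A' \<in> rowm e x M" if "A \<in> rowm e x M" "A' \<in> rowm e x M" for A A'
    using that unfolding rowm_def by (simp add: distrib_left km_add[OF iM])
  show "A * A' \<in> rowm e x M" if "A \<in> rowm e x M" for A A'
    using that unfolding rowm_def by (simp add: km_right[OF iM] flip: mult.assoc)
  show "A \<in> rowm e x M" if A: "A \<in> km K" for A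
  proof -
    have "(\<Sum>j<e. x j * ent A j k) \<in> M" for k
      by (rule idl_sum[OF iM]) (use KC[OF kmD[OF A]] in \<open>simp add: mult.commute\<close>)
    then show ?thesis unfolding rowm_def using idl_zero[OF iM] by (auto simp: km_def ent_row)
  qed
  show "A \<in> rowm e x M" if u: "u \<notin> p" "u *\<^sub>m A \<in> rowm e x M" for u A
    unfolding rowm_def
  proof (intro CollectI kmI)
    fix i k
    have "ent (mk (Suc 0) e (\<lambda>_ j. x j) * (u *\<^sub>m A)) i k \<in> M" using u(2) unfolding rowm_def by (intro kmD) simp
    then have "u * ent (mk (Suc 0) e (\<lambda>_ j. x j) * A) i k \<in> M" by (simp add: mat_simps)
    then show "ent (mk (Suc 0) e (\<lambda>_ j. x j) * A) i k \<in> M" using M u(1) row_mem[of C e x A i k, OF C] unfolding ssub_def by blast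
  qed
qed

lemma rowm_scalar:
  assumes C: "idl C" "\<And>j. j < e \<Longrightarrow> x j \<in> C" and reg: "\<And>a. a \<in> C \<Longrightarrow> r * a \<in> M \<Longrightarrow> a \<in> M"
    and A: "r *\<^sub>m A \<in> rowm e x M"
  shows "A \<in> rowm e x M"
  unfolding rowm_def
proof (intro CollectI kmI)
  fix i k
  have "ent (mk (Suc 0) e (\<lambda>_ j. x j) * (r *\<^sub>m A)) i k \<in> M" using A unfolding rowm_def by (intro kmD) simp
  then have "r * ent (mk (Suc 0) e (\<lambda>_ j. x j) * A) i k \<in> M" by (simp add: mat_simps)
  from reg[OF row_mem[of C e x A i k, OF C] this] show "ent (mk (Suc 0) e (\<lambda>_ j. x j) * A) i k \<in> M" .
qed

lemma km_csat:
  assumes p: "prim p" and C: "idl C" "\<And>j. j < e \<Longrightarrow> x j \<in> C" and B: "idl B"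
  shows "A \<in> rowm e x (csat p C B) \<longleftrightarrow> (\<exists>u. u \<notin> p \<and> u *\<^sub>m A \<in> rowm e x B)"
proof -
  have "csat p C B = C \<inter> sat p B" by (auto simp: csat_def sat_def)
  then have "A \<in> rowm e x (csat p C B) \<longleftrightarrow> mk (Suc 0) e (\<lambda>_ j. x j) * A \<in> km (sat p B)"
    unfolding rowm_def km_def using row_mem[of C e x A, OF C] by auto
  then show ?thesis unfolding km_sat[OF p B] rowm_def by (simp add: mat_simps)
qed

text \<open>The element of \<open>C\<close> that is multiplied by \<open>r\<close> is written,
  modulo \<open>B\<close>, in the generators \<open>x j\<close>; its coefficients form the matrix
  that is subtracted.\<close>

lemma coker_rowm:
  assumes p: "prim p" and C: "idl C" "\<And>j. j < e \<Longrightarrow> x j \<in> C" and B: "idl B" "B \<subseteq> C"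
    and gen: "\<And>y. y \<in> C \<Longrightarrow> \<exists>c. y - (\<Sum>j<e. x j * c j) \<in> B"
  shows "coker p (\<lambda>A. r *\<^sub>m A) (rowm e x B) = rowm e x (csat p C (adjm C B r))"
proof (intro Set.set_eqI)
  let ?x = "mk (Suc 0) e (\<lambda>_ j. x j)"
  fix A
  have "(\<exists>Y. A - r *\<^sub>m Y \<in> rowm e x B) \<longleftrightarrow> A \<in> rowm e x (adjm C B r)" for A
  proof
    assume "\<exists>Y. A - r *\<^sub>m Y \<in> rowm e x B"
    then obtain Y where Y: "?x * (A - r *\<^sub>m Y) \<in> km B" by (auto simp: rowm_def)
    show "A \<in> rowm e x (adjm C B r)"
      unfolding rowm_def
    proof (intro CollectI kmI)
      fix i k
      have "ent (?x * A) i k = ent (?x * (A - r *\<^sub>m Y)) i k + r * ent (?x * Y) i k" by (simp add: mat_simps)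
      then show "ent (?x * A) i k \<in> adjm C B r" unfolding adjm_def using kmD[OF Y] row_mem[of C e x Y, OF C] by blast
    qed
  next
    assume A: "A \<in> rowm e x (adjm C B r)"
    obtain N where N: "\<And>i j. N \<le> i \<or> N \<le> j \<Longrightarrow> ent A i j = 0" using ent_bound by blast
    have "\<exists>c. (\<Sum>j<e. x j * ent A j k) - r * (\<Sum>j<e. x j * c j) \<in> B" for k
    proof -
      have "ent (?x * A) 0 k \<in> adjm C B r" using A unfolding rowm_def by (intro kmD) simp
      then obtain b c where bc: "(\<Sum>j<e. x j * ent A j k) = b + r * c" "b \<in> B" "c \<in> C" by (auto simp: adjm_def ent_row)
      obtain d where d: "c - (\<Sum>j<e. x j * d j) \<in> B" using gen[OF bc(3)] by blast
      from idl_add[OF B(1) bc(2) idl_mult[OF B(1) d, of r]]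
      have "(\<Sum>j<e. x j * ent A j k) - r * (\<Sum>j<e. x j * d j) \<in> B" unfolding bc(1) by (simp add: algebra_simps)
      then show ?thesis by blast
    qed
    then obtain c where c: "\<And>k. (\<Sum>j<e. x j * ent A j k) - r * (\<Sum>j<e. x j * c k j) \<in> B" by metis
    let ?Y = "mk e N (\<lambda>j k. c k j)"
    have "A - r *\<^sub>m ?Y \<in> rowm e x B"
      unfolding rowm_def
    proof (intro CollectI kmI)
      fix i k
      have "(\<Sum>j<e. x j * ent (A - r *\<^sub>m ?Y) j k) \<in> B"
      proof (cases "k < N")
        case True
        then have "(\<Sum>j<e. x j * ent (A - r *\<^sub>m ?Y) j k) = (\<Sum>j<e. x j * ent A j k) - r * (\<Sum>j<e. x j * c k j)"
          by (simp add: right_diff_distrib sum_subtractf sum_distrib_left mult.left_commute)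
        then show ?thesis using c by simp
      qed (use N idl_zero[OF B(1)] in simp)
      then show "ent (?x * (A - r *\<^sub>m ?Y)) i k \<in> B" using idl_zero[OF B(1)] unfolding ent_row by simp
    qed
    then show "\<exists>Y. A - r *\<^sub>m Y \<in> rowm e x B" by blast
  qed
  note star = this
  have "A \<in> rowm e x (csat p C (adjm C B r)) \<longleftrightarrow> (\<exists>u. u \<notin> p \<and> u *\<^sub>m A \<in> rowm e x (adjm C B r))"
    by (rule km_csat[OF p C idl_adjm[OF C(1) B(1)]])
  then show "A \<in> coker p (\<lambda>A. r *\<^sub>m A) (rowm e x B) \<longleftrightarrow> A \<in> rowm e x (csat p C (adjm C B r))"
    unfolding coker_def mem_Collect_eq star[symmetric] by simp
qed

lemma EV_msq:
  assumes p: "prim p" and K: "idl K" and L: "pres K p l L"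
    and C: "idl C" "\<And>j. j < e \<Longrightarrow> x j \<in> C"
  shows "ssub p C B B \<Longrightarrow> (\<And>k j. k \<in> K \<Longrightarrow> j < e \<Longrightarrow> k * x j \<in> B) \<Longrightarrow>
    (\<And>y. y \<in> C \<Longrightarrow> \<exists>c. y - (\<Sum>j<e. x j * c j) \<in> B) \<Longrightarrow> msq p C B rs \<Longrightarrow> EV p l L (rowm e x B) (length rs)"
proof (induction rs arbitrary: B)
  case Nil
  then show ?case by (simp add: EV_def)
next
  case (Cons r rs)
  let ?B = "csat p C (adjm C B r)"
  note st = ssub_step[OF p C(1) Cons.prems(1), where r = r]
  have B: "idl B" "B \<subseteq> C" using Cons.prems(1) by (auto simp: ssub_def)
  have "EV p l L (rowm e x ?B) (length rs)"
  proof (rule Cons.IH[OF st(1)])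
    show "k * x j \<in> ?B" if "k \<in> K" "j < e" for k j using subsetD[OF st(2) Cons.prems(2)[OF that]] .
    show "\<exists>c. y - (\<Sum>j<e. x j * c j) \<in> ?B" if "y \<in> C" for y using Cons.prems(3)[OF that] st(2) by blast
    show "msq p C ?B rs" using Cons.prems(4) by simp
  qed
  moreover have "coker p (\<lambda>A. r *\<^sub>m A) (rowm e x B) = rowm e x ?B"
    by (rule coker_rowm[OF p C B Cons.prems(3)])
  ultimately have "EV p l L (coker p (\<lambda>A. r *\<^sub>m A) (rowm e x B)) (length rs)" by simp
  moreover have "A \<in> rowm e x B" if "r *\<^sub>m A \<in> rowm e x B" for A
    by (rule rowm_scalar[OF C _ that]) (use Cons.prems(4) in auto)
  ultimately show ?case
    using EV_regular[OF p K L psub_rowm[of C e x p B B K, OF C Cons.prems(1,2)], of r] Cons.prems(4) by simp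
qed

text \<open>Two encodings of one localized module are matched: a quotient of ideals, on which depth
  is measured by regular sequences, and the cokernel of a presentation matrix, on which the
  homological argument runs.\<close>

lemma rowm_presentation:
  assumes p: "prim p" and C: "idl C" "\<And>j. j < e \<Longrightarrow> x j \<in> C" and J: "idl J" and K: "idl K"
    and rel: "\<And>v. (\<Sum>j<e. x j * v j) \<in> J \<longleftrightarrow> (\<exists>w. \<forall>j<e. v j - mv n D w j \<in> K)"
    and D: "D * idm n = D"
  shows "rowm e x (csat p C J) = coker p (\<lambda>A. D * A) (ringm e (sat p K))"
proof (intro Set.set_eqI)
  fix A
  let ?x = "mk (Suc 0) e (\<lambda>_ j. x j)"
  have col: "ent (D * Y) j k = mv n D (\<lambda>i. ent Y i k) j" for Y j k
    unfolding mv_col[OF D] ..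
  have *: "A \<in> rowm e x J \<longleftrightarrow> (\<exists>Y. idm e * (A - D * Y) \<in> km K)" for A
  proof
    assume A: "A \<in> rowm e x J"
    obtain N where N: "\<And>i j. N \<le> i \<or> N \<le> j \<Longrightarrow> ent A i j = 0" using ent_bound by blast
    have "(\<Sum>j<e. x j * ent A j k) \<in> J" for k
    proof -
      have "ent (?x * A) 0 k \<in> J" using A unfolding rowm_def by (intro kmD) simp
      then show ?thesis by (simp add: ent_row)
    qed
    then obtain w where w: "\<And>k j. j < e \<Longrightarrow> ent A j k - mv n D (w k) j \<in> K" unfolding rel by metis
    let ?Y = "mk n N (\<lambda>i k. w k i)"
    have "idm e * (A - D * ?Y) \<in> km K"
    proof (rule kmI)
      fix i k
      show "ent (idm e * (A - D * ?Y)) i k \<in> K"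
      proof (cases "i < e \<and> k < N")
        case True
        have "mv n D (\<lambda>i. ent ?Y i k) = mv n D (w k)" by (rule mv_cong) (simp add: True)
        then show ?thesis using True w[of i k] by (simp add: col)
      next
        case False
        have "ent (D * ?Y) i k = 0" if "\<not> k < N" unfolding col mv_def using that by simp
        then show ?thesis using False N idl_zero[OF K] by auto
      qed
    qed
    then show "\<exists>Y. idm e * (A - D * Y) \<in> km K" by blast
  next
    assume "\<exists>Y. idm e * (A - D * Y) \<in> km K"
    then obtain Y where Y: "idm e * (A - D * Y) \<in> km K" by blast
    have "(\<Sum>j<e. x j * ent A j k) \<in> J" for k
      unfolding rel
    proof (intro exI[of _ "\<lambda>i. ent Y i k"] allI impI)
      fix j assume "j < e"
      then show "ent A j k - mv n D (\<lambda>i. ent Y i k) j \<in> K" using kmD[OF Y, of j k] unfolding col[symmetric] by simp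
    qed
    then show "A \<in> rowm e x J" unfolding rowm_def using idl_zero[OF J] by (intro CollectI kmI) (simp only: ent_row split: if_split, blast)
  qed
  have cs: "A \<in> rowm e x (csat p C J) \<longleftrightarrow> (\<exists>u. u \<notin> p \<and> u *\<^sub>m A \<in> rowm e x J)" by (rule km_csat[OF p C J])
  show "A \<in> rowm e x (csat p C J) \<longleftrightarrow> A \<in> coker p (\<lambda>A. D * A) (ringm e (sat p K))"
  proof
    assume "A \<in> rowm e x (csat p C J)"
    then obtain u Y where u: "u \<notin> p" "idm e * (u *\<^sub>m A - D * Y) \<in> km K"
      unfolding cs * by blast
    then have "u *\<^sub>m A - D * Y \<in> ringm e (sat p K)" unfolding ringm_def using km_mono[OF sat_superset[OF p]] by blast
    then show "A \<in> coker p (\<lambda>A. D * A) (ringm e (sat p K))" by (rule cokerI[OF u(1)])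
  next
    assume "A \<in> coker p (\<lambda>A. D * A) (ringm e (sat p K))"
    then obtain u Y where u: "u \<notin> p" "idm e * (u *\<^sub>m A - D * Y) \<in> km (sat p K)" by (auto simp: coker_def ringm_def)
    then obtain v where v: "v \<notin> p" "v *\<^sub>m (idm e * (u *\<^sub>m A - D * Y)) \<in> km K" unfolding km_sat[OF p K] by blast
    then have "idm e * ((v * u) *\<^sub>m A - D * (v *\<^sub>m Y)) \<in> km K" by (simp add: mat_simps)
    moreover have "v * u \<notin> p" using p u(1) v(1) by (auto simp: prim_def)
    ultimately show "A \<in> rowm e x (csat p C J)" unfolding cs * by blast
  qed
qed

text \<open>The converse half of the Rees characterization: a socle element survives in degree 0
  after dividing by the regular sequence, and \<open>EV_coker\<close> moves the obstruction up one
  degree for each element. Together with \<open>EV_rsq\<close> it bounds the length of every regular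
  sequence.\<close>

lemma not_EV_socle:
  assumes p: "prim p" and K: "idl K" and L: "pres K p l L"
  shows "idl K' \<Longrightarrow> K \<subseteq> K' \<Longrightarrow> (\<And>u a. u \<notin> p \<Longrightarrow> u * a \<in> K' \<Longrightarrow> a \<in> K') \<Longrightarrow> rsq p K' xs \<Longrightarrow>
    s \<notin> rsid p K' xs \<Longrightarrow> (\<And>a. a \<in> p \<Longrightarrow> s * a \<in> rsid p K' xs) \<Longrightarrow> \<not> EV p l L (ringm 1 K') (Suc (length xs))"
proof (induction xs arbitrary: K')
  case Nil
  show ?case
  proof
    assume E: "EV p l L (ringm 1 K') (Suc (length []))"
    have "psub p K (ringm 1 K')" by (rule psub_ringm[OF Nil.prems(1-3)])
    note EV_socle[OF p K L this E[unfolded list.size]]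
    then have "s *\<^sub>m idm 1 \<in> ringm 1 K'"
    proof (rule)
      fix a assume "a \<in> p"
      then have "a * s \<in> K'" using Nil.prems(6)[of a] by (simp add: mult.commute)
      then show "a *\<^sub>m (s *\<^sub>m idm 1) \<in> ringm 1 K'" unfolding ringm_def using km_scm'[OF Nil.prems(1), of "a * s" "idm 1"]
        by (simp add: mat_simps)
    qed (simp_all add: mat_simps)
    then have "ent (idm 1 * (s *\<^sub>m idm 1)) 0 0 \<in> K'" unfolding ringm_def by (intro kmD) simp
    then show False using Nil.prems(5) by (simp add: ent_idm)
  qed
next
  case (Cons x xs)
  let ?K = "sat p (adj K' x)"
  have ps: "psub p K (ringm 1 K')" by (rule psub_ringm[OF Cons.prems(1-3)])
  have reg: "x *\<^sub>m A \<in> ringm 1 K' \<longleftrightarrow> A \<in> ringm 1 K'" for A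
    using ringm_scalar[of x K' A 1] Cons.prems(4) psub_scm[OF ps] by auto
  have "\<not> EV p l L (ringm 1 ?K) (Suc (length xs))"
  proof (rule Cons.IH)
    show "idl ?K" by (intro idl_sat idl_adj p Cons.prems)
    show "K \<subseteq> ?K" using Cons.prems(2) adj_superset[of K' x] sat_superset[OF p, of "adj K' x"] by (blast dest: subsetD)
    show "a \<in> ?K" if "u \<notin> p" "u * a \<in> ?K" for u a by (rule sat_sat[OF p that])
  qed (use Cons.prems(4,5,6) in auto)
  moreover have "EV p l L (ringm 1 ?K) (Suc (length xs))" if "EV p l L (ringm 1 K') (Suc (Suc (length xs)))"
    using EV_coker[OF p K L ps ps lin_scalar reg that EV_mono[OF that]] unfolding coker_ringm[OF p Cons.prems(1)] by simp
  ultimately show ?case by auto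
qed

section \<open>A universal ring over all ring records\<close>

text \<open>Every commutative ring record on \<open>'a\<close> is a quotient of this ring, which allows a record to be
  treated with type classes. The integer component only serves to make \<open>0 \<noteq> 1\<close>.\<close>

typedef 'a uring = "{x :: int \<times> ('a ring \<Rightarrow> 'a). \<forall>S. if cring S then snd x S \<in> carrier S else snd x S = undefined}"
  by (rule exI[of _ "(0, \<lambda>S. if cring S then \<zero>\<^bsub>S\<^esub> else undefined)"])
    (auto intro: abelian_monoid.zero_closed abelian_group.axioms ring.axioms cring.axioms)

setup_lifting type_definition_uring

instantiation uring :: (type) comm_ring_1
begin

lift_definition zero_uring :: "'a uring" is "(0, \<lambda>S. if cring S then \<zero>\<^bsub>S\<^esub> else undefined)"
  by (auto simp: cring.cring_simprules)
lift_definition one_uring :: "'a uring" is "(1, \<lambda>S. if cring S then \<one>\<^bsub>S\<^esub> else undefined)"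
  by (auto simp: cring.cring_simprules)
lift_definition plus_uring :: "'a uring \<Rightarrow> 'a uring \<Rightarrow> 'a uring"
  is "\<lambda>x y. (fst x + fst y, \<lambda>S. if cring S then snd x S \<oplus>\<^bsub>S\<^esub> snd y S else undefined)"
  by (auto simp: cring.cring_simprules)
lift_definition times_uring :: "'a uring \<Rightarrow> 'a uring \<Rightarrow> 'a uring"
  is "\<lambda>x y. (fst x * fst y, \<lambda>S. if cring S then snd x S \<otimes>\<^bsub>S\<^esub> snd y S else undefined)"
  by (auto simp: cring.cring_simprules)
lift_definition uminus_uring :: "'a uring \<Rightarrow> 'a uring"
  is "\<lambda>x. (- fst x, \<lambda>S. if cring S then \<ominus>\<^bsub>S\<^esub> snd x S else undefined)"
  by (auto simp: cring.cring_simprules)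
lift_definition minus_uring :: "'a uring \<Rightarrow> 'a uring \<Rightarrow> 'a uring"
  is "\<lambda>x y. (fst x - fst y, \<lambda>S. if cring S then snd x S \<ominus>\<^bsub>S\<^esub> snd y S else undefined)"
  by (auto simp: cring.cring_simprules)

instance
proof
  fix a b c :: "'a uring"
  show "a + b + c = a + (b + c)" by transfer (auto simp: fun_eq_iff cring.cring_simprules)
  show "a + b = b + a" by transfer (auto simp: fun_eq_iff add.commute, metis cring.cring_simprules(10) snd_conv)
  show "0 + a = a" by transfer (auto simp: fun_eq_iff prod_eq_iff cring.cring_simprules)
  show "- a + a = 0" by transfer (auto simp: fun_eq_iff cring.cring_simprules)
  show "a - b = a + - b" by transfer (auto simp: fun_eq_iff cring.cring_simprules)
  show "a * b * c = a * (b * c)" by transfer (auto simp: fun_eq_iff cring.cring_simprules)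
  show "a * b = b * a" by transfer (auto simp: fun_eq_iff mult.commute, metis cring.cring_simprules(14) snd_conv)
  show "1 * a = a" by transfer (auto simp: fun_eq_iff prod_eq_iff cring.cring_simprules)
  show "(a + b) * c = a * c + b * c" by transfer (auto simp: fun_eq_iff distrib_right cring.cring_simprules)
  show "(0 :: 'a uring) \<noteq> 1" by transfer simp
qed

end

definition ev :: "'a ring \<Rightarrow> 'a uring \<Rightarrow> 'a" where "ev S x = snd (Rep_uring x) S"

lemma rpres_ev:
  assumes S: "cring S"
  shows "rpres S (ev S)"
proof (intro rpres.intro S rpres_axioms.intro)
  show "ev S a \<in> carrier S" for a using Rep_uring[of a] S by (auto simp: ev_def split: if_splits)
  show "ev S (a + b) = ev S a \<oplus>\<^bsub>S\<^esub> ev S b" for a b using S by (simp add: ev_def plus_uring.rep_eq)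
  show "ev S (a * b) = ev S a \<otimes>\<^bsub>S\<^esub> ev S b" for a b using S by (simp add: ev_def times_uring.rep_eq)
  show "ev S 1 = \<one>\<^bsub>S\<^esub>" using S by (simp add: ev_def one_uring.rep_eq)
  fix x assume x: "x \<in> carrier S"
  \<comment> \<open>The element concentrated at the record \<open>S\<close> and zero at all other
    rings.\<close>
  let ?f = "\<lambda>T. if T = S then x else if cring T then \<zero>\<^bsub>T\<^esub> else undefined"
  have "ev S (Abs_uring (0, ?f)) = x"
    unfolding ev_def by (subst Abs_uring_inverse) (use S x in \<open>auto simp: cring.cring_simprules\<close>)
  then show "\<exists>a. ev S a = x" by blast
qed

section \<open>Quotients, ideals and the conormal module as presented modules\<close>

locale conormal = rpres S \<rho> for S :: "('a, 'y) ring_scheme" (structure) and \<rho> :: "'p::comm_ring_1 \<Rightarrow> 'a" +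
  fixes I :: "'a set"
  assumes I: "ideal I S"
begin

lemma coset_mem:
  assumes H: "ideal H S"
  shows "\<rho> a \<in> H +> \<rho> b \<longleftrightarrow> a - b \<in> \<rho> -` H"
proof -
  interpret H: ideal H S by (rule H)
  have "\<rho> a \<in> H +> \<rho> b \<longleftrightarrow> (\<exists>h\<in>H. \<rho> a = h \<oplus> \<rho> b)" by (auto simp: a_r_coset_def')
  also have "\<dots> \<longleftrightarrow> \<rho> a \<ominus> \<rho> b \<in> H"
  proof
    assume "\<exists>h\<in>H. \<rho> a = h \<oplus> \<rho> b"
    then obtain h where h: "h \<in> H" "\<rho> a = h \<oplus> \<rho> b" by blast
    have "\<rho> a \<ominus> \<rho> b = h" unfolding h(2) using H.Icarr[OF h(1)] by (simp add: a_minus_def a_assoc r_neg)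
    then show "\<rho> a \<ominus> \<rho> b \<in> H" using h(1) by simp
  next
    assume "\<rho> a \<ominus> \<rho> b \<in> H"
    moreover have "\<rho> a = (\<rho> a \<ominus> \<rho> b) \<oplus> \<rho> b" by (simp add: a_minus_def a_assoc l_neg)
    ultimately show "\<exists>h\<in>H. \<rho> a = h \<oplus> \<rho> b" by blast
  qed
  finally show ?thesis by (simp add: \<rho>_diff)
qed

lemma coset_eq:
  assumes H: "ideal H S"
  shows "H +> \<rho> a = H +> \<rho> b \<longleftrightarrow> a - b \<in> \<rho> -` H"
proof -
  interpret H: ideal H S by (rule H)
  show ?thesis
    using coset_mem[OF H, of a b] H.a_repr_independence'[of "\<rho> a" "\<rho> b"] H.a_rcos_self[of "\<rho> a"] by auto
qed

lemma coset_rep: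
  assumes H: "ideal H S" and z: "z \<in> H +> \<rho> b"
  obtains a where "z = \<rho> a" "a - b \<in> \<rho> -` H"
proof -
  interpret H: ideal H S by (rule H)
  have "z \<in> carrier S" using z H.Icarr by (auto simp: a_r_coset_def')
  then obtain a where "\<rho> a = z" using \<rho>_surj by blast
  then show ?thesis using that coset_mem[OF H, of a b] z by auto
qed

abbreviation "Q \<equiv> S Quot I"
abbreviation "\<rho>I a \<equiv> I +> \<rho> a"

lemma rpres_quot: "rpres Q (\<lambda>a. \<rho>I a)"
proof -
  interpret I: ideal I S by (rule I)
  show ?thesis
  proof (intro rpres.intro I.quotient_is_cring is_cring rpres_axioms.intro)
    show "\<rho>I a \<in> carrier Q" for a by (auto simp: FactRing_simps)
    show "\<rho>I (a + b) = \<rho>I a \<oplus>\<^bsub>Q\<^esub> \<rho>I b" for a b by (simp add: FactRing_def \<rho>_add I.a_rcos_sum)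
    show "\<rho>I (a * b) = \<rho>I a \<otimes>\<^bsub>Q\<^esub> \<rho>I b" for a b by (simp add: FactRing_def \<rho>_mult I.rcoset_mult_add)
    show "\<rho>I 1 = \<one>\<^bsub>Q\<^esub>" by (simp add: FactRing_def \<rho>_one)
    show "\<exists>a. \<rho>I a = x" if "x \<in> carrier Q" for x using that \<rho>_surj by (auto simp: FactRing_simps)
  qed
qed

abbreviation "K \<equiv> \<rho> -` I"
abbreviation "J \<equiv> \<rho> -` (I \<cdot> I)"

abbreviation "\<theta>J a \<equiv> (I \<cdot> I) +> \<rho> a"

lemma I2: "ideal (I \<cdot> I) S" by (rule ideal_prod_is_ideal[OF I I])

lemma idlKJ: "idl K" "idl J" "J \<subseteq> K" "kr \<subseteq> J" "a \<in> K \<Longrightarrow> b \<in> K \<Longrightarrow> a * b \<in> J"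
  using ideal_vimage[OF I] ideal_vimage[OF I2] ideal_prod_inter[OF I I] kr_vimage[OF I2]
  by (auto simp: \<rho>_mult intro: ideal_prod.prod)

lemma krK: "kr \<subseteq> K" using idlKJ(3,4) by blast

lemma kr_quot: "rpres.kr Q (\<lambda>a. \<rho>I a) = K"
proof -
  have "\<rho>I a = I \<longleftrightarrow> a \<in> K" for a
  proof -
    interpret I: ideal I S by (rule I)
    have "I = \<rho>I 0" using a_coset_add_zero[OF I.a_subset] by (simp add: \<rho>_zero)
    then show ?thesis using coset_eq[OF I, of a 0] by simp
  qed
  then show ?thesis unfolding rpres.kr_def[OF rpres_quot] by (auto simp: FactRing_def)
qed

lemma subq_conormal: "subq Q (\<lambda>a. \<rho>I a) (conormal_module S I) K J (\<lambda>a. \<theta>J a)"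
proof (intro subq.intro rpres_quot subq_axioms.intro idlKJ)
  interpret I2: ideal "I \<cdot> I" S by (rule I2)
  show "\<theta>J a \<in> carrier (conormal_module S I)" if "a \<in> K" for a using that by (auto simp: conormal_module_def)
  show "\<exists>a\<in>K. x = \<theta>J a" if x: "x \<in> carrier (conormal_module S I)" for x
  proof -
    obtain y where y: "y \<in> I" "x = (I \<cdot> I) +> y" using x by (auto simp: conormal_module_def)
    obtain a where "\<rho> a = y" using \<rho>_surj[OF ideal.Icarr[OF I y(1)]] by blast
    then show ?thesis using y by auto
  qed
  show "\<theta>J (a + b) = (\<theta>J a) \<oplus>\<^bsub>conormal_module S I\<^esub> (\<theta>J b)" for a b
    by (simp add: conormal_module_def \<rho>_add I2.a_rcos_sum)
  show "\<theta>J a = \<theta>J b \<longleftrightarrow> a - b \<in> J" for a b by (rule coset_eq[OF I2])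
  show "\<theta>J 0 = \<zero>\<^bsub>conormal_module S I\<^esub>"
    using a_coset_add_zero[OF I2.a_subset] by (simp add: conormal_module_def \<rho>_zero)
  show "\<theta>J (r * a) = (\<rho>I r) \<odot>\<^bsub>conormal_module S I\<^esub> (\<theta>J a)" if a: "a \<in> K" for a r
  proof -
    have "(I \<cdot> I) +> (x \<otimes> y) = \<theta>J (r * a)" if x: "x \<in> \<rho>I r" and y: "y \<in> \<theta>J a" for x y
    proof -
      obtain b where b: "x = \<rho> b" "b - r \<in> K" using coset_rep[OF I x] by blast
      obtain c where c: "y = \<rho> c" "c - a \<in> J" using coset_rep[OF I2 y] by blast
      have "b * c - r * a = b * (c - a) + (b - r) * a" by (simp add: algebra_simps)
      also have "\<dots> \<in> J" by (intro idl_add[OF idlKJ(2)] idl_mult[OF idlKJ(2) c(2)] idlKJ(5) b a)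
      finally show ?thesis unfolding b(1) c(1) \<rho>_mult[symmetric] coset_eq[OF I2] .
    qed
    moreover have "\<rho> r \<in> \<rho>I r" "\<rho> a \<in> \<theta>J a"
      using coset_mem[OF I] coset_mem[OF I2] idl_zero[OF idlKJ(1)] idl_zero[OF idlKJ(2)] by auto
    ultimately show ?thesis unfolding conormal_module_def rcoset_mult_def by (simp, blast)
  qed
qed

end

section \<open>Free resolutions of ideals and of duals\<close>

context rpres
begin

lemma cpx_kernel_iff:
  assumes C: "cpx kr n F" and v: "\<And>j. n (Suc i) \<le> j \<Longrightarrow> v j = 0"
  shows "(\<forall>j<n i. mv (n (Suc i)) (F i) v j \<in> kr) \<longleftrightarrow> (\<exists>w. \<forall>j. v j - mv (n (Suc (Suc i))) (F (Suc i)) w j \<in> kr)"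
proof
  have rows: "mv l (F k) u j = 0" if "n k \<le> j" for k l u j
    using idm_mult_bound[OF cpxD(1)[OF C] that] by (simp add: mv_def)
  assume "\<forall>j<n i. mv (n (Suc i)) (F i) v j \<in> kr"
  then have "mv (n (Suc i)) (F i) v j \<in> kr" for j
    using rows[of i j] idl_zero[OF idl_kr] by (cases "j < n i") auto
  from cpx_vectors[OF C this] obtain w
    where w: "\<And>j. j < n (Suc i) \<Longrightarrow> v j - mv (n (Suc (Suc i))) (F (Suc i)) w j \<in> kr" by blast
  have "v j - mv (n (Suc (Suc i))) (F (Suc i)) w j \<in> kr" for j
    using w[of j] rows[of "Suc i" j] v[of j] idl_zero[OF idl_kr] by (cases "j < n (Suc i)") auto
  then show "\<exists>w. \<forall>j. v j - mv (n (Suc (Suc i))) (F (Suc i)) w j \<in> kr" by blast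
next
  assume "\<exists>w. \<forall>j. v j - mv (n (Suc (Suc i))) (F (Suc i)) w j \<in> kr"
  then obtain w where w: "\<And>j. v j - mv (n (Suc (Suc i))) (F (Suc i)) w j \<in> kr" by blast
  show "\<forall>j<n i. mv (n (Suc i)) (F i) v j \<in> kr"
  proof (intro allI impI)
    fix j
    have "mv (n (Suc i)) (F i) (\<lambda>j. v j - mv (n (Suc (Suc i))) (F (Suc i)) w j) j \<in> kr" by (rule mv_idl[OF idl_kr w])
    then have "mv (n (Suc i)) (F i) v j - mv (n (Suc (Suc i))) (F i * F (Suc i)) w j \<in> kr"
      unfolding mv_diff mv_mult[OF cpxD(2)[OF C]] .
    moreover have "mv (n (Suc (Suc i))) (F i * F (Suc i)) w j \<in> kr" by (rule mv_km[OF idl_kr cpxD(3)[OF C]])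
    ultimately show "mv (n (Suc i)) (F i) v j \<in> kr" using idl_add[OF idl_kr] by fastforce
  qed
qed

text \<open>Dropping the first map from a resolution of the quotient ring leaves a resolution of the
  ideal; the dropped row becomes the augmentation.\<close>

lemma ideal_resolves:
  assumes I: "ideal I A" and P: "pres kr (\<rho> -` I) n D"
  shows "resolves (\<lambda>i. n (Suc i)) (\<lambda>i. D (Suc i)) (ideal_as_module A I) (\<lambda>v. \<rho> (mv (n 1) (D 0) v 0))"
proof -
  note C = presD(1)[OF P]
  have iI: "idl (\<rho> -` I)" by (rule ideal_vimage[OF I])
  have "cpx kr (\<lambda>i. n (Suc i)) (\<lambda>i. D (Suc i))" using cpx_shift[OF C, of 1] by simp
  moreover have "prsn (ideal_as_module A I) (n (Suc 0)) (\<lambda>v. \<rho> (mv (n 1) (D 0) v 0))"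
    unfolding prsn_def
  proof (intro conjI allI impI ballI)
    show "\<rho> (mv (n 1) (D 0) v 0) \<in> carrier (ideal_as_module A I)" for v
      using mv_km[OF iI presD(3)[OF P], of "n 1" v 0] by (simp add: ideal_as_module_def)
    show "\<rho> (mv (n 1) (D 0) v 0) = \<rho> (mv (n 1) (D 0) w 0)" if "\<forall>i<n (Suc 0). v i = w i" for v w
      using mv_cong[of "n 1" v w "D 0"] that by simp
    fix x assume "x \<in> carrier (ideal_as_module A I)"
    then have x: "x \<in> I" by (simp add: ideal_as_module_def)
    then obtain a where a: "\<rho> a = x" using \<rho>_surj[OF ideal.Icarr[OF I x]] by blast
    then obtain W where W: "a *\<^sub>m idm 1 - D 0 * W \<in> km kr" using presD(4)[OF P, of a] x by auto
    have "a - mv (n 1) (D 0) (\<lambda>i. ent W i 0) 0 \<in> kr"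
      using kmD[OF W, of 0 0] mv_col[of "D 0" "n 1" W 0] cpxD(2)[OF C, of 0] by (simp add: ent_idm)
    then have "\<rho> (mv (n 1) (D 0) (\<lambda>i. ent W i 0) 0) = x" unfolding a[symmetric] \<rho>_eq_iff using idl_minus[OF idl_kr] by fastforce
    then show "\<exists>v. \<rho> (mv (n 1) (D 0) v 0) = x" by blast
  qed (simp_all add: ideal_as_module_def ring_as_module_def mv_add mv_scale \<rho>_add \<rho>_mult, simp add: mv_def \<rho>_zero)
  moreover have "\<rho> (mv (n 1) (D 0) v 0) = \<zero>\<^bsub>ideal_as_module A I\<^esub> \<longleftrightarrow>
      (\<exists>w. \<forall>i. v i - mv (n (Suc 1)) (D (Suc 0)) w i \<in> kr)" if v: "\<forall>i\<ge>n (Suc 0). v i = 0" for v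
    using cpx_kernel_iff[OF C, of 0 v] v presD(2)[OF P]
    by (simp add: ideal_as_module_def ring_as_module_def kr_def)
  ultimately show ?thesis unfolding resolves_def by blast
qed

text \<open>A homomorphism from \<open>X\<close> to the ring is given by its values on the
  generators, a vector killed by \<open>tr (D 0) = G 0\<close>. By exactness such vectors are the
  values of \<open>G 1\<close>, so the dual is resolved from \<open>G 2\<close> on.\<close>

theorem dual_resolves:
  assumes F: "resolves n D X \<theta>" and G: "cpx kr g G" and G0: "G 0 = tr (D 0)" "g 0 = n 1" "g 1 = n 0"
  obtains \<psi> where "resolves (\<lambda>i. g (Suc (Suc i))) (\<lambda>i. G (Suc (Suc i))) (hom_module A X (ring_as_module A)) \<psi>"
proof -
  let ?R = "ring_as_module A" and ?H = "hom_module A X (ring_as_module A)"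
  note C = resolvesD(1)[OF F] and \<theta> = resolvesD(2)[OF F] and ker = resolvesD(3)[OF F]
  \<comment> \<open>The pairing of a coefficient vector \<open>w\<close> with the vector
    \<open>a\<close> of values on the generators.\<close>
  define pr where "pr w a = (\<Sum>j<n 0. w j * a j)" for w a :: "nat \<Rightarrow> 'p"
  have pr_add: "pr (\<lambda>i. w i + w' i) a = pr w a + pr w' a" "pr w (\<lambda>i. a i + b i) = pr w a + pr w b"
    "pr (\<lambda>i. c * w i) a = c * pr w a" "pr w (\<lambda>i. c * a i) = c * pr w a"
    "pr (\<lambda>i. w i - w' i) a = pr w a - pr w' a" "pr w (\<lambda>i. a i - b i) = pr w a - pr w b" for w w' a b c
    by (simp_all add: pr_def distrib_left distrib_right sum.distrib sum_distrib_left mult.assoc mult.left_commute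
        left_diff_distrib right_diff_distrib sum_subtractf)
  have pr_kr: "pr w a \<in> kr" if "\<And>j. j < n 0 \<Longrightarrow> a j \<in> kr" for w a
    unfolding pr_def by (rule idl_sum[OF idl_kr]) (use that idl_mult[OF idl_kr] in auto)
  have pr_kr': "pr w a \<in> kr" if "\<And>j. j < n 0 \<Longrightarrow> w j \<in> kr" for w a
    unfolding pr_def by (rule idl_sum[OF idl_kr]) (use that idl_mult'[OF idl_kr] in auto)
  have adj: "pr (mv (n 1) (D 0) z) a = (\<Sum>k<n 1. z k * mv (n 0) (tr (D 0)) a k)" for z a
  proof -
    have "pr (mv (n 1) (D 0) z) a = (\<Sum>j<n 0. \<Sum>k<n 1. ent (D 0) j k * z k * a j)"
      by (simp add: pr_def mv_def sum_distrib_right)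
    also have "\<dots> = (\<Sum>k<n 1. \<Sum>j<n 0. ent (D 0) j k * z k * a j)" by (rule sum.swap)
    also have "\<dots> = (\<Sum>k<n 1. z k * mv (n 0) (tr (D 0)) a k)"
      by (simp add: mv_def sum_distrib_left mult.assoc mult.left_commute)
    finally show ?thesis .
  qed
  define dv where "dv v = mv (g 2) (G 1) v" for v
  have g2: "g (Suc (Suc 0)) = g 2" "G (Suc 0) = G 1" "g (Suc 0) = g 1" by (simp_all add: numeral_2_eq_2)
  have G0': "g (Suc 0) = n 0" using G0(3) by simp
  have G1: "G 1 * idm (g 2) = G 1" "G 0 * idm (g 1) = G 0" "G 0 * G 1 \<in> km kr" "idm (g 1) * G 1 = G 1"
    using cpxD(1,2,3)[OF G, of 1] cpxD(2,3)[OF G, of 0] by (simp_all add: numeral_2_eq_2)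
  have dual0: "mv (n 0) (tr (D 0)) (dv v) k \<in> kr" for v k
    unfolding dv_def G0(1)[symmetric] G0(3)[symmetric] mv_mult[OF G1(2), symmetric] by (rule mv_km[OF idl_kr G1(3)])
  \<comment> \<open>The functional does not depend on the coefficient vector: two vectors of the
    same element differ by a relation, and relations pair to zero with \<open>dv v\<close> by
    adjointness.\<close>
  have cong: "pr w (dv v) - pr w' (dv v) \<in> kr" if w: "\<theta> w = \<theta> w'" for w w' v
  proof -
    let ?u = "\<lambda>i. if i < n 0 then w i - w' i else 0"
    have "\<theta> ?u = \<theta> (\<lambda>i. w i - w' i)" by (rule prsnD(4)[OF \<theta>]) simp
    also have "\<dots> = \<zero>\<^bsub>X\<^esub>" using w prsn_eq_iff[OF \<theta>] by blast
    finally have "\<exists>z. \<forall>i. ?u i - mv (n 1) (D 0) z i \<in> kr" using ker[of ?u] by simp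
    then obtain z where z: "\<And>i. ?u i - mv (n 1) (D 0) z i \<in> kr" by blast
    have "pr (\<lambda>i. ?u i - mv (n 1) (D 0) z i) (dv v) \<in> kr" by (rule pr_kr') (rule z)
    moreover have "pr (mv (n 1) (D 0) z) (dv v) \<in> kr"
      unfolding adj by (rule idl_sum[OF idl_kr]) (rule idl_mult[OF idl_kr dual0])
    ultimately have "pr ?u (dv v) \<in> kr" unfolding pr_add(5) using idl_add[OF idl_kr] by fastforce
    moreover have "pr ?u (dv v) = pr w (dv v) - pr w' (dv v)" unfolding pr_add(5)[symmetric] by (simp add: pr_def)
    ultimately show ?thesis by simp
  qed
  define \<psi> where "\<psi> v = (\<lambda>x\<in>carrier X. \<rho> (pr (SOME w. \<theta> w = x) (dv v)))" for v
  have \<psi>\<theta>: "\<psi> v (\<theta> w) = \<rho> (pr w (dv v))" for v w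
  proof -
    have "\<theta> (SOME w'. \<theta> w' = \<theta> w) = \<theta> w" by (rule someI[of "\<lambda>w'. \<theta> w' = \<theta> w" w]) (rule refl)
    from cong[OF this, of v] show ?thesis using prsnD(1)[OF \<theta>, of w] by (simp add: \<psi>_def \<rho>_eq_iff)
  qed
  have ext: "f = f'" if "f \<in> extensional (carrier X)" "f' \<in> extensional (carrier X)" "\<And>w. f (\<theta> w) = f' (\<theta> w)" for f f' :: "_ \<Rightarrow> 'r"
  proof (rule extensionalityI[OF that(1,2)])
    fix x assume "x \<in> carrier X"
    then obtain w where "\<theta> w = x" using prsnD(6)[OF \<theta>] by blast
    then show "f x = f' x" using that(3)[of w] by simp
  qed
  have \<psi>_ext: "\<psi> v \<in> extensional (carrier X)" for v by (simp add: \<psi>_def)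
  have dv_simps: "dv (\<lambda>i. v i + w i) = (\<lambda>i. dv v i + dv w i)" "dv (\<lambda>i. a * v i) = (\<lambda>i. a * dv v i)" for v w a
    by (simp_all add: dv_def mv_add mv_scale)
  have hom: "\<psi> v \<in> module_hom A X ?R" for v
    unfolding module_hom_def
  proof (intro CollectI conjI ballI)
    show "\<psi> v \<in> carrier X \<rightarrow>\<^sub>E carrier ?R" by (auto simp: \<psi>_def ring_as_module_def)
  next
    fix x y assume "x \<in> carrier X" "y \<in> carrier X"
    then obtain w w' where w: "\<theta> w = x" "\<theta> w' = y" using prsnD(6)[OF \<theta>] by metis
    have "\<psi> v (x \<oplus>\<^bsub>X\<^esub> y) = \<psi> v (\<theta> (\<lambda>i. w i + w' i))" unfolding w[symmetric] prsnD(2)[OF \<theta>] ..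
    then show "\<psi> v (x \<oplus>\<^bsub>X\<^esub> y) = \<psi> v x \<oplus>\<^bsub>?R\<^esub> \<psi> v y"
      unfolding \<psi>\<theta> w[symmetric] by (simp add: ring_as_module_def pr_add \<rho>_add)
  next
    fix a x assume a: "a \<in> carrier A" and "x \<in> carrier X"
    then obtain w where w: "\<theta> w = x" using prsnD(6)[OF \<theta>] by metis
    obtain b where b: "\<rho> b = a" using \<rho>_surj[OF a] by blast
    have "\<psi> v (a \<odot>\<^bsub>X\<^esub> x) = \<psi> v (\<theta> (\<lambda>i. b * w i))" unfolding w[symmetric] b[symmetric] prsnD(3)[OF \<theta>] ..
    then show "\<psi> v (a \<odot>\<^bsub>X\<^esub> x) = a \<odot>\<^bsub>?R\<^esub> \<psi> v x"
      unfolding \<psi>\<theta> w[symmetric] b[symmetric] by (simp add: ring_as_module_def pr_add \<rho>_mult)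
  qed
  have H: "carrier ?H = module_hom A X ?R" "\<zero>\<^bsub>?H\<^esub> = (\<lambda>x\<in>carrier X. \<zero>)"
    "f \<oplus>\<^bsub>?H\<^esub> f' = (\<lambda>x\<in>carrier X. f x \<oplus> f' x)" "a \<odot>\<^bsub>?H\<^esub> f = (\<lambda>x\<in>carrier X. a \<otimes> f x)" for f f' a
    by (simp_all add: hom_module_def ring_as_module_def)
  note \<theta>c = prsnD(1)[OF \<theta>]
  have "prsn ?H (g (Suc (Suc 0))) \<psi>"
    unfolding prsn_def H
  proof (intro conjI allI impI ballI)
    show "\<psi> v \<in> module_hom A X ?R" for v by (rule hom)
    show "\<psi> (\<lambda>i. v i + w i) = (\<lambda>x\<in>carrier X. \<psi> v x \<oplus> \<psi> w x)" for v w
      by (rule ext[OF \<psi>_ext]) (simp_all add: \<psi>\<theta> \<theta>c dv_simps pr_add \<rho>_add)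
    show "\<psi> (\<lambda>i. a * v i) = (\<lambda>x\<in>carrier X. \<rho> a \<otimes> \<psi> v x)" for a v
      by (rule ext[OF \<psi>_ext]) (simp_all add: \<psi>\<theta> \<theta>c dv_simps pr_add \<rho>_mult)
    show "\<psi> v = \<psi> w" if "\<forall>i<g (Suc (Suc 0)). v i = w i" for v w
    proof -
      have "dv v = dv w" unfolding dv_def by (rule mv_cong) (use that g2(1) in simp)
      then show ?thesis by (simp add: \<psi>_def)
    qed
    show "\<psi> (\<lambda>_. 0) = (\<lambda>x\<in>carrier X. \<zero>)"
      by (rule ext[OF \<psi>_ext]) (simp_all add: \<psi>\<theta> \<theta>c dv_def mv_def pr_def \<rho>_zero)
    fix f assume f: "f \<in> module_hom A X ?R"
    obtain M where M: "M * idm (n 0) = M" "\<And>v. f (\<theta> v) = \<rho> (mv (n 0) M v 0)"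
      using prsn_lift[OF \<theta> prsn_ring module_hom_hom_like[OF f]] by metis
    define a where "a = (\<lambda>j. ent M 0 j)"
    have fa: "f (\<theta> v) = \<rho> (pr v a)" for v unfolding M(2) by (simp add: mv_def pr_def a_def mult.commute)
    have "mv (n 0) (tr (D 0)) a k \<in> kr" for k
    proof (cases "k < n 1")
      case True
      let ?z = "\<lambda>i. if i = k then 1 else 0 :: 'p"
      have "mv (n 1) (D 0) ?z j = 0" if "n 0 \<le> j" for j
        using idm_mult_bound[OF cpxD(1)[OF C] that] by (simp add: mv_def)
      then have "\<theta> (mv (n 1) (D 0) ?z) = \<zero>\<^bsub>X\<^esub>"
        using ker[of "mv (n 1) (D 0) ?z"] idl_zero[OF idl_kr] by (auto intro!: exI[of _ ?z])
      then have "f (\<theta> (mv (n 1) (D 0) ?z)) = \<zero>"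
        using prsn_hom_zero[OF \<theta> prsn_ring module_hom_hom_like[OF f]] by (simp add: ring_as_module_def)
      then have "pr (mv (n 1) (D 0) ?z) a \<in> kr" unfolding fa kr_def by simp
      moreover have "(\<Sum>i<n 1. ?z i * mv (n 0) (tr (D 0)) a i) = (\<Sum>i<n 1. if i = k then mv (n 0) (tr (D 0)) a i else 0)"
        by (rule sum.cong) auto
      ultimately show ?thesis unfolding adj using True by simp
    next
      case False
      then have "ent (D 0) j k = 0" for j using mult_idm_bound[of "D 0" "n 1" k j] cpxD(2)[OF C, of 0] by simp
      then show ?thesis using idl_zero[OF idl_kr] by (simp add: mv_def)
    qed
    then have "mv (g (Suc 0)) (G 0) a k \<in> kr" for k using G0 by simp
    from cpx_vectors[OF G this] obtain w where "\<forall>j<g 1. a j - dv w j \<in> kr"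
      unfolding dv_def g2 by (rule exE)
    then have w: "a j - dv w j \<in> kr" if "j < n 0" for j using G0(3) that by simp
    have "f = \<psi> w"
    proof (rule ext[OF _ \<psi>_ext])
      show "f \<in> extensional (carrier X)" using f by (auto simp: module_hom_def PiE_def)
      show "f (\<theta> u) = \<psi> w (\<theta> u)" for u
        unfolding fa \<psi>\<theta> \<rho>_eq_iff pr_add(6)[symmetric] by (rule pr_kr) (rule w)
    qed
    then show "\<exists>v. \<psi> v = f" by blast
  qed
  moreover have "\<psi> v = \<zero>\<^bsub>?H\<^esub> \<longleftrightarrow> (\<exists>w. \<forall>i. v i - mv (g (Suc (Suc (Suc 0)))) (G (Suc (Suc 0))) w i \<in> kr)"
    if v: "\<And>i. g (Suc (Suc 0)) \<le> i \<Longrightarrow> v i = 0" for v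
  proof -
    have "\<psi> v = \<zero>\<^bsub>?H\<^esub> \<longleftrightarrow> (\<forall>w. pr w (dv v) \<in> kr)"
    proof
      assume "\<psi> v = \<zero>\<^bsub>?H\<^esub>"
      then have "\<psi> v (\<theta> w) = \<zero>" for w unfolding H using \<theta>c by simp
      then show "\<forall>w. pr w (dv v) \<in> kr" unfolding \<psi>\<theta> kr_def by simp
    next
      assume "\<forall>w. pr w (dv v) \<in> kr"
      then show "\<psi> v = \<zero>\<^bsub>?H\<^esub>" unfolding H by (intro ext[OF \<psi>_ext]) (simp_all add: \<psi>\<theta> \<theta>c kr_def)
    qed
    also have "\<dots> \<longleftrightarrow> (\<forall>j<g (Suc 0). dv v j \<in> kr)"
    proof
      assume h: "\<forall>w. pr w (dv v) \<in> kr"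
      show "\<forall>j<g (Suc 0). dv v j \<in> kr"
      proof (intro allI impI)
        fix j assume j: "j < g (Suc 0)"
        have "pr (\<lambda>i. if i = j then 1 else 0) (dv v) = (\<Sum>i<n 0. if i = j then dv v i else 0)"
          unfolding pr_def by (rule sum.cong) auto
        also have "\<dots> = dv v j" using j G0' by simp
        finally show "dv v j \<in> kr" using h by metis
      qed
    next
      assume "\<forall>j<g (Suc 0). dv v j \<in> kr"
      then show "\<forall>w. pr w (dv v) \<in> kr" using G0' by (intro allI pr_kr) simp
    qed
    also have "\<dots> \<longleftrightarrow> (\<exists>w. \<forall>i. v i - mv (g (Suc (Suc (Suc 0)))) (G (Suc (Suc 0))) w i \<in> kr)"
      unfolding dv_def g2(2)[symmetric] g2(1)[symmetric] by (rule cpx_kernel_iff[OF G v])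
    finally show ?thesis .
  qed
  ultimately have "resolves (\<lambda>i. g (Suc (Suc i))) (\<lambda>i. G (Suc (Suc i))) ?H \<psi>"
    unfolding resolves_def using cpx_shift[OF G, of 2] by simp
  then show ?thesis by (rule that)
qed

end

context conormal
begin

lemma conormal_resolves:
  assumes x: "\<And>i. i < e \<Longrightarrow> x i \<in> K" and gen: "\<And>y. y \<in> K \<Longrightarrow> \<exists>c. y - (\<Sum>i<e. x i * c i) \<in> J"
    and C: "cpx K n D" "n 0 = e"
    and rel: "\<And>v. (\<Sum>j<e. x j * v j) \<in> J \<longleftrightarrow> (\<exists>w. \<forall>j<e. v j - mv (n 1) (D 0) w j \<in> K)"
  shows "rpres.resolves Q (\<lambda>a. \<rho>I a) n D (conormal_module S I) (\<lambda>v. \<theta>J (\<Sum>i<e. x i * v i))"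
proof -
  interpret Q: rpres Q "\<lambda>a. \<rho>I a" by (rule rpres_quot)
  interpret M: subq Q "\<lambda>a. \<rho>I a" "conormal_module S I" K J "\<lambda>a. \<theta>J a" by (rule subq_conormal)
  have sumK: "(\<Sum>i<e. x i * v i) \<in> K" for v by (rule idl_sum[OF idlKJ(1)]) (use x idl_mult'[OF idlKJ(1)] in auto)
  have "Q.prsn (conormal_module S I) (n 0) (\<lambda>v. \<theta>J (\<Sum>i<e. x i * v i))"
    unfolding Q.prsn_def
  proof (intro conjI allI impI ballI)
    show "\<theta>J (\<Sum>i<e. x i * v i) \<in> carrier (conormal_module S I)" for v by (rule M.\<theta>_closed[OF sumK])
    show "\<theta>J (\<Sum>i<e. x i * (v i + w i)) =
       (\<theta>J (\<Sum>i<e. x i * v i)) \<oplus>\<^bsub>conormal_module S I\<^esub> (\<theta>J (\<Sum>i<e. x i * w i))" for v w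
      using M.\<theta>_add[OF sumK sumK, of v w] by (simp add: distrib_left sum.distrib)
    show "\<theta>J (\<Sum>i<e. x i * (a * v i)) = \<rho>I a \<odot>\<^bsub>conormal_module S I\<^esub> (\<theta>J (\<Sum>i<e. x i * v i))" for a v
      using M.\<theta>_smult[OF sumK, of a v] by (simp add: sum_distrib_left mult.left_commute)
    show "\<theta>J (\<Sum>i<e. x i * v i) = \<theta>J (\<Sum>i<e. x i * w i)" if "\<forall>i<n 0. v i = w i" for v w
      using that C(2) by simp
    show "\<theta>J (\<Sum>i<e. x i * 0) = \<zero>\<^bsub>conormal_module S I\<^esub>" using M.\<theta>_zero by simp
    fix y assume "y \<in> carrier (conormal_module S I)"
    then obtain a where a: "a \<in> K" "y = \<theta>J a" using M.\<theta>_surj by blast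
    obtain c where c: "a - (\<Sum>i<e. x i * c i) \<in> J" using gen[OF a(1)] by blast
    show "\<exists>v. \<theta>J (\<Sum>i<e. x i * v i) = y"
      unfolding a(2) using c M.\<theta>_eq[OF a(1) sumK, of c] by (intro exI[of _ c]) simp
  qed
  moreover have "\<theta>J (\<Sum>i<e. x i * v i) = \<zero>\<^bsub>conormal_module S I\<^esub> \<longleftrightarrow>
      (\<exists>w. \<forall>i. v i - mv (n 1) (D 0) w i \<in> K)" if v: "\<forall>i\<ge>n 0. v i = 0" for v
  proof -
    have "\<theta>J (\<Sum>i<e. x i * v i) = \<zero>\<^bsub>conormal_module S I\<^esub> \<longleftrightarrow> (\<Sum>i<e. x i * v i) \<in> J"
      using M.\<theta>_eq[OF sumK idl_zero[OF idlKJ(1)], of v] M.\<theta>_zero by simp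
    also have "\<dots> \<longleftrightarrow> (\<exists>w. \<forall>i. v i - mv (n 1) (D 0) w i \<in> K)"
    proof -
      have "mv (n 1) (D 0) w i = 0" if "e \<le> i" for w i
        using idm_mult_bound[OF cpxD(1)[OF C(1)], of 0 i] that C(2) by (simp add: mv_def)
      then have "(\<forall>j<e. v j - mv (n 1) (D 0) w j \<in> K) \<longleftrightarrow> (\<forall>i. v i - mv (n 1) (D 0) w i \<in> K)" for w
        using v C(2) idl_zero[OF idlKJ(1)] by (metis diff_zero not_less)
      then show ?thesis unfolding rel by simp
    qed
    finally show ?thesis .
  qed
  ultimately show ?thesis unfolding Q.resolves_def kr_quot using C(1) by blast
qed

end

section \<open>Minimal presentations of the conormal module\<close>

lemma rsid_subset: "prim p \<Longrightarrow> K \<subseteq> p \<Longrightarrow> rsq p K xs \<Longrightarrow> rsid p K xs \<subseteq> p"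
proof (induction xs arbitrary: K)
  case (Cons x xs)
  have "adj K x \<subseteq> p" using Cons.prems by (intro adj_least prim_idl) auto
  then have "sat p (adj K x) \<subseteq> p" using Cons.prems(1) by (auto simp: sat_def prim_def)
  then show ?case using Cons.IH[OF Cons.prems(1)] Cons.prems(3) by simp
qed simp

context conormal
begin

lemma product_combination:
  fixes G :: "'p set"
  assumes fin: "finite G" and gen: "\<And>y. y \<in> K \<Longrightarrow> \<exists>c. y - (\<Sum>g\<in>G. g * c g) \<in> kr" and y: "y \<in> J"
  shows "\<exists>d. (\<forall>g\<in>G. d g \<in> K) \<and> y - (\<Sum>g\<in>G. g * d g) \<in> kr"
proof -
  define T where "T = {y. \<exists>d. (\<forall>g\<in>G. d g \<in> K) \<and> y - (\<Sum>g\<in>G. g * d g) \<in> kr}"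
  have iT: "idl T" unfolding T_def using idl_span[OF idl_kr idlKJ(1), of G "\<lambda>g. g"] by (simp add: mult.commute)
  have "z \<in> \<rho> ` T" if "z \<in> I \<cdot> I" for z using that
  proof induction
    case (prod i j)
    obtain a b where ab: "\<rho> a = i" "\<rho> b = j" using \<rho>_surj ideal.Icarr[OF I] prod by metis
    obtain c where c: "b - (\<Sum>g\<in>G. g * c g) \<in> kr" using gen[of b] ab(2) prod(2) by auto
    have "a * b - (\<Sum>g\<in>G. g * (a * c g)) = a * (b - (\<Sum>g\<in>G. g * c g))"
      by (simp add: right_diff_distrib sum_distrib_left mult.left_commute)
    then have "a * b - (\<Sum>g\<in>G. g * (a * c g)) \<in> kr" using idl_mult[OF idl_kr c, of a] by simp
    moreover have "a * c g \<in> K" for g using idl_mult'[OF idlKJ(1), of a "c g"] ab(1) prod(1) by simp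
    ultimately have "a * b \<in> T" unfolding T_def by (intro CollectI exI[of _ "\<lambda>g. a * c g"]) simp
    then show ?case using ab \<rho>_mult by (metis image_eqI)
  next
    case (sum s1 s2)
    then obtain y z where yz: "y \<in> T" "z \<in> T" "s1 = \<rho> y" "s2 = \<rho> z" by blast
    then show ?case using idl_add[OF iT yz(1,2)] \<rho>_add by (metis image_eqI)
  qed
  then obtain t where t: "t \<in> T" "\<rho> y = \<rho> t" using y by blast
  then obtain d where d: "\<forall>g\<in>G. d g \<in> K" "t - (\<Sum>g\<in>G. g * d g) \<in> kr" unfolding T_def by blast
  have "y - t \<in> kr" using t(2) \<rho>_eq_iff by simp
  from idl_add[OF idl_kr this d(2)] show ?thesis using d(1) by auto
qed

text \<open>A set of generators of least cardinality. In a relation modulo the square of the ideal,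
  the part in the square is rewritten with coefficients in \<open>K\<close>; a coefficient outside
  \<open>m\<close> would remain invertible and make its generator redundant.\<close>

lemma minimal_generators:
  assumes noe: "noeth kr" and m: "prim m" "K \<subseteq> m" and unit: "\<And>u. u \<notin> m \<Longrightarrow> \<exists>v. v * u - 1 \<in> kr"
  obtains e x where "\<And>i. i < (e::nat) \<Longrightarrow> x i \<in> K" "\<And>y. y \<in> K \<Longrightarrow> \<exists>c. y - (\<Sum>i<e. x i * c i) \<in> kr"
    "\<And>c i. (\<Sum>i<e. x i * c i) \<in> J \<Longrightarrow> i < e \<Longrightarrow> c i \<in> m"
proof -
  define gens where "gens G \<longleftrightarrow> finite G \<and> G \<subseteq> K \<and> (\<forall>y\<in>K. \<exists>c. y - (\<Sum>g\<in>G. g * c g) \<in> kr)" for G :: "'p set"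
  have "\<exists>G. gens G"
  proof -
    obtain n a where a: "\<And>i. i < (n::nat) \<Longrightarrow> a i \<in> K" "\<And>y. y \<in> K \<Longrightarrow> \<exists>c. y - (\<Sum>i<n. c i * a i) \<in> kr"
      using noeth_gens[OF noe idlKJ(1)] idlKJ(3,4) by blast
    have "\<exists>c. y - (\<Sum>g\<in>a ` {..<n}. g * c g) \<in> kr" if y: "y \<in> K" for y
    proof -
      obtain c where c: "y - (\<Sum>i<n. c i * a i) \<in> kr" using a(2)[OF y] by blast
      have "(\<Sum>g\<in>a ` {..<n}. g * (\<Sum>i\<in>{i\<in>{..<n}. a i = g}. c i)) = (\<Sum>g\<in>a ` {..<n}. \<Sum>i\<in>{i\<in>{..<n}. a i = g}. c i * a i)"
        by (auto intro!: sum.cong simp: sum_distrib_left mult.commute)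
      also have "\<dots> = (\<Sum>i<n. c i * a i)" by (rule sum.image_gen[symmetric]) simp
      finally show ?thesis using c by (intro exI[of _ "\<lambda>g. \<Sum>i\<in>{i\<in>{..<n}. a i = g}. c i"]) simp
    qed
    then have "gens (a ` {..<n})" unfolding gens_def using a(1) by auto
    then show ?thesis by blast
  qed
  then obtain G where G: "gens G" and min: "\<And>G'. gens G' \<Longrightarrow> card G \<le> card G'"
    using ex_has_least_nat[of gens _ card] by blast
  have fin: "finite G" and GK: "G \<subseteq> K" and gen: "\<And>y. y \<in> K \<Longrightarrow> \<exists>c. y - (\<Sum>g\<in>G. g * c g) \<in> kr"
    using G by (auto simp: gens_def)
  have coeff: "c h \<in> m" if c: "(\<Sum>g\<in>G. g * c g) \<in> J" and h: "h \<in> G" for c h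
  proof (rule ccontr)
    assume ch: "c h \<notin> m"
    obtain d where d: "\<forall>g\<in>G. d g \<in> K" "(\<Sum>g\<in>G. g * c g) - (\<Sum>g\<in>G. g * d g) \<in> kr"
      using product_combination[OF fin gen c] by blast
    define b where "b g = c g - d g" for g
    have "b h \<notin> m"
    proof
      assume "b h \<in> m"
      from idl_add[OF prim_idl[OF m(1)] this subsetD[OF m(2) d(1)[rule_format, OF h]]] show False using ch by (simp add: b_def)
    qed
    then obtain v where v: "v * b h - 1 \<in> kr" using unit by blast
    have "(\<Sum>g\<in>G. g * b g) \<in> kr" using d(2) by (simp add: b_def right_diff_distrib sum_subtractf)
    moreover have "(\<Sum>g\<in>G. g * b g) = h * b h + (\<Sum>g\<in>G - {h}. g * b g)" by (rule sum.remove[OF fin h])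
    ultimately have s: "h * b h + (\<Sum>g\<in>G - {h}. g * b g) \<in> kr" by simp
    have "gens (G - {h})"
      unfolding gens_def
    proof (intro conjI ballI)
      fix y assume "y \<in> K"
      then obtain a where a: "y - (\<Sum>g\<in>G. g * a g) \<in> kr" using gen by blast
      have "(\<Sum>g\<in>G. g * a g) = h * a h + (\<Sum>g\<in>G - {h}. g * a g)" by (rule sum.remove[OF fin h])
      then have e: "y - (\<Sum>g\<in>G - {h}. g * (a g - a h * v * b g)) =
          (y - (\<Sum>g\<in>G. g * a g)) + a h * v * (h * b h + (\<Sum>g\<in>G - {h}. g * b g)) - h * a h * (v * b h - 1)"
        by (simp add: algebra_simps sum_subtractf sum_distrib_left)
      have "y - (\<Sum>g\<in>G - {h}. g * (a g - a h * v * b g)) \<in> kr"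
        unfolding e by (rule idl_diff[OF idl_kr idl_add[OF idl_kr a idl_mult[OF idl_kr s]] idl_mult[OF idl_kr v]])
      then show "\<exists>c. y - (\<Sum>g\<in>G - {h}. g * c g) \<in> kr" by (intro exI[of _ "\<lambda>g. a g - a h * v * b g"])
    qed (use fin GK in auto)
    from min[OF this] show False using card_Diff1_less[OF fin h] by simp
  qed
  obtain x where x: "bij_betw x {..<card G} G" using ex_bij_betw_nat_finite[OF fin] by (auto simp: atLeast0LessThan)
  have re: "(\<Sum>i<card G. x i * c (x i)) = (\<Sum>g\<in>G. g * c g)" for c by (rule sum.reindex_bij_betw[OF x])
  have inv: "the_inv_into {..<card G} x (x i) = i" if "i < card G" for i
    using the_inv_into_f_f[of x "{..<card G}" i] x that by (auto simp: bij_betw_def)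
  show ?thesis
  proof (rule that[of "card G" x])
    show "x i \<in> K" if "i < card G" for i using bij_betwE[OF x] that GK by auto
    show "\<exists>c. y - (\<Sum>i<card G. x i * c i) \<in> kr" if y: "y \<in> K" for y
    proof -
      obtain c where "y - (\<Sum>g\<in>G. g * c g) \<in> kr" using gen[OF y] by blast
      then show ?thesis unfolding re[symmetric] by (intro exI[of _ "\<lambda>i. c (x i)"])
    qed
    show "c i \<in> m" if c: "(\<Sum>i<card G. x i * c i) \<in> J" and i: "i < card G" for c i
    proof -
      let ?c = "\<lambda>g. c (the_inv_into {..<card G} x g)"
      have "(\<Sum>i<card G. x i * c i) = (\<Sum>i<card G. x i * ?c (x i))" by (rule sum.cong) (simp_all add: inv)
      then have "(\<Sum>g\<in>G. g * ?c g) \<in> J" using c re[of ?c] by (simp only:)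
      then have "?c (x i) \<in> m" by (rule coeff) (use bij_betwE[OF x] i in auto)
      then show ?thesis using inv[OF i] by simp
    qed
  qed
qed

lemma minimal_presentation:
  assumes noe: "noeth kr" and m: "prim m" "K \<subseteq> m" and unit: "\<And>u. u \<notin> m \<Longrightarrow> \<exists>v. v * u - 1 \<in> kr"
  obtains e x n D where "\<forall>i<(e::nat). x i \<in> K" "\<forall>y\<in>K. \<exists>c. y - (\<Sum>i<e. x i * c i) \<in> kr"
    "\<forall>v. (\<Sum>j<e. x j * v j) \<in> J \<longleftrightarrow> (\<exists>w. \<forall>j<e. v j - mv (n 1) (D 0) w j \<in> K)"
    "cpx K n D" "n 0 = e" "D 0 \<in> km m"
proof -
  obtain e x where x: "\<And>i. i < (e::nat) \<Longrightarrow> x i \<in> K" and gen: "\<And>y. y \<in> K \<Longrightarrow> \<exists>c. y - (\<Sum>i<e. x i * c i) \<in> kr"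
    and min: "\<And>c i. (\<Sum>i<e. x i * c i) \<in> J \<Longrightarrow> i < e \<Longrightarrow> c i \<in> m"
    using minimal_generators[OF noe m unit] by blast
  have noeK: "noeth K" using noeth_mono[OF noe idlKJ(1)] idlKJ(3,4) by blast
  let ?X = "{v. (\<Sum>j<e. x j * v j) \<in> J}"
  have "\<exists>k w. (\<forall>j<(k::nat). w j \<in> ?X) \<and> (\<forall>v\<in>?X. \<exists>c. \<forall>i<e. v i - (\<Sum>j<k. c j * w j i) \<in> K)"
  proof (rule noeth_vectors[OF noeK])
    show "(\<lambda>_. 0) \<in> ?X" using idl_zero[OF idlKJ(2)] by simp
    show "(\<lambda>i. v i + w i) \<in> ?X" if "v \<in> ?X" "w \<in> ?X" for v w
      using that idl_add[OF idlKJ(2)] by (simp add: distrib_left sum.distrib)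
    show "(\<lambda>i. a * v i) \<in> ?X" if "v \<in> ?X" for a v
    proof -
      have "(\<Sum>j<e. x j * (a * v j)) = a * (\<Sum>j<e. x j * v j)" by (simp add: sum_distrib_left mult.left_commute)
      then show ?thesis using that idl_mult[OF idlKJ(2), of _ a] by simp
    qed
  qed
  then obtain k w where w: "\<And>j. j < (k::nat) \<Longrightarrow> (\<Sum>i<e. x i * w j i) \<in> J"
    and wgen: "\<And>v. (\<Sum>j<e. x j * v j) \<in> J \<Longrightarrow> \<exists>c. \<forall>i<e. v i - (\<Sum>j<k. c j * w j i) \<in> K" by auto
  define D0 where "D0 = mk e k (\<lambda>i j. w j i)"
  have "idm e * D0 = D0" "D0 * idm k = D0" by (rule fmat_eqI, simp add: D0_def)+
  then obtain n D where D: "cpx K n D" "D 0 = D0" "n 0 = e" "n (Suc 0) = k" by (rule cpx_exists[OF noeK])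
  have mvD: "mv (n 1) (D 0) c i = (\<Sum>j<k. c j * w j i)" if "i < e" for c i
    using that D by (simp add: mv_def D0_def mult.commute)
  have rel: "(\<Sum>j<e. x j * v j) \<in> J \<longleftrightarrow> (\<exists>w. \<forall>j<e. v j - mv (n 1) (D 0) w j \<in> K)" for v
  proof
    assume "(\<Sum>j<e. x j * v j) \<in> J"
    then obtain c where "\<forall>i<e. v i - (\<Sum>j<k. c j * w j i) \<in> K" using wgen by blast
    then show "\<exists>w. \<forall>j<e. v j - mv (n 1) (D 0) w j \<in> K" using mvD by (intro exI[of _ c]) simp
  next
    assume "\<exists>w. \<forall>j<e. v j - mv (n 1) (D 0) w j \<in> K"
    then obtain c where c: "\<And>j. j < e \<Longrightarrow> v j - mv (n 1) (D 0) c j \<in> K" by blast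
    have "(\<Sum>j<e. x j * v j) = (\<Sum>j<e. x j * (v j - mv (n 1) (D 0) c j)) + (\<Sum>j<e. x j * mv (n 1) (D 0) c j)"
      by (simp add: right_diff_distrib sum_subtractf)
    also have "(\<Sum>j<e. x j * mv (n 1) (D 0) c j) = (\<Sum>j<e. \<Sum>l<k. c l * (x j * w l j))"
      by (rule sum.cong) (simp_all add: mvD[simplified] sum_distrib_left mult.left_commute)
    also have "\<dots> = (\<Sum>l<k. c l * (\<Sum>j<e. x j * w l j))" by (subst sum.swap) (simp add: sum_distrib_left)
    also have "(\<Sum>j<e. x j * (v j - mv (n 1) (D 0) c j)) + \<dots> \<in> J"
    proof (rule idl_add[OF idlKJ(2)])
      show "(\<Sum>j<e. x j * (v j - mv (n 1) (D 0) c j)) \<in> J" by (rule idl_sum[OF idlKJ(2)]) (use idlKJ(5) x c in auto)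
      show "(\<Sum>l<k. c l * (\<Sum>j<e. x j * w l j)) \<in> J" by (rule idl_sum[OF idlKJ(2)]) (use idl_mult[OF idlKJ(2)] w in auto)
    qed
    finally show "(\<Sum>j<e. x j * v j) \<in> J" .
  qed
  have "D 0 \<in> km m"
    unfolding D(2) D0_def using min[OF w] idl_zero[OF prim_idl[OF m(1)]] by (intro kmI) auto
  then show ?thesis using that x gen rel D(1,3) by blast
qed

end

section \<open>Vasconcelos' conjecture\<close>

lemma EV_UNIV: "EV p l L B h" if "B = UNIV" "prim p"
  using that prim_one[of p] unfolding EV_def by blast

lemma enat_min_le:
  assumes "enat l \<le> a" "min (enat r) a \<le> b"
  shows "enat (min r l) \<le> b"
proof -
  have "enat (min r l) \<le> enat l" by simp
  then have "enat (min r l) \<le> min (enat r) a" using order_trans[OF _ assms(1)] by (intro min.boundedI) auto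
  then show ?thesis using assms(2) by (rule order_trans)
qed

context conormal
begin

context
  fixes m :: "'p set"
  assumes noe: "noeth kr" and m: "prim m" "K \<subseteq> m" and unit: "\<And>u. u \<notin> m \<Longrightarrow> \<exists>v. v * u - 1 \<in> kr"
begin

lemma unitK: "u \<notin> m \<Longrightarrow> \<exists>v. v * u - 1 \<in> K" using unit[of u] krK by blast

lemma noeK: "noeth K" by (rule noeth_mono[OF noe idlKJ(1) krK])

lemma prime_below_m: "prim p \<Longrightarrow> K \<subseteq> p \<Longrightarrow> p \<subseteq> m"
  using ideal_below_local[of m K p, OF unitK] prim_idl prim_one by blast

text \<open>By \<open>mid_least\<close> the ideal \<open>rsid m kr ys\<close> is the least saturated
  ideal above \<open>kr\<close> containing \<open>ys\<close>. Over a local ring every ideal above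
  \<open>kr\<close> is saturated, so it is the preimage of the ideal generated by the
  images.\<close>

lemma generated_by_rsq:
  assumes ys: "rsq m kr ys" "rsid m kr ys = K"
  shows "generated_by_regular_sequence S I"
proof -
  interpret R: subq S \<rho> "ring_as_module S" UNIV kr \<rho> by (rule subq_ring)
  have krm: "kr \<subseteq> m" using krK m(2) by blast
  interpret L: lpres S "ring_as_module S" "{1}" UNIV "\<lambda>a s. \<rho> a" "\<lambda>r s. \<rho> r" m kr
    by (rule R.lpres_local[OF m(1) krm unit])
  let ?xs = "map \<rho> ys"
  have ym: "y \<in> m" if "y \<in> set ys" for y
    using ys(1) that unfolding msq_UNIV[symmetric] msq_nth by (metis in_set_conv_nth)
  have "list_all2 (\<lambda>x r. r \<in> m \<and> (\<exists>s\<in>{1}. x = \<rho> r)) ?xs ys" using ym by (auto simp: list_all2_conv_all_nth)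
  moreover have "K \<noteq> UNIV" using m prim_one by blast
  ultimately have reg: "regular_sequence S (ring_as_module S) ?xs"
    using L.regular_sequence_iff ys unfolding msq_UNIV mid_UNIV by blast
  have ml: "ssub m UNIV kr (mid m UNIV kr ys) \<and> (\<forall>r\<in>set ys. \<forall>a\<in>UNIV. r * a \<in> mid m UNIV kr ys) \<and>
    (\<forall>M. ssub m UNIV kr M \<longrightarrow> (\<forall>r\<in>set ys. \<forall>a\<in>UNIV. r * a \<in> M) \<longrightarrow> mid m UNIV kr ys \<subseteq> M)"
    using mid_least[OF m(1) _ L.B] by (simp add: idl_def)
  have sub: "set ?xs \<subseteq> carrier S" by auto
  have "I = genideal S (set ?xs)"
  proof
    have "y \<in> K" if "y \<in> set ys" for y
      using ml that unfolding mid_UNIV ys(2) by (metis UNIV_I mult.right_neutral)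
    then have "set ?xs \<subseteq> I" by auto
    then show "genideal S (set ?xs) \<subseteq> I" by (rule genideal_minimal[OF I])
    let ?P = "\<rho> -` genideal S (set ?xs)"
    have gi: "ideal (genideal S (set ?xs)) S" by (rule genideal_ideal[OF sub])
    have iP: "idl ?P" "kr \<subseteq> ?P" by (rule ideal_vimage[OF gi], rule kr_vimage[OF gi])
    have "ssub m UNIV kr ?P"
      unfolding ssub_def using iP local_saturated[of m kr ?P, OF unit iP] by auto
    moreover have "r * a \<in> ?P" if "r \<in> set ys" for r a
    proof (rule idl_mult'[OF iP(1)])
      have "\<rho> r \<in> set ?xs" using that by simp
      then show "r \<in> ?P" using genideal_self[OF sub] by blast
    qed
    ultimately have "K \<subseteq> ?P" using ml unfolding mid_UNIV ys(2) by blast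
    show "I \<subseteq> genideal S (set ?xs)"
    proof
      fix z assume z: "z \<in> I"
      then obtain a where a: "\<rho> a = z" using \<rho>_surj[OF ideal.Icarr[OF I z]] by blast
      then have "a \<in> ?P" using \<open>K \<subseteq> ?P\<close> z by blast
      then show "z \<in> genideal S (set ?xs)" using a by simp
    qed
  qed
  then show ?thesis unfolding generated_by_regular_sequence_def using reg by blast
qed

lemma lpres_quot: "lpres Q (ring_as_module Q) {1} UNIV (\<lambda>a s. \<rho>I a) (\<lambda>r s. \<rho>I r) m K"
proof -
  interpret Q: rpres Q "\<lambda>a. \<rho>I a" by (rule rpres_quot)
  interpret R: subq Q "\<lambda>a. \<rho>I a" "ring_as_module Q" UNIV K "\<lambda>a. \<rho>I a" using Q.subq_ring unfolding kr_quot .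
  show ?thesis by (rule R.lpres_local[OF m(1)]) (use m(2) unitK kr_quot in auto)
qed

lemma depth_quot_ge:
  assumes "rsq m K zs"
  shows "enat (length zs) \<le> ring_depth Q"
proof -
  interpret L: lpres Q "ring_as_module Q" "{1}" UNIV "\<lambda>a s. \<rho>I a" "\<lambda>r s. \<rho>I r" m K by (rule lpres_quot)
  have "1 \<notin> rsid m K zs" using rsid_subset[OF m assms] prim_one[OF m(1)] by blast
  then have "mid m UNIV K zs \<noteq> UNIV" unfolding mid_UNIV by blast
  with L.depth_le[of zs] show ?thesis using assms unfolding msq_UNIV ring_depth_def by blast
qed

lemma depth_quot_le:
  assumes "enat i \<le> ring_depth Q"
  obtains zs where "rsq m K zs" "i \<le> length zs"
proof (cases "i = 0")
  case True
  then show ?thesis using that[of "[]"] by simp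
next
  case False
  interpret L: lpres Q "ring_as_module Q" "{1}" UNIV "\<lambda>a s. \<rho>I a" "\<lambda>r s. \<rho>I r" m K by (rule lpres_quot)
  have "\<not> UNIV \<subseteq> K" using m prim_one by blast
  then show ?thesis using L.depth_ge[of i] that assms False unfolding msq_UNIV ring_depth_def by blast
qed

context
  fixes e :: nat and x :: "nat \<Rightarrow> 'p"
  assumes x: "\<And>i. i < e \<Longrightarrow> x i \<in> K" and gen: "\<And>y. y \<in> K \<Longrightarrow> \<exists>c. y - (\<Sum>i<e. x i * c i) \<in> kr"
begin

text \<open>Freeness of the conormal module, i.e. vanishing of its minimal presentation matrix, is the
  hypothesis of the Ferrand-Vasconcelos theorem.\<close>

lemma generated_by_free_conormal:
  assumes pd: "proj_dim S (ideal_as_module S I) < \<infinity>"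
    and rel: "\<And>v. (\<Sum>j<e. x j * v j) \<in> J \<longleftrightarrow> (\<exists>w. \<forall>j<e. v j - mv k D w j \<in> K)"
    and D: "D \<in> km K"
  shows "generated_by_regular_sequence S I"
proof -
  obtain n F where F: "pres kr K n F" using pres_exists[OF noe idlKJ(1) krK] by blast
  obtain N where N: "vreg m kr (F (Suc N))" using proj_dim_vreg[OF pd ideal_resolves[OF I F] m(1)] by blast
  have "\<exists>ys. rsq m kr ys \<and> rsid m kr ys = K"
  proof (rule ferrand_vasconcelos[OF m(1) idlKJ(1) m(2) noe krK unit x _ _ F N])
    show "\<exists>c. y - (\<Sum>i<e. c i * x i) \<in> kr" if "y \<in> K" for y using gen[OF that] by (simp add: mult.commute)
    show "c i \<in> K" if c: "(\<Sum>i<e. c i * x i) \<in> kr" and i: "i < e" for c i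
    proof -
      have "(\<Sum>i<e. x i * c i) \<in> J" using c idlKJ(4) by (auto simp: mult.commute)
      then obtain w where w: "c i - mv k D w i \<in> K" using rel i by blast
      have "mv k D w i \<in> K" by (rule mv_km[OF idlKJ(1) D])
      from idl_add[OF idlKJ(1) w this] show ?thesis by simp
    qed
  qed
  then show ?thesis using generated_by_rsq by blast
qed

text \<open>The common end of both cases, which differ in how they supply \<open>dual\<close> and
  \<open>HS\<close>. The sequence \<open>xs\<close> with its socle element stands for the depth of
  the quotient ring.\<close>

lemma generated_core:
  assumes pdI: "proj_dim S (ideal_as_module S I) < \<infinity>" and pdN: "proj_dim Q (normal_module S I) < \<infinity>"
    and rel: "\<And>v. (\<Sum>j<e. x j * v j) \<in> J \<longleftrightarrow> (\<exists>w. \<forall>j<e. v j - mv (n 1) (D 0) w j \<in> K)"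
    and D: "cpx K n D" "n 0 = e" "D 0 \<in> km m"
    and xs: "rsq m K xs" "s \<notin> rsid m K xs" "\<And>a. a \<in> m \<Longrightarrow> s * a \<in> rsid m K xs"
    and dual: "\<And>i V. Suc i \<le> length xs - r \<Longrightarrow> V * idm (n (Suc i)) = V \<Longrightarrow> V * D (Suc i) \<in> km K \<Longrightarrow> \<exists>W. V - W * D i \<in> km K"
    and HS: "\<And>p zs l L. prim p \<Longrightarrow> K \<subseteq> p \<Longrightarrow> rsq p (sat p K) zs \<Longrightarrow> pres K p l L \<Longrightarrow>
      EV p l L (rowm e x (csat p K J)) (min r (length zs))"
  shows "generated_by_regular_sequence S I"
proof -
  interpret Q: rpres Q "\<lambda>a. \<rho>I a" by (rule rpres_quot)
  have genJ: "\<exists>c. y - (\<Sum>i<e. x i * c i) \<in> J" if "y \<in> K" for y using gen[OF that] idlKJ(4) by blast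
  note res = conormal_resolves[OF x genJ D(1,2) rel]
  have D0: "idm (n 0) * D 0 = D 0" "D 0 * idm (n 1) = D 0" using cpxD(1,2)[OF D(1), of 0] by simp_all
  have "idm (n 1) * tr (D 0) = tr (D 0)" "tr (D 0) * idm (n 0) = tr (D 0)"
    using arg_cong[OF D0(2), of tr] arg_cong[OF D0(1), of tr] by (simp_all add: mat_simps)
  then obtain g G where G: "cpx K g G" "G 0 = tr (D 0)" "g 0 = n 1" "g (Suc 0) = n 0" by (rule cpx_exists[OF noeK])
  obtain \<psi> where "Q.resolves (\<lambda>i. g (Suc (Suc i))) (\<lambda>i. G (Suc (Suc i))) (hom_module Q (conormal_module S I) (ring_as_module Q)) \<psi>"
    by (rule Q.dual_resolves[OF res, of g G]) (use G kr_quot in auto)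
  then obtain N where N: "vreg m K (G (Suc (Suc N)))"
    using Q.proj_dim_vreg[OF _ _ m(1)] pdN unfolding normal_module_def kr_quot by metis
  have "D 0 \<in> km K"
  proof (rule free_of_dual_pd_finite[OF noeK m unitK D(1,3) G(1,2,3) _ N xs dual])
    show "g 1 = n 0" using G(4) by simp
    fix p zs l L assume p: "prim p" "K \<subseteq> p" "rsq p (sat p K) zs" "pres K p l L"
    have "rowm e x (csat p K J) = coker p (\<lambda>A. D 0 * A) (ringm e (sat p K))"
      by (rule rowm_presentation[OF p(1) idlKJ(1) x idlKJ(2,1) rel D0(2)])
    then show "EV p l L (coker p (\<lambda>A. D 0 * A) (ringm (n 0) (sat p K))) (min r (length zs))"
      using HS[OF p] D(2) by simp
  qed
  then show ?thesis using generated_by_free_conormal[OF pdI rel] by blast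
qed

section \<open>Lower bounds for the depth of the localized conormal module\<close>

lemma EV_conormal:
  assumes p: "prim p" and L: "pres K p l L"
    and B: "ssub p K B B" "J \<subseteq> B" and rs: "msq p K B rs" "i \<le> length rs"
  shows "EV p l L (rowm e x B) i"
proof (rule EV_mono[OF EV_msq[OF p idlKJ(1) L idlKJ(1) x B(1) _ _ rs(1)] rs(2)])
  show "k * x j \<in> B" if "k \<in> K" "j < e" for k j using idlKJ(5)[OF that(1) x[OF that(2)]] B(2) by blast
  show "\<exists>c. y - (\<Sum>j<e. x j * c j) \<in> B" if "y \<in> K" for y using gen[OF that] idlKJ(4) B(2) by blast
qed

lemma rowm_UNIV:
  assumes "K \<subseteq> B" "idl B"
  shows "rowm e x B = UNIV"
proof -
  have "ent (mk (Suc 0) e (\<lambda>_ j. x j) * A) i k \<in> B" for A i k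
    by (rule row_mem[OF assms(2)]) (use assms(1) x in blast)
  then show ?thesis unfolding rowm_def by (auto intro: kmI)
qed

lemma EV_serre:
  assumes st: "serre_tilde Q r (conormal_module S I)"
    and p: "prim p" "K \<subseteq> p" and zs: "rsq p (sat p K) zs" and L: "pres K p l L"
  shows "EV p l L (rowm e x (csat p K J)) (min r (length zs))"
proof -
  interpret Q: rpres Q "\<lambda>a. \<rho>I a" by (rule rpres_quot)
  have pQ: "Q.kr \<subseteq> p" unfolding kr_quot by (rule p(2))
  have iB: "idl (csat p K J)" by (rule idl_csat[OF p(1) idlKJ(1,2)])
  interpret R: subq_prime Q "\<lambda>a. \<rho>I a" "ring_as_module Q" UNIV K "\<lambda>a. \<rho>I a" p
    by (intro subq_prime.intro subq_prime_axioms.intro p(1) pQ) (use Q.subq_ring in \<open>simp add: kr_quot\<close>)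
  interpret M: subq_prime Q "\<lambda>a. \<rho>I a" "conormal_module S I" K J "\<lambda>a. \<theta>J a" p
    by (intro subq_prime.intro subq_prime_axioms.intro p(1) pQ subq_conormal)
  have satK: "csat p UNIV K = sat p K" by (auto simp: csat_def sat_def)
  have "sat p K \<subseteq> p" using p by (auto simp: sat_def prim_def)
  from rsid_subset[OF p(1) this zs] have "1 \<notin> rsid p (sat p K) zs" using prim_one[OF p(1)] by blast
  then have "mid p UNIV (sat p K) zs \<noteq> UNIV" unfolding mid_UNIV by blast
  then have "enat (length zs) \<le> depth (loc_ring Q R.W) (loc_module Q R.W (ring_as_module Q))"
    using lpres.depth_le[OF R.lpres_loc, of zs] zs unfolding satK msq_UNIV by blast
  then have "enat (length zs) \<le> ring_depth (loc_ring Q R.W)"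
    unfolding ring_depth_def Q.loc_ring_as_module[OF p(1) pQ] .
  moreover have "primeideal ((\<lambda>a. \<rho>I a) ` p) Q" by (rule Q.primeideal_image[OF p(1) pQ])
  then have "min (enat r) (ring_depth (loc_ring Q R.W)) \<le> depth (loc_ring Q R.W) (loc_module Q R.W (conormal_module S I))"
    using st unfolding serre_tilde_def by blast
  ultimately have dep: "enat (min r (length zs)) \<le> depth (loc_ring Q R.W) (loc_module Q R.W (conormal_module S I))"
    by (rule enat_min_le)
  \<comment> \<open>Where the conormal module vanishes its depth is infinite although it has no
    regular sequence at all; Ext vanishing is then trivial and is obtained separately.\<close>
  consider "min r (length zs) = 0" | "K \<subseteq> csat p K J" | "0 < min r (length zs)" "\<not> K \<subseteq> csat p K J" by blast
  then show ?thesis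
  proof cases
    case 1
    then show ?thesis by (simp add: EV_def)
  next
    case 2
    show ?thesis by (rule EV_UNIV[OF rowm_UNIV[OF 2 iB] p(1)])
  next
    case 3
    obtain rs where rs: "msq p K (csat p K J) rs" "min r (length zs) \<le> length rs"
      using lpres.depth_ge[OF M.lpres_loc dep 3(2,1)] by blast
    show ?thesis
      by (rule EV_conormal[OF p(1) L lpres.B[OF M.lpres_loc] csat_superset[OF p(1) idlKJ(3)] rs])
  qed
qed

lemma EV_cohen_macaulay:
  assumes cm: "krull_dim Q = ring_depth Q" "depth Q (conormal_module S I) = krull_dim Q"
    and xs: "rsq m K xs" "s \<notin> rsid m K xs" "\<And>a. a \<in> m \<Longrightarrow> s * a \<in> rsid m K xs"
    and p: "prim p" "K \<subseteq> p" and zs: "rsq p (sat p K) zs" and L: "pres K p l L"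
  shows "EV p l L (rowm e x (csat p K J)) (length zs)"
proof -
  interpret Q: rpres Q "\<lambda>a. \<rho>I a" by (rule rpres_quot)
  obtain lm Lm where Lm: "pres K m lm Lm" using pres_exists[OF noeK prim_idl[OF m(1)] m(2)] by blast
  have Ksat: "a \<in> K" if "u \<notin> m" "u * a \<in> K" for u a
    by (rule local_saturated[of m K K, OF unitK idlKJ(1) subset_refl that])
  have Jsat: "a \<in> J" if "u \<notin> m" "u * a \<in> J" for u a
    by (rule local_saturated[of m kr J, OF unit idlKJ(2,4) that])
  have sJ: "ssub m K J J" unfolding ssub_def using idlKJ(2,3) Jsat by blast
  have EVring: "EV m lm Lm (ringm 1 K) (length rs)" if "rsq m K rs" for rs
    by (rule EV_rsq[OF m(1) idlKJ(1) Lm idlKJ(1) subset_refl Ksat that])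
  \<comment> \<open>The socle element modulo \<open>xs\<close> caps the length of every regular
    sequence, so \<open>length xs\<close> is the depth of the quotient ring.\<close>
  have bound: "length rs \<le> length xs" if rs: "rsq m K rs" for rs
  proof (rule ccontr)
    assume "\<not> length rs \<le> length xs"
    then have "EV m lm Lm (ringm 1 K) (Suc (length xs))" by (intro EV_mono[OF EVring[OF rs]]) simp
    moreover have "\<not> EV m lm Lm (ringm 1 K) (Suc (length xs))"
      by (rule not_EV_socle[OF m(1) idlKJ(1) Lm idlKJ(1) subset_refl Ksat xs])
    ultimately show False by contradiction
  qed
  \<comment> \<open>The Cohen-Macaulay equality turns a longer chain of primes into a longer regular
    sequence.\<close>
  have dim: "\<not> pchain K (Suc (length xs)) c" for c
  proof
    assume "pchain K (Suc (length xs)) c"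
    then have "enat (Suc (length xs)) \<le> ring_depth Q"
      using Q.krull_dim_chain[of "Suc (length xs)" c] cm(1) unfolding kr_quot by simp
    then show False using depth_quot_le bound by (metis not_less_eq_eq order_trans)
  qed
  have EVm: "EV m lm Lm (rowm e x J) (length xs)"
  proof -
    have dep: "enat (length xs) \<le> depth Q (conormal_module S I)" using depth_quot_ge[OF xs(1)] cm by simp
    interpret M: subq Q "\<lambda>a. \<rho>I a" "conormal_module S I" K J "\<lambda>a. \<theta>J a" by (rule subq_conormal)
    interpret LM: lpres Q "conormal_module S I" "{1}" K "\<lambda>a s. \<theta>J a" "\<lambda>r s. \<rho>I r" m J
      by (rule M.lpres_local[OF m(1)]) (use m(2) unitK kr_quot in auto)
    consider "length xs = 0" | "K \<subseteq> J" | "0 < length xs" "\<not> K \<subseteq> J" by blast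
    then show ?thesis
    proof cases
      case 1
      then show ?thesis by (simp add: EV_def)
    next
      case 2
      show ?thesis by (rule EV_UNIV[OF rowm_UNIV[OF 2 idlKJ(2)] m(1)])
    next
      case 3
      obtain rs where rs: "msq m K J rs" "length xs \<le> length rs" using LM.depth_ge[OF dep 3(2,1)] by blast
      show ?thesis by (rule EV_conormal[OF m(1) Lm sJ subset_refl rs])
    qed
  qed
  have Kx: "k * x j \<in> J" if "k \<in> K" "j < e" for k j using idlKJ(5)[OF that(1) x[OF that(2)]] .
  have satK: "idl (sat p K)" "K \<subseteq> sat p K" "\<And>u a. u \<notin> p \<Longrightarrow> u * a \<in> sat p K \<Longrightarrow> a \<in> sat p K"
    by (rule idl_sat[OF p(1) idlKJ(1)], rule sat_superset[OF p(1)], rule sat_sat[OF p(1)])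
  have "EV p l L (satm p (rowm e x J)) (length zs)"
  proof (rule cm_localizes[OF noeK m(1) _ Lm p(1) prime_below_m[OF p] L idlKJ(1) subset_refl p(2) _ _ _ dim EVring[OF xs(1)] EVm])
    show "a \<in> J'" if "u \<notin> m" "idl J'" "K \<subseteq> J'" "u * a \<in> J'" for u a J'
      by (rule local_saturated[of m K J', OF unitK that(2,3,1,4)])
    show "psub m K (rowm e x J)" by (rule psub_rowm[OF idlKJ(1) x sJ Kx])
    show "idm e * A \<in> rowm e x J \<longleftrightarrow> A \<in> rowm e x J" for A
    proof -
      have "mk (Suc 0) e (\<lambda>_ j. x j) * idm e = mk (Suc 0) e (\<lambda>_ j. x j)" by (rule fmat_eqI) simp
      then show ?thesis unfolding rowm_def by (simp flip: mult.assoc)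
    qed
    show "a *\<^sub>m A \<in> rowm e x J" if a: "a \<in> K" for a A
      unfolding rowm_def
    proof (intro CollectI kmI)
      fix i k
      have "a * ent (mk (Suc 0) e (\<lambda>_ j. x j) * A) i k \<in> J"
        by (rule idlKJ(5)[OF a row_mem[OF idlKJ(1) x]])
      then show "ent (mk (Suc 0) e (\<lambda>_ j. x j) * (a *\<^sub>m A)) i k \<in> J" by (simp add: mat_simps)
    qed
    show "EV p l L (ringm 1 (sat p K)) (length zs)"
      by (rule EV_rsq[OF p(1) idlKJ(1) L satK zs])
  qed
  moreover have "A \<in> rowm e x (csat p K J) \<longleftrightarrow> (\<exists>u. u \<notin> p \<and> u *\<^sub>m A \<in> rowm e x J)" for A
    by (rule km_csat[OF p(1) idlKJ(1) x idlKJ(2)])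
  then have "satm p (rowm e x J) = rowm e x (csat p K J)" unfolding satm_def by blast
  ultimately show ?thesis by simp
qed

end

lemma sat_mK: "sat m K = K" by (rule sat_local[OF m(1) unitK idlKJ(1) subset_refl])

theorem generated_serre:
  assumes pdI: "proj_dim S (ideal_as_module S I) < \<infinity>" and pdN: "proj_dim Q (normal_module S I) < \<infinity>"
    and st: "serre_tilde Q r (conormal_module S I)"
    and ext: "\<And>i. 1 \<le> i \<Longrightarrow> enat i \<le> ring_depth Q - enat r \<Longrightarrow>
       trivial_module (ext_module Q i (conormal_module S I) (ring_as_module Q))"
  shows "generated_by_regular_sequence S I"
proof -
  obtain e x n D where mp: "\<forall>i<(e::nat). x i \<in> K" "\<forall>y\<in>K. \<exists>c. y - (\<Sum>i<e. x i * c i) \<in> kr"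
    "\<forall>v. (\<Sum>j<e. x j * v j) \<in> J \<longleftrightarrow> (\<exists>w. \<forall>j<e. v j - mv (n 1) (D 0) w j \<in> K)"
    and D: "cpx K n D" "n 0 = e" "D 0 \<in> km m"
    by (rule minimal_presentation[OF noe m unit])
  note x = mp(1)[rule_format] and gen = mp(2)[rule_format] and rel = mp(3)[rule_format]
  obtain xs s where xs: "rsq m K xs" "s \<notin> rsid m K xs" "\<And>a. a \<in> m \<Longrightarrow> s * a \<in> rsid m K xs"
    using maximal_rsq[OF noeK m] unfolding sat_mK by blast
  interpret Q: rpres Q "\<lambda>a. \<rho>I a" by (rule rpres_quot)
  have genJ: "\<exists>c. y - (\<Sum>i<e. x i * c i) \<in> J" if "y \<in> K" for y using gen[OF that] idlKJ(4) by blast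
  note res = conormal_resolves[OF x genJ D(1,2) rel]
  have triv: "trivial_module (ext_module Q i (conormal_module S I) (ring_as_module Q))" if "1 \<le> i" "i \<le> length xs - r" for i
  proof (rule ext[OF that(1)])
    \<comment> \<open>The Ext hypothesis refers to the depth, the argument to
      \<open>length xs\<close>; monotonicity of subtraction in \<open>enat\<close> bridges the
      two.\<close>
    have "enat i \<le> enat (length xs) - enat r" using that(2) by simp
    also have "\<dots> \<le> ring_depth Q - enat r"
      using depth_quot_ge[OF xs(1)] by (cases "ring_depth Q") auto
    finally show "enat i \<le> ring_depth Q - enat r" .
  qed
  obtain P d ee where R: "proj_resolution Q (conormal_module S I) (P, d, ee)"
    "\<And>i. Suc i \<le> length xs - r \<Longrightarrow> ext_cocycles Q (P, d, ee) (Suc i) (ring_as_module Q) \<subseteq> ext_coboundaries Q (P, d, ee) (Suc i) (ring_as_module Q)"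
    using Q.ext_trivial_cocycles[OF Q.resolution_exists[OF res] triv] by metis
  show ?thesis
  proof (rule generated_core[OF x gen pdI pdN rel D xs])
    show "\<exists>W. V - W * D i \<in> km K"
      if "Suc i \<le> length xs - r" "V * idm (n (Suc i)) = V" "V * D (Suc i) \<in> km K" for i V
      using Q.ext_dual_exact[OF R(1) res R(2)[OF that(1)] that(2)] that(3) unfolding kr_quot by blast
    show "EV p l L (rowm e x (csat p K J)) (min r (length zs))"
      if "prim p" "K \<subseteq> p" "rsq p (sat p K) zs" "pres K p l L" for p zs l L
      by (rule EV_serre[OF x gen st that])
  qed
qed

theorem generated_cohen_macaulay:
  assumes pdI: "proj_dim S (ideal_as_module S I) < \<infinity>" and pdN: "proj_dim Q (normal_module S I) < \<infinity>"
    and cm: "krull_dim Q = ring_depth Q" "depth Q (conormal_module S I) = krull_dim Q"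
  shows "generated_by_regular_sequence S I"
proof -
  obtain e x n D where mp: "\<forall>i<(e::nat). x i \<in> K" "\<forall>y\<in>K. \<exists>c. y - (\<Sum>i<e. x i * c i) \<in> kr"
    "\<forall>v. (\<Sum>j<e. x j * v j) \<in> J \<longleftrightarrow> (\<exists>w. \<forall>j<e. v j - mv (n 1) (D 0) w j \<in> K)"
    and D: "cpx K n D" "n 0 = e" "D 0 \<in> km m"
    by (rule minimal_presentation[OF noe m unit])
  note x = mp(1)[rule_format] and gen = mp(2)[rule_format] and rel = mp(3)[rule_format]
  obtain xs s where xs: "rsq m K xs" "s \<notin> rsid m K xs" "\<And>a. a \<in> m \<Longrightarrow> s * a \<in> rsid m K xs"
    using maximal_rsq[OF noeK m] unfolding sat_mK by blast
  show ?thesis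
  \<comment> \<open>With \<open>r\<close> equal to \<open>length xs\<close> the range of degrees in
    \<open>dual\<close> is empty.\<close>
  proof (rule generated_core[OF x gen pdI pdN rel D xs, of "length xs"])
    show "EV p l L (rowm e x (csat p K J)) (min (length xs) (length zs))"
      if "prim p" "K \<subseteq> p" "rsq p (sat p K) zs" "pres K p l L" for p zs l L
      by (rule EV_mono[OF EV_cohen_macaulay[OF x gen cm xs that]]) (assumption | rule min.cobounded2)+
  qed simp_all
qed

end

end

theorem corollary56:
  fixes S :: "'a ring" and I :: "'a set" and R :: "'a set ring" and t :: enat
  assumes "noetherian_local_ring S"
    and "ideal I S" and "I \<noteq> carrier S"
    and "proj_dim S (ideal_as_module S I) < \<infinity>"
    and "R = S Quot I"
    and "t = ring_depth R"
  shows "((\<exists>r::nat. enat r \<le> t \<and>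
              serre_tilde R r (conormal_module S I) \<and>
              (enat r < t \<longrightarrow>
                (\<forall>i::nat. 1 \<le> i \<and> enat i \<le> t - enat r \<longrightarrow>
                   trivial_module (ext_module R i (conormal_module S I) (ring_as_module R))))) \<and>
            proj_dim R (normal_module S I) < \<infinity>
            \<longrightarrow> generated_by_regular_sequence S I) \<and>
         (cohen_macaulay_ring R \<and>
            maximal_cohen_macaulay R (conormal_module S I) \<and>
            proj_dim R (normal_module S I) < \<infinity>
            \<longrightarrow> generated_by_regular_sequence S I)"
proof -
  have S: "cring S" "noetherian_ring S" using assms(1) by (auto simp: noetherian_local_ring_def)
  interpret conormal S "ev S" I
    by (intro conormal.intro rpres_ev conormal_axioms.intro S assms(2))
  obtain m where m: "prim m" "kr \<subseteq> m" and unit: "\<And>u. u \<notin> m \<Longrightarrow> \<exists>v. v * u - 1 \<in> kr"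
    using local_data[OF assms(1)] by blast
  have "\<one>\<^bsub>S\<^esub> \<notin> I" using ideal.one_imp_carrier[OF assms(2)] assms(3) by blast
  then have "1 \<notin> K" by (simp add: \<rho>_one)
  with unit idlKJ(1) krK have Km: "K \<subseteq> m" by (rule ideal_below_local)
  note data = noeth_kr[OF S(2)] m(1) Km unit
  show ?thesis
  proof (intro conjI impI; elim conjE exE)
    fix r assume r: "enat r \<le> t" "serre_tilde R r (conormal_module S I)" "proj_dim R (normal_module S I) < \<infinity>"
      "enat r < t \<longrightarrow> (\<forall>i::nat. 1 \<le> i \<and> enat i \<le> t - enat r \<longrightarrow>
         trivial_module (ext_module R i (conormal_module S I) (ring_as_module R)))"
    show "generated_by_regular_sequence S I"
    proof (rule generated_serre[OF data assms(4)])
      show "proj_dim Q (normal_module S I) < \<infinity>" "serre_tilde Q r (conormal_module S I)"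
        using r assms(5) by simp_all
      fix i :: nat assume i: "1 \<le> i" "enat i \<le> ring_depth Q - enat r"
      \<comment> \<open>If \<open>t\<close> equals \<open>enat r\<close>, the difference is 0 and
        admits no \<open>i\<close> with \<open>1 \<le> i\<close>.\<close>
      have "enat r < t"
      proof (rule ccontr)
        assume "\<not> enat r < t"
        then have "t = enat r" using r(1) by simp
        then show False using i assms(5,6) by (simp add: zero_enat_def)
      qed
      then show "trivial_module (ext_module Q i (conormal_module S I) (ring_as_module Q))"
        using r(4) i assms(5,6) by simp
    qed
  next
    assume "cohen_macaulay_ring R" "maximal_cohen_macaulay R (conormal_module S I)" "proj_dim R (normal_module S I) < \<infinity>"
    then show "generated_by_regular_sequence S I"
      using generated_cohen_macaulay[OF data assms(4)] assms(5)
      by (simp add: cohen_macaulay_ring_def maximal_cohen_macaulay_def)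
  qed
qed

end
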